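(* Let $f(Z)=\sum_{i=1}^d \alpha_i Z^i\in\mathbb{R}[Z]$ be any polynomial of degree $d\ge 3$ whose leading coefficient $\alpha_d$ is irrational and of Diophantine type $\tau=1$. Then for integers $0\le s\le r$, $$D_f(\mathcal{G}_s(r))\le \binom rs^{-\beta_1(d)}2^{\gamma_1(d)r+o(r)}+\binom rs^{-\beta_2(d)}2^{\gamma_2(d)r+o(r)}+\binom rs^{-\beta_3(d)}2^{\gamma_3(d)r+o(r)}$$ as $r\to\infty$, where $$\beta_1(d)=\frac{2d^2-4d+3}{4d^2-8d+7},\qquad \beta_2(d)=\frac{d(d-1)}{2d^2-2d+1},\qquad \beta_3(d)=\frac12,$$ $$\gamma_1(d)=\frac{2d^2-5d+4}{4d^2-8d+7},\qquad \gamma_2(d)=\frac{d^2-2d+2}{2d^2-2d+1},\qquad \gamma_3(d)=\frac{(d-1)(d-2)}{2(d^2-3d+3)}.$$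
   Context: $\sigma(n)$ denotes the sum of the binary digits of $n$, and for integers $0\le s\le r$, $\mathcal{G}_s(r)=\{0\le n<2^r:\ \sigma(n)=s\}$. The Diophantine type of an irrational number $\alpha$ is $$\tau=\sup\left\{\vartheta\in\mathbb{R}:\ \liminf_{q\to\infty,\ q\in\mathbb{N}}q^{\vartheta}\|\alpha q\|=0\right\},$$ where $\|x\|$ is the distance from $x\in\mathbb{R}$ to the nearest integer. For a finite nonempty set $M$ of nonnegative integers, the discrepancy of $\{\{f(n)\}: n\in M\}$ is $$D_f(M)=\sup_{\mathcal{I}\subseteq[0,1)}\left|\frac{\#\{n\in M:\ \{f(n)\}\in\mathcal{I}\}}{\#M}-\mathcal{L}(\mathcal{I})\right|,$$ where the supremum is over intervals $\mathcal{I}\subseteq[0,1)$, $\{y\}$ is the fractional part of $y$, and $\mathcal{L}$ is Lebesgue measure. The notation $o(r)$ means: for every $\varepsilon>0$ there is $r_0$ (depending on $\varepsilon$ and $f$, but not on $s$) such that for all $r\ge r_0$ the bound holds with $o(r)$ replaced by $\varepsilon r$. *)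

theory Defs
  imports "HOL-Analysis.Analysis" "HOL-Computational_Algebra.Polynomial"
begin

(* The digit at position i is n div 2 ^ i mod 2. Positions i \<ge> n may be dropped
   because n < 2 ^ n. *)
definition binary_digit_sum :: "nat \<Rightarrow> nat" where
  "binary_digit_sum n = (\<Sum>i<n. n div 2 ^ i mod 2)"

definition fixed_digit_sum_set :: "nat \<Rightarrow> nat \<Rightarrow> nat set" where
  "fixed_digit_sum_set s r = {n. n < 2 ^ r \<and> binary_digit_sum n = s}"

definition dist_nearest_int :: "real \<Rightarrow> real" where
  "dist_nearest_int x = \<bar>x - of_int (round x)\<bar>"

(* The supremum is taken in ereal because it is infinite for Liouville numbers,
   where a supremum in the reals would be unspecified. *)
definition diophantine_type :: "real \<Rightarrow> ereal" where
  "diophantine_type \<alpha> =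
     Sup (ereal ` {\<theta>. liminf (\<lambda>q. ereal (real q powr \<theta> * dist_nearest_int (\<alpha> * real q))) = 0})"

(* Intervals may be open, closed, half-open, degenerate or empty; the empty one
   contributes 0. The supremum is over a nonempty set bounded above by 1. *)
definition discrepancy :: "(nat \<Rightarrow> real) \<Rightarrow> nat set \<Rightarrow> real" where
  "discrepancy f M =
     (SUP I \<in> {I :: real set. is_interval I \<and> I \<subseteq> {0..<1}}.
        \<bar>real (card {n \<in> M. frac (f n) \<in> I}) / real (card M) - measure lborel I\<bar>)"

definition beta1 :: "nat \<Rightarrow> real" where
  "beta1 d = (2 * real d ^ 2 - 4 * real d + 3) / (4 * real d ^ 2 - 8 * real d + 7)"

definition beta2 :: "nat \<Rightarrow> real" where
  "beta2 d = (real d * (real d - 1)) / (2 * real d ^ 2 - 2 * real d + 1)"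

definition beta3 :: "nat \<Rightarrow> real" where
  "beta3 d = 1 / 2"

definition gamma1 :: "nat \<Rightarrow> real" where
  "gamma1 d = (2 * real d ^ 2 - 5 * real d + 4) / (4 * real d ^ 2 - 8 * real d + 7)"

definition gamma2 :: "nat \<Rightarrow> real" where
  "gamma2 d = (real d ^ 2 - 2 * real d + 2) / (2 * real d ^ 2 - 2 * real d + 1)"

definition gamma3 :: "nat \<Rightarrow> real" where
  "gamma3 d = ((real d - 1) * (real d - 2)) / (2 * (real d ^ 2 - 3 * real d + 3))"

end

theory Submission
  imports Defs "HOL-Number_Theory.Cong" "HOL-Real_Asymp.Real_Asymp"
begin

text \<open>Put \<open>k = d - 1\<close> and \<open>K = k (k - 1)\<close>. Splitting the binary expansion \<open>n = u + 2\<^sup>m v\<close> at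
  \<open>m \<approx> K r / (K + 1)\<close> turns \<open>\<Sum>\<^sub>n e(h f(n))\<close> over a fixed digit sum into \<open>m + 1\<close> bilinear sums over
  arbitrary sets of \<open>u\<close> and \<open>v\<close>. After Cauchy--Schwarz in \<open>u\<close>, the differences \<open>f(x + y + 2\<^sup>m v) - f(x + y + 2\<^sup>m v')\<close>
  are polynomials of degree \<open>k\<close> in \<open>x\<close>; raising to the power \<open>K\<close> (critical for Vinogradov's system of degree \<open>k - 1\<close>)
  and applying the large sieve in the coefficient of \<open>x\<^bsup>k-1\<^esup>\<close>, which moves with \<open>y\<close>, leaves a sum
  of \<open>min(2\<^bsup>m(k-1)\<^esup>, 1/\<parallel>\<beta> t\<parallel>)\<close> with \<open>\<beta>\<close> an integer multiple of \<open>\<alpha>\<^sub>d\<close>, which type \<open>1\<close> controls. This saves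
  \<open>2\<^bsup>\<omega>r/2\<^esup>\<close> over \<open>2\<^bsup>r/2\<^esup> |G|\<^bsup>1/2\<^esup>\<close> for \<open>h \<le> 4 2\<^bsup>\<omega>r\<^esup>\<close>, where \<open>\<omega> = 1/(K + 1)\<close> for \<open>d \<ge> 4\<close> and \<open>\<omega> = 1/6\<close> for
  \<open>d = 3\<close>, and by an Erdos--Turan inequality the discrepancy is at most \<open>|G|\<^bsup>-1/2\<^esup> 2\<^bsup>(1-\<omega>)r/2+o(r)\<^esup>\<close>. For \<open>d \<ge> 4\<close> this is
  the third term; for \<open>d = 3\<close> it is at most the second term if \<open>|G| \<ge> 2\<^bsup>5r/6\<^esup>\<close>, and otherwise the second
  term exceeds \<open>1\<close>. Vinogradov's mean value theorem is proved by \<open>p\<close>-adic \<open>\<ell>\<^sup>2\<close> decoupling, following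
  the bilinear induction on scales of Guo, Li, Yung and Zorin-Kranich.\<close>

section \<open>Moment functionals and exponential sums\<close>

text \<open>The digit-sum condition leaves sets of low and high halves without usable structure, so
  \<open>cauchy_step\<close> discards the set of low halves and all cancellation has to come from a
  full interval of x. The mean value system has degree k - 1 because, when a difference polynomial
  is expanded at y, the coefficient of x^k is the same for all y and becomes a fixed weight, that of
  x^(k-1) is linear in y and supplies the points of the large sieve, and the lower ones can only be
  absorbed by grouping solutions by their power sums. Before the root of order K is taken the sieve
  gains at most 2^m, while the diagonal v = v' gains 2^(r-m); the two balance at m = K r / (K + 1),
  whence 1 / (K + 1). For d = 3 a second constraint intervenes: h and 2^m multiply the leading
  coefficient, the approximating denominators grow with them, and this caps the saving exponent at
  1/5. In the decoupling part the obstacle is that a projection to lower degree does not send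
  integer points of one moment curve to points of another; sequences subject only to divisibility
  conditions are closed under it.\<close>

definition unit_exp :: "real \<Rightarrow> complex" where
  "unit_exp t = cis (2 * pi * t)"

lemma unit_exp_0 [simp]: "unit_exp 0 = 1"
  by (simp add: unit_exp_def)

lemma norm_unit_exp [simp]: "cmod (unit_exp t) = 1"
  by (simp add: unit_exp_def)

lemma unit_exp_add: "unit_exp (s + t) = unit_exp s * unit_exp t"
  by (simp add: unit_exp_def cis_mult algebra_simps)

lemma unit_exp_of_int [simp]: "unit_exp (of_int n) = 1"
  by (simp add: unit_exp_def)

lemma unit_exp_minus: "unit_exp (- t) = cnj (unit_exp t)"
  by (simp add: unit_exp_def cis_cnj)

lemma unit_exp_sum: "finite A \<Longrightarrow> unit_exp (\<Sum>i\<in>A. f i) = (\<Prod>i\<in>A. unit_exp (f i))"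
  by (induction A rule: finite_induct) (auto simp: unit_exp_add)

lemma unit_exp_eq_1_iff: "unit_exp t = 1 \<longleftrightarrow> t \<in> \<int>"
proof
  assume "unit_exp t = 1"
  then have "cos (2 * pi * t) = 1"
    by (auto simp: unit_exp_def complex_eq_iff)
  then obtain n :: int where "2 * pi * t = of_int n * 2 * pi"
    by (auto simp: cos_one_2pi_int)
  then show "t \<in> \<int>" by auto
qed (auto elim!: Ints_cases)

lemma unit_exp_add_of_int [simp]: "unit_exp (t + of_int n) = unit_exp t"
  by (simp add: unit_exp_add)

section \<open>Integer functionals on polynomials and approximate points of the moment curve\<close>

definition moment :: "(nat \<Rightarrow> int) \<Rightarrow> int poly \<Rightarrow> int" where
  "moment y P = (\<Sum>j\<le>degree P. coeff P j * y j)"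

lemma moment_alt: "degree P \<le> n \<Longrightarrow> moment y P = (\<Sum>j\<le>n. coeff P j * y j)"
  unfolding moment_def by (rule sum.mono_neutral_left) (auto simp: coeff_eq_0)

lemma moment_add: "moment y (P + R) = moment y P + moment y R"
proof -
  let ?n = "max (degree P) (degree R)"
  have "degree (P + R) \<le> ?n" by (rule degree_add_le_max)
  then show ?thesis
    by (simp add: moment_alt[of _ ?n] sum.distrib algebra_simps)
qed

lemma moment_smult: "moment y (smult c P) = c * moment y P"
  by (simp add: moment_alt[of "smult c P" "degree P"] moment_def sum_distrib_left algebra_simps)

lemma moment_0 [simp]: "moment y 0 = 0"
  by (simp add: moment_def)

lemma moment_1 [simp]: "moment y 1 = y 0"
  by (simp add: moment_def)

lemma moment_sum: "moment y (\<Sum>i\<in>A. P i) = (\<Sum>i\<in>A. moment y (P i))"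
  by (induction A rule: infinite_finite_induct) (auto simp: moment_add)

lemma moment_monom [simp]: "moment y (monom c j) = c * y j"
  by (simp add: moment_alt[OF degree_monom_le] if_distrib[of "\<lambda>x. x * _"] cong: if_cong)

lemma moment_power: "moment (\<lambda>j. x ^ j) P = poly P x"
  by (simp add: moment_def poly_altdef)

text \<open>A sequence \<open>y\<close> that imitates the moments \<open>1, t, t\<^sup>2, \<dots>\<close> of a point \<open>t\<close> up to the anisotropic box of
  scale \<open>p\<^sup>m\<close>. Unlike actual points, such sequences are stable under the affine changes of coordinates
  of the projection argument.\<close>

definition near_curve :: "nat \<Rightarrow> nat \<Rightarrow> (nat \<Rightarrow> int) \<Rightarrow> int \<Rightarrow> nat \<Rightarrow> bool" where
  "near_curve p k y t m \<longleftrightarrow> y 0 = 1 \<and> (\<forall>i\<le>k. int p ^ (i * m) dvd moment y ([:-t, 1:] ^ i))"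

lemma degree_linear_power_int: "degree ([:c, 1::int:] ^ i) = i"
  by (simp add: degree_power_eq)

lemma pcompose_linear_power:
  fixes R :: "'a :: comm_semiring_1 poly"
  shows "pcompose (S ^ n) R = pcompose S R ^ n"
  by (induction n) (simp_all add: pcompose_mult pcompose_1)

text \<open>Substituting X + t and then X - t is the identity, so the Taylor coefficients at t are
  the coefficients of the shifted polynomial. No derivatives or factorials occur and everything
  stays integral.\<close>

lemma taylor_int:
  fixes R :: "int poly"
  shows "R = (\<Sum>e\<le>degree R. smult (coeff (pcompose R [:t, 1:]) e) ([:-t, 1:] ^ e))"
proof -
  let ?S = "pcompose R [:t, 1:]"
  have deg: "degree ?S = degree R"
    by (simp add: degree_pcompose)
  have "R = pcompose R (pcompose [:t, 1:] [:-t, 1:])"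
    by (simp add: pcompose_pCons pcompose_idR)
  also have "\<dots> = pcompose ?S [:-t, 1:]"
    by (simp add: pcompose_assoc)
  also have "\<dots> = pcompose (\<Sum>e\<le>degree R. monom (coeff ?S e) e) [:-t, 1:]"
    using deg by (metis poly_as_sum_of_monoms)
  also have "\<dots> = (\<Sum>e\<le>degree R. smult (coeff ?S e) ([:-t, 1:] ^ e))"
    by (simp only: pcompose_sum monom_altdef pcompose_smult pcompose_linear_power pcompose_pCons) simp
  finally show ?thesis .
qed

lemma moment_taylor: "moment y R = (\<Sum>e\<le>degree R. coeff (pcompose R [:t, 1:]) e * moment y ([:-t, 1:] ^ e))"
  by (subst taylor_int[of R t]) (simp add: moment_sum moment_smult)

text \<open>Expand (X - s)^i in powers of X - t: the moment of the e-th power contributes p^(ea),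
  the remaining i - e factors t - s contribute p^(a(i-e)). Thus one sequence can be compared with
  the centre of every coarser class that contains it.\<close>

lemma near_curve_coarsen:
  assumes y: "near_curve p k y t m" and am: "a \<le> m" and cong: "int p ^ a dvd t - s"
  shows "near_curve p k y s a"
  unfolding near_curve_def
proof (intro conjI allI impI)
  show "y 0 = 1" using y by (simp add: near_curve_def)
  fix i assume i: "i \<le> k"
  have "[:-s, 1:] = [:-t, 1:] + [:t - s:]" by simp
  then have "[:-s, 1:] ^ i = (\<Sum>e\<le>i. of_nat (i choose e) * [:-t, 1:] ^ e * [:t - s:] ^ (i - e))"
    by (metis binomial_ring)
  also have "\<dots> = (\<Sum>e\<le>i. smult (of_nat (i choose e) * (t - s) ^ (i - e)) ([:-t, 1:] ^ e))"
    by (intro sum.cong refl) (simp add: of_nat_poly poly_const_pow mult_ac)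
  finally have "moment y ([:-s, 1:] ^ i)
      = (\<Sum>e\<le>i. of_nat (i choose e) * (t - s) ^ (i - e) * moment y ([:-t, 1:] ^ e))"
    by (simp only: moment_sum moment_smult)
  also have "int p ^ (i * a) dvd \<dots>"
  proof (rule dvd_sum)
    fix e assume e: "e \<in> {..i}"
    have "int p ^ (e * a) dvd int p ^ (e * m)"
      using am by (simp add: le_imp_power_dvd)
    moreover have "int p ^ (e * m) dvd moment y ([:-t, 1:] ^ e)"
      using y e i by (auto simp: near_curve_def)
    ultimately have 1: "int p ^ (e * a) dvd moment y ([:-t, 1:] ^ e)"
      by (rule dvd_trans)
    have "int p ^ (a * (i - e)) dvd (t - s) ^ (i - e)"
      using dvd_power_same[OF cong, of "i - e"] by (simp add: power_mult)
    then have 2: "int p ^ (a * (i - e)) dvd of_nat (i choose e) * (t - s) ^ (i - e)"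
      by (rule dvd_mult)
    have "i * a = a * (i - e) + e * a"
      using e by (simp add: mult.commute[of _ a] flip: distrib_left)
    then show "int p ^ (i * a) dvd
        of_nat (i choose e) * (t - s) ^ (i - e) * moment y ([:-t, 1:] ^ e)"
      using mult_dvd_mono[OF 2 1] by (simp add: power_add)
  qed
  finally show "int p ^ (i * a) dvd moment y ([:-s, 1:] ^ i)" .
qed

section \<open>Averages over a finite group of frequencies\<close>

definition freqs :: "nat \<Rightarrow> nat \<Rightarrow> int poly set" where
  "freqs k Q = {P. degree P \<le> k \<and> (\<forall>i. 0 \<le> coeff P i \<and> coeff P i < int Q)}"

lemma finite_freqs: "finite (freqs k Q)"
proof -
  let ?f = "\<lambda>g :: nat \<Rightarrow> int. (\<Sum>i\<le>k. monom (g i) i)"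
  have "P \<in> ?f ` (PiE {..k} (\<lambda>_. {0..<int Q}))" if "P \<in> freqs k Q" for P
  proof (rule image_eqI[of _ _ "restrict (coeff P) {..k}"])
    have "?f (restrict (coeff P) {..k}) = (\<Sum>i\<le>k. monom (coeff P i) i)"
      by (intro sum.cong) auto
    also have "\<dots> = P"
      using that by (intro poly_as_sum_of_monoms') (auto simp: freqs_def)
    finally show "P = ?f (restrict (coeff P) {..k})" ..
    show "restrict (coeff P) {..k} \<in> PiE {..k} (\<lambda>_. {0..<int Q})"
      using that by (auto simp: freqs_def)
  qed
  then have "freqs k Q \<subseteq> ?f ` (PiE {..k} (\<lambda>_. {0..<int Q}))" by blast
  then show ?thesis
    by (rule finite_subset) (intro finite_imageI finite_PiE, auto)
qed

lemma card_freqs_pos: "Q > 0 \<Longrightarrow> 0 < card (freqs k Q)"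
  using finite_freqs[of k Q] by (subst card_gt_0_iff) (auto simp: freqs_def intro!: exI[of _ 0])

text \<open>Frequencies are stored as polynomials: P is the character y |-> e(moment y P / Q) of
  (Z/Q)^(k+1), and \<open>avg\<close> is the normalised integral over the dual group. Adding a
  polynomial V multiplies the term of x by e(moment (y x) V / Q), so choosing V means choosing a
  direction in frequency space.\<close>

definition avg :: "nat \<Rightarrow> nat \<Rightarrow> (int poly \<Rightarrow> real) \<Rightarrow> real" where
  "avg k Q G = (\<Sum>P\<in>freqs k Q. G P) / card (freqs k Q)"

lemma avg_mono: "(\<And>P. degree P \<le> k \<Longrightarrow> G P \<le> G' P) \<Longrightarrow> avg k Q G \<le> avg k Q G'"
  unfolding avg_def by (intro divide_right_mono sum_mono) (auto simp: freqs_def)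

lemma avg_nonneg: "(\<And>P. 0 \<le> G P) \<Longrightarrow> 0 \<le> avg k Q G"
  unfolding avg_def by (intro divide_nonneg_nonneg sum_nonneg) auto

lemma avg_add: "avg k Q (\<lambda>P. G P + G' P) = avg k Q G + avg k Q G'"
  by (simp add: avg_def sum.distrib add_divide_distrib)

lemma avg_sum: "avg k Q (\<lambda>P. \<Sum>i\<in>A. G i P) = (\<Sum>i\<in>A. avg k Q (G i))"
  unfolding avg_def by (subst sum.swap) (simp add: sum_divide_distrib)

lemma avg_cmult: "avg k Q (\<lambda>P. c * G P) = c * avg k Q G"
  by (simp add: avg_def sum_distrib_left)

lemma avg_multc: "avg k Q (\<lambda>P. G P * c) = avg k Q G * c"
  by (simp add: avg_def sum_distrib_right)

lemma avg_divide: "avg k Q (\<lambda>P. G P / c) = avg k Q G / c"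
  using avg_multc[of k Q G "1 / c"] by simp

lemma avg_const: "Q > 0 \<Longrightarrow> avg k Q (\<lambda>_. c) = c"
  using card_freqs_pos[of Q k] by (simp add: avg_def)

definition periodic :: "nat \<Rightarrow> (int poly \<Rightarrow> 'a) \<Rightarrow> bool" where
  "periodic Q G \<longleftrightarrow> (\<forall>P R. G (P + smult (int Q) R) = G P)"

text \<open>Reducing all coefficients modulo Q maps the translated box bijectively back onto the
  box, and a periodic summand does not see the reduction.\<close>

lemma sum_freqs_translate:
  fixes G :: "int poly \<Rightarrow> 'a :: comm_monoid_add"
  assumes G: "periodic Q G" and V: "degree V \<le> k" and Q: "Q > 0"
  shows "(\<Sum>P\<in>freqs k Q. G (P + V)) = (\<Sum>P\<in>freqs k Q. G P)"
proof -
  define red where "red = (\<lambda>P :: int poly. map_poly (\<lambda>c. c mod int Q) P)"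
  have coeff_red: "coeff (red P) i = coeff P i mod int Q" for P i
    by (simp add: red_def coeff_map_poly)
  have degree_red: "degree (red P) \<le> degree P" for P
    by (rule degree_le) (simp add: coeff_red coeff_eq_0)
  have red_in: "red P \<in> freqs k Q" if "degree P \<le> k" for P
    using that Q order_trans[OF degree_red that] unfolding freqs_def
    by (auto simp: coeff_red)
  have G_red: "G (red P) = G P" for P
  proof -
    have "P = red P + smult (int Q) (map_poly (\<lambda>c. c div int Q) P)"
      by (rule poly_eqI) (simp add: coeff_red coeff_map_poly)
    then show ?thesis using G unfolding periodic_def by metis
  qed
  have red_id: "red P = P" if "P \<in> freqs k Q" for P
    using that by (intro poly_eqI) (auto simp: coeff_red freqs_def)
  have red_red: "red (red (P + V) - V) = red P" "red (red (P - V) + V) = red P" for P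
    by (intro poly_eqI; simp add: coeff_red mod_simps)+
  have "(\<Sum>P\<in>freqs k Q. G (P + V)) = (\<Sum>P\<in>freqs k Q. G (red (P + V)))"
    by (simp add: G_red)
  also have "\<dots> = (\<Sum>P\<in>freqs k Q. G P)"
  proof (rule sum.reindex_bij_witness[where i = "\<lambda>P. red (P - V)" and j = "\<lambda>P. red (P + V)"])
    fix P assume P: "P \<in> freqs k Q"
    then have "degree (P + V) \<le> k" "degree (P - V) \<le> k"
      using V by (auto simp: freqs_def intro!: degree_add_le degree_diff_le)
    then show "red (P + V) \<in> freqs k Q" "red (P - V) \<in> freqs k Q"
      by (auto intro: red_in)
    show "red (red (P + V) - V) = P" "red (red (P - V) + V) = P"
      using P by (simp_all add: red_red red_id)
  qed auto
  finally show ?thesis .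
qed

lemma avg_translate:
  assumes "periodic Q G" "degree V \<le> k" "Q > 0"
  shows "avg k Q (\<lambda>P. G (P + V)) = avg k Q G"
  using sum_freqs_translate[OF assms] by (simp add: avg_def)

definition exp_sum :: "nat \<Rightarrow> (int \<Rightarrow> nat \<Rightarrow> int) \<Rightarrow> (int \<Rightarrow> complex) \<Rightarrow> int set \<Rightarrow> int poly \<Rightarrow> complex" where
  "exp_sum Q y a X P = (\<Sum>x\<in>X. a x * unit_exp (moment (y x) P / Q))"

lemma periodic_exp_sum: "Q > 0 \<Longrightarrow> periodic Q (exp_sum Q y a X)"
  by (simp add: periodic_def exp_sum_def moment_add moment_smult add_divide_distrib)

lemma periodic_compose: "periodic Q G \<Longrightarrow> periodic Q (\<lambda>P. h (G P))"
  by (simp add: periodic_def)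

lemma periodic_mult: "periodic Q G \<Longrightarrow> periodic Q G' \<Longrightarrow> periodic Q (\<lambda>P. G P * G' P)"
  by (simp add: periodic_def)

lemma convex_on_power_nonneg: "convex_on {0::real..} (\<lambda>x. x ^ n)"
  by (cases "even n") (auto intro: convex_power_odd convex_on_subset[OF convex_power_even])

text \<open>Jensen for t^q at the points \<open>z c / w c\<close> with weights
  \<open>w c / W\<close>. The weights are free, and the right side is linear in the powers
  \<open>z c ^ q\<close>, so it survives averaging.\<close>

lemma jensen_power:
  fixes w z :: "'i \<Rightarrow> real"
  assumes fin: "finite C" and w: "\<And>c. c \<in> C \<Longrightarrow> 0 < w c"
    and z: "\<And>c. c \<in> C \<Longrightarrow> 0 \<le> z c" and q: "q \<ge> 1"
  shows "(\<Sum>c\<in>C. z c) ^ q \<le> (\<Sum>c\<in>C. w c) ^ (q - 1) * (\<Sum>c\<in>C. z c ^ q / w c ^ (q - 1))"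
proof (cases "C = {}")
  case True
  then show ?thesis using q by (simp add: power_0_left)
next
  case False
  define W where "W = (\<Sum>c\<in>C. w c)"
  have W: "W > 0" unfolding W_def using fin False w by (intro sum_pos) auto
  have "(\<Sum>c\<in>C. (w c / W) *\<^sub>R (z c / w c)) ^ q \<le> (\<Sum>c\<in>C. (w c / W) * (z c / w c) ^ q)"
  proof (rule convex_on_sum[OF fin False convex_on_power_nonneg[of q]])
    show "(\<Sum>c\<in>C. w c / W) = 1" using W by (simp add: W_def flip: sum_divide_distrib)
  qed (use w z W in \<open>auto intro!: divide_nonneg_nonneg intro: less_imp_le\<close>)
  also have "(\<Sum>c\<in>C. (w c / W) *\<^sub>R (z c / w c)) = (\<Sum>c\<in>C. z c) / W"
    by (simp add: sum_divide_distrib) (intro sum.cong; use w in fastforce)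
  also have "(\<Sum>c\<in>C. (w c / W) * (z c / w c) ^ q) = (\<Sum>c\<in>C. z c ^ q / w c ^ (q - 1)) / W"
    unfolding sum_divide_distrib
  proof (intro sum.cong refl)
    fix c assume "c \<in> C"
    then have "w c > 0" by (rule w)
    moreover have "w c ^ q = w c * w c ^ (q - 1)" using q by (cases q) auto
    ultimately show "(w c / W) * (z c / w c) ^ q = z c ^ q / w c ^ (q - 1) / W"
      by (simp add: power_divide field_simps)
  qed
  finally have "(\<Sum>c\<in>C. z c) ^ q / W ^ q \<le> (\<Sum>c\<in>C. z c ^ q / w c ^ (q - 1)) / W"
    by (simp add: power_divide)
  moreover have "W ^ q = W * W ^ (q - 1)" using q by (cases q) auto
  ultimately show ?thesis using W by (simp add: W_def[symmetric] field_simps)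
qed

section \<open>Decoupling for the moment curve\<close>

definition tri :: "nat \<Rightarrow> nat" where
  "tri k = k * (k + 1) div 2"

lemma tri_0 [simp]: "tri 0 = 0" and tri_Suc: "tri (Suc k) = tri k + Suc k"
  by (simp_all add: tri_def)

lemma tri_mono: "k \<le> l \<Longrightarrow> tri k \<le> tri l"
  unfolding tri_def by (intro div_le_mono mult_le_mono) auto

lemma tri_pos: "k \<ge> 1 \<Longrightarrow> tri k \<ge> 1"
  using tri_mono[of 1 k] by (simp add: tri_def)

lemma two_tri: "2 * tri k = k * (k + 1)"
  by (simp add: tri_def)

definition residue_class :: "nat \<Rightarrow> (int \<Rightarrow> int) \<Rightarrow> int set \<Rightarrow> nat \<Rightarrow> int \<Rightarrow> int set" where
  "residue_class p t X A c = {x \<in> X. t x mod int p ^ A = c}"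

definition configuration :: "nat \<Rightarrow> nat \<Rightarrow> nat \<Rightarrow> int set \<Rightarrow> (int \<Rightarrow> nat \<Rightarrow> int) \<Rightarrow> (int \<Rightarrow> int)
    \<Rightarrow> (int \<Rightarrow> complex) \<Rightarrow> (int \<Rightarrow> real) \<Rightarrow> bool" where
  "configuration p k n X y t a lam \<longleftrightarrow>
     finite X \<and> (\<forall>x\<in>X. near_curve p k (y x) (t x) n) \<and>
     (\<forall>c\<in>{0..<int p ^ n}. 0 < lam c \<and>
        avg k (p ^ (k * n)) (\<lambda>P. cmod (exp_sum (p ^ (k * n)) y a (residue_class p t X n c) P) ^ (2 * tri k)) \<le> lam c ^ tri k)"

text \<open>The exponent \<open>2 tri k = k (k + 1)\<close> is the critical one. The numbers \<open>lam c\<close> stand for the squared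
  \<open>L\<close>-norms of the pieces; upper bounds keep them positive.\<close>

definition decoupling :: "nat \<Rightarrow> nat \<Rightarrow> nat \<Rightarrow> real \<Rightarrow> bool" where
  "decoupling p k n D \<longleftrightarrow> (\<forall>X y t a lam. configuration p k n X y t a lam \<longrightarrow>
     avg k (p ^ (k * n)) (\<lambda>P. cmod (exp_sum (p ^ (k * n)) y a X P) ^ (2 * tri k))
       \<le> D * (\<Sum>c\<in>{0..<int p ^ n}. lam c) ^ tri k)"

text \<open>Lets quantities that may vanish be replaced by positive ones: an estimate proved with
  slack tau > 0 passes to tau = 0.\<close>

lemma le_limit_at_0:
  fixes h :: "real \<Rightarrow> real"
  assumes "\<And>\<tau>. \<tau> > 0 \<Longrightarrow> A \<le> h \<tau>" and "isCont h 0"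
  shows "A \<le> h 0"
proof (rule tendsto_lowerbound)
  show "(h \<longlongrightarrow> h 0) (at_right 0)"
    using assms(2) by (auto simp: isCont_def intro: filterlim_at_split[THEN iffD1, THEN conjunct2])
  show "\<forall>\<^sub>F \<tau> in at_right 0. A \<le> h \<tau>"
    using assms(1) by (auto simp: eventually_at_right_field intro!: exI[of _ 1])
qed simp

text \<open>The defining inequality raises a sum of norms to a power and cannot be averaged over
  fibres. Taking for \<open>lam\<close> the q-th roots of the averages and then applying Jensen with
  arbitrary weights gives a right side linear in the averages, which can.\<close>

lemma decoupling_weighted:
  assumes D: "decoupling p k n D" "D \<ge> 0" and k: "k \<ge> 1"
    and X: "finite X" "\<And>x. x \<in> X \<Longrightarrow> near_curve p k (y x) (t x) n"
    and w: "\<And>c. c \<in> {0..<int p ^ n} \<Longrightarrow> 0 < w c"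
  shows "avg k (p ^ (k * n)) (\<lambda>P. cmod (exp_sum (p ^ (k * n)) y a X P) ^ (2 * tri k))
    \<le> D * (\<Sum>c\<in>{0..<int p ^ n}. w c) ^ (tri k - 1) *
      (\<Sum>c\<in>{0..<int p ^ n}.
         avg k (p ^ (k * n)) (\<lambda>P. cmod (exp_sum (p ^ (k * n)) y a (residue_class p t X n c) P) ^ (2 * tri k))
         / w c ^ (tri k - 1))"
proof -
  define C where "C = {0..<int p ^ n}"
  have fin: "finite C" by (simp add: C_def)
  let ?A = "\<lambda>X. avg k (p ^ (k * n)) (\<lambda>P. cmod (exp_sum (p ^ (k * n)) y a X P) ^ (2 * tri k))"
  define g where "g = (\<lambda>c. ?A (residue_class p t X n c))"
  define q where "q = tri k"
  have q: "q \<ge> 1" using tri_pos[OF k] by (simp add: q_def)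
  have g: "g c \<ge> 0" for c unfolding g_def by (rule avg_nonneg) simp
  define z where "z = (\<lambda>c. root q (g c))"
  have z: "z c \<ge> 0" "z c ^ q = g c" for c
    using g q by (auto simp: z_def real_root_pow_pos2)
  \<comment> \<open>The slack keeps \<open>lam\<close> positive, as a configuration demands, even
    where a piece vanishes.\<close>
  have le: "?A X \<le> D * (\<Sum>c\<in>C. z c + \<tau>) ^ q" if \<tau>: "\<tau> > 0" for \<tau>
  proof -
    have "g c \<le> (z c + \<tau>) ^ q" for c
      using power_mono[of "z c" "z c + \<tau>" q] z \<tau> by auto
    moreover have "z c + \<tau> > 0" for c using z(1)[of c] \<tau> by linarith
    ultimately have "configuration p k n X y t a (\<lambda>c. z c + \<tau>)"
      using X by (auto simp: configuration_def g_def q_def)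
    then show ?thesis using D(1) unfolding decoupling_def C_def q_def by blast
  qed
  have "?A X \<le> D * (\<Sum>c\<in>C. z c + 0) ^ q"
    by (rule le_limit_at_0[where h = "\<lambda>\<tau>. D * (\<Sum>c\<in>C. z c + \<tau>) ^ q", OF le])
       (auto intro!: continuous_intros)
  also have "\<dots> \<le> D * ((\<Sum>c\<in>C. w c) ^ (q - 1) * (\<Sum>c\<in>C. z c ^ q / w c ^ (q - 1)))"
    using jensen_power[of C w z q] fin w z(1) q D(2)
    by (intro mult_left_mono) (auto simp: C_def)
  also have "\<dots> = D * (\<Sum>c\<in>C. w c) ^ (q - 1) * (\<Sum>c\<in>C. g c / w c ^ (q - 1))"
    by (simp add: z(2))
  finally show ?thesis by (simp add: C_def q_def g_def)
qed

lemma avg_swap: "avg k Q (\<lambda>P. avg l R (\<lambda>h. F P h)) = avg l R (\<lambda>h. avg k Q (\<lambda>P. F P h))"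
  unfolding avg_def
  by (simp add: sum_divide_distrib[symmetric] sum.swap[of _ "freqs k Q"] field_simps)

lemma invariant_smult:
  assumes "\<And>P. G (P + V) = G P"
  shows "G (P + smult (int n) V) = G P"
proof (induction n)
  case (Suc n)
  have "P + smult (int (Suc n)) V = (P + smult (int n) V) + V"
    by (simp add: smult_add_left algebra_simps)
  then show ?case using assms Suc by metis
qed simp

text \<open>Frequencies have nonnegative coefficients, so invariance under adding each
  \<open>V i\<close> once is enough.\<close>

lemma invariant_sum:
  fixes c :: "'i \<Rightarrow> int"
  assumes "\<And>i P. i \<in> I \<Longrightarrow> G (P + V i) = G P" and "finite I" and "\<And>i. 0 \<le> c i"
  shows "G (P + (\<Sum>i\<in>I. smult (c i) (V i))) = G P"
  using assms(2,1)
proof (induction I arbitrary: P rule: finite_induct)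
  case (insert i I)
  have "G (P + (\<Sum>i\<in>insert i I. smult (c i) (V i)))
      = G ((P + smult (int (nat (c i))) (V i)) + (\<Sum>i\<in>I. smult (c i) (V i)))"
    using insert.hyps assms(3)[of i] by (simp add: add.assoc)
  also have "\<dots> = G (P + smult (int (nat (c i))) (V i))" using insert by auto
  also have "\<dots> = G P" by (rule invariant_smult) (use insert in auto)
  finally show ?case .
qed simp

text \<open>Decoupling of degree \<open>l\<close> on the fibres of the projection along the directions \<open>V i\<close>, on which the
  factor \<open>G\<close> is constant.\<close>

lemma decoupling_coset:
  assumes D: "decoupling p l m D" "D \<ge> 0" and l: "l \<ge> 1" and p: "p > 0"
    and X: "finite X" "\<And>x. x \<in> X \<Longrightarrow> near_curve p l (z x) (t x) m"
    and V: "\<And>i. i \<le> l \<Longrightarrow> degree (V i) \<le> k" and L: "l * m \<le> L"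
    and moment_V: "\<And>x i. x \<in> X \<Longrightarrow> i \<le> l \<Longrightarrow>
      int p ^ L dvd moment (y x) (V i) - int p ^ (L - l * m) * z x i - cst i"
    and G: "periodic (p ^ L) G" "\<And>P. 0 \<le> G P" "\<And>i P. i \<le> l \<Longrightarrow> G (P + V i) = G P"
    and w: "\<And>c. c \<in> {0..<int p ^ m} \<Longrightarrow> 0 < w c"
  shows "avg k (p ^ L) (\<lambda>P. cmod (exp_sum (p ^ L) y a X P) ^ (2 * tri l) * G P)
    \<le> D * (\<Sum>c\<in>{0..<int p ^ m}. w c) ^ (tri l - 1) *
      (\<Sum>c\<in>{0..<int p ^ m}.
         avg k (p ^ L) (\<lambda>P. cmod (exp_sum (p ^ L) y a (residue_class p t X m c) P) ^ (2 * tri l) * G P)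
         / w c ^ (tri l - 1))"
proof -
  define Q where "Q = p ^ L"
  define R where "R = p ^ (l * m)"
  have Q: "Q > 0" and R: "R > 0" using p by (auto simp: Q_def R_def)
  have QR: "real Q = real R * real p ^ (L - l * m)"
    using L by (simp add: Q_def R_def flip: power_add)
  \<comment> \<open>\<open>T h\<close> moves P along its fibre; h is the degree-l frequency on the
    fibre and \<open>V i\<close> the direction belonging to its i-th coefficient.\<close>
  define T where "T = (\<lambda>h :: int poly. \<Sum>i\<le>l. smult (coeff h i) (V i))"
  define b where "b = (\<lambda>P x. a x * unit_exp (moment (y x) P / Q))"
  have T: "degree (T h) \<le> k" for h
    unfolding T_def using V by (intro degree_sum_le) (auto intro: order_trans[OF degree_smult_le])
  \<comment> \<open>On the fibre through P the phase of x splits into its value at P, absorbed into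
    the coefficient \<open>b P x\<close>, the degree-l phase of \<open>z x\<close>, a term
    independent of x that the modulus removes, and an integer.\<close>
  have shift: "cmod (exp_sum Q y a S (P + T h)) = cmod (exp_sum R z (b P) S h)"
    if S: "S \<subseteq> X" and h: "h \<in> freqs l R" for S P h
  proof -
    have "exp_sum Q y a S (P + T h) = (\<Sum>x\<in>S. unit_exp ((\<Sum>i\<le>l. coeff h i * cst i) / Q) *
        (b P x * unit_exp (moment (z x) h / R)))"
      unfolding exp_sum_def
    proof (intro sum.cong refl)
      fix x assume "x \<in> S"
      then have x: "x \<in> X" using S by auto
      define r where "r = (\<lambda>i. (moment (y x) (V i) - int p ^ (L - l * m) * z x i - cst i) div int Q)"
      have r: "moment (y x) (V i) = int p ^ (L - l * m) * z x i + cst i + int Q * r i" if "i \<le> l" for i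
        using moment_V[OF x that] by (auto simp: r_def Q_def elim!: dvdE)
      have "moment (y x) (T h) = (\<Sum>i\<le>l. coeff h i * moment (y x) (V i))"
        by (simp add: T_def moment_sum moment_smult)
      also have "\<dots> = (\<Sum>i\<le>l. int p ^ (L - l * m) * (coeff h i * z x i) + coeff h i * cst i + int Q * (coeff h i * r i))"
        by (intro sum.cong refl) (simp add: r algebra_simps)
      also have "\<dots> = int p ^ (L - l * m) * moment (z x) h + (\<Sum>i\<le>l. coeff h i * cst i) + int Q * (\<Sum>i\<le>l. coeff h i * r i)"
        using h by (simp add: sum.distrib sum_distrib_left moment_alt[of h l] freqs_def)
      finally have "real_of_int (moment (y x) (P + T h)) / Q = moment (y x) P / Q + moment (z x) h / R
          + (\<Sum>i\<le>l. coeff h i * cst i) / Q + of_int (\<Sum>i\<le>l. coeff h i * r i)"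
        using Q R p unfolding moment_add by (simp add: QR add_divide_distrib)
      then show "a x * unit_exp (moment (y x) (P + T h) / Q) =
          unit_exp ((\<Sum>i\<le>l. coeff h i * cst i) / Q) * (b P x * unit_exp (moment (z x) h / R))"
        by (simp only: unit_exp_add unit_exp_of_int b_def) (simp add: mult_ac)
    qed
    then show ?thesis
      by (simp add: exp_sum_def norm_mult flip: sum_distrib_left)
  qed
  have G_T: "G (P + T h) = G P" if "h \<in> freqs l R" for P h
    unfolding T_def using G(3) that by (intro invariant_sum) (auto simp: freqs_def)
  have avg_S: "avg k Q (\<lambda>P. cmod (exp_sum Q y a S P) ^ (2 * tri l) * G P)
     = avg k Q (\<lambda>P. avg l R (\<lambda>h. cmod (exp_sum R z (b P) S h) ^ (2 * tri l)) * G P)"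
    if S: "S \<subseteq> X" for S
  proof -
    let ?H = "\<lambda>P. cmod (exp_sum Q y a S P) ^ (2 * tri l) * G P"
    have per: "periodic Q ?H"
      using G(1) Q by (auto simp: Q_def intro!: periodic_mult periodic_compose[of _ _ "\<lambda>x. cmod x ^ _"] periodic_exp_sum)
    have "avg k Q ?H = avg l R (\<lambda>h. avg k Q ?H)"
      using R by (simp add: avg_const)
    \<comment> \<open>Translation invariance inserts the shift by \<open>T h\<close> for free and
      turns the full average into an average of fibre averages.\<close>
    also have "\<dots> = avg l R (\<lambda>h. avg k Q (\<lambda>P. ?H (P + T h)))"
      using avg_translate[OF per T Q] by simp
    also have "\<dots> = avg l R (\<lambda>h. avg k Q (\<lambda>P. cmod (exp_sum R z (b P) S h) ^ (2 * tri l) * G P))"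
      unfolding avg_def[of l] using shift[OF S] G_T
      by (intro arg_cong2[of _ _ _ _ "(/)"] sum.cong refl) simp_all
    finally show ?thesis by (simp add: avg_multc flip: avg_swap)
  qed
  define C where "C = {0..<int p ^ m}"
  define W where "W = D * (\<Sum>c\<in>C. w c) ^ (tri l - 1)"
  have "avg k Q (\<lambda>P. cmod (exp_sum Q y a X P) ^ (2 * tri l) * G P)
     = avg k Q (\<lambda>P. avg l R (\<lambda>h. cmod (exp_sum R z (b P) X h) ^ (2 * tri l)) * G P)"
    by (rule avg_S) simp
  also have "\<dots> \<le> avg k Q (\<lambda>P. (W * (\<Sum>c\<in>C. avg l R (\<lambda>h. cmod (exp_sum R z (b P) (residue_class p t X m c) h) ^ (2 * tri l))
      / w c ^ (tri l - 1))) * G P)"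
    unfolding W_def C_def R_def
    by (intro avg_mono mult_right_mono decoupling_weighted D l X w G(2))
  also have "\<dots> = W * (\<Sum>c\<in>C. avg k Q (\<lambda>P. avg l R (\<lambda>h. cmod (exp_sum R z (b P) (residue_class p t X m c) h) ^ (2 * tri l)) * G P)
      / w c ^ (tri l - 1))"
    by (simp add: mult.assoc avg_cmult sum_distrib_right avg_sum avg_divide)
  also have "\<dots> = W * (\<Sum>c\<in>C. avg k Q (\<lambda>P. cmod (exp_sum Q y a (residue_class p t X m c) P) ^ (2 * tri l) * G P) / w c ^ (tri l - 1))"
    by (simp add: avg_S residue_class_def)
  finally show ?thesis by (simp add: W_def C_def Q_def)
qed

section \<open>Change of base point and the dual frame\<close>

lemma moment_shift:
  "moment y ([:-(u + s), 1:] ^ i)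
    = (\<Sum>j\<le>i. of_nat (i choose j) * (-s) ^ (i - j) * moment y ([:-u, 1:] ^ j))"
proof -
  have "[:-(u + s), 1:] = [:-u, 1:] + [:-s:]" by simp
  then have "[:-(u + s), 1:] ^ i = (\<Sum>j\<le>i. of_nat (i choose j) * [:-u, 1:] ^ j * [:-s:] ^ (i - j))"
    by (metis binomial_ring)
  also have "\<dots> = (\<Sum>j\<le>i. smult (of_nat (i choose j) * (-s) ^ (i - j)) ([:-u, 1:] ^ j))"
    by (intro sum.cong refl) (simp add: of_nat_poly poly_const_pow mult_ac)
  finally show ?thesis
    by (simp only: moment_sum moment_smult)
qed

lemma moment_linear_power: "moment z ([:-s, 1:] ^ i) = (\<Sum>j\<le>i. of_nat (i choose j) * (-s) ^ (i - j) * z j)"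
proof -
  have "[:0, 1:] ^ j = monom (1::int) j" for j
    by (simp add: monom_altdef)
  then show ?thesis using moment_shift[of z 0 s i] by simp
qed

lemma coeff_mult_dvd:
  fixes q :: int
  assumes "\<And>e. e < l \<Longrightarrow> q dvd coeff P e" "e < l"
  shows "q dvd coeff (P * S) e"
  unfolding coeff_mult using assms by (intro dvd_sum) auto

lemma inverse_mod_prime_power:
  fixes u :: int
  assumes "prime p" "\<not> int p dvd u"
  obtains v where "int p ^ W dvd u * v - 1"
proof -
  have "coprime (int p) u"
    using assms by (intro prime_imp_coprime) auto
  then have "coprime u (int p ^ W)"
    by (simp add: coprime_commute)
  then obtain v where "[u * v = 1] (mod (int p ^ W))"
    using cong_solve_coprime_int by blast
  then show ?thesis using that by (auto simp: cong_iff_dvd_diff)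
qed

lemma pcompose_linear_neg: "pcompose ([:-s, 1:] ^ i) [:u, 1:] = [:u - s, 1:] ^ i" for s :: int
  by (simp add: pcompose_linear_power pcompose_pCons)

lemma pderiv_sum: "pderiv (\<Sum>i\<in>A. P i) = (\<Sum>i\<in>A. pderiv (P i))"
  by (induction A rule: infinite_finite_induct) (auto simp: pderiv_add)

lemma pderiv_linear_power:
  "pderiv ([:c, 1::int:] ^ (m + 1 + j)) = smult (int (m + 1 + j)) ([:c, 1:] ^ (m + j))"
  by (simp add: pderiv_power pderiv_pCons one_pCons[symmetric] del: power_Suc)

text \<open>The dual frame: \<open>R\<close> is obtained by integrating \<open>i (X - u)\<^bsup>i-1\<^esup>\<close>, expanded in
  powers of \<open>X - s\<close> after division by \<open>(X - s)\<^bsup>k-l\<^esup>\<close>; all denominators are prime to \<open>p\<close>.\<close>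

lemma dual_frame:
  assumes p: "prime p" "k < p" and l: "1 \<le> i" "i \<le> l" "l \<le> k" and us: "\<not> int p dvd u - s"
  obtains R :: "int poly" where "degree R \<le> k"
    "\<And>e. e \<le> k - l \<Longrightarrow> coeff (pcompose R [:s, 1:]) e = 0"
    "\<And>e. 1 \<le> e \<Longrightarrow> e \<le> l \<Longrightarrow> int p ^ W dvd coeff (pcompose R [:u, 1:]) e - (if e = i then 1 else 0)"
proof -
  define m where "m = k - l"
  define q where "q = int p ^ W"
  define \<zeta> where "\<zeta> = u - s"
  obtain \<omega> where \<omega>: "q dvd \<zeta> * \<omega> - 1"
    using inverse_mod_prime_power[OF p(1)] us unfolding q_def \<zeta>_def by blast
  have "\<exists>v. q dvd int (m + 1 + j) * v - 1" if "j < l" for j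
  proof -
    have "\<not> p dvd m + 1 + j"
      using that l p(2) by (intro nat_dvd_not_less) (auto simp: m_def)
    then have "\<not> int p dvd int (m + 1 + j)" by (simp only: int_dvd_int_iff not_False_eq_True)
    then show ?thesis using inverse_mod_prime_power[OF p(1)] unfolding q_def by metis
  qed
  then obtain \<nu> where \<nu>: "\<And>j. j < l \<Longrightarrow> q dvd int (m + 1 + j) * \<nu> j - 1" by metis
  \<comment> \<open>The truncated geometric series for 1 / (zeta + X): an inverse of zeta + X modulo
    p^W and X^l.\<close>
  define U where "U = smult \<omega> (\<Sum>j<l. [:0, -\<omega>:] ^ j)"
  have U_eq: "[:\<zeta>, 1:] * U - 1 = smult (\<zeta> * \<omega> - 1) (\<Sum>j<l. [:0, -\<omega>:] ^ j) - [:0, -\<omega>:] ^ l"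
  proof -
    have 1: "[:\<zeta>, 1:] * [:\<omega>:] = [:\<zeta> * \<omega> - 1:] + (1 - [:0, -\<omega>:])"
      by (simp add: one_pCons mult.commute)
    have 2: "(1 - [:0, -\<omega>:]) * (\<Sum>j<l. [:0, -\<omega>:] ^ j) = 1 - [:0, -\<omega>:] ^ l"
      by (simp add: one_diff_power_eq)
    have "[:\<zeta>, 1:] * U = ([:\<zeta>, 1:] * [:\<omega>:]) * (\<Sum>j<l. [:0, -\<omega>:] ^ j)"
      by (simp add: U_def smult_add_right)
    also have "\<dots> = smult (\<zeta> * \<omega> - 1) (\<Sum>j<l. [:0, -\<omega>:] ^ j) + (1 - [:0, -\<omega>:] ^ l)"
      unfolding 1 distrib_right 2 by simp
    finally show ?thesis by simp
  qed
  have lin: "[:0, -\<omega>:] ^ l = monom ((-\<omega>) ^ l) l"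
    by (simp add: monom_altdef flip: smult_power)
  have U1: "q dvd coeff ([:\<zeta>, 1:] * U - 1) e" if "e < l" for e
    unfolding U_eq lin using \<omega> that by (simp add: dvd_mult2)
  have U2: "q dvd coeff (([:\<zeta>, 1:] * U) ^ m - 1) e" if "e < l" for e
  proof -
    have "([:\<zeta>, 1:] * U) ^ m - 1 = ([:\<zeta>, 1:] * U - 1) * (\<Sum>j<m. ([:\<zeta>, 1:] * U) ^ j)"
      by (simp add: power_diff_1_eq)
    then show ?thesis using coeff_mult_dvd[OF U1 that] by simp
  qed
  \<comment> \<open>In the variable X - u the factor X - s reads zeta + X, so T0 is the desired
    derivative i X^(i-1) divided by (zeta + X)^m. Cutting it off at X^l keeps the degree of R at
    most k and does not affect the first l coefficients of the product.\<close>
  define T0 where "T0 = monom (int i) (i - 1) * U ^ m"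
  define T where "T = poly_cutoff l T0"
  have T0: "q dvd coeff ([:\<zeta>, 1:] ^ m * T0 - monom (int i) (i - 1)) e" if "e < l" for e
  proof -
    have "[:\<zeta>, 1:] ^ m * T0 - monom (int i) (i - 1)
        = (([:\<zeta>, 1:] * U) ^ m - 1) * monom (int i) (i - 1)"
      by (simp only: T0_def power_mult_distrib left_diff_distrib right_diff_distrib mult_1_left mult_1_right mult_ac)
    then show ?thesis using coeff_mult_dvd[OF U2 that] by simp
  qed
  have T1: "coeff ([:\<zeta>, 1:] ^ m * T) e = coeff ([:\<zeta>, 1:] ^ m * T0) e" if "e < l" for e
    unfolding coeff_mult using that by (intro sum.cong refl) (simp add: T_def coeff_poly_cutoff)
  have deg_T: "degree T \<le> l - 1"
    by (rule degree_le) (use l in \<open>auto simp: T_def coeff_poly_cutoff\<close>)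
  define \<tau> where "\<tau> = coeff (pcompose T [:-\<zeta>, 1:])"
  have T_exp: "T = (\<Sum>j<l. smult (\<tau> j) ([:\<zeta>, 1:] ^ j))"
  proof -
    have "T = (\<Sum>j\<le>degree T. smult (\<tau> j) ([:\<zeta>, 1:] ^ j))"
      using taylor_int[of T "-\<zeta>"] by (simp add: \<tau>_def)
    also have "\<dots> = (\<Sum>j<l. smult (\<tau> j) ([:\<zeta>, 1:] ^ j))"
      using deg_T l by (intro sum.mono_neutral_left) (auto simp: \<tau>_def coeff_eq_0 degree_pcompose)
    finally show ?thesis .
  qed
  \<comment> \<open>Termwise integration: (zeta + X)^(m+j) becomes (zeta + X)^(m+1+j) divided by m +
    1 + j, with \<open>\<nu> j\<close> as the reciprocal, which exists since m + 1 + j \<le> k < p.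
    Every term is divisible by (X - s)^(m+1), which is the vanishing at s.\<close>
  define R where "R = (\<Sum>j<l. smult (\<tau> j * \<nu> j) ([:-s, 1:] ^ (m + 1 + j)))"
  define S where "S = pcompose R [:u, 1:]"
  have S: "S = (\<Sum>j<l. smult (\<tau> j * \<nu> j) ([:\<zeta>, 1:] ^ (m + 1 + j)))"
    by (simp only: S_def R_def pcompose_sum pcompose_smult pcompose_linear_neg \<zeta>_def)
  show ?thesis
  proof (rule that[of R])
    show "degree R \<le> k"
      unfolding R_def using l
      by (intro degree_sum_le) (auto intro!: order_trans[OF degree_smult_le] simp: degree_linear_power_int m_def simp del: power_Suc)
  next
    fix e assume e: "e \<le> k - l"
    have "pcompose R [:s, 1:] = (\<Sum>j<l. smult (\<tau> j * \<nu> j) (monom 1 (m + 1 + j)))"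
      by (simp only: R_def pcompose_sum pcompose_smult pcompose_linear_neg) (simp add: monom_altdef)
    then show "coeff (pcompose R [:s, 1:]) e = 0"
      using e by (simp add: coeff_sum m_def)
  next
    fix e assume e: "1 \<le> e" "e \<le> l"
    have "pderiv S = (\<Sum>j<l. smult (\<tau> j * (int (m + 1 + j) * \<nu> j)) ([:\<zeta>, 1:] ^ (m + j)))"
      unfolding S by (simp only: pderiv_sum pderiv_smult pderiv_linear_power smult_smult) (simp add: mult_ac)
    also have "\<dots> = [:\<zeta>, 1:] ^ m * T + (\<Sum>j<l. smult (\<tau> j * (int (m + 1 + j) * \<nu> j - 1)) ([:\<zeta>, 1:] ^ (m + j)))"
      unfolding T_exp
      by (simp add: sum_distrib_left power_add right_diff_distrib smult_diff_left flip: sum.distrib)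
    finally have D: "pderiv S = [:\<zeta>, 1:] ^ m * T + (\<Sum>j<l. smult (\<tau> j * (int (m + 1 + j) * \<nu> j - 1)) ([:\<zeta>, 1:] ^ (m + j)))" .
    have "q dvd coeff (\<Sum>j<l. smult (\<tau> j * (int (m + 1 + j) * \<nu> j - 1)) ([:\<zeta>, 1:] ^ (m + j))) (e - 1)"
      unfolding coeff_sum coeff_smult by (intro dvd_sum dvd_mult2 dvd_mult \<nu>) auto
    moreover have "q dvd coeff ([:\<zeta>, 1:] ^ m * T) (e - 1) - coeff (monom (int i) (i - 1)) (e - 1)"
      using T0[of "e - 1"] T1[of "e - 1"] e by simp
    ultimately have "q dvd coeff (pderiv S) (e - 1) - coeff (monom (int i) (i - 1)) (e - 1)"
      unfolding D coeff_add by (metis (no_types, lifting) add_diff_eq add.commute dvd_add)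
    moreover have "coeff (pderiv S) (e - 1) - coeff (monom (int i) (i - 1)) (e - 1)
        = int e * (coeff S e - (if e = i then 1 else 0))"
      using e l by (auto simp: coeff_pderiv algebra_simps)
    ultimately have "q dvd int e * (coeff S e - (if e = i then 1 else 0))" by simp
    \<comment> \<open>Returning from the derivative to S means dividing by e, which is a unit
      because e \<le> l \<le> k < p.\<close>
    moreover have "coprime q (int e)"
    proof -
      have "\<not> p dvd e" using e l p by (intro nat_dvd_not_less) auto
      then have "coprime p e" using p(1) by (rule prime_imp_coprime[rotated])
      then show ?thesis by (simp add: q_def)
    qed
    ultimately show "int p ^ W dvd coeff (pcompose R [:u, 1:]) e - (if e = i then 1 else 0)"
      unfolding S_def q_def using coprime_dvd_mult_right_iff by blast
  qed
qed

section \<open>Bilinear decoupling\<close>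

text \<open>The l2-mass of a coarse class, added up over the finest classes inside it. It is
  additive under refinement by construction, which a norm of the coarse piece itself would not
  be.\<close>

definition coarse_weight :: "nat \<Rightarrow> nat \<Rightarrow> (int \<Rightarrow> real) \<Rightarrow> nat \<Rightarrow> int \<Rightarrow> real" where
  "coarse_weight p n lam A c = (\<Sum>d | d \<in> {0..<int p ^ n} \<and> d mod int p ^ A = c. lam d)"

text \<open>The exponents add up to the critical one for degree k. The first factor carries the
  exponent critical for degree l, so that decoupling of degree l can act on it while the second
  factor is held constant.\<close>

definition bilinear_mean :: "nat \<Rightarrow> nat \<Rightarrow> nat \<Rightarrow> (int \<Rightarrow> nat \<Rightarrow> int) \<Rightarrow> (int \<Rightarrow> complex) \<Rightarrow> nat \<Rightarrow> int set \<Rightarrow> int set \<Rightarrow> real" where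
  "bilinear_mean p k n y a l S S' = avg k (p ^ (k * n)) (\<lambda>P. cmod (exp_sum (p ^ (k * n)) y a S P) ^ (2 * tri l) *
      cmod (exp_sum (p ^ (k * n)) y a S' P) ^ (2 * (tri k - tri l)))"

text \<open>Different residues modulo p play the part of transversality: they make \<xi> - \<eta> a
  p-adic unit, which the dual frame inverts.\<close>

definition bilinear_decoupling :: "nat \<Rightarrow> nat \<Rightarrow> nat \<Rightarrow> nat \<Rightarrow> nat \<Rightarrow> nat \<Rightarrow> real \<Rightarrow> bool" where
  "bilinear_decoupling p k n l A B M \<longleftrightarrow> (\<forall>X y t a lam \<xi> \<eta>. configuration p k n X y t a lam \<longrightarrow>
     \<xi> \<in> {0..<int p ^ A} \<longrightarrow> \<eta> \<in> {0..<int p ^ B} \<longrightarrow> \<xi> mod int p \<noteq> \<eta> mod int p \<longrightarrow>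
     bilinear_mean p k n y a l (residue_class p t X A \<xi>) (residue_class p t X B \<eta>)
       \<le> M * coarse_weight p n lam A \<xi> ^ tri l * coarse_weight p n lam B \<eta> ^ (tri k - tri l))"

lemma bilinear_decoupling_I:
  assumes "\<And>X y t a lam \<xi> \<eta>. configuration p k n X y t a lam \<Longrightarrow>
     \<xi> \<in> {0..<int p ^ A} \<Longrightarrow> \<eta> \<in> {0..<int p ^ B} \<Longrightarrow> \<xi> mod int p \<noteq> \<eta> mod int p \<Longrightarrow>
     bilinear_mean p k n y a l (residue_class p t X A \<xi>) (residue_class p t X B \<eta>)
       \<le> M * coarse_weight p n lam A \<xi> ^ tri l * coarse_weight p n lam B \<eta> ^ (tri k - tri l)"
  shows "bilinear_decoupling p k n l A B M"
  using assms unfolding bilinear_decoupling_def by blast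

lemma bilinear_decoupling_D:
  assumes "bilinear_decoupling p k n l A B M" "configuration p k n X y t a lam"
     "\<xi> \<in> {0..<int p ^ A}" "\<eta> \<in> {0..<int p ^ B}" "\<xi> mod int p \<noteq> \<eta> mod int p"
  shows "bilinear_mean p k n y a l (residue_class p t X A \<xi>) (residue_class p t X B \<eta>)
       \<le> M * coarse_weight p n lam A \<xi> ^ tri l * coarse_weight p n lam B \<eta> ^ (tri k - tri l)"
  using assms unfolding bilinear_decoupling_def by blast

section \<open>Refinement of residue classes\<close>

lemma finite_residue_class [simp]: "finite {d. 0 \<le> d \<and> d < (N :: int) \<and> R d}"
  by (rule finite_subset[of _ "{0..<N}"]) auto

lemma power_split: "j \<le> i \<Longrightarrow> x ^ i = x ^ (i - j) * x ^ j" for x :: "'a :: monoid_mult"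
  by (metis power_add le_add_diff_inverse2)

lemma coarse_weight_pos:
  assumes "configuration p k n X y t a lam" "c \<in> {0..<int p ^ A}" "A \<le> n" "p > 0"
  shows "coarse_weight p n lam A c > 0"
proof -
  have "int p ^ A \<le> int p ^ n" using assms by (intro power_increasing) auto
  then have "c \<in> {d. d \<in> {0..<int p ^ n} \<and> d mod int p ^ A = c}"
    using assms by auto
  then show ?thesis unfolding coarse_weight_def
    using assms(1) by (intro sum_pos) (auto simp: configuration_def)
qed

lemma coarse_weight_top: "c \<in> {0..<int p ^ n} \<Longrightarrow> coarse_weight p n lam n c = lam c"
proof -
  assume c: "c \<in> {0..<int p ^ n}"
  have "{d. d \<in> {0..<int p ^ n} \<and> d mod int p ^ n = c} = {c}"
    using c by auto
  then show ?thesis by (simp add: coarse_weight_def)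
qed

lemma refine_mod:
  fixes d :: int
  assumes "\<xi> \<in> {0..<int p ^ a}" "c \<in> {0..<int p ^ (a' - a)}" "a \<le> a'" "p > 0"
  shows "d mod int p ^ a' = \<xi> + int p ^ a * c \<longleftrightarrow>
    d mod int p ^ a = \<xi> \<and> d div int p ^ a mod int p ^ (a' - a) = c"
proof -
  have eq: "int p ^ a' = int p ^ a * int p ^ (a' - a)"
    using assms by (simp flip: power_add)
  have d: "d mod int p ^ a' = int p ^ a * (d div int p ^ a mod int p ^ (a' - a)) + d mod int p ^ a"
    unfolding eq by (rule zmod_zmult2_eq) simp
  show ?thesis
  proof
    assume *: "d mod int p ^ a' = \<xi> + int p ^ a * c"
    have "(d mod int p ^ a') mod int p ^ a = \<xi>" "(d mod int p ^ a') div int p ^ a = c"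
      using assms unfolding * by auto
    then show "d mod int p ^ a = \<xi> \<and> d div int p ^ a mod int p ^ (a' - a) = c"
      using assms unfolding d by auto
  qed (simp add: d)
qed

lemma refine_bounds:
  assumes "\<xi> \<in> {0..<int p ^ a}" "c \<in> {0..<int p ^ (a' - a)}" "a \<le> a'" "p > 0"
  shows "\<xi> + int p ^ a * c \<in> {0..<int p ^ a'}"
proof -
  have eq: "int p ^ a' = int p ^ a * int p ^ (a' - a)"
    using assms by (simp flip: power_add)
  have "int p ^ a * c \<le> int p ^ a * (int p ^ (a' - a) - 1)"
    using assms by (intro mult_left_mono) auto
  then show ?thesis using assms unfolding eq by (auto simp: algebra_simps)
qed

lemma coarse_weight_refine:
  assumes "\<xi> \<in> {0..<int p ^ a}" "a \<le> a'" "p > 0"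
  shows "(\<Sum>c\<in>{0..<int p ^ (a' - a)}. coarse_weight p n lam a' (\<xi> + int p ^ a * c)) = coarse_weight p n lam a \<xi>"
proof -
  let ?S = "{d. d \<in> {0..<int p ^ n} \<and> d mod int p ^ a = \<xi>}"
  let ?g = "\<lambda>d. d div int p ^ a mod int p ^ (a' - a)"
  have "(\<Sum>c\<in>{0..<int p ^ (a' - a)}. coarse_weight p n lam a' (\<xi> + int p ^ a * c))
     = (\<Sum>c\<in>{0..<int p ^ (a' - a)}. sum lam {d \<in> ?S. ?g d = c})"
    unfolding coarse_weight_def
    by (intro sum.cong refl) (use assms in \<open>auto simp: refine_mod\<close>)
  also have "\<dots> = sum lam ?S"
    by (rule sum.group) (use assms in auto)
  finally show ?thesis by (simp add: coarse_weight_def)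
qed

lemma residue_class_refine:
  assumes "\<xi> \<in> {0..<int p ^ a}" "c \<in> {0..<int p ^ (a' - a)}" "a \<le> a'" "p > 0"
  shows "residue_class p (\<lambda>x. t x div int p ^ a) (residue_class p t X a \<xi>) (a' - a) c = residue_class p t X a' (\<xi> + int p ^ a * c)"
  using assms by (auto simp: residue_class_def refine_mod)

lemma refine_mod_p:
  assumes "a \<ge> 1"
  shows "(\<xi> + int p ^ a * c) mod int p = \<xi> mod int p"
proof -
  have "int p ^ a = int p * int p ^ (a - 1)" using assms by (cases a) auto
  then show ?thesis by (simp add: mult.assoc)
qed

text \<open>If the free weights of the linear estimate are the weights of the finer classes, each
  quotient \<open>F c / w c ^ (q - 1)\<close> is at most a multiple of \<open>w c\<close>, and the
  sum closes up to the weight of the coarse class.\<close>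

lemma collect_refined:
  fixes w :: "'i \<Rightarrow> real"
  assumes "finite C" "\<And>c. c \<in> C \<Longrightarrow> 0 < w c" "q \<ge> 1" "E \<ge> 0"
    and F: "\<And>c. c \<in> C \<Longrightarrow> F c \<le> M * w c ^ q * B"
    and A: "A \<le> E * (\<Sum>c\<in>C. w c) ^ (q - 1) * (\<Sum>c\<in>C. F c / w c ^ (q - 1))"
  shows "A \<le> (E * M) * (\<Sum>c\<in>C. w c) ^ q * B"
proof -
  have "(\<Sum>c\<in>C. F c / w c ^ (q - 1)) \<le> (\<Sum>c\<in>C. M * B * w c)"
  proof (rule sum_mono)
    fix c assume c: "c \<in> C"
    have "w c ^ q = w c * w c ^ (q - 1)" using assms(3) by (cases q) auto
    then show "F c / w c ^ (q - 1) \<le> M * B * w c"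
      using F[OF c] assms(2)[OF c] by (simp add: divide_le_eq mult_ac)
  qed
  then have "A \<le> E * (\<Sum>c\<in>C. w c) ^ (q - 1) * (\<Sum>c\<in>C. M * B * w c)"
    using assms by (intro order_trans[OF A] mult_left_mono mult_nonneg_nonneg zero_le_power sum_nonneg)
      (auto intro: less_imp_le)
  also have "(\<Sum>c\<in>C. M * B * w c) = M * B * (\<Sum>c\<in>C. w c)"
    by (simp add: sum_distrib_left)
  also have "E * (\<Sum>c\<in>C. w c) ^ (q - 1) * (M * B * (\<Sum>c\<in>C. w c)) = (E * M) * (\<Sum>c\<in>C. w c) ^ q * B"
    using assms(3) by (cases q) auto
  finally show ?thesis .
qed

lemma exp_sum_invariant:
  assumes "Q > 0" "\<And>x. x \<in> S \<Longrightarrow> int Q dvd moment (y x) V"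
  shows "exp_sum Q y a S (P + V) = exp_sum Q y a S P"
  unfolding exp_sum_def
proof (intro sum.cong refl)
  fix x assume "x \<in> S"
  then obtain r where "moment (y x) V = int Q * r" using assms(2) by (meson dvdE)
  then have "real_of_int (moment (y x) (P + V)) / Q = moment (y x) P / Q + of_int r"
    using assms(1) by (simp add: moment_add add_divide_distrib)
  then show "a x * unit_exp (moment (y x) (P + V) / Q) = a x * unit_exp (moment (y x) P / Q)"
    by simp
qed

lemma near_curve_residue_class:
  assumes "near_curve p k (y x) (t x) n" "A \<le> n" "t x mod int p ^ A = \<xi>"
  shows "near_curve p k (y x) \<xi> A"
  by (rule near_curve_coarsen[OF assms(1,2)]) (use assms(3) dvd_minus_mod in blast)

text \<open>A polynomial vanishing to order r at the centre combines powers (X - u)^e with e \<ge> r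
  only, and their moments are divisible by p^(ae).\<close>

lemma near_curve_dvd_moment:
  assumes y: "near_curve p k y u a" and R: "degree R \<le> k"
    and c: "\<And>e. e < r \<Longrightarrow> coeff (pcompose R [:u, 1:]) e = 0"
  shows "int p ^ (a * r) dvd moment y R"
  unfolding moment_taylor[of y R u]
proof (rule dvd_sum)
  fix e assume e: "e \<in> {..degree R}"
  show "int p ^ (a * r) dvd coeff (pcompose R [:u, 1:]) e * moment y ([:-u, 1:] ^ e)"
  proof (cases "e < r")
    case False
    then have "int p ^ (a * r) dvd int p ^ (e * a)"
      by (intro le_imp_power_dvd) (simp add: mult.commute)
    also have "\<dots> dvd moment y ([:-u, 1:] ^ e)"
      using y e R by (auto simp: near_curve_def)
    finally show ?thesis by (rule dvd_mult)
  qed (simp add: c)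
qed

text \<open>For l = 0 a single factor is left, and the substitution X = \<eta> + p^b X' carries the
  class modulo p^b to a whole curve at scale n - b. These b scales gained are what the later
  iteration feeds on.\<close>

lemma bilinear_decoupling_zero:
  assumes p: "p > 0" and k: "k \<ge> 1" and D: "decoupling p k (n - b) D" "D \<ge> 0" and b: "b \<le> n"
  shows "bilinear_decoupling p k n 0 a b D"
proof (rule bilinear_decoupling_I)
  fix X y t ac lam \<xi> \<eta>
  assume configuration: "configuration p k n X y t ac lam" and \<eta>: "\<eta> \<in> {0..<int p ^ b}"
  define Q where "Q = p ^ (k * n)"
  define I where "I = residue_class p t X b \<eta>"
  \<comment> \<open>Moments in the rescaled coordinate (X - \<eta>) / p^b, integral up to degree k
    because y is near \<eta> at scale b.\<close>
  define z where "z = (\<lambda>x i. moment (y x) ([:-\<eta>, 1:] ^ i) div int p ^ (b * i))"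
  define w where "w = (\<lambda>c. coarse_weight p n lam n (\<eta> + int p ^ b * c))"
  have I: "near_curve p k (y x) \<eta> b" "near_curve p k (y x) (t x) n" "t x = \<eta> + int p ^ b * (t x div int p ^ b)"
    if "x \<in> I" for x
    using that configuration b near_curve_residue_class[of p k y x t n b \<eta>]
    by (auto simp: I_def residue_class_def configuration_def)
  have z: "int p ^ (b * i) * z x i = moment (y x) ([:-\<eta>, 1:] ^ i)" if "x \<in> I" "i \<le> k" for x i
    using I(1)[OF that(1)] that(2) by (auto simp: z_def near_curve_def mult.commute)
  have "avg k (p ^ (k * n)) (\<lambda>P. cmod (exp_sum (p ^ (k * n)) y ac I P) ^ (2 * tri k) * 1)
    \<le> D * (\<Sum>c\<in>{0..<int p ^ (n - b)}. w c) ^ (tri k - 1) *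
      (\<Sum>c\<in>{0..<int p ^ (n - b)}.
         avg k (p ^ (k * n)) (\<lambda>P. cmod (exp_sum (p ^ (k * n)) y ac (residue_class p (\<lambda>x. t x div int p ^ b) I (n - b) c) P) ^ (2 * tri k) * 1)
         / w c ^ (tri k - 1))"
  proof (rule decoupling_coset[where z = z and V = "\<lambda>i. smult (int p ^ (k * n - k * (n - b) - b * i)) ([:-\<eta>, 1:] ^ i)" and cst = "\<lambda>_. 0"])
    show "finite I" using configuration by (auto simp: I_def residue_class_def configuration_def)
    show "near_curve p k (z x) (t x div int p ^ b) (n - b)" if x: "x \<in> I" for x
      unfolding near_curve_def
    proof (intro conjI allI impI)
      show "z x 0 = 1" using z[OF x, of 0] I(1)[OF x] by (simp add: near_curve_def)
      fix i assume i: "i \<le> k"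
      define \<tau> where "\<tau> = t x div int p ^ b"
      have "int p ^ (b * i) * moment (z x) ([:-\<tau>, 1:] ^ i)
        = (\<Sum>j\<le>i. of_nat (i choose j) * (- (int p ^ b * \<tau>)) ^ (i - j) * moment (y x) ([:-\<eta>, 1:] ^ j))"
        unfolding moment_linear_power[of "z x"] sum_distrib_left
      proof (intro sum.cong refl)
        fix j assume j: "j \<in> {..i}"
        have "int p ^ (b * i) = int p ^ (b * (i - j)) * int p ^ (b * j)"
          using j by (simp flip: power_add distrib_left)
        moreover have "(- (int p ^ b * \<tau>)) ^ (i - j) = int p ^ (b * (i - j)) * (- \<tau>) ^ (i - j)"
          by (simp add: power_mult power_mult_distrib[symmetric])
        ultimately show "int p ^ (b * i) * (int (i choose j) * (- \<tau>) ^ (i - j) * z x j)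
            = int (i choose j) * (- (int p ^ b * \<tau>)) ^ (i - j) * moment (y x) ([:-\<eta>, 1:] ^ j)"
          using z[OF x, of j] i j by (simp add: mult_ac)
      qed
      also have "\<dots> = moment (y x) ([:-t x, 1:] ^ i)"
        using I(3)[OF x] moment_shift[of "y x" \<eta> "int p ^ b * \<tau>" i] by (simp add: \<tau>_def)
      finally have eq: "int p ^ (b * i) * moment (z x) ([:-\<tau>, 1:] ^ i) = moment (y x) ([:-t x, 1:] ^ i)" .
      have "int p ^ (i * n) = int p ^ (b * i) * int p ^ (i * (n - b))"
        using b by (simp add: mult.commute[of b] flip: power_add distrib_left)
      moreover have "int p ^ (i * n) dvd moment (y x) ([:-t x, 1:] ^ i)"
        using I(2)[OF x] i by (simp add: near_curve_def)
      ultimately show "int p ^ (i * (n - b)) dvd moment (z x) ([:-(t x div int p ^ b), 1:] ^ i)"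
        using p by (simp add: \<tau>_def flip: eq)
    qed
    show "degree (smult (int p ^ (k * n - k * (n - b) - b * i)) ([:-\<eta>, 1:] ^ i)) \<le> k" if "i \<le> k" for i
      using that by (intro order_trans[OF degree_smult_le]) (simp add: degree_linear_power_int)
    show "int p ^ (k * n) dvd moment (y x) (smult (int p ^ (k * n - k * (n - b) - b * i)) ([:-\<eta>, 1:] ^ i))
       - int p ^ (k * n - k * (n - b)) * z x i - 0" if x: "x \<in> I" and i: "i \<le> k" for x i
    proof -
      have "b * i \<le> k * n - k * (n - b)"
        using b i by (simp add: mult.commute[of b] flip: right_diff_distrib' diff_mult_distrib2)
      then have "int p ^ (k * n - k * (n - b)) = int p ^ (k * n - k * (n - b) - b * i) * int p ^ (b * i)"
        by (rule power_split)
      then show ?thesis using z[OF x i] by (simp add: moment_smult mult.assoc)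
    qed
    show "0 < w c" if "c \<in> {0..<int p ^ (n - b)}" for c
      unfolding w_def by (rule coarse_weight_pos[OF configuration refine_bounds[OF \<eta> that b p]]) (use p in auto)
  qed (use D k p b in \<open>auto simp: periodic_def\<close>)
  then have "avg k (p ^ (k * n)) (\<lambda>P. cmod (exp_sum (p ^ (k * n)) y ac I P) ^ (2 * tri k) * 1)
     \<le> (D * 1) * (\<Sum>c\<in>{0..<int p ^ (n - b)}. w c) ^ tri k * 1"
  proof (rule collect_refined[rotated -1])
    fix c assume c: "c \<in> {0..<int p ^ (n - b)}"
    show "0 < w c" 
      unfolding w_def by (rule coarse_weight_pos[OF configuration refine_bounds[OF \<eta> c b p]]) (use p in auto)
    show "avg k (p ^ (k * n)) (\<lambda>P. cmod (exp_sum (p ^ (k * n)) y ac (residue_class p (\<lambda>x. t x div int p ^ b) I (n - b) c) P) ^ (2 * tri k) * 1)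
       \<le> 1 * w c ^ tri k * 1"
      using configuration refine_bounds[OF \<eta> c b p] unfolding I_def residue_class_refine[OF \<eta> c b p] w_def
      by (simp add: coarse_weight_top configuration_def)
  qed (use D tri_pos[OF k] in auto)
  then show "bilinear_mean p k n y ac 0 (residue_class p t X a \<xi>) (residue_class p t X b \<eta>)
     \<le> D * coarse_weight p n lam a \<xi> ^ tri 0 * coarse_weight p n lam b \<eta> ^ (tri k - tri 0)"
    using coarse_weight_refine[OF \<eta> b p, of n lam] by (simp add: bilinear_mean_def w_def I_def)
qed

text \<open>Expanded at u, R has a constant term, a unit coefficient in degree i and negligible ones
  in the other degrees up to l; degrees above l contribute multiples of p^(a(l+1)). So R reads off
  the i-th moment up to that error.\<close>

lemma frame_error:
  assumes y: "near_curve p k y u a" and R: "degree R \<le> k" and l: "1 \<le> i" "i \<le> l" "l < k" and an: "a \<le> n"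
    and c: "\<And>e. 1 \<le> e \<Longrightarrow> e \<le> l \<Longrightarrow>
      int p ^ (k * n) dvd coeff (pcompose R [:u, 1:]) e - (if e = i then 1 else 0)"
  shows "int p ^ (a * (l + 1)) dvd moment y R - coeff (pcompose R [:u, 1:]) 0 - moment y ([:-u, 1:] ^ i)"
proof -
  let ?r = "coeff (pcompose R [:u, 1:])"
  let ?u = "\<lambda>e. moment y ([:-u, 1:] ^ e)"
  have *: "moment y R = (\<Sum>e\<le>k. ?r e * ?u e)"
    unfolding moment_taylor[of y R u]
    using R by (intro sum.mono_neutral_left) (auto simp: coeff_eq_0 degree_pcompose)
  have "(\<Sum>e\<le>k. (if e = i then 1 else 0) * ?u e) = ?u i"
    using l by (simp add: if_distrib[of "\<lambda>x. x * _"] cong: if_cong)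
  moreover have "(\<Sum>e\<le>k. (if e = 0 then ?r 0 else 0) * ?u e) = ?r 0"
    using y by (simp add: if_distrib[of "\<lambda>x. x * _"] near_curve_def cong: if_cong)
  ultimately have "moment y R - ?r 0 - ?u i
    = (\<Sum>e\<le>k. (?r e - (if e = 0 then ?r 0 else 0) - (if e = i then 1 else 0)) * ?u e)"
    by (simp only: * left_diff_distrib sum_subtractf)
  also have "int p ^ (a * (l + 1)) dvd \<dots>"
  proof (rule dvd_sum)
    fix e assume e: "e \<in> {..k}"
    consider "e = 0" | "1 \<le> e" "e \<le> l" | "e \<ge> l + 1" by linarith
    then show "int p ^ (a * (l + 1)) dvd (?r e - (if e = 0 then ?r 0 else 0) - (if e = i then 1 else 0)) * ?u e"
    proof cases
      case 1
      then show ?thesis using l by simp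
    next
      case 2
      have "a * (l + 1) \<le> n * k" using an l by (intro mult_le_mono) auto
      then have "int p ^ (a * (l + 1)) dvd int p ^ (k * n)"
        by (intro le_imp_power_dvd) (simp add: mult.commute)
      then have "int p ^ (a * (l + 1)) dvd ?r e - (if e = i then 1 else 0)"
        using c[OF 2] by (rule dvd_trans)
      then show ?thesis using 2 by simp
    next
      case 3
      then have "int p ^ (a * (l + 1)) dvd int p ^ (e * a)"
        by (intro le_imp_power_dvd) (subst mult.commute, rule mult_le_mono, auto)
      also have "\<dots> dvd ?u e" using y e by (auto simp: near_curve_def)
      finally show ?thesis by (rule dvd_mult)
    qed
  qed
  finally show ?thesis .
qed

text \<open>The projected sequence knows the moments about \<xi> only up to p^(a(l+1)). After the
  shift by p^a \<tau> and division by p^(ai) this error is still below the resolution a' - a, as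
  long as l (a' - a) \<le> a.\<close>

lemma near_curve_projection:
  assumes p: "p > 0" and y: "near_curve p k y \<xi> a" "near_curve p k y (\<xi> + int p ^ a * \<tau>) a'"
    and l: "l \<le> k" "1 \<le> a" "a \<le> a'" "l * a' \<le> (l + 1) * a"
    and z0: "z 0 = 1"
    and z: "\<And>i. 1 \<le> i \<Longrightarrow> i \<le> l \<Longrightarrow>
      int p ^ (a * (l + 1)) dvd int p ^ (a * i) * z i - moment y ([:-\<xi>, 1:] ^ i)"
  shows "near_curve p l z \<tau> (a' - a)"
  unfolding near_curve_def
proof (intro conjI allI impI)
  show "z 0 = 1" by (rule z0)
  fix i assume i: "i \<le> l"
  define s where "s = int p ^ a * \<tau>"
  have "int p ^ (a * i) * moment z ([:-\<tau>, 1:] ^ i)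
    = (\<Sum>j\<le>i. of_nat (i choose j) * (- s) ^ (i - j) * (int p ^ (a * j) * z j))"
    unfolding moment_linear_power[of z] sum_distrib_left
  proof (intro sum.cong refl)
    fix j assume j: "j \<in> {..i}"
    have "int p ^ (a * i) = int p ^ (a * (i - j)) * int p ^ (a * j)"
      using j by (simp flip: power_add distrib_left)
    moreover have "(- s) ^ (i - j) = int p ^ (a * (i - j)) * (- \<tau>) ^ (i - j)"
      by (simp add: s_def power_mult power_mult_distrib[symmetric])
    ultimately show "int p ^ (a * i) * (int (i choose j) * (- \<tau>) ^ (i - j) * z j)
        = int (i choose j) * (- s) ^ (i - j) * (int p ^ (a * j) * z j)"
      by (simp add: mult_ac)
  qed
  also have "\<dots> = moment y ([:-(\<xi> + s), 1:] ^ i) + (\<Sum>j\<le>i. of_nat (i choose j) * (- s) ^ (i - j) *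
      (int p ^ (a * j) * z j - moment y ([:-\<xi>, 1:] ^ j)))"
    unfolding moment_shift[of y \<xi> s] by (simp add: right_diff_distrib flip: sum.distrib)
  also have "int p ^ (a' * i) dvd \<dots>"
  proof (rule dvd_add)
    show "int p ^ (a' * i) dvd moment y ([:-(\<xi> + s), 1:] ^ i)"
      using y(2) i l unfolding near_curve_def s_def mult.commute[of a'] by auto
    show "int p ^ (a' * i) dvd (\<Sum>j\<le>i. of_nat (i choose j) * (- s) ^ (i - j) *
      (int p ^ (a * j) * z j - moment y ([:-\<xi>, 1:] ^ j)))"
    proof (rule dvd_sum)
      fix j assume j: "j \<in> {..i}"
      show "int p ^ (a' * i) dvd of_nat (i choose j) * (- s) ^ (i - j) *
        (int p ^ (a * j) * z j - moment y ([:-\<xi>, 1:] ^ j))"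
      proof (cases "j = 0")
        case True
        then show ?thesis using z0 y(1) by (simp add: near_curve_def)
      next
        case False
        have 1: "int p ^ (a * (i - j)) dvd of_nat (i choose j) * (- s) ^ (i - j)"
          unfolding s_def by (intro dvd_mult) (simp add: power_mult power_mult_distrib flip: mult_minus_right)
        have 2: "int p ^ (a * (l + 1)) dvd int p ^ (a * j) * z j - moment y ([:-\<xi>, 1:] ^ j)"
          using z[of j] False j i by auto
        have "(a' - a) * i \<le> (a' - a) * l" using i by simp
        also have "\<dots> \<le> a" using l(4) by (simp add: algebra_simps)
        finally have "a' * i \<le> a + a * i" by (simp add: diff_mult_distrib)
        also have "\<dots> = a * (i + 1)" by simp
        also have "\<dots> \<le> a * ((i - j) + (l + 1))"
          by (rule mult_le_mono2) (use i j in auto)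
        also have "\<dots> = a * (i - j) + a * (l + 1)" by (rule distrib_left)
        finally have "int p ^ (a' * i) dvd int p ^ (a * (i - j)) * int p ^ (a * (l + 1))"
          by (simp add: le_imp_power_dvd flip: power_add)
        then show ?thesis using mult_dvd_mono[OF 1 2] by (rule dvd_trans)
      qed
    qed
  qed
  also have "int p ^ (a' * i) = int p ^ (a * i) * int p ^ (i * (a' - a))"
    using l by (simp add: mult.commute[of _ i] flip: power_add distrib_left)
  finally show "int p ^ (i * (a' - a)) dvd moment z ([:-\<tau>, 1:] ^ i)"
    using p by simp
qed

lemma power_dvd_mult:
  fixes x :: "'a :: comm_semiring_1"
  assumes "n \<le> i + j" "x ^ j dvd c"
  shows "x ^ n dvd x ^ i * c"
proof -
  have "x ^ n dvd x ^ i * x ^ j"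
    unfolding power_add[symmetric] using assms(1) by (rule le_imp_power_dvd)
  also have "\<dots> dvd x ^ i * c" using assms(2) by (intro mult_dvd_mono) auto
  finally show ?thesis .
qed

text \<open>Along the fibres spanned by the dual frame the factor at \<eta> is constant, since each
  frame polynomial vanishes there to order k - l + 1, while the factor at \<xi> is a degree-l sum at
  scale a' - a. Condition \<open>c1\<close> controls the error of the projection, \<open>c2\<close>
  the constancy.\<close>

lemma bilinear_decoupling_step:
  assumes p: "prime p" "k < p" and l: "1 \<le> l" "l < k"
    and D: "decoupling p l (a' - a) D" "D \<ge> 0" and M: "bilinear_decoupling p k n l a' b M"
    and a: "1 \<le> a" "a \<le> a'" "a' \<le> n" and b: "1 \<le> b" "b \<le> n"
    and c1: "l * a' \<le> (l + 1) * a" and c2: "l * a' \<le> (k - l + 1) * b"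
  shows "bilinear_decoupling p k n l a b (D * M)"
proof (rule bilinear_decoupling_I)
  fix X y t ac lam \<xi> \<eta>
  assume configuration: "configuration p k n X y t ac lam" and \<xi>: "\<xi> \<in> {0..<int p ^ a}" and \<eta>: "\<eta> \<in> {0..<int p ^ b}"
    and neq: "\<xi> mod int p \<noteq> \<eta> mod int p"
  have p0: "p > 0" using p by linarith
  define I where "I = residue_class p t X a \<xi>"
  define I' where "I' = residue_class p t X b \<eta>"
  define L where "L = k * n"
  have la: "l * a' \<le> L" using l a unfolding L_def by (intro mult_le_mono) auto
  have lm: "l * (a' - a) + a * l = l * a'" using a by (simp add: diff_mult_distrib2 mult.commute)
  have ndvd: "\<not> int p dvd \<xi> - \<eta>" using neq by (simp add: mod_eq_dvd_iff)
  define RP where "RP = (\<lambda>i (R :: int poly). degree R \<le> k \<and> (\<forall>e\<le>k - l. coeff (pcompose R [:\<eta>, 1:]) e = 0) \<and>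
      (\<forall>e. 1 \<le> e \<longrightarrow> e \<le> l \<longrightarrow> int p ^ (k * n) dvd coeff (pcompose R [:\<xi>, 1:]) e - (if e = i then 1 else 0)))"
  have "\<exists>R. RP i R" if "1 \<le> i" "i \<le> l" for i
    unfolding RP_def using dual_frame[OF p that _ ndvd, of "k * n"] l by (metis less_imp_le)
  then have "\<forall>i\<in>{1..l}. \<exists>R. RP i R" by simp
  from bchoice[OF this] obtain R where RP0: "\<forall>i\<in>{1..l}. RP i (R i)" ..
  then have RP: "RP i (R i)" if "1 \<le> i" "i \<le> l" for i
    using that by simp
  have R: "degree (R i) \<le> k" if "1 \<le> i" "i \<le> l" for i
    using RP[OF that] by (simp add: RP_def)
  have R\<eta>: "coeff (pcompose (R i) [:\<eta>, 1:]) e = 0" if "1 \<le> i" "i \<le> l" "e \<le> k - l" for i e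
    using RP[OF that(1,2)] that(3) by (simp add: RP_def)
  have R\<xi>: "int p ^ (k * n) dvd coeff (pcompose (R i) [:\<xi>, 1:]) e - (if e = i then 1 else 0)"
    if "1 \<le> i" "i \<le> l" "1 \<le> e" "e \<le> l" for i e
    using RP[OF that(1,2)] that(3,4) unfolding RP_def by blast
  define c0 where "c0 = (\<lambda>i. coeff (pcompose (R i) [:\<xi>, 1:]) 0)"
  define z where "z = (\<lambda>x i. if i = 0 then 1 else (moment (y x) (R i) - c0 i) div int p ^ (a * i))"
  \<comment> \<open>There is no direction for i = 0: the coordinate \<open>z x 0 = 1\<close> is the
    same for all x and is matched by \<open>cst 0\<close> alone.\<close>
  define V where "V = (\<lambda>i. if i = 0 then 0 else smult (int p ^ (L - l * (a' - a) - a * i)) (R i))"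
  define cst where "cst = (\<lambda>i. if i = 0 then - (int p ^ (L - l * (a' - a)))
      else int p ^ (L - l * (a' - a) - a * i) * c0 i)"
  define w where "w = (\<lambda>c. coarse_weight p n lam a' (\<xi> + int p ^ a * c))"
  define G where "G = (\<lambda>P. cmod (exp_sum (p ^ L) y ac I' P) ^ (2 * (tri k - tri l)))"
  have ai: "a * i \<le> L - l * (a' - a)" if "i \<le> l" for i
  proof -
    have "a * i \<le> a * l" using that by simp
    then show ?thesis using la lm by linarith
  qed
  have I: "near_curve p k (y x) \<xi> a" "near_curve p k (y x) (t x) n" "t x = \<xi> + int p ^ a * (t x div int p ^ a)"
    if "x \<in> I" for x
    using that configuration a near_curve_residue_class[of p k y x t n a \<xi>]
    by (auto simp: I_def residue_class_def configuration_def)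
  have err: "int p ^ (a * (l + 1)) dvd moment (y x) (R i) - c0 i - moment (y x) ([:-\<xi>, 1:] ^ i)"
    if "x \<in> I" "1 \<le> i" "i \<le> l" for x i
    unfolding c0_def using frame_error[OF I(1)[OF that(1)] R[OF that(2,3)] that(2,3) l(2) _ R\<xi>[OF that(2,3)]] a by simp
  have z: "int p ^ (a * i) * z x i = moment (y x) (R i) - c0 i" if x: "x \<in> I" "1 \<le> i" "i \<le> l" for x i
  proof -
    have "int p ^ (a * i) dvd moment (y x) (R i) - c0 i - moment (y x) ([:-\<xi>, 1:] ^ i)"
      by (rule dvd_trans[OF le_imp_power_dvd err[OF x]], rule mult_le_mono2) (use x in simp)
    moreover have "int p ^ (a * i) dvd moment (y x) ([:-\<xi>, 1:] ^ i)"
      using I(1)[OF x(1)] x l unfolding near_curve_def mult.commute[of a i] by auto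
    ultimately have "int p ^ (a * i) dvd (moment (y x) (R i) - c0 i - moment (y x) ([:-\<xi>, 1:] ^ i)) + moment (y x) ([:-\<xi>, 1:] ^ i)"
      by (rule dvd_add)
    then have "int p ^ (a * i) dvd moment (y x) (R i) - c0 i" by simp
    then show ?thesis using x by (simp add: z_def)
  qed
  have "avg k (p ^ L) (\<lambda>P. cmod (exp_sum (p ^ L) y ac I P) ^ (2 * tri l) * G P)
    \<le> D * (\<Sum>c\<in>{0..<int p ^ (a' - a)}. w c) ^ (tri l - 1) *
      (\<Sum>c\<in>{0..<int p ^ (a' - a)}.
         avg k (p ^ L) (\<lambda>P. cmod (exp_sum (p ^ L) y ac (residue_class p (\<lambda>x. t x div int p ^ a) I (a' - a) c) P) ^ (2 * tri l) * G P)
         / w c ^ (tri l - 1))"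
  proof (rule decoupling_coset[where z = z and V = V and cst = cst])
    show "finite I" using configuration by (auto simp: I_def residue_class_def configuration_def)
    show "near_curve p l (z x) (t x div int p ^ a) (a' - a)" if x: "x \<in> I" for x
    proof (rule near_curve_projection[OF p0 I(1)[OF x]])
      show "near_curve p k (y x) (\<xi> + int p ^ a * (t x div int p ^ a)) a'"
        using near_curve_coarsen[OF I(2)[OF x] a(3), of "t x"] I(3)[OF x] by simp
      show "int p ^ (a * (l + 1)) dvd int p ^ (a * i) * z x i - moment (y x) ([:-\<xi>, 1:] ^ i)"
        if "1 \<le> i" "i \<le> l" for i
        using err[OF x that] z[OF x that] by simp
    qed (use l a c1 in \<open>auto simp: z_def\<close>)
    show "degree (V i) \<le> k" if "i \<le> l" for i
      using that R[of i] by (auto simp: V_def intro: order_trans[OF degree_smult_le])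
    show "l * (a' - a) \<le> L" using la lm by linarith
    show "int p ^ L dvd moment (y x) (V i) - int p ^ (L - l * (a' - a)) * z x i - cst i"
      if x: "x \<in> I" and i: "i \<le> l" for x i
    proof (cases "i = 0")
      case False
      then have i': "1 \<le> i" by simp
      show ?thesis
        using z[OF x i' i] power_split[OF ai[OF i], of "int p"] False
        by (simp add: V_def cst_def moment_smult mult.assoc right_diff_distrib)
    qed (simp add: V_def cst_def z_def)
    show "periodic (p ^ L) G"
      unfolding G_def using p0 by (intro periodic_compose[of _ _ "\<lambda>x. cmod x ^ _"] periodic_exp_sum) auto
    show "0 \<le> G P" for P by (simp add: G_def)
    show "G (P + V i) = G P" if i: "i \<le> l" for i P
    proof -
      have "exp_sum (p ^ L) y ac I' (P + V i) = exp_sum (p ^ L) y ac I' P"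
      proof (rule exp_sum_invariant)
        fix x assume "x \<in> I'"
        then have "near_curve p k (y x) \<eta> b"
          using configuration b near_curve_residue_class[of p k y x t n b \<eta>] by (auto simp: I'_def residue_class_def configuration_def)
        then have "int p ^ (b * (k - l + 1)) dvd moment (y x) (R i)" if "i \<noteq> 0"
          using that i R\<eta>[of i] R[of i] by (intro near_curve_dvd_moment[of _ _ _ \<eta>]) auto
        moreover have "L \<le> (L - l * (a' - a) - a * i) + b * (k - l + 1)"
        proof -
          have "a * i \<le> a * l" using i by simp
          then have "l * (a' - a) + a * i \<le> b * (k - l + 1)"
            using lm c2 mult.commute[of b "k - l + 1"] by linarith
          then show ?thesis by linarith
        qed
        ultimately have "int p ^ L dvd int p ^ (L - l * (a' - a) - a * i) * moment (y x) (R i)" if "i \<noteq> 0"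
          using that by (intro power_dvd_mult[where j = "b * (k - l + 1)"]) auto
        then show "int (p ^ L) dvd moment (y x) (V i)"
          by (simp add: V_def moment_smult)
      qed (use p0 in simp)
      then show ?thesis by (simp add: G_def)
    qed
    show "0 < w c" if "c \<in> {0..<int p ^ (a' - a)}" for c
      unfolding w_def by (rule coarse_weight_pos[OF configuration refine_bounds[OF \<xi> that a(2) p0]]) (use p0 a in auto)
  qed (use D l p0 in auto)
  then have "avg k (p ^ L) (\<lambda>P. cmod (exp_sum (p ^ L) y ac I P) ^ (2 * tri l) * G P)
     \<le> (D * M) * (\<Sum>c\<in>{0..<int p ^ (a' - a)}. w c) ^ tri l * coarse_weight p n lam b \<eta> ^ (tri k - tri l)"
  proof (rule collect_refined[rotated -1])
    fix c assume c: "c \<in> {0..<int p ^ (a' - a)}"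
    show "0 < w c"
      unfolding w_def by (rule coarse_weight_pos[OF configuration refine_bounds[OF \<xi> c a(2) p0]]) (use p0 a in auto)
    show "avg k (p ^ L) (\<lambda>P. cmod (exp_sum (p ^ L) y ac (residue_class p (\<lambda>x. t x div int p ^ a) I (a' - a) c) P) ^ (2 * tri l) * G P)
       \<le> M * w c ^ tri l * coarse_weight p n lam b \<eta> ^ (tri k - tri l)"
      using bilinear_decoupling_D[OF M configuration refine_bounds[OF \<xi> c a(2) p0] \<eta>] neq
      unfolding I_def residue_class_refine[OF \<xi> c a(2) p0] w_def bilinear_mean_def G_def I'_def L_def
      by (simp add: refine_mod_p[OF a(1)])
  qed (use D tri_pos[OF l(1)] in auto)
  then show "bilinear_mean p k n y ac l (residue_class p t X a \<xi>) (residue_class p t X b \<eta>)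
     \<le> (D * M) * coarse_weight p n lam a \<xi> ^ tri l * coarse_weight p n lam b \<eta> ^ (tri k - tri l)"
    using coarse_weight_refine[OF \<xi> a(2) p0, of n lam] by (simp add: bilinear_mean_def w_def I_def I'_def G_def L_def)
qed

section \<open>Interpolation between bilinear means\<close>

lemma weighted_am_gm:
  fixes x y :: real
  assumes "x > 0" "y > 0" "m + n \<ge> 1"
  shows "x ^ m * y ^ n \<le> ((real m * x + real n * y) / real (m + n)) ^ (m + n)"
proof -
  define s where "s = real (m + n)"
  have s: "s > 0" using assms by (simp add: s_def)
  have "(x powr (m / s) * y powr (n / s)) powr s \<le> (m / s * x + n / s * y) powr s"
    using assms s Youngs_inequality_0[of "m / s" "n / s" x y]
    by (intro powr_mono2) (auto simp: s_def simp flip: add_divide_distrib)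
  also have "(x powr (m / s) * y powr (n / s)) powr s = x ^ m * y ^ n"
    using assms s by (simp add: powr_mult powr_powr powr_realpow)
  also have "m / s * x + n / s * y = (real m * x + real n * y) / real (m + n)"
    by (simp add: s_def add_divide_distrib)
  also have "\<dots> powr s = \<dots> ^ (m + n)"
    unfolding s_def
  proof (rule powr_realpow)
    have "real m * x + real n * y > 0"
      using assms by (cases "m = 0") (auto intro: add_pos_nonneg)
    then show "(real m * x + real n * y) / real (m + n) > 0" using assms by auto
  qed
  finally show ?thesis .
qed

text \<open>Divide both functions by their means and apply the weighted AM-GM inequality pointwise;
  the slack tau covers vanishing means. Natural exponents in the hypothesis avoid real powers of the
  integrands.\<close>

lemma avg_Holder:
  assumes Q: "Q > 0" and mn: "m + n \<ge> 1"
    and F: "\<And>P. 0 \<le> F P" and G: "\<And>P. 0 \<le> G P" and Z: "\<And>P. 0 \<le> Z P"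
    and le: "\<And>P. Z P ^ (m + n) \<le> F P ^ m * G P ^ n"
  shows "avg k Q Z ^ (m + n) \<le> avg k Q F ^ m * avg k Q G ^ n"
proof -
  define A where "A = avg k Q F"
  define B where "B = avg k Q G"
  have AB: "A \<ge> 0" "B \<ge> 0" unfolding A_def B_def using F G by (auto intro!: avg_nonneg)
  have "avg k Q Z ^ (m + n) \<le> (A + \<tau>) ^ m * (B + \<tau>) ^ n" if \<tau>: "\<tau> > 0" for \<tau>
  proof -
    define K where "K = root (m + n) ((A + \<tau>) ^ m * (B + \<tau>) ^ n)"
    have pos: "A + \<tau> > 0" "B + \<tau> > 0" using AB \<tau> by auto
    have pr: "0 < (A + \<tau>) ^ m * (B + \<tau>) ^ n" using pos by simp
    have mn0: "0 < m + n" using mn by linarith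
    have K: "K > 0" "K ^ (m + n) = (A + \<tau>) ^ m * (B + \<tau>) ^ n"
      using real_root_gt_zero[OF mn0 pr] real_root_pow_pos[OF mn0 pr] unfolding K_def by blast+
    have "Z P \<le> K * ((real m * ((F P + \<tau>) / (A + \<tau>)) + real n * ((G P + \<tau>) / (B + \<tau>))) / real (m + n))" for P
    proof -
      let ?x = "(F P + \<tau>) / (A + \<tau>)" and ?y = "(G P + \<tau>) / (B + \<tau>)"
      have xy: "?x > 0" "?y > 0" using F[of P] G[of P] \<tau> pos by auto
      have "Z P ^ (m + n) \<le> (F P + \<tau>) ^ m * (G P + \<tau>) ^ n"
        using F[of P] G[of P] \<tau> by (intro order_trans[OF le] mult_mono power_mono) auto
      also have "\<dots> = K ^ (m + n) * (?x ^ m * ?y ^ n)"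
        using pos by (simp add: K(2) power_divide)
      also have "\<dots> \<le> K ^ (m + n) * ((real m * ?x + real n * ?y) / real (m + n)) ^ (m + n)"
        using K(1) xy mn by (intro mult_left_mono weighted_am_gm) auto
      finally have "Z P ^ (m + n) \<le> (K * ((real m * ?x + real n * ?y) / real (m + n))) ^ (m + n)"
        by (simp only: power_mult_distrib)
      moreover have "0 \<le> K * ((real m * ?x + real n * ?y) / real (m + n))"
        by (intro mult_nonneg_nonneg divide_nonneg_nonneg add_nonneg_nonneg) (use K(1) F[of P] G[of P] \<tau> AB in auto)
      ultimately show ?thesis
        using mn0 Z by (metis power_mono_iff)
    qed
    then have "avg k Q Z \<le> avg k Q (\<lambda>P. K * ((real m * ((F P + \<tau>) / (A + \<tau>)) + real n * ((G P + \<tau>) / (B + \<tau>))) / real (m + n)))"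
      by (intro avg_mono)
    also have "\<dots> = K * ((real m * ((A + \<tau>) / (A + \<tau>)) + real n * ((B + \<tau>) / (B + \<tau>))) / real (m + n))"
      unfolding avg_cmult avg_divide avg_add A_def B_def by (simp only: avg_const[OF Q])
    also have "\<dots> = K" using pos mn by (simp flip: of_nat_add)
    finally have "avg k Q Z ^ (m + n) \<le> K ^ (m + n)"
      using Z by (intro power_mono avg_nonneg)
    then show ?thesis by (simp add: K)
  qed
  then have "avg k Q Z ^ (m + n) \<le> (A + 0) ^ m * (B + 0) ^ n"
    by (rule le_limit_at_0[where h = "\<lambda>\<tau>. (A + \<tau>) ^ m * (B + \<tau>) ^ n"]) (auto intro!: continuous_intros)
  then show ?thesis by (simp add: A_def B_def)
qed

text \<open>Exponent count for the interpolation of index l with weight 1 on index k - l, factors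
  exchanged, and weight k - l on index l - 1.\<close>

lemma tri_Holder_identities:
  assumes "1 \<le> l" "l \<le> k"
  shows "(k - l + 1) * tri l = (tri k - tri (k - l)) + (k - l) * tri (l - 1)"
    "(k - l + 1) * (tri k - tri l) = tri (k - l) + (k - l) * (tri k - tri (l - 1))"
proof -
  define m where "m = k - l"
  define j where "j = l - 1"
  have kl: "k = Suc (j + m)" "l = Suc j" "k - l = m" "l - 1 = j" using assms by (auto simp: m_def j_def)
  have le: "tri m \<le> tri k" "tri l \<le> tri k" "tri j \<le> tri k"
    unfolding kl(1,2) by (auto intro!: tri_mono)
  have t: "2 * int (tri i) = int i * (int i + 1)" for i
    using two_tri[of i] by (metis of_nat_1 of_nat_add of_nat_mult of_nat_numeral)
  have "2 * ((int m + 1) * int (tri l)) = 2 * ((int (tri k) - int (tri m)) + int m * int (tri j))"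
    using t[of k] t[of l] t[of m] t[of j] unfolding kl(1,2) by (simp add: algebra_simps)
  then have "int ((m + 1) * tri l) = int ((tri k - tri m) + m * tri j)"
    unfolding of_nat_add of_nat_mult of_nat_diff[OF le(1)] of_nat_1
    by (subst (asm) mult_left_cancel) auto
  then show "(k - l + 1) * tri l = (tri k - tri (k - l)) + (k - l) * tri (l - 1)"
    unfolding kl(3,4) by (simp only: of_nat_eq_iff)
  have "2 * ((int m + 1) * (int (tri k) - int (tri l))) = 2 * (int (tri m) + int m * (int (tri k) - int (tri j)))"
    using t[of k] t[of l] t[of m] t[of j] unfolding kl(1,2) by (simp add: algebra_simps)
  then have "int ((m + 1) * (tri k - tri l)) = int (tri m + m * (tri k - tri j))"
    unfolding of_nat_add of_nat_mult of_nat_diff[OF le(2)] of_nat_diff[OF le(3)] of_nat_1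
    by (subst (asm) mult_left_cancel) auto
  then show "(k - l + 1) * (tri k - tri l) = tri (k - l) + (k - l) * (tri k - tri (l - 1))"
    unfolding kl(3,4) by (simp only: of_nat_eq_iff)
qed

lemma bilinear_mean_nonneg: "0 \<le> bilinear_mean p k n y a l S S'"
  unfolding bilinear_mean_def by (rule avg_nonneg) simp

text \<open>Exchanging the two classes is what transfers depth from one to the other: index k - l at
  scales (b, a) helps index l at scales (a, b).\<close>

lemma bilinear_decoupling_Holder:
  assumes p: "p > 0" and l: "1 \<le> l" "l \<le> k" and ab: "a \<le> n" "b \<le> n"
    and M1: "bilinear_decoupling p k n (k - l) b a M1" and M2: "bilinear_decoupling p k n (l - 1) a b M2"
    and M: "M \<ge> 0" "M1 * M2 ^ (k - l) \<le> M ^ (k - l + 1)" "M1 \<ge> 0" "M2 \<ge> 0"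
  shows "bilinear_decoupling p k n l a b M"
proof (rule bilinear_decoupling_I)
  fix X y t ac lam \<xi> \<eta>
  assume configuration: "configuration p k n X y t ac lam" and \<xi>: "\<xi> \<in> {0..<int p ^ a}" and \<eta>: "\<eta> \<in> {0..<int p ^ b}"
    and neq: "\<xi> mod int p \<noteq> \<eta> mod int p"
  define m where "m = k - l"
  define I where "I = residue_class p t X a \<xi>"
  define I' where "I' = residue_class p t X b \<eta>"
  define u where "u = coarse_weight p n lam a \<xi>"
  define v where "v = coarse_weight p n lam b \<eta>"
  have uv: "u > 0" "v > 0" unfolding u_def v_def using coarse_weight_pos[OF configuration] \<xi> \<eta> ab p by auto
  note id = tri_Holder_identities[OF l, folded m_def]
  have "bilinear_mean p k n y ac l I I' ^ (1 + m) \<le> bilinear_mean p k n y ac m I' I ^ 1 * bilinear_mean p k n y ac (l - 1) I I' ^ m"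
    unfolding bilinear_mean_def
  proof (rule avg_Holder)
    fix P
    let ?x = "cmod (exp_sum (p ^ (k * n)) y ac I P)" and ?y = "cmod (exp_sum (p ^ (k * n)) y ac I' P)"
    have "(?x ^ (2 * tri l) * ?y ^ (2 * (tri k - tri l))) ^ (1 + m)
        = ?x ^ (2 * ((m + 1) * tri l)) * ?y ^ (2 * ((m + 1) * (tri k - tri l)))"
      by (simp only: power_mult_distrib power_mult[symmetric] mult_ac add.commute)
    also have "\<dots> = (?y ^ (2 * tri m) * ?x ^ (2 * (tri k - tri m))) ^ 1 *
       (?x ^ (2 * tri (l - 1)) * ?y ^ (2 * (tri k - tri (l - 1)))) ^ m"
      unfolding id by (simp only: distrib_left power_add power_mult_distrib power_mult[symmetric] power_one_right mult_ac)
    finally show "(?x ^ (2 * tri l) * ?y ^ (2 * (tri k - tri l))) ^ (1 + m) \<le>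
       (?y ^ (2 * tri m) * ?x ^ (2 * (tri k - tri m))) ^ 1 *
       (?x ^ (2 * tri (l - 1)) * ?y ^ (2 * (tri k - tri (l - 1)))) ^ m" by simp
  qed (use p in auto)
  also have "\<dots> \<le> (M1 * v ^ tri m * u ^ (tri k - tri m)) ^ 1 * (M2 * u ^ tri (l - 1) * v ^ (tri k - tri (l - 1))) ^ m"
    using bilinear_decoupling_D[OF M1 configuration \<eta> \<xi>] bilinear_decoupling_D[OF M2 configuration \<xi> \<eta> neq] neq M uv
    by (intro mult_mono power_mono zero_le_power)
      (auto simp: bilinear_mean_nonneg I_def I'_def u_def v_def m_def intro!: mult_nonneg_nonneg)
  also have "\<dots> = (M1 * M2 ^ m) * (u ^ ((m + 1) * tri l) * v ^ ((m + 1) * (tri k - tri l)))"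
    unfolding id by (simp only: distrib_left power_add power_mult_distrib power_mult[symmetric] power_one_right mult_ac)
  also have "\<dots> \<le> M ^ (1 + m) * (u ^ ((m + 1) * tri l) * v ^ ((m + 1) * (tri k - tri l)))"
    using M uv by (intro mult_right_mono) (auto simp: m_def)
  also have "\<dots> = (M * u ^ tri l * v ^ (tri k - tri l)) ^ (1 + m)"
    by (simp only: power_mult_distrib power_mult[symmetric] mult_ac add.commute)
  finally show "bilinear_mean p k n y ac l I I' \<le> M * u ^ tri l * v ^ (tri k - tri l)"
    using M uv by (subst (asm) power_mono_iff) (auto simp: bilinear_mean_nonneg)
qed

text \<open>Hoelder separates the two factors, and a single factor is the case l = 0.\<close>

lemma bilinear_decoupling_trivial:
  assumes p: "p > 0" and l: "l \<le> k" "1 \<le> k" and D: "decoupling p k (n - a) D" "decoupling p k (n - b) D" "D \<ge> 0"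
    and ab: "a \<le> n" "b \<le> n"
  shows "bilinear_decoupling p k n l a b D"
proof (rule bilinear_decoupling_I)
  fix X y t ac lam \<xi> \<eta>
  assume configuration: "configuration p k n X y t ac lam" and \<xi>: "\<xi> \<in> {0..<int p ^ a}" and \<eta>: "\<eta> \<in> {0..<int p ^ b}"
    and neq: "\<xi> mod int p \<noteq> \<eta> mod int p"
  define I where "I = residue_class p t X a \<xi>"
  define I' where "I' = residue_class p t X b \<eta>"
  define u where "u = coarse_weight p n lam a \<xi>"
  define v where "v = coarse_weight p n lam b \<eta>"
  have uv: "u > 0" "v > 0" unfolding u_def v_def using coarse_weight_pos[OF configuration] \<xi> \<eta> ab p by auto
  define q where "q = tri k"
  have ql: "tri l \<le> q" "q \<ge> 1" using tri_mono[OF l(1)] tri_pos[OF l(2)] by (auto simp: q_def)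
  have sum: "tri l + (q - tri l) = q" using ql by simp
  have "bilinear_mean p k n y ac l I I' ^ (tri l + (q - tri l)) \<le> bilinear_mean p k n y ac 0 I' I ^ tri l * bilinear_mean p k n y ac 0 I I' ^ (q - tri l)"
    unfolding bilinear_mean_def
  proof (rule avg_Holder)
    fix P
    let ?x = "cmod (exp_sum (p ^ (k * n)) y ac I P)" and ?y = "cmod (exp_sum (p ^ (k * n)) y ac I' P)"
    show "(?x ^ (2 * tri l) * ?y ^ (2 * (tri k - tri l))) ^ (tri l + (q - tri l)) \<le>
       (?y ^ (2 * tri 0) * ?x ^ (2 * (tri k - tri 0))) ^ tri l *
       (?x ^ (2 * tri 0) * ?y ^ (2 * (tri k - tri 0))) ^ (q - tri l)"
      unfolding sum by (simp add: q_def power_mult_distrib mult_ac flip: power_mult)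
  qed (use p ql in auto)
  also have "\<dots> \<le> (D * v ^ tri 0 * u ^ (tri k - tri 0)) ^ tri l * (D * u ^ tri 0 * v ^ (tri k - tri 0)) ^ (q - tri l)"
    using bilinear_decoupling_D[OF bilinear_decoupling_zero[OF p l(2) D(1,3) ab(1)] configuration \<eta> \<xi>] bilinear_decoupling_D[OF bilinear_decoupling_zero[OF p l(2) D(2,3) ab(2)] configuration \<xi> \<eta> neq] neq uv D(3)
    by (intro mult_mono power_mono zero_le_power)
      (auto simp: bilinear_mean_nonneg I_def I'_def u_def v_def intro!: mult_nonneg_nonneg)
  also have "\<dots> = (D * u ^ tri l * v ^ (tri k - tri l)) ^ (tri l + (q - tri l))"
    unfolding sum using power_add[of D "tri l" "q - tri l"] sum
    by (simp add: q_def power_mult_distrib mult_ac flip: power_mult)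
  finally show "bilinear_mean p k n y ac l I I' \<le> D * u ^ tri l * v ^ (tri k - tri l)"
    using D(3) uv ql by (subst (asm) power_mono_iff) (auto simp: bilinear_mean_nonneg)
qed

section \<open>Trivial refinement and reduction to transversal pairs\<close>

lemma norm_sum_power_le:
  fixes v :: "'i \<Rightarrow> complex" and w :: "'i \<Rightarrow> real"
  assumes "finite C" "\<And>c. c \<in> C \<Longrightarrow> 0 < w c" "q \<ge> 1"
  shows "cmod (\<Sum>c\<in>C. v c) ^ (2 * q)
    \<le> real (card C) ^ q * (\<Sum>c\<in>C. w c) ^ (q - 1) * (\<Sum>c\<in>C. cmod (v c) ^ (2 * q) / w c ^ (q - 1))"
proof -
  have "cmod (\<Sum>c\<in>C. v c) ^ 2 \<le> (\<Sum>c\<in>C. cmod (v c)) ^ 2"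
    by (intro power_mono norm_sum) auto
  also have "\<dots> \<le> real (card C) * (\<Sum>c\<in>C. cmod (v c) ^ 2)"
    using sum_squared_le_sum_of_squares[of "\<lambda>c. cmod (v c)" C] by (simp add: mult.commute)
  finally have "(cmod (\<Sum>c\<in>C. v c) ^ 2) ^ q \<le> (real (card C) * (\<Sum>c\<in>C. cmod (v c) ^ 2)) ^ q"
    by (intro power_mono) auto
  also have "\<dots> \<le> real (card C) ^ q * ((\<Sum>c\<in>C. w c) ^ (q - 1) * (\<Sum>c\<in>C. (cmod (v c) ^ 2) ^ q / w c ^ (q - 1)))"
    unfolding power_mult_distrib using assms by (intro mult_left_mono jensen_power) auto
  finally show ?thesis by (simp add: power_mult mult.assoc)
qed

lemma exp_sum_partition:
  assumes "finite X" "p > 0"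
  shows "(\<Sum>c\<in>{0..<int p ^ m}. exp_sum Q y a (residue_class p t X m c) P) = exp_sum Q y a X P"
  unfolding exp_sum_def residue_class_def
  by (rule sum.group) (use assms in auto)

text \<open>Cauchy--Schwarz over p^m pieces in place of decoupling, at the price p^(mq). It has the
  same linear shape as \<open>decoupling_weighted\<close>, so both can be fed into
  \<open>collect_refined\<close>.\<close>

lemma trivial_refine:
  assumes p: "p > 0" and X: "finite X" and q: "q \<ge> 1"
    and w: "\<And>c. c \<in> {0..<int p ^ m} \<Longrightarrow> 0 < w c" and G: "\<And>P. 0 \<le> G P"
  shows "avg k Q (\<lambda>P. cmod (exp_sum Q y a X P) ^ (2 * q) * G P)
    \<le> real p ^ (m * q) * (\<Sum>c\<in>{0..<int p ^ m}. w c) ^ (q - 1) *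
      (\<Sum>c\<in>{0..<int p ^ m}. avg k Q (\<lambda>P. cmod (exp_sum Q y a (residue_class p t X m c) P) ^ (2 * q) * G P) / w c ^ (q - 1))"
proof -
  define C where "C = {0..<int p ^ m}"
  define W where "W = real p ^ (m * q) * (\<Sum>c\<in>C. w c) ^ (q - 1)"
  have card: "real (card C) ^ q = real p ^ (m * q)"
    by (simp add: C_def power_mult nat_power_eq)
  have "avg k Q (\<lambda>P. cmod (exp_sum Q y a X P) ^ (2 * q) * G P)
    \<le> avg k Q (\<lambda>P. (W * (\<Sum>c\<in>C. cmod (exp_sum Q y a (residue_class p t X m c) P) ^ (2 * q) / w c ^ (q - 1))) * G P)"
    unfolding W_def card[symmetric] exp_sum_partition[OF X p, of Q y a t m, symmetric]
    unfolding C_def[symmetric]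
    by (intro avg_mono mult_right_mono norm_sum_power_le q G) (use w in \<open>auto simp: C_def\<close>)
  also have "\<dots> = W * (\<Sum>c\<in>C. avg k Q (\<lambda>P. cmod (exp_sum Q y a (residue_class p t X m c) P) ^ (2 * q) * G P) / w c ^ (q - 1))"
    by (simp add: mult.assoc avg_cmult sum_distrib_right avg_sum avg_divide)
  finally show ?thesis by (simp add: W_def C_def)
qed

text \<open>This and its counterpart for b bring an estimate at deep scales back to scale 1. The
  loss is affordable because the saving at scale b can be made a large multiple of b.\<close>

lemma bilinear_decoupling_refine_left:
  assumes p: "p > 0" and l: "1 \<le> l" and M: "bilinear_decoupling p k n l a' b M" and a: "1 \<le> a" "a \<le> a'" "a' \<le> n"
  shows "bilinear_decoupling p k n l a b (real p ^ ((a' - a) * tri l) * M)"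
proof (rule bilinear_decoupling_I)
  fix X y t ac lam \<xi> \<eta>
  assume configuration: "configuration p k n X y t ac lam" and \<xi>: "\<xi> \<in> {0..<int p ^ a}" and \<eta>: "\<eta> \<in> {0..<int p ^ b}"
    and neq: "\<xi> mod int p \<noteq> \<eta> mod int p"
  define I where "I = residue_class p t X a \<xi>"
  define w where "w = (\<lambda>c. coarse_weight p n lam a' (\<xi> + int p ^ a * c))"
  have w: "0 < w c" if "c \<in> {0..<int p ^ (a' - a)}" for c
    unfolding w_def by (rule coarse_weight_pos[OF configuration refine_bounds[OF \<xi> that a(2) p]]) (use p a in auto)
  have fin: "finite I" using configuration by (auto simp: I_def residue_class_def configuration_def)
  have "bilinear_mean p k n y ac l I (residue_class p t X b \<eta>)
     \<le> (real p ^ ((a' - a) * tri l) * M) * (\<Sum>c\<in>{0..<int p ^ (a' - a)}. w c) ^ tri l * coarse_weight p n lam b \<eta> ^ (tri k - tri l)"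
    unfolding bilinear_mean_def
  proof (rule collect_refined[OF _ w tri_pos[OF l] _ _ trivial_refine[where t = "\<lambda>x. t x div int p ^ a", OF p fin tri_pos[OF l] w]])
    fix c assume c: "c \<in> {0..<int p ^ (a' - a)}"
    show "avg k (p ^ (k * n)) (\<lambda>P. cmod (exp_sum (p ^ (k * n)) y ac (residue_class p (\<lambda>x. t x div int p ^ a) I (a' - a) c) P) ^ (2 * tri l)
        * cmod (exp_sum (p ^ (k * n)) y ac (residue_class p t X b \<eta>) P) ^ (2 * (tri k - tri l)))
       \<le> M * w c ^ tri l * coarse_weight p n lam b \<eta> ^ (tri k - tri l)"
      using bilinear_decoupling_D[OF M configuration refine_bounds[OF \<xi> c a(2) p] \<eta>] neq
      unfolding I_def residue_class_refine[OF \<xi> c a(2) p] w_def bilinear_mean_def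
      by (simp add: refine_mod_p[OF a(1)])
  qed auto
  then show "bilinear_mean p k n y ac l (residue_class p t X a \<xi>) (residue_class p t X b \<eta>)
     \<le> (real p ^ ((a' - a) * tri l) * M) * coarse_weight p n lam a \<xi> ^ tri l * coarse_weight p n lam b \<eta> ^ (tri k - tri l)"
    using coarse_weight_refine[OF \<xi> a(2) p, of n lam] by (simp add: w_def I_def)
qed

lemma bilinear_decoupling_refine_right:
  assumes p: "p > 0" and l: "l < k" and M: "bilinear_decoupling p k n l a b' M" and b: "1 \<le> b" "b \<le> b'" "b' \<le> n"
  shows "bilinear_decoupling p k n l a b (real p ^ ((b' - b) * (tri k - tri l)) * M)"
proof (rule bilinear_decoupling_I)
  fix X y t ac lam \<xi> \<eta>
  assume configuration: "configuration p k n X y t ac lam" and \<xi>: "\<xi> \<in> {0..<int p ^ a}" and \<eta>: "\<eta> \<in> {0..<int p ^ b}"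
    and neq: "\<xi> mod int p \<noteq> \<eta> mod int p"
  define q where "q = tri k - tri l"
  have q: "q \<ge> 1"
    using tri_mono[of "Suc l" k] l by (simp add: q_def tri_Suc)
  define I where "I = residue_class p t X b \<eta>"
  define w where "w = (\<lambda>c. coarse_weight p n lam b' (\<eta> + int p ^ b * c))"
  have w: "0 < w c" if "c \<in> {0..<int p ^ (b' - b)}" for c
    unfolding w_def by (rule coarse_weight_pos[OF configuration refine_bounds[OF \<eta> that b(2) p]]) (use p b in auto)
  have fin: "finite I" using configuration by (auto simp: I_def residue_class_def configuration_def)
  have "bilinear_mean p k n y ac l (residue_class p t X a \<xi>) I
     \<le> (real p ^ ((b' - b) * q) * M) * (\<Sum>c\<in>{0..<int p ^ (b' - b)}. w c) ^ q * coarse_weight p n lam a \<xi> ^ tri l"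
    unfolding bilinear_mean_def q_def[symmetric] mult.commute[of "cmod (exp_sum _ _ _ (residue_class p t X a \<xi>) _) ^ _"]
  proof (rule collect_refined[OF _ w q _ _ trivial_refine[where t = "\<lambda>x. t x div int p ^ b", OF p fin q w]])
    fix c assume c: "c \<in> {0..<int p ^ (b' - b)}"
    show "avg k (p ^ (k * n)) (\<lambda>P. cmod (exp_sum (p ^ (k * n)) y ac (residue_class p (\<lambda>x. t x div int p ^ b) I (b' - b) c) P) ^ (2 * q)
        * cmod (exp_sum (p ^ (k * n)) y ac (residue_class p t X a \<xi>) P) ^ (2 * tri l))
       \<le> M * w c ^ q * coarse_weight p n lam a \<xi> ^ tri l"
      using bilinear_decoupling_D[OF M configuration \<xi> refine_bounds[OF \<eta> c b(2) p]] neq refine_mod_p[OF b(1), of \<eta> p c]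
      unfolding I_def residue_class_refine[OF \<eta> c b(2) p] w_def bilinear_mean_def q_def
      by (simp add: mult_ac)
  qed auto
  then show "bilinear_mean p k n y ac l (residue_class p t X a \<xi>) (residue_class p t X b \<eta>)
     \<le> (real p ^ ((b' - b) * (tri k - tri l)) * M) * coarse_weight p n lam a \<xi> ^ tri l * coarse_weight p n lam b \<eta> ^ (tri k - tri l)"
    using coarse_weight_refine[OF \<eta> b(2) p, of n lam] by (simp add: w_def I_def q_def mult_ac)
qed

text \<open>The diagonal comes with constant exactly 1. It is handed on from scale to scale, so any
  larger constant would compound.\<close>

lemma norm_sum_square_le:
  fixes v :: "'i \<Rightarrow> complex"
  assumes "finite C"
  shows "cmod (\<Sum>c\<in>C. v c) ^ 2
    \<le> (\<Sum>c\<in>C. cmod (v c) ^ 2) + (\<Sum>(c, c')\<in>{(c, c') \<in> C \<times> C. c \<noteq> c'}. cmod (v c) * cmod (v c'))"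
proof -
  have "cmod (\<Sum>c\<in>C. v c) ^ 2 \<le> (\<Sum>c\<in>C. cmod (v c)) ^ 2"
    by (intro power_mono norm_sum) auto
  also have "\<dots> = (\<Sum>(c, c')\<in>C \<times> C. cmod (v c) * cmod (v c'))"
    by (simp add: power2_eq_square sum_product sum.cartesian_product)
  also have "C \<times> C = (\<lambda>c. (c, c)) ` C \<union> {(c, c') \<in> C \<times> C. c \<noteq> c'}" by auto
  also have "(\<Sum>(c, c')\<in>\<dots>. cmod (v c) * cmod (v c'))
     = (\<Sum>(c, c')\<in>(\<lambda>c. (c, c)) ` C. cmod (v c) * cmod (v c')) + (\<Sum>(c, c')\<in>{(c, c') \<in> C \<times> C. c \<noteq> c'}. cmod (v c) * cmod (v c'))"
    by (rule sum.union_disjoint) (use assms in \<open>auto intro: finite_subset[of _ "C \<times> C"]\<close>)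
  also have "(\<Sum>(c, c')\<in>(\<lambda>c. (c, c)) ` C. cmod (v c) * cmod (v c')) = (\<Sum>c\<in>C. cmod (v c) ^ 2)"
    by (subst sum.reindex) (auto simp: inj_on_def power2_eq_square)
  finally show ?thesis .
qed

text \<open>Deliberately lopsided convexity: the first term is multiplied by a factor close to 1 and
  the loss in tau falls on the second.\<close>

lemma power_add_le_weighted:
  fixes A B \<tau> :: real
  assumes "A \<ge> 0" "B \<ge> 0" "\<tau> > 0" "q \<ge> 1"
  shows "(A + B) ^ q \<le> (1 + \<tau>) ^ (q - 1) * (A ^ q + B ^ q / \<tau> ^ (q - 1))"
  using jensen_power[of "{False, True}" "\<lambda>b. if b then \<tau> else 1" "\<lambda>b. if b then B else A" q] assms
  by simp

text \<open>A broad-narrow recursion in n: classes modulo p paired with themselves rescale to scale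
  n - 1, distinct ones are transversal and obey the bilinear estimate at scales (1, 1).\<close>

lemma decoupling_broad:
  assumes p: "prime p" and k: "1 \<le> k" and l: "l \<le> k" and n: "n \<ge> 1"
    and D: "decoupling p k (n - 1) D" "D \<ge> 0" and M: "bilinear_decoupling p k n l 1 1 M" "M \<ge> 0" and \<tau>: "\<tau> > 0"
  shows "decoupling p k n ((1 + \<tau>) ^ (tri k - 1) * (D + real p ^ (2 * tri k) * M / \<tau> ^ (tri k - 1)))"
  unfolding decoupling_def
proof (intro allI impI)
  fix X y t ac lam
  assume configuration: "configuration p k n X y t ac lam"
  have p0: "p > 0" and p2: "p \<ge> 2" using p prime_gt_0_nat prime_ge_2_nat by auto
  define q where "q = tri k"
  have q: "q \<ge> 1" using tri_pos[OF k] by (simp add: q_def)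
  have ql: "tri l \<le> q" using l by (simp add: q_def tri_mono)
  define Q where "Q = p ^ (k * n)"
  define C where "C = {0..<int p}"
  define T where "T = {(c, c') \<in> C \<times> C. c \<noteq> c'}"
  define f where "f = (\<lambda>c. exp_sum Q y ac (residue_class p t X 1 c))"
  define w where "w = coarse_weight p n lam 1"
  define \<Lambda> where "\<Lambda> = (\<Sum>c\<in>{0..<int p ^ n}. lam c)"
  have fin: "finite C" "finite T" by (auto simp: C_def T_def intro: finite_subset[of _ "C \<times> C"])
  have w: "w c > 0" if "c \<in> C" for c
    using coarse_weight_pos[OF configuration, of c 1] that n p0 by (simp add: w_def C_def)
  have sum_w: "(\<Sum>c\<in>C. w c) = \<Lambda>"
    using coarse_weight_refine[of 0 p 0 1 n lam] p0
    by (simp add: w_def C_def \<Lambda>_def coarse_weight_def atLeastLessThan_def lessThan_def atLeast_def Collect_conj_eq)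
  have w_le: "w c \<le> \<Lambda>" if "c \<in> C" for c
    unfolding sum_w[symmetric] using fin w that by (intro member_le_sum) (auto intro: less_imp_le)
  have \<Lambda>: "\<Lambda> > 0"
  proof -
    have "0 \<in> C" using p0 by (simp add: C_def)
    then show ?thesis using w w_le by force
  qed
  have f_sum: "exp_sum Q y ac X P = (\<Sum>c\<in>C. f c P)" for P
    using exp_sum_partition[of X p Q y ac t 1 P] configuration p0 by (simp add: f_def C_def configuration_def)
  have diag: "avg k Q (\<lambda>P. cmod (f c P) ^ (2 * q)) \<le> D * w c ^ q" if c: "c \<in> C" for c
  proof -
    \<comment> \<open>The mean with l = 0 does not see the class of \<xi>, but the bilinear
      statement asks for some class transversal to c.\<close>
    define \<xi> where "\<xi> = (if c = 0 then 1 else 0 :: int)"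
    have "\<xi> \<in> {0..<int p ^ 1}" "\<xi> mod int p \<noteq> c mod int p" using c p2 by (auto simp: \<xi>_def C_def)
    then have "bilinear_mean p k n y ac 0 (residue_class p t X 1 \<xi>) (residue_class p t X 1 c)
       \<le> D * coarse_weight p n lam 1 \<xi> ^ tri 0 * coarse_weight p n lam 1 c ^ (tri k - tri 0)"
      using c by (intro bilinear_decoupling_D[OF bilinear_decoupling_zero[OF p0 k D n] configuration]) (auto simp: C_def)
    then show ?thesis by (simp add: bilinear_mean_def f_def Q_def q_def w_def)
  qed
  have offdiag: "avg k Q (\<lambda>P. (cmod (f c P) * cmod (f c' P)) ^ q) \<le> M * \<Lambda> ^ q" if "(c, c') \<in> T" for c c'
  proof -
    have c: "c \<in> {0..<int p ^ 1}" "c' \<in> {0..<int p ^ 1}" "c mod int p \<noteq> c' mod int p"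
      using that by (auto simp: T_def C_def)
    \<comment> \<open>The integrand is the geometric mean of two bilinear integrands with the
      classes exchanged, which equalises the exponents.\<close>
    have "avg k Q (\<lambda>P. (cmod (f c P) * cmod (f c' P)) ^ q) ^ (1 + 1)
        \<le> bilinear_mean p k n y ac l (residue_class p t X 1 c) (residue_class p t X 1 c') ^ 1 * bilinear_mean p k n y ac l (residue_class p t X 1 c') (residue_class p t X 1 c) ^ 1"
      unfolding bilinear_mean_def Q_def
    proof (rule avg_Holder)
      fix P
      define x where "x = cmod (f c P)"
      define z where "z = cmod (f c' P)"
      have "2 * q = 2 * tri l + 2 * (tri k - tri l)" using ql by (simp add: q_def)
      then have sp: "u ^ (2 * q) = u ^ (2 * tri l) * u ^ (2 * (tri k - tri l))" for u :: real
        by (simp only: power_add)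
      have "((x * z) ^ q) ^ (1 + 1) = x ^ (2 * q) * z ^ (2 * q)"
        by (simp add: power_mult_distrib power2_eq_square power_mult)
      also have "\<dots> = (x ^ (2 * tri l) * z ^ (2 * (tri k - tri l))) ^ 1 * (z ^ (2 * tri l) * x ^ (2 * (tri k - tri l))) ^ 1"
        unfolding sp by simp
      finally show "((cmod (f c P) * cmod (f c' P)) ^ q) ^ (1 + 1) \<le>
        (cmod (exp_sum (p ^ (k * n)) y ac (residue_class p t X 1 c) P) ^ (2 * tri l) * cmod (exp_sum (p ^ (k * n)) y ac (residue_class p t X 1 c') P) ^ (2 * (tri k - tri l))) ^ 1 *
        (cmod (exp_sum (p ^ (k * n)) y ac (residue_class p t X 1 c') P) ^ (2 * tri l) * cmod (exp_sum (p ^ (k * n)) y ac (residue_class p t X 1 c) P) ^ (2 * (tri k - tri l))) ^ 1"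
        by (simp only: f_def Q_def x_def z_def order_refl)
    qed (use p0 in auto)
    also have "\<dots> \<le> (M * w c ^ tri l * w c' ^ (tri k - tri l)) ^ 1 * (M * w c' ^ tri l * w c ^ (tri k - tri l)) ^ 1"
      using bilinear_decoupling_D[OF M(1) configuration c] bilinear_decoupling_D[OF M(1) configuration c(2,1) c(3)[symmetric]] M(2) w[of c] w[of c'] c
      by (intro mult_mono power_mono zero_le_power)
        (auto simp: bilinear_mean_nonneg w_def C_def intro!: mult_nonneg_nonneg intro: less_imp_le)
    also have "\<dots> \<le> (M * \<Lambda> ^ tri l * \<Lambda> ^ (tri k - tri l)) ^ 1 * (M * \<Lambda> ^ tri l * \<Lambda> ^ (tri k - tri l)) ^ 1"
      using M(2) w[of c] w[of c'] w_le[of c] w_le[of c'] c \<Lambda>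
      by (intro mult_mono power_mono zero_le_power)
        (auto simp: C_def intro!: mult_nonneg_nonneg intro: less_imp_le)
    also have "M * \<Lambda> ^ tri l * \<Lambda> ^ (tri k - tri l) = M * \<Lambda> ^ q"
      using ql by (simp add: mult.assoc q_def flip: power_add)
    finally have "avg k Q (\<lambda>P. (cmod (f c P) * cmod (f c' P)) ^ q) ^ 2 \<le> (M * \<Lambda> ^ q) ^ 2"
      by (simp add: power2_eq_square)
    then show ?thesis using M(2) \<Lambda> by (subst (asm) power_mono_iff) (auto intro!: avg_nonneg)
  qed
  have card_T: "real (card T) \<le> real p ^ 2"
  proof -
    have "card T \<le> card (C \<times> C)" using fin by (intro card_mono) (auto simp: T_def)
    then show ?thesis by (simp add: C_def card_cartesian_product power2_eq_square flip: of_nat_mult)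
  qed
  define E where "E = (\<lambda>P. (\<Sum>c\<in>C. cmod (f c P) ^ 2))"
  define B where "B = (\<lambda>P. \<Sum>(c, c')\<in>T. cmod (f c P) * cmod (f c' P))"
  have EB: "E P \<ge> 0" "B P \<ge> 0" for P by (auto simp: E_def B_def intro!: sum_nonneg)
  have avg_E: "avg k Q (\<lambda>P. E P ^ q) \<le> D * \<Lambda> ^ q"
  proof -
    have "avg k Q (\<lambda>P. E P ^ q) \<le> avg k Q (\<lambda>P. \<Lambda> ^ (q - 1) * (\<Sum>c\<in>C. (cmod (f c P) ^ 2) ^ q / w c ^ (q - 1)))"
      unfolding E_def sum_w[symmetric] using fin w q by (intro avg_mono jensen_power) auto
    also have "\<dots> = \<Lambda> ^ (q - 1) * (\<Sum>c\<in>C. avg k Q (\<lambda>P. cmod (f c P) ^ (2 * q)) / w c ^ (q - 1))"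
      by (simp add: avg_cmult avg_sum avg_divide flip: power_mult)
    also have "\<dots> \<le> \<Lambda> ^ (q - 1) * (\<Sum>c\<in>C. D * w c ^ q / w c ^ (q - 1))"
      using diag \<Lambda> w by (intro mult_left_mono sum_mono divide_right_mono) (auto intro: less_imp_le)
    also have "(\<Sum>c\<in>C. D * w c ^ q / w c ^ (q - 1)) = (\<Sum>c\<in>C. D * w c)"
    proof (intro sum.cong refl)
      fix c assume "c \<in> C"
      then show "D * w c ^ q / w c ^ (q - 1) = D * w c"
        using w[of c] q by (cases q) auto
    qed
    also have "\<dots> = D * \<Lambda>" by (simp add: sum_w flip: sum_distrib_left)
    finally show ?thesis using q by (cases q) (auto simp: mult_ac)
  qed
  have avg_B: "avg k Q (\<lambda>P. B P ^ q) \<le> real p ^ (2 * q) * M * \<Lambda> ^ q"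
  proof -
    have "avg k Q (\<lambda>P. B P ^ q) \<le> avg k Q (\<lambda>P. (\<Sum>x\<in>T. 1) ^ (q - 1) *
        (\<Sum>(c, c')\<in>T. (cmod (f c P) * cmod (f c' P)) ^ q))"
      unfolding B_def
    proof (rule avg_mono)
      fix P
      show "(\<Sum>(c, c')\<in>T. cmod (f c P) * cmod (f c' P)) ^ q \<le> (\<Sum>x\<in>T. 1) ^ (q - 1) *
        (\<Sum>(c, c')\<in>T. (cmod (f c P) * cmod (f c' P)) ^ q)"
        using jensen_power[of T "\<lambda>_. 1" "\<lambda>(c, c'). cmod (f c P) * cmod (f c' P)" q] fin q
        by (simp add: case_prod_unfold)
    qed
    also have "\<dots> = real (card T) ^ (q - 1) * (\<Sum>(c, c')\<in>T. avg k Q (\<lambda>P. (cmod (f c P) * cmod (f c' P)) ^ q))"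
      by (simp add: avg_cmult avg_sum case_prod_unfold)
    also have "\<dots> \<le> real (card T) ^ (q - 1) * (\<Sum>(c, c')\<in>T. M * \<Lambda> ^ q)"
      using offdiag by (intro mult_left_mono sum_mono) auto
    also have "\<dots> = real (card T) ^ q * (M * \<Lambda> ^ q)"
      using q by (cases q) (auto simp: mult_ac)
    also have "\<dots> \<le> (real p ^ 2) ^ q * (M * \<Lambda> ^ q)"
      using card_T M(2) \<Lambda> by (intro mult_right_mono power_mono) auto
    finally show ?thesis by (simp only: power_mult mult.assoc)
  qed
  have "avg k Q (\<lambda>P. cmod (exp_sum Q y ac X P) ^ (2 * q))
     \<le> avg k Q (\<lambda>P. (1 + \<tau>) ^ (q - 1) * (E P ^ q + B P ^ q / \<tau> ^ (q - 1)))"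
  proof (rule avg_mono)
    fix P
    have "cmod (exp_sum Q y ac X P) ^ (2 * q) = (cmod (exp_sum Q y ac X P) ^ 2) ^ q" by (simp add: power_mult)
    also have "\<dots> \<le> (E P + B P) ^ q"
      unfolding f_sum E_def B_def T_def using fin by (intro power_mono norm_sum_square_le) auto
    also have "\<dots> \<le> (1 + \<tau>) ^ (q - 1) * (E P ^ q + B P ^ q / \<tau> ^ (q - 1))"
      by (rule power_add_le_weighted[OF EB \<tau> q])
    finally show "cmod (exp_sum Q y ac X P) ^ (2 * q) \<le> (1 + \<tau>) ^ (q - 1) * (E P ^ q + B P ^ q / \<tau> ^ (q - 1))" .
  qed
  also have "\<dots> = (1 + \<tau>) ^ (q - 1) * (avg k Q (\<lambda>P. E P ^ q) + avg k Q (\<lambda>P. B P ^ q) / \<tau> ^ (q - 1))"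
    by (simp add: avg_cmult avg_add avg_divide)
  also have "\<dots> \<le> (1 + \<tau>) ^ (q - 1) * (D * \<Lambda> ^ q + (real p ^ (2 * q) * M * \<Lambda> ^ q) / \<tau> ^ (q - 1))"
    using avg_E avg_B \<tau> by (intro mult_left_mono add_mono divide_right_mono) auto
  also have "\<dots> = (1 + \<tau>) ^ (q - 1) * (D + real p ^ (2 * q) * M / \<tau> ^ (q - 1)) * \<Lambda> ^ q"
    by (simp add: algebra_simps)
  finally show "avg k (p ^ (k * n)) (\<lambda>P. cmod (exp_sum (p ^ (k * n)) y ac X P) ^ (2 * tri k))
      \<le> (1 + \<tau>) ^ (tri k - 1) * (D + real p ^ (2 * tri k) * M / \<tau> ^ (tri k - 1)) * (\<Sum>c\<in>{0..<int p ^ n}. lam c) ^ tri k"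
    by (simp add: Q_def q_def \<Lambda>_def)
qed

lemma decoupling_mono: "decoupling p k n D \<Longrightarrow> D \<le> D' \<Longrightarrow> decoupling p k n D'"
  unfolding decoupling_def
proof (intro allI impI)
  fix X y t a lam
  assume D: "\<forall>X y t a lam. configuration p k n X y t a lam \<longrightarrow>
     avg k (p ^ (k * n)) (\<lambda>P. cmod (exp_sum (p ^ (k * n)) y a X P) ^ (2 * tri k))
       \<le> D * (\<Sum>c\<in>{0..<int p ^ n}. lam c) ^ tri k"
    and le: "D \<le> D'" and configuration: "configuration p k n X y t a lam"
  have "avg k (p ^ (k * n)) (\<lambda>P. cmod (exp_sum (p ^ (k * n)) y a X P) ^ (2 * tri k))
       \<le> D * (\<Sum>c\<in>{0..<int p ^ n}. lam c) ^ tri k" using D configuration by blast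
  also have "\<dots> \<le> D' * (\<Sum>c\<in>{0..<int p ^ n}. lam c) ^ tri k"
    using le configuration by (intro mult_right_mono zero_le_power sum_nonneg) (auto simp: configuration_def intro: less_imp_le)
  finally show "avg k (p ^ (k * n)) (\<lambda>P. cmod (exp_sum (p ^ (k * n)) y a X P) ^ (2 * tri k))
       \<le> D' * (\<Sum>c\<in>{0..<int p ^ n}. lam c) ^ tri k" .
qed

lemma bilinear_decoupling_mono: "bilinear_decoupling p k n l a b M \<Longrightarrow> M \<le> M' \<Longrightarrow> bilinear_decoupling p k n l a b M'"
proof (rule bilinear_decoupling_I)
  fix X y t ac lam \<xi> \<eta>
  assume M: "bilinear_decoupling p k n l a b M" "M \<le> M'"
  assume h: "configuration p k n X y t ac lam" "\<xi> \<in> {0..<int p ^ a}" "\<eta> \<in> {0..<int p ^ b}" "\<xi> mod int p \<noteq> \<eta> mod int p"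
  have nn: "coarse_weight p n lam c d \<ge> 0" for c d
    unfolding coarse_weight_def using h(1) by (intro sum_nonneg) (auto simp: configuration_def intro: less_imp_le)
  have "bilinear_mean p k n y ac l (residue_class p t X a \<xi>) (residue_class p t X b \<eta>) \<le> M * (coarse_weight p n lam a \<xi> ^ tri l * coarse_weight p n lam b \<eta> ^ (tri k - tri l))"
    using bilinear_decoupling_D[OF M(1) h] by (simp add: mult.assoc)
  also have "\<dots> \<le> M' * (coarse_weight p n lam a \<xi> ^ tri l * coarse_weight p n lam b \<eta> ^ (tri k - tri l))"
    using M(2) nn by (intro mult_right_mono) auto
  finally show "bilinear_mean p k n y ac l (residue_class p t X a \<xi>) (residue_class p t X b \<eta>)
       \<le> M' * coarse_weight p n lam a \<xi> ^ tri l * coarse_weight p n lam b \<eta> ^ (tri k - tri l)" by (simp add: mult.assoc)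
qed

lemma decoupling_trivial:
  assumes p: "p > 0" and k: "k \<ge> 1"
  shows "decoupling p k n (real p ^ (n * tri k))"
  unfolding decoupling_def
proof (intro allI impI)
  fix X y t a lam
  assume configuration: "configuration p k n X y t a lam"
  have fin: "finite X" using configuration by (simp add: configuration_def)
  have lam: "0 < lam c" if "c \<in> {0..<int p ^ n}" for c using configuration that by (simp add: configuration_def)
  have "avg k (p ^ (k * n)) (\<lambda>P. cmod (exp_sum (p ^ (k * n)) y a X P) ^ (2 * tri k) * 1)
    \<le> (real p ^ (n * tri k) * 1) * (\<Sum>c\<in>{0..<int p ^ n}. lam c) ^ tri k * 1"
    by (rule collect_refined[OF _ lam tri_pos[OF k] _ _ trivial_refine[where t = t, OF p fin tri_pos[OF k] lam]])
       (use configuration in \<open>auto simp: configuration_def\<close>)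
  then show "avg k (p ^ (k * n)) (\<lambda>P. cmod (exp_sum (p ^ (k * n)) y a X P) ^ (2 * tri k))
    \<le> real p ^ (n * tri k) * (\<Sum>c\<in>{0..<int p ^ n}. lam c) ^ tri k" by simp
qed

section \<open>Induction on the decoupling exponent\<close>

definition decoupling_rate :: "nat \<Rightarrow> nat \<Rightarrow> real \<Rightarrow> bool" where
  "decoupling_rate p k \<eta> \<longleftrightarrow> (\<exists>C\<ge>1. \<forall>n. decoupling p k n (C * real p powr (\<eta> * real n)))"

text \<open>\<open>\<kappa>\<close> measures the gain of the bilinear constant over the trivial bound at scale \<open>b\<close>. Since it can be
  made arbitrarily large, any positive rate \<open>\<eta>\<close> improves.\<close>

definition saving_const :: "nat \<Rightarrow> nat \<Rightarrow> nat \<Rightarrow> real \<Rightarrow> nat \<Rightarrow> nat \<Rightarrow> real \<Rightarrow> real \<Rightarrow> real \<Rightarrow> bool" where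
  "saving_const p k l \<kappa> T Z \<eta> \<epsilon> C \<longleftrightarrow> (\<forall>n a b :: nat.
     T dvd b \<longrightarrow> 1 \<le> b \<longrightarrow> Z * b \<le> n \<longrightarrow> 1 \<le> a \<longrightarrow> a \<le> n \<longrightarrow> b \<le> k * a \<longrightarrow> l * a \<le> (k - l + 1) * b \<longrightarrow>
     bilinear_decoupling p k n l a b (C * real p powr (\<eta> * n - \<eta> * \<kappa> * b + \<epsilon> * n)))"

definition saving_within :: "nat \<Rightarrow> nat \<Rightarrow> nat \<Rightarrow> real \<Rightarrow> nat \<Rightarrow> nat \<Rightarrow> bool" where
  "saving_within p k l \<kappa> T Z \<longleftrightarrow> (\<forall>\<eta> \<epsilon>. \<eta> > 0 \<longrightarrow> decoupling_rate p k \<eta> \<longrightarrow> \<epsilon> > 0 \<longrightarrow> (\<exists>C>0. saving_const p k l \<kappa> T Z \<eta> \<epsilon> C))"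

text \<open>T takes care of divisibility, Z of how deep the scale b may go. Both are fixed before
  \<eta> and \<epsilon>, which is what later makes the improvement of the rate uniform in
  \<eta>.\<close>

definition saving :: "nat \<Rightarrow> nat \<Rightarrow> nat \<Rightarrow> real \<Rightarrow> bool" where
  "saving p k l \<kappa> \<longleftrightarrow> (\<exists>T\<ge>1. \<exists>Z\<ge>1. saving_within p k l \<kappa> T Z)"

lemma saving_const_D:
  assumes "saving_const p k l \<kappa> T Z \<eta> \<epsilon> C" "T dvd b" "1 \<le> b" "Z * b \<le> n" "1 \<le> a" "a \<le> n" "b \<le> k * a" "l * a \<le> (k - l + 1) * b"
  shows "bilinear_decoupling p k n l a b (C * real p powr (\<eta> * n - \<eta> * \<kappa> * b + \<epsilon> * n))"
  using assms unfolding saving_const_def by blast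

text \<open>Rescaling a class modulo p^b leaves n - b scales, hence a saving of \<eta> b in the
  exponent.\<close>

lemma saving_zero:
  assumes p: "p \<ge> 2" and k: "k \<ge> 1"
  shows "saving p k 0 1"
proof -
  have "\<exists>C>0. saving_const p k 0 1 1 1 \<eta> \<epsilon> C" if \<eta>: "\<eta> > 0" "decoupling_rate p k \<eta>" and \<epsilon>: "\<epsilon> > 0" for \<eta> \<epsilon>
  proof -
    obtain C where C: "C \<ge> 1" "\<And>n. decoupling p k n (C * real p powr (\<eta> * real n))"
      using \<eta> by (auto simp: decoupling_rate_def)
    have "bilinear_decoupling p k n 0 a b (C * real p powr (\<eta> * n - \<eta> * 1 * b + \<epsilon> * n))" if "b \<le> n" for n a b :: nat
    proof (rule bilinear_decoupling_mono[OF bilinear_decoupling_zero[OF _ k C(2)]])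
      show "C * real p powr (\<eta> * real (n - b)) \<le> C * real p powr (\<eta> * n - \<eta> * 1 * b + \<epsilon> * n)"
        using that p C(1) \<epsilon> by (intro mult_left_mono powr_mono) (auto simp: of_nat_diff algebra_simps)
    qed (use p C that in auto)
    then show ?thesis using C(1) unfolding saving_const_def by (intro exI[of _ C]) auto
  qed
  then show ?thesis unfolding saving_def saving_within_def by blast
qed

lemma saving_start:
  assumes p: "p \<ge> 2" and k: "k \<ge> 1" "l \<le> k"
  shows "saving p k l 0"
proof -
  have "\<exists>C>0. saving_const p k l 0 1 1 \<eta> \<epsilon> C" if \<eta>: "\<eta> > 0" "decoupling_rate p k \<eta>" and \<epsilon>: "\<epsilon> > 0" for \<eta> \<epsilon>
  proof -
    obtain C where C: "C \<ge> 1" "\<And>n. decoupling p k n (C * real p powr (\<eta> * real n))"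
      using \<eta> by (auto simp: decoupling_rate_def)
    have D: "decoupling p k (n - j) (C * real p powr (\<eta> * n - \<eta> * 0 * b + \<epsilon> * n))" for j n b :: nat
    proof (rule decoupling_mono[OF C(2)])
      have "\<eta> * real (n - j) \<le> \<eta> * real n" using \<eta>(1) by (intro mult_left_mono) auto
      also have "\<dots> \<le> \<eta> * n - \<eta> * 0 * b + \<epsilon> * n" using \<epsilon> by simp
      finally show "C * real p powr (\<eta> * real (n - j)) \<le> C * real p powr (\<eta> * n - \<eta> * 0 * b + \<epsilon> * n)"
        using p C(1) by (intro mult_left_mono powr_mono) auto
    qed
    have "bilinear_decoupling p k n l a b (C * real p powr (\<eta> * n - \<eta> * 0 * b + \<epsilon> * n))" if "b \<le> n" "a \<le> n" for n a b :: nat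
      by (rule bilinear_decoupling_trivial[OF _ _ _ D D]) (use p C that k in auto)
    then show ?thesis using C(1) unfolding saving_const_def by (intro exI[of _ C]) auto
  qed
  then show ?thesis unfolding saving_def saving_within_def by blast
qed

text \<open>One step can enlarge a at most by the factor (l + 1) / l. The way to a' is cut into
  steps of length at most g = b / k^2, which is short enough because k g \<le> a. The number j of
  steps will be bounded in terms of k, so \<open>C ^ j\<close> is harmless.\<close>

lemma bilinear_decoupling_multi_step:
  assumes p: "prime p" "k < p" and l: "1 \<le> l" "l < k"
    and C: "C \<ge> 1" "\<And>m. decoupling p l m (C * real p powr (\<epsilon> * real m))" and \<epsilon>: "\<epsilon> > 0"
    and M: "bilinear_decoupling p k n l a' b M" "M \<ge> 0" and a': "a' \<le> n" "l * a' \<le> (k - l + 1) * b"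
    and b: "b = k * k * g" "g \<ge> 1" "b \<le> n"
  shows "1 \<le> a \<Longrightarrow> a \<le> a' \<Longrightarrow> b \<le> k * a \<Longrightarrow> a' - a \<le> j * g \<Longrightarrow>
    bilinear_decoupling p k n l a b (C ^ j * real p powr (\<epsilon> * real (a' - a)) * M)"
proof (induction j arbitrary: a)
  case 0
  then show ?case using M p by simp
next
  case (Suc j)
  have p0: "real p > 0" using p prime_gt_0_nat by simp
  define a1 where "a1 = min (a + g) a'"
  have a1: "a \<le> a1" "a1 \<le> a'" "a1 - a \<le> g" using Suc.prems by (auto simp: a1_def)
  have rest: "a' - a1 \<le> j * g" using Suc.prems by (auto simp: a1_def)
  have "k * (k * g) \<le> k * a" using Suc.prems b by (simp add: mult.assoc)
  then have kg: "k * g \<le> a" using l by simp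
  have "l * a1 = l * a + l * (a1 - a)" using a1 by (simp flip: distrib_left)
  also have "l * (a1 - a) \<le> k * g" using a1 l by (intro mult_le_mono) auto
  finally have c1: "l * a1 \<le> (l + 1) * a" using kg by simp
  have c2: "l * a1 \<le> (k - l + 1) * b" using a' a1 by (meson mult_le_mono2 order_trans)
  have "b \<le> k * a1" using Suc.prems(3) a1 by (meson mult_le_mono2 order_trans)
  then have IH: "bilinear_decoupling p k n l a1 b (C ^ j * real p powr (\<epsilon> * real (a' - a1)) * M)"
    using Suc.IH[of a1] Suc.prems a1 rest by simp
  have "bilinear_decoupling p k n l a b (C * real p powr (\<epsilon> * real (a1 - a)) * (C ^ j * real p powr (\<epsilon> * real (a' - a1)) * M))"
    by (rule bilinear_decoupling_step[OF p l C(2) _ IH]) (use C a1 a' b l Suc.prems c1 c2 in auto)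
  moreover have "real p powr (\<epsilon> * real (a1 - a)) * real p powr (\<epsilon> * real (a' - a1)) = real p powr (\<epsilon> * real (a' - a))"
    using a1 by (simp add: of_nat_diff algebra_simps flip: powr_add)
  ultimately show ?case by (simp add: mult_ac)
qed

text \<open>Decouple in degree l up to a' = (k - l + 1) b / l, the largest scale at which the factor
  at \<eta> is still constant on fibres, and interpolate at (a', b). The saving \<kappa>1 a' enters
  with weight 1 / (k - l + 1), that is, as \<kappa>1 / l relative to b.\<close>

lemma saving_step:
  assumes p: "prime p" "k < p" and l: "1 \<le> l" "l < k"
    and IH: "\<And>\<epsilon>. \<epsilon> > 0 \<Longrightarrow> decoupling_rate p l \<epsilon>"
    and S: "saving p k (k - l) \<kappa>1" "saving p k (l - 1) \<kappa>2"
  shows "saving p k l (\<kappa>1 / l + \<kappa>2 * (k - l) / (k - l + 1))"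
proof -
  have p2: "p \<ge> 2" using p prime_ge_2_nat by auto
  define m where "m = k - l"
  have m: "m \<ge> 1" "k = l + m" using l by (auto simp: m_def)
  from S(1) obtain T1 Z1 where TZ1: "T1 \<ge> 1" "Z1 \<ge> 1" and S1: "saving_within p k (k - l) \<kappa>1 T1 Z1"
    unfolding saving_def by blast
  from S(2) obtain T2 Z2 where TZ2: "T2 \<ge> 1" "Z2 \<ge> 1" and S2: "saving_within p k (l - 1) \<kappa>2 T2 Z2"
    unfolding saving_def by blast
  \<comment> \<open>The factor l makes a' an integer, k * k yields the step length g, and T1, T2
    serve the two interpolated estimates. The factor k in Z is due to applying the estimate for
    index k - l at scale a' \<le> k b instead of b.\<close>
  define T where "T = l * (k * k) * T1 * T2"
  define Z where "Z = k * (Z1 + Z2)"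
  define \<kappa> where "\<kappa> = \<kappa>1 / l + \<kappa>2 * (k - l) / (k - l + 1)"
  have main: "saving_within p k l \<kappa> T Z"
    unfolding saving_within_def
  proof (intro allI impI)
    fix \<eta> \<epsilon> :: real assume \<eta>: "\<eta> > 0" "decoupling_rate p k \<eta>" and \<epsilon>: "\<epsilon> > 0"
    have e2: "\<epsilon> / 2 > 0" using \<epsilon> by simp
    obtain C1 where C1: "C1 > 0" and M1: "saving_const p k (k - l) \<kappa>1 T1 Z1 \<eta> (\<epsilon> / 2) C1"
      using S1 \<eta> e2 unfolding saving_within_def by blast
    obtain C2 where C2: "C2 > 0" and M2: "saving_const p k (l - 1) \<kappa>2 T2 Z2 \<eta> (\<epsilon> / 2) C2"
      using S2 \<eta> e2 unfolding saving_within_def by blast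
    obtain C3 where C3: "C3 \<ge> 1" "\<And>m. decoupling p l m (C3 * real p powr (\<epsilon> / 2 * real m))"
      using IH[OF e2] by (auto simp: decoupling_rate_def)
    define C where "C = max C1 C2"
    have C: "C > 0" "C1 \<le> C" "C2 \<le> C" using C1 by (auto simp: C_def)
    have "saving_const p k l \<kappa> T Z \<eta> \<epsilon> (C3 ^ (k ^ 3) * C)"
      unfolding saving_const_def
    proof (intro allI impI)
      fix n a b :: nat
      assume b: "T dvd b" "1 \<le> b" "Z * b \<le> n" and a: "1 \<le> a" "a \<le> n" "b \<le> k * a" "l * a \<le> (k - l + 1) * b"
      obtain r where r: "b = T * r" using b(1) by (auto elim: dvdE)
      define b' where "b' = (k * k) * T1 * T2 * r"
      have b': "b = l * b'" "T1 dvd b'" by (simp_all add: r T_def b'_def mult_ac)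
      define g where "g = l * T1 * T2 * r"
      have g: "b = k * k * g" by (simp add: r T_def g_def mult_ac)
      have T2b: "T2 dvd b" by (simp add: r T_def)
      have g1: "g \<ge> 1" "b' \<ge> 1" using b(2) g b' by (auto simp: Suc_le_eq intro!: gr0I)
      define a' where "a' = (k - l + 1) * b'"
      have la': "l * a' = (k - l + 1) * b" by (simp only: a'_def b'(1) mult_ac)
      have b'b: "b' \<le> b" using l by (simp add: b')
      have a'kb: "a' \<le> k * b" unfolding a'_def using l b'b by (intro mult_le_mono) auto
      have kb: "Z1 * (k * b) \<le> n" "Z2 * b \<le> n" "k * b \<le> n"
      proof -
        have Zb: "Z * b = Z1 * (k * b) + k * (Z2 * b)" by (simp add: Z_def algebra_simps)
        have 1: "k * b \<le> Z1 * (k * b)" and 2: "Z2 * b \<le> k * (Z2 * b)" using TZ1 l by auto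
        show "Z1 * (k * b) \<le> n" "Z2 * b \<le> n" "k * b \<le> n"
          using b(3) Zb 1 2 by linarith+
      qed
      have a'n: "a' \<le> n" using a'kb kb by simp
      have bn: "b \<le> n" by (rule order_trans[OF _ kb(3)]) (use l in simp)
      have a'1: "a' \<ge> 1" using g1 by (simp add: a'_def Suc_le_eq)
      have aa': "a \<le> a'"
      proof -
        have "l * a \<le> l * a'" using a la' by simp
        then show ?thesis using l by simp
      qed
      have M1': "bilinear_decoupling p k n (k - l) b a' (C1 * real p powr (\<eta> * n - \<eta> * \<kappa>1 * a' + \<epsilon> / 2 * n))"
      proof (rule saving_const_D[OF M1])
        show "T1 dvd a'" using b' by (simp add: a'_def)
        show "Z1 * a' \<le> n" by (rule order_trans[OF mult_le_mono2[OF a'kb] kb(1)])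
        have "l * ((k - l) * b) \<le> (l + 1) * ((k - l + 1) * b)"
          by (intro mult_le_mono) auto
        also have "\<dots> = l * ((l + 1) * a')" unfolding la'[symmetric] by (simp only: mult_ac)
        finally have "(k - l) * b \<le> (l + 1) * a'" using l by simp
        then show "(k - l) * b \<le> (k - (k - l) + 1) * a'" using l by simp
      qed (use a'1 b a'kb bn in auto)
      have M2': "bilinear_decoupling p k n (l - 1) a' b (C2 * real p powr (\<eta> * n - \<eta> * \<kappa>2 * b + \<epsilon> / 2 * n))"
      proof (rule saving_const_D[OF M2])
        have "b \<le> l * a'" unfolding la' by simp
        also have "\<dots> \<le> k * a'" using l by simp
        finally show "b \<le> k * a'" .
        have "(l - 1) * a' \<le> l * a'" by simp
        also have "\<dots> \<le> (k - (l - 1) + 1) * b" unfolding la' by (intro mult_le_mono) auto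
        finally show "(l - 1) * a' \<le> (k - (l - 1) + 1) * b" .
      qed (use T2b b kb a'1 a'n in auto)
      define E where "E = \<eta> * n - \<eta> * \<kappa> * b + \<epsilon> / 2 * n"
      have M: "bilinear_decoupling p k n l a' b (C * real p powr E)"
      proof (rule bilinear_decoupling_Holder[OF _ l(1) _ a'n bn M1' M2'])
        have ra: "real a' = (real m + 1) * (real b / l)"
        proof -
          have "real b / l = real b'" using l b'(1) by simp
          moreover have "a' = (m + 1) * b'" by (simp only: a'_def m_def)
          ultimately show ?thesis by (simp add: distrib_right)
        qed
        have "(\<eta> * n - \<eta> * \<kappa>1 * a' + \<epsilon> / 2 * n) + real m * (\<eta> * n - \<eta> * \<kappa>2 * b + \<epsilon> / 2 * n)
           = (real m + 1) * E"
        proof -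
          have kap: "\<kappa> = \<kappa>1 / l + \<kappa>2 * m / (real m + 1)"
            using l by (simp add: \<kappa>_def m_def of_nat_diff)
          have mne: "real m + 1 \<noteq> 0" by linarith
          have "(real m + 1) * (\<eta> * \<kappa> * b) = \<eta> * \<kappa>1 * a' + real m * (\<eta> * \<kappa>2 * b)"
          proof -
            have gen: "M * (\<eta> * (x + w) * b) = M * \<eta> * (x * b) + \<eta> * b * (M * w)" for x w M :: real
              by (simp add: algebra_simps)
            have w: "(real m + 1) * (\<kappa>2 * m / (real m + 1)) = \<kappa>2 * m" using mne by simp
            show ?thesis unfolding kap ra gen w by (simp add: mult_ac)
          qed
          then show ?thesis unfolding E_def by (simp add: algebra_simps)
        qed
        note sumE = this
        have pw: "real p powr (\<eta> * n - \<eta> * \<kappa>1 * a' + \<epsilon> / 2 * n) * (real p powr (\<eta> * n - \<eta> * \<kappa>2 * b + \<epsilon> / 2 * n)) ^ m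
          = (real p powr E) ^ (m + 1)"
        proof -
          have pp: "(real p powr c) ^ j = real p powr (real j * c)" for c j
            using p2 by (induction j) (auto simp: powr_add algebra_simps)
          have "real p powr x * (real p powr z) ^ m = (real p powr E) ^ (m + 1)"
            if "x + real m * z = (real m + 1) * E" for x z
            unfolding pp using that by (simp add: add.commute flip: powr_add)
          then show ?thesis using sumE by blast
        qed
        have "C1 * C2 ^ m \<le> C ^ (m + 1)"
          using mult_mono[of C1 C "C2 ^ m" "C ^ m"] power_mono[of C2 C m] C C1 C2 by simp
        then have fin: "(C1 * C2 ^ m) * (real p powr E) ^ (m + 1) \<le> C ^ (m + 1) * (real p powr E) ^ (m + 1)"
          by (intro mult_right_mono) auto
        have "C1 * x * (C2 * z) ^ m = (C1 * C2 ^ m) * (x * z ^ m)" for x z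
          by (simp only: power_mult_distrib mult_ac)
        then show "C1 * real p powr (\<eta> * n - \<eta> * \<kappa>1 * a' + \<epsilon> / 2 * n) *
          (C2 * real p powr (\<eta> * n - \<eta> * \<kappa>2 * b + \<epsilon> / 2 * n)) ^ (k - l) \<le> (C * real p powr E) ^ (k - l + 1)"
          unfolding m_def[symmetric] using fin by (simp only: pw power_mult_distrib[of C])
      qed (use p2 l C C1 C2 in auto)
      have "a' - a \<le> k ^ 3 * g"
      proof -
        have "a' - a \<le> k * b" using a'kb by simp
        then show ?thesis by (simp add: g power3_eq_cube mult_ac)
      qed
      then have "bilinear_decoupling p k n l a b (C3 ^ (k ^ 3) * real p powr (\<epsilon> / 2 * real (a' - a)) * (C * real p powr E))"
        using bilinear_decoupling_multi_step[OF p l C3 e2 M _ a'n _ g g1(1) bn a(1) aa' a(3)] la' C by simp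
      then show "bilinear_decoupling p k n l a b (C3 ^ (k ^ 3) * C * real p powr (\<eta> * n - \<eta> * \<kappa> * b + \<epsilon> * n))"
      proof (rule bilinear_decoupling_mono)
        have "real p powr (\<epsilon> / 2 * real (a' - a)) \<le> real p powr (\<epsilon> / 2 * n)"
          using p2 e2 a'n by (intro powr_mono mult_left_mono) auto
        then have "real p powr (\<epsilon> / 2 * real (a' - a)) * real p powr E \<le> real p powr (\<epsilon> / 2 * n) * real p powr E"
          by (intro mult_right_mono) auto
        also have "\<dots> = real p powr (\<eta> * n - \<eta> * \<kappa> * b + \<epsilon> * n)"
          by (simp add: E_def algebra_simps flip: powr_add)
        finally have "(C3 ^ (k ^ 3) * C) * (real p powr (\<epsilon> / 2 * real (a' - a)) * real p powr E)
            \<le> (C3 ^ (k ^ 3) * C) * real p powr (\<eta> * n - \<eta> * \<kappa> * b + \<epsilon> * n)"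
          using C C3 by (intro mult_left_mono) auto
        then show "C3 ^ (k ^ 3) * real p powr (\<epsilon> / 2 * real (a' - a)) * (C * real p powr E)
            \<le> C3 ^ (k ^ 3) * C * real p powr (\<eta> * n - \<eta> * \<kappa> * b + \<epsilon> * n)"
          by (simp only: mult_ac)
      qed
    qed
    moreover have "C3 ^ (k ^ 3) * C > 0" using C C3 by auto
    ultimately show "\<exists>C>0. saving_const p k l \<kappa> T Z \<eta> \<epsilon> C" by blast
  qed
  have "T \<ge> 1" "Z \<ge> 1" using l TZ1 TZ2 by (auto simp: T_def Z_def)
  then show ?thesis
    unfolding saving_def \<kappa>_def[symmetric] using main by blast
qed

text \<open>Each \<open>\<kappa> j\<close> with 1 \<le> j < k is passed on with total weight 1: 1 /
  (k - j) goes to index k - j and (k - j - 1) / (k - j) to index j + 1. Index 0 only gives, sending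
  (k - 1) / k to index 1.\<close>

lemma savings_sum:
  fixes \<kappa> :: "nat \<Rightarrow> real"
  assumes k: "k \<ge> 2"
  shows "(\<Sum>l\<in>{1..<k}. \<kappa> (k - l) / l + \<kappa> (l - 1) * (k - l) / (k - l + 1))
    = (\<Sum>l\<in>{1..<k}. \<kappa> l) + \<kappa> 0 * (real k - 1) / k"
proof -
  have 1: "(\<Sum>l\<in>{1..<k}. \<kappa> (k - l) / l) = (\<Sum>j\<in>{1..<k}. \<kappa> j / (k - j))"
    by (rule sum.reindex_bij_witness[of _ "\<lambda>j. k - j" "\<lambda>l. k - l"]) auto
  have "(\<Sum>l\<in>{1..<k}. \<kappa> (l - 1) * (k - l) / (k - l + 1)) = (\<Sum>j\<in>{0..<k - 1}. \<kappa> j * (k - Suc j) / (k - j))"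
    by (rule sum.reindex_bij_witness[of _ Suc "\<lambda>l. l - 1"]) (auto simp: Suc_diff_le of_nat_diff)
  also have "\<dots> = (\<Sum>j\<in>{0..<k}. \<kappa> j * (k - Suc j) / (k - j))"
    using k by (intro sum.mono_neutral_left) (auto simp: not_less)
  also have "\<dots> = \<kappa> 0 * (k - Suc 0) / k + (\<Sum>j\<in>{1..<k}. \<kappa> j * (k - Suc j) / (k - j))"
    using k by (subst sum.atLeast_Suc_lessThan) auto
  finally have "(\<Sum>l\<in>{1..<k}. \<kappa> (k - l) / l + \<kappa> (l - 1) * (k - l) / (k - l + 1))
    = \<kappa> 0 * (k - Suc 0) / k + (\<Sum>j\<in>{1..<k}. \<kappa> j / (k - j) + \<kappa> j * (k - Suc j) / (k - j))"
    unfolding sum.distrib 1 by simp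
  also have "(\<Sum>j\<in>{1..<k}. \<kappa> j / (k - j) + \<kappa> j * (k - Suc j) / (k - j)) = (\<Sum>j\<in>{1..<k}. \<kappa> j)"
  proof (intro sum.cong refl)
    fix j assume j: "j \<in> {1..<k}"
    have gen: "c / x + c * (x - 1) / x = c" if "x > 0" for c x :: real
      using that by (simp add: field_simps)
    have eq: "real (k - Suc j) = real (k - j) - 1" and pos: "real (k - j) > 0" using j by (auto simp: of_nat_diff)
    show "\<kappa> j / (k - j) + \<kappa> j * (k - Suc j) / (k - j) = \<kappa> j"
      unfolding eq by (rule gen[OF pos])
  qed
  finally show ?thesis using k by (simp add: of_nat_diff)
qed

text \<open>One round of \<open>saving_step\<close> raises the total saving \<open>\<Sum>\<^bsub>1\<le>l<k\<^esub> \<kappa> l\<close> by \<open>(k - 1)/k\<close>, whence it is unbounded.\<close>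

lemma saving_large:
  assumes p: "prime p" "k < p" and k: "k \<ge> 2"
    and IH: "\<And>l \<epsilon>. 1 \<le> l \<Longrightarrow> l < k \<Longrightarrow> \<epsilon> > 0 \<Longrightarrow> decoupling_rate p l \<epsilon>"
  obtains l \<kappa> where "1 \<le> l" "l < k" "\<kappa> \<ge> K" "saving p k l \<kappa>"
proof -
  have p2: "p \<ge> 2" using p prime_ge_2_nat by auto
  have "\<exists>\<kappa>. \<kappa> 0 = 1 \<and> (\<forall>l<k. saving p k l (\<kappa> l)) \<and> (\<Sum>l\<in>{1..<k}. \<kappa> l) \<ge> real R * ((real k - 1) / k)" for R
  proof (induction R)
    case 0
    show ?case
      using saving_zero[OF p2] saving_start[OF p2] k
      by (intro exI[of _ "\<lambda>l. if l = 0 then 1 else 0"]) auto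
  next
    case (Suc R)
    then obtain \<kappa> :: "nat \<Rightarrow> real" where \<kappa>: "\<kappa> 0 = 1" "\<And>l. l < k \<Longrightarrow> saving p k l (\<kappa> l)"
      "(\<Sum>l\<in>{1..<k}. \<kappa> l) \<ge> real R * ((real k - 1) / k)" by blast
    define \<kappa>' where "\<kappa>' = (\<lambda>l. if l = 0 then 1 else \<kappa> (k - l) / l + \<kappa> (l - 1) * (k - l) / (k - l + 1))"
    have "saving p k l (\<kappa>' l)" if "l < k" for l
    proof (cases "l = 0")
      case False
      then have l: "1 \<le> l" by simp
      show ?thesis
        using saving_step[OF p l that IH[OF l that] \<kappa>(2)[of "k - l"] \<kappa>(2)[of "l - 1"]] that False
        by (simp add: \<kappa>'_def)
    qed (use that \<kappa>(2)[of 0] \<kappa>(1) in \<open>simp add: \<kappa>'_def\<close>)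
    moreover have "(\<Sum>l\<in>{1..<k}. \<kappa>' l) \<ge> real (Suc R) * ((real k - 1) / k)"
    proof -
      have "(\<Sum>l\<in>{1..<k}. \<kappa>' l) = (\<Sum>l\<in>{1..<k}. \<kappa> (k - l) / l + \<kappa> (l - 1) * (k - l) / (k - l + 1))"
        by (intro sum.cong) (auto simp: \<kappa>'_def)
      also have "\<dots> = (\<Sum>l\<in>{1..<k}. \<kappa> l) + (real k - 1) / k"
        unfolding savings_sum[OF k] by (simp add: \<kappa>(1))
      finally show ?thesis using \<kappa>(3) unfolding of_nat_Suc distrib_right mult_1 by linarith
    qed
    ultimately show ?case by (intro exI[of _ \<kappa>']) (auto simp: \<kappa>'_def)
  qed
  note growth = this
  define \<rho> where "\<rho> = (real k - 1) / k"
  have \<rho>: "\<rho> > 0" using k by (simp add: \<rho>_def)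
  obtain R :: nat where R: "real R \<ge> real k * \<bar>K\<bar> / \<rho>" using real_arch_simple by blast
  obtain \<kappa> where \<kappa>: "\<And>l. l < k \<Longrightarrow> saving p k l (\<kappa> l)" "(\<Sum>l\<in>{1..<k}. \<kappa> l) \<ge> real R * \<rho>"
    using growth[of R] unfolding \<rho>_def by blast
  have "\<exists>l\<in>{1..<k}. \<kappa> l \<ge> K"
  proof (rule ccontr)
    assume "\<not> ?thesis"
    then have "(\<Sum>l\<in>{1..<k}. \<kappa> l) < (\<Sum>l\<in>{1..<k}. \<bar>K\<bar>)"
      using k by (intro sum_strict_mono) (auto simp: not_le intro: less_le_trans[OF _ abs_ge_self])
    also have "\<dots> = real (k - 1) * \<bar>K\<bar>" by simp
    also have "\<dots> \<le> real k * \<bar>K\<bar>" by (intro mult_right_mono) auto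
    also have "\<dots> \<le> real R * \<rho>" using R \<rho> by (simp add: divide_le_eq)
    finally show False using \<kappa>(2) by simp
  qed
  then show ?thesis using that \<kappa>(1) by auto
qed

lemma decoupling_rate_mono:
  assumes "decoupling_rate p k \<eta>" "\<eta> \<le> \<eta>'" "p \<ge> 1"
  shows "decoupling_rate p k \<eta>'"
proof -
  obtain C where C: "C \<ge> 1" "\<And>n. decoupling p k n (C * real p powr (\<eta> * real n))"
    using assms by (auto simp: decoupling_rate_def)
  have "decoupling p k n (C * real p powr (\<eta>' * real n))" for n
    by (rule decoupling_mono[OF C(2)]) (use assms C in \<open>auto intro!: mult_left_mono powr_mono mult_right_mono\<close>)
  then show ?thesis using C(1) by (auto simp: decoupling_rate_def)
qed

text \<open>The decrement has to be uniform over \<eta> \<ge> \<eta>0, so that finitely many rounds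
  reach \<eta>0. With \<kappa> \<ge> 2 q / \<eta>0 the saving at scale b pays twice for the trivial
  return from (a, b) to (1, 1).\<close>

lemma decoupling_rate_improve:
  assumes p: "prime p" "k < p" and k: "k \<ge> 2"
    and IH: "\<And>l \<epsilon>. 1 \<le> l \<Longrightarrow> l < k \<Longrightarrow> \<epsilon> > 0 \<Longrightarrow> decoupling_rate p l \<epsilon>"
    and \<eta>0: "\<eta>0 > 0"
  obtains \<sigma> where "\<sigma> > 0" "\<And>\<eta>. \<eta> \<ge> \<eta>0 \<Longrightarrow> decoupling_rate p k \<eta> \<Longrightarrow> decoupling_rate p k (max (\<eta> - \<sigma>) \<eta>0)"
proof -
  have p2: "p \<ge> 2" using p prime_ge_2_nat by auto
  define q where "q = tri k"
  have q: "q \<ge> 1" using tri_pos[of k] k by (simp add: q_def)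
  obtain l \<kappa> where l: "1 \<le> l" "l < k" and \<kappa>: "\<kappa> \<ge> 2 * real q / \<eta>0" and S: "saving p k l \<kappa>"
    using saving_large[OF p k IH] by blast
  from S obtain T Z where TZ: "T \<ge> 1" "Z \<ge> 1" and SW: "saving_within p k l \<kappa> T Z"
    unfolding saving_def by blast
  \<comment> \<open>After the return is paid a saving q b is left, and for the largest allowed b
    this is q n / Z up to a constant. Half of it pays for the loss \<sigma> n in the saving
    estimate, half is the gain.\<close>
  define \<sigma> where "\<sigma> = real q / (2 * Z)"
  define n0 where "n0 = Z * (T * k)"
  have \<sigma>: "\<sigma> > 0" using q TZ by (simp add: \<sigma>_def)
  have n0: "n0 \<ge> 1" using TZ k by (simp add: n0_def)
  have "decoupling_rate p k (max (\<eta> - \<sigma>) \<eta>0)" if \<eta>: "\<eta> \<ge> \<eta>0" and H: "decoupling_rate p k \<eta>" for \<eta>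
  proof -
    have \<eta>p: "\<eta> > 0" using \<eta> \<eta>0 by simp
    obtain C0 where C0: "C0 \<ge> 1" "\<And>n. decoupling p k n (C0 * real p powr (\<eta> * real n))"
      using H by (auto simp: decoupling_rate_def)
    obtain C where C: "C > 0" and SC: "saving_const p k l \<kappa> T Z \<eta> \<sigma> C"
      using SW \<eta>p H \<sigma> unfolding saving_within_def by blast
    define C1 where "C1 = C * real p powr (real q * (T * k))"
    have C1: "C1 > 0" using C p2 by (simp add: C1_def)
    have M: "bilinear_decoupling p k n l 1 1 (C1 * real p powr ((\<eta> - \<sigma>) * n))" if n: "n \<ge> n0" for n
    proof -
      \<comment> \<open>Makes b = k T B the largest multiple of k T with Z b \<le> n.\<close>
      define B where "B = n div n0"
      have B: "B \<ge> 1" using n n0 by (simp add: B_def Suc_le_eq div_greater_zero_iff)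
      define a where "a = B * T"
      define b where "b = k * a"
      have a1: "a \<ge> 1" using B TZ by (simp add: a_def)
      have b1: "b \<ge> 1" using a1 k by (simp add: b_def)
      have Zb: "Z * b \<le> n"
      proof -
        have "Z * b = B * n0" by (simp add: b_def a_def n0_def mult_ac)
        then show ?thesis by (simp add: B_def)
      qed
      have ab: "a \<le> b" using k by (simp add: b_def)
      have bn: "b \<le> n" using Zb TZ by (metis le_trans mult.commute mult_le_mono1 nat_mult_1_right One_nat_def mult_le_mono2)
      have "bilinear_decoupling p k n l a b (C * real p powr (\<eta> * n - \<eta> * \<kappa> * b + \<sigma> * n))"
      proof (rule saving_const_D[OF SC _ b1 Zb a1])
        show "T dvd b" by (simp add: b_def a_def)
        show "l * a \<le> (k - l + 1) * b"
        proof -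
          have "l * a \<le> 1 * b" using l by (simp add: b_def)
          also have "\<dots> \<le> (k - l + 1) * b" by (rule mult_le_mono1) simp
          finally show ?thesis .
        qed
      qed (use order_trans[OF ab bn] in \<open>auto simp: b_def\<close>)
      then have "bilinear_decoupling p k n l a 1 (real p ^ ((b - 1) * (tri k - tri l)) * (C * real p powr (\<eta> * n - \<eta> * \<kappa> * b + \<sigma> * n)))"
        using b1 bn p2 l by (intro bilinear_decoupling_refine_right) auto
      then have "bilinear_decoupling p k n l 1 1 (real p ^ ((a - 1) * tri l) *
          (real p ^ ((b - 1) * (tri k - tri l)) * (C * real p powr (\<eta> * n - \<eta> * \<kappa> * b + \<sigma> * n))))"
        using a1 ab bn p2 l by (intro bilinear_decoupling_refine_left) auto
      then show ?thesis
      proof (rule bilinear_decoupling_mono)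
        have "(a - 1) * tri l + (b - 1) * (tri k - tri l) \<le> b * tri l + b * (tri k - tri l)"
          using ab by (intro add_mono mult_le_mono) auto
        also have "\<dots> = b * q"
          using tri_mono[of l k] l by (simp add: q_def flip: distrib_left)
        finally have "real p ^ ((a - 1) * tri l) * real p ^ ((b - 1) * (tri k - tri l)) \<le> real p ^ (b * q)"
          unfolding power_add[symmetric] using p2 by (intro power_increasing) auto
        also have "\<dots> = real p powr (real b * q)"
          using p2 by (simp add: powr_realpow[symmetric])
        finally have "(real p ^ ((a - 1) * tri l) * real p ^ ((b - 1) * (tri k - tri l))) * (C * real p powr (\<eta> * n - \<eta> * \<kappa> * b + \<sigma> * n))
          \<le> real p powr (real b * q) * (C * real p powr (\<eta> * n - \<eta> * \<kappa> * b + \<sigma> * n))"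
          using C by (intro mult_right_mono) auto
        also have "\<dots> = C * real p powr (real b * q + (\<eta> * n - \<eta> * \<kappa> * b + \<sigma> * n))"
          by (simp add: powr_add)
        also have "\<dots> \<le> C * real p powr (real q * (T * k) + (\<eta> - \<sigma>) * n)"
        proof (intro mult_left_mono powr_mono)
          have "2 * real q \<le> \<eta> * \<kappa>"
          proof -
            have "2 * real q \<le> \<eta>0 * \<kappa>" using \<kappa> \<eta>0 by (simp add: divide_le_eq mult.commute)
            also have "\<dots> \<le> \<eta> * \<kappa>"
            proof (rule mult_right_mono[OF \<eta>])
              have "0 \<le> 2 * real q / \<eta>0" using \<eta>0 by simp
              then show "0 \<le> \<kappa>" using \<kappa> by linarith
            qed
            finally show ?thesis .
          qed
          then have 1: "2 * real q * b \<le> \<eta> * \<kappa> * b" by (intro mult_right_mono) auto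
          have "n \<le> n0 * (B + 1)"
            using n0 dividend_less_times_div[of n0 n] by (simp add: B_def algebra_simps)
          also have "n0 * (B + 1) = Z * (b + T * k)" by (simp add: n0_def b_def a_def algebra_simps)
          finally have "real n \<le> real Z * (real b + real (T * k))"
            by (metis of_nat_add of_nat_le_iff of_nat_mult)
          then have "real q / Z * real n \<le> real q / Z * (real Z * (real b + real (T * k)))"
            by (intro mult_left_mono) auto
          also have "\<dots> = real q * b + real q * (T * k)" using TZ by (simp add: distrib_left)
          finally have "2 * \<sigma> * n \<le> real q * b + real q * (T * k)" by (simp add: \<sigma>_def)
          then show "real b * q + (\<eta> * n - \<eta> * \<kappa> * b + \<sigma> * n) \<le> real q * (T * k) + (\<eta> - \<sigma>) * n"
            using 1 by (simp add: algebra_simps)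
        qed (use p2 C in auto)
        also have "\<dots> = C1 * real p powr ((\<eta> - \<sigma>) * n)"
          by (simp add: C1_def powr_add)
        finally show "real p ^ ((a - 1) * tri l) *
          (real p ^ ((b - 1) * (tri k - tri l)) * (C * real p powr (\<eta> * n - \<eta> * \<kappa> * b + \<sigma> * n)))
          \<le> C1 * real p powr ((\<eta> - \<sigma>) * n)" by (simp only: mult.assoc)
      qed
    qed
    define \<theta> where "\<theta> = max (\<eta> - \<sigma>) \<eta>0"
    have \<theta>: "\<theta> > 0" "\<eta> - \<sigma> \<le> \<theta>" using \<eta>0 by (auto simp: \<theta>_def)
    \<comment> \<open>Half of the target growth per scale is allotted to the factor (1 +
      \<tau>)^(q-1) of the recursion; the other half makes the term inherited from scale n contract
      by 1 / u.\<close>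
    define u where "u = real p powr (\<theta> / 2)"
    have u: "u > 1" using p2 \<theta> by (simp add: u_def)
    obtain \<tau> where \<tau>: "\<tau> > 0" "(1 + \<tau>) ^ (q - 1) \<le> u"
    proof -
      define \<tau> where "\<tau> = u powr (1 / q) - 1"
      have "\<tau> > 0" using u q by (simp add: \<tau>_def)
      have "(1 + \<tau>) ^ (q - 1) \<le> (1 + \<tau>) ^ q" using \<open>\<tau> > 0\<close> by (intro power_increasing) auto
      also have "\<dots> = u" using u q by (simp add: \<tau>_def powr_powr flip: powr_realpow)
      finally show ?thesis using that \<open>\<tau> > 0\<close> by blast
    qed
    define C2 where "C2 = real p ^ (2 * q) * C1 / \<tau> ^ (q - 1)"
    have C2: "C2 > 0" using C1 \<tau> p2 by (simp add: C2_def)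
    \<comment> \<open>The first entry covers n \<le> n0, the second is the solution of C3 / u + C2 u
      = C3.\<close>
    define C3 where "C3 = max (C0 * real p powr (\<eta> * n0)) (C2 * u / (1 - 1 / u))"
    have C3a: "C3 \<ge> C0 * real p powr (\<eta> * n0)" and C3b: "C3 \<ge> C2 * u / (1 - 1 / u)" by (auto simp: C3_def)
    have "1 \<le> real p powr (\<eta> * n0)" using p2 \<eta>p by (intro ge_one_powr_ge_zero) auto
    then have "1 * 1 \<le> C0 * real p powr (\<eta> * n0)" using C0 by (intro mult_mono) auto
    then have C3: "C3 \<ge> 1" using C3a by simp
    have "decoupling p k n (C3 * real p powr (\<theta> * n))" for n
    proof (induction n)
      case 0
      have "C0 * real p powr (\<eta> * real 0) \<le> C3 * real p powr (\<theta> * real 0)"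
      proof -
        have "C0 * 1 \<le> C0 * real p powr (\<eta> * n0)" using C0 \<open>1 \<le> real p powr (\<eta> * n0)\<close> by (intro mult_left_mono) auto
        then show ?thesis using C3a p2 by simp
      qed
      then show ?case by (rule decoupling_mono[OF C0(2)])
    next
      case (Suc n)
      show ?case
      proof (cases "Suc n \<le> n0")
        case True
        show ?thesis
        proof (rule decoupling_mono[OF C0(2)])
          have "C0 * real p powr (\<eta> * real (Suc n)) \<le> C0 * real p powr (\<eta> * n0)"
            using True p2 C0 \<eta>p by (intro mult_left_mono powr_mono) auto
          also have "\<dots> \<le> C3 * 1" using C3a by simp
          also have "\<dots> \<le> C3 * real p powr (\<theta> * real (Suc n))"
            using C3 p2 \<theta> by (intro mult_left_mono ge_one_powr_ge_zero) auto
          finally show "C0 * real p powr (\<eta> * real (Suc n)) \<le> C3 * real p powr (\<theta> * real (Suc n))" .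
        qed
      next
        case False
        define y where "y = real p powr (\<theta> * real (Suc n))"
        have yn: "real p powr (\<theta> * real n) = y / u ^ 2"
          using p2 by (simp add: y_def u_def distrib_left powr_add field_simps power2_eq_square flip: powr_add)
        have "decoupling p k (Suc n) ((1 + \<tau>) ^ (tri k - 1) * (C3 * real p powr (\<theta> * n) +
            real p ^ (2 * tri k) * (C1 * real p powr ((\<eta> - \<sigma>) * real (Suc n))) / \<tau> ^ (tri k - 1)))"
          using Suc.IH C3 C1 M[of "Suc n"] False l k \<tau> by (intro decoupling_broad[OF p(1), where l = l]) auto
        then show ?thesis
        proof (rule decoupling_mono)
          have "real p powr ((\<eta> - \<sigma>) * real (Suc n)) \<le> y"
            unfolding y_def using p2 \<theta> by (intro powr_mono mult_right_mono) auto
          then have "C2 * real p powr ((\<eta> - \<sigma>) * real (Suc n)) \<le> C2 * y"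
            using C2 by (intro mult_left_mono) auto
          then have "real p ^ (2 * tri k) * (C1 * real p powr ((\<eta> - \<sigma>) * real (Suc n))) / \<tau> ^ (tri k - 1) \<le> C2 * y"
            by (simp add: C2_def q_def)
          then have "(1 + \<tau>) ^ (tri k - 1) * (C3 * real p powr (\<theta> * n) +
            real p ^ (2 * tri k) * (C1 * real p powr ((\<eta> - \<sigma>) * real (Suc n))) / \<tau> ^ (tri k - 1))
            \<le> u * (C3 * (y / u ^ 2) + C2 * y)"
            unfolding yn using \<tau> u C3 C1 by (intro mult_mono add_mono) (auto simp: q_def y_def intro!: add_nonneg_nonneg)
          also have "\<dots> = (C3 / u + C2 * u) * y" using u by (simp add: field_simps power2_eq_square)
          also have "\<dots> \<le> C3 * y"
          proof (rule mult_right_mono)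
            have "C2 * u \<le> C3 * (1 - 1 / u)" using C3b u by (simp add: pos_divide_le_eq)
            then show "C3 / u + C2 * u \<le> C3" by (simp add: algebra_simps)
          qed (simp add: y_def)
          finally show "(1 + \<tau>) ^ (tri k - 1) * (C3 * real p powr (\<theta> * n) +
            real p ^ (2 * tri k) * (C1 * real p powr ((\<eta> - \<sigma>) * real (Suc n))) / \<tau> ^ (tri k - 1))
            \<le> C3 * real p powr (\<theta> * real (Suc n))" by (simp add: y_def)
        qed
      qed
    qed
    then show ?thesis using C3 by (auto simp: decoupling_rate_def \<theta>_def)
  qed
  then show ?thesis using that \<sigma> by blast
qed

section \<open>Vinogradov's mean value theorem\<close>

text \<open>Translation by X^j multiplies the sum by e(y j / Q), which differs from 1.\<close>

lemma sum_freqs_character: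
  assumes j: "j \<le> k" and y: "\<not> int Q dvd y j" and Q: "Q > 0"
  shows "(\<Sum>P\<in>freqs k Q. unit_exp (moment y P / Q)) = 0"
proof -
  let ?G = "\<lambda>P. unit_exp (moment y P / Q)"
  have "periodic Q ?G"
    using Q by (simp add: periodic_def moment_add moment_smult add_divide_distrib)
  then have "(\<Sum>P\<in>freqs k Q. ?G P) = (\<Sum>P\<in>freqs k Q. ?G (P + monom 1 j))"
    using j Q by (subst sum_freqs_translate) (auto simp: degree_monom_eq)
  also have "\<dots> = (\<Sum>P\<in>freqs k Q. unit_exp (y j / Q) * ?G P)"
    by (simp add: moment_add add_divide_distrib unit_exp_add mult.commute)
  also have "\<dots> = unit_exp (y j / Q) * (\<Sum>P\<in>freqs k Q. ?G P)"
    by (simp add: sum_distrib_left)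
  finally have "(1 - unit_exp (y j / Q)) * (\<Sum>P\<in>freqs k Q. ?G P) = 0"
    by (simp add: algebra_simps)
  moreover have "unit_exp (y j / Q) \<noteq> 1"
  proof
    assume "unit_exp (y j / Q) = 1"
    then obtain i :: int where "real_of_int (y j) / Q = of_int i"
      unfolding unit_exp_eq_1_iff by (auto elim: Ints_cases)
    then have "real_of_int (y j) = of_int (i * int Q)" using Q by (simp add: field_simps)
    then have "y j = i * int Q" by (simp only: of_int_eq_iff)
    then show False using y by simp
  qed
  ultimately show ?thesis by simp
qed

lemma moment_diff_left: "moment (\<lambda>i. y i - z i) P = moment y P - moment z P"
  by (simp add: moment_def sum_subtractf left_diff_distrib right_diff_distrib)

lemma norm_square_sum:
  fixes g :: "'i \<Rightarrow> complex"
  shows "complex_of_real (cmod (\<Sum>x\<in>X. g x) ^ 2) = (\<Sum>x\<in>X. \<Sum>x'\<in>X. g x * cnj (g x'))"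
  by (simp only: complex_norm_square) (simp add: sum_product)

lemma sum_norm_square_exp_sum:
  assumes "finite X"
  shows "complex_of_real (\<Sum>P\<in>freqs k Q. cmod (exp_sum Q y a X P) ^ 2)
    = (\<Sum>x\<in>X. \<Sum>x'\<in>X. a x * cnj (a x') * (\<Sum>P\<in>freqs k Q. unit_exp (moment (\<lambda>i. y x i - y x' i) P / Q)))"
proof -
  have "complex_of_real (\<Sum>P\<in>freqs k Q. cmod (exp_sum Q y a X P) ^ 2)
    = (\<Sum>P\<in>freqs k Q. \<Sum>x\<in>X. \<Sum>x'\<in>X. a x * cnj (a x') * unit_exp (moment (\<lambda>i. y x i - y x' i) P / Q))"
    unfolding of_real_sum
  proof (intro sum.cong refl)
    fix P
    have "unit_exp (moment (y x) P / Q) * cnj (unit_exp (moment (y x') P / Q))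
        = unit_exp (moment (\<lambda>i. y x i - y x' i) P / Q)" for x x'
      by (simp add: moment_diff_left diff_divide_distrib flip: unit_exp_minus unit_exp_add)
    then show "complex_of_real (cmod (exp_sum Q y a X P) ^ 2)
      = (\<Sum>x\<in>X. \<Sum>x'\<in>X. a x * cnj (a x') * unit_exp (moment (\<lambda>i. y x i - y x' i) P / Q))"
      unfolding exp_sum_def norm_square_sum
      by (intro sum.cong refl) (simp add: mult_ac)
  qed
  also have "\<dots> = (\<Sum>x\<in>X. \<Sum>P\<in>freqs k Q. \<Sum>x'\<in>X. a x * cnj (a x') * unit_exp (moment (\<lambda>i. y x i - y x' i) P / Q))"
    by (rule sum.swap)
  also have "\<dots> = (\<Sum>x\<in>X. \<Sum>x'\<in>X. a x * cnj (a x') * (\<Sum>P\<in>freqs k Q. unit_exp (moment (\<lambda>i. y x i - y x' i) P / Q)))"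
    unfolding sum_distrib_left by (intro sum.cong refl) (rule sum.swap)
  finally show ?thesis .
qed

text \<open>In degree 1 the exponent is 2 and the pieces are orthogonal: \<open>y x 1\<close> is
  congruent to \<open>t x\<close> modulo p^n, so different classes have different
  frequencies.\<close>

lemma decoupling_one:
  assumes p: "p > 0"
  shows "decoupling p 1 n 1"
  unfolding decoupling_def
proof (intro allI impI)
  fix X y t a lam
  assume configuration: "configuration p 1 n X y t a lam"
  define Q where "Q = p ^ (1 * n)"
  have Q: "Q > 0" using p by (simp add: Q_def)
  have fin: "finite X" using configuration by (simp add: configuration_def)
  define C where "C = {0..<int p ^ n}"
  let ?S = "\<lambda>x x'. \<Sum>P\<in>freqs 1 Q. unit_exp (moment (\<lambda>i. y x i - y x' i) P / Q)"
  let ?n = "\<lambda>X. \<Sum>P\<in>freqs 1 Q. cmod (exp_sum Q y a X P) ^ 2"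
  have cross: "?S x x' = 0" if "x \<in> X" "x' \<in> X" "t x mod int p ^ n \<noteq> t x' mod int p ^ n" for x x'
  proof (rule sum_freqs_character[of 1])
    have *: "int p ^ n dvd y x 1 - t x" if "x \<in> X" for x
    proof -
      have "near_curve p 1 (y x) (t x) n" using configuration that by (simp add: configuration_def)
      then have "y x 0 = 1" "int p ^ (1 * n) dvd moment (y x) ([:- t x, 1:] ^ 1)"
        unfolding near_curve_def by blast+
      then show ?thesis by (simp add: moment_def)
    qed
    show "\<not> int Q dvd y x 1 - y x' 1"
    proof
      assume "int Q dvd y x 1 - y x' 1"
      then have "int p ^ n dvd y x 1 - y x' 1" by (simp add: Q_def)
      then have "int p ^ n dvd (y x 1 - y x' 1) - (y x 1 - t x) + (y x' 1 - t x')"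
        by (rule dvd_add[OF dvd_diff[OF _ *[OF that(1)]] *[OF that(2)]])
      then have "int p ^ n dvd t x - t x'" by simp
      then show False using that(3) by (simp add: mod_eq_dvd_iff)
    qed
  qed (use Q in auto)
  have "complex_of_real (?n X) = (\<Sum>x\<in>X. \<Sum>x'\<in>X. a x * cnj (a x') * ?S x x')"
    by (rule sum_norm_square_exp_sum[OF fin])
  also have "\<dots> = (\<Sum>c\<in>C. \<Sum>x\<in>residue_class p t X n c. \<Sum>x'\<in>X. a x * cnj (a x') * ?S x x')"
    unfolding residue_class_def C_def by (rule sum.group[symmetric]) (use fin p in auto)
  also have "\<dots> = (\<Sum>c\<in>C. \<Sum>x\<in>residue_class p t X n c. \<Sum>x'\<in>residue_class p t X n c. a x * cnj (a x') * ?S x x')"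
  proof (rule sum.cong[OF refl], rule sum.cong[OF refl])
    fix c x assume x: "x \<in> residue_class p t X n c"
    have "?S x x' = 0" if "x' \<in> X - residue_class p t X n c" for x'
      by (rule cross) (use x that in \<open>auto simp: residue_class_def\<close>)
    then show "(\<Sum>x'\<in>X. a x * cnj (a x') * ?S x x') = (\<Sum>x'\<in>residue_class p t X n c. a x * cnj (a x') * ?S x x')"
      using fin by (intro sum.mono_neutral_right ballI) (auto simp: residue_class_def)
  qed
  also have "\<dots> = (\<Sum>c\<in>C. complex_of_real (?n (residue_class p t X n c)))"
    using fin by (intro sum.cong refl sum_norm_square_exp_sum[symmetric]) (auto simp: residue_class_def)
  finally have "?n X = (\<Sum>c\<in>C. ?n (residue_class p t X n c))"
    by (simp only: of_real_sum[symmetric] of_real_eq_iff)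
  then have "avg 1 Q (\<lambda>P. cmod (exp_sum Q y a X P) ^ 2) = (\<Sum>c\<in>C. avg 1 Q (\<lambda>P. cmod (exp_sum Q y a (residue_class p t X n c) P) ^ 2))"
    by (simp add: avg_def sum_divide_distrib)
  also have "\<dots> \<le> (\<Sum>c\<in>C. lam c)"
    using configuration by (intro sum_mono) (simp add: configuration_def C_def Q_def tri_def)
  finally show "avg 1 (p ^ (1 * n)) (\<lambda>P. cmod (exp_sum (p ^ (1 * n)) y a X P) ^ (2 * tri 1))
       \<le> 1 * (\<Sum>c\<in>{0..<int p ^ n}. lam c) ^ tri 1"
    by (simp add: Q_def C_def tri_def)
qed

text \<open>From the trivial rate \<open>tri k\<close> the rate is lowered by \<sigma> until it
  reaches \<epsilon>; \<sigma> does not depend on the current rate, so finitely many rounds suffice.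
  Each round uses all lower degrees.\<close>

theorem decoupling_rate_all:
  assumes p: "prime p"
  shows "1 \<le> k \<Longrightarrow> k < p \<Longrightarrow> \<epsilon> > 0 \<Longrightarrow> decoupling_rate p k \<epsilon>"
proof (induction k arbitrary: \<epsilon> rule: less_induct)
  case (less k)
  have p2: "p \<ge> 2" using p prime_ge_2_nat by auto
  show ?case
  proof (cases "k = 1")
    case True
    have "decoupling_rate p 1 0" unfolding decoupling_rate_def
      using decoupling_one[of p] p2 by (intro exI[of _ 1]) auto
    then show ?thesis using decoupling_rate_mono[of p 1 0 \<epsilon>] less.prems p2 True by simp
  next
    case False
    then have k: "k \<ge> 2" using less.prems by simp
    obtain \<sigma> where \<sigma>: "\<sigma> > 0" and step: "\<And>\<eta>. \<eta> \<ge> \<epsilon> \<Longrightarrow> decoupling_rate p k \<eta> \<Longrightarrow> decoupling_rate p k (max (\<eta> - \<sigma>) \<epsilon>)"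
      using decoupling_rate_improve[OF p less.prems(2) k _ less.prems(3)] less.IH less.prems by (metis less_trans)
    define \<eta>1 where "\<eta>1 = max (real (tri k)) \<epsilon>"
    have "decoupling p k n (1 * real p powr (real (tri k) * real n))" for n
    proof -
      have "real p ^ (n * tri k) = 1 * real p powr (real (tri k) * real n)"
        using p2 by (simp add: mult.commute flip: powr_realpow)
      then show ?thesis using decoupling_trivial[of p k n] p2 k by simp
    qed
    then have "decoupling_rate p k (tri k)" unfolding decoupling_rate_def by (intro exI[of _ 1]) auto
    then have start: "decoupling_rate p k \<eta>1" by (rule decoupling_rate_mono) (use p2 in \<open>auto simp: \<eta>1_def\<close>)
    have iter: "decoupling_rate p k (max (\<eta>1 - real j * \<sigma>) \<epsilon>)" for j
    proof (induction j)
      case 0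
      then show ?case using start by (simp add: \<eta>1_def)
    next
      case (Suc j)
      have "max (max (\<eta>1 - real j * \<sigma>) \<epsilon> - \<sigma>) \<epsilon> = max (\<eta>1 - real (Suc j) * \<sigma>) \<epsilon>"
        using \<sigma> by (auto simp: max_def algebra_simps)
      then show ?case using step[OF _ Suc] by (metis max.cobounded2)
    qed
    obtain j :: nat where "real j > \<eta>1 / \<sigma>" using reals_Archimedean2 by blast
    then have "\<eta>1 - real j * \<sigma> \<le> \<epsilon>" using \<sigma> less.prems(3) by (simp add: pos_divide_less_eq)
    then show ?thesis using iter[of j] by (simp add: max_def)
  qed
qed

section \<open>Counting solutions of Vinogradov's system\<close>

definition vinogradov_pairs :: "nat \<Rightarrow> nat \<Rightarrow> int set \<Rightarrow> ((nat \<Rightarrow> int) \<times> (nat \<Rightarrow> int)) set" where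
  "vinogradov_pairs s k X = {(u, v) \<in> PiE {..<s} (\<lambda>_. X) \<times> PiE {..<s} (\<lambda>_. X).
     \<forall>j\<in>{1..k}. (\<Sum>i<s. u i ^ j) = (\<Sum>i<s. v i ^ j)}"

lemma sum_power_PiE:
  fixes g :: "'b \<Rightarrow> 'a :: comm_semiring_1"
  assumes "finite X"
  shows "(\<Sum>x\<in>X. g x) ^ s = (\<Sum>u\<in>PiE {..<s} (\<lambda>_. X). \<Prod>i<s. g (u i))"
  using prod_sum_PiE[of "{..<s}" "\<lambda>_. X" "\<lambda>_. g"] assms by simp

lemma moment_sum_left: "moment (\<lambda>j. \<Sum>i\<in>I. y i j) P = (\<Sum>i\<in>I. moment (y i) P)"
  unfolding moment_def by (subst sum.swap) (simp add: sum_distrib_left)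

text \<open>The mean counts solutions of the system modulo Q, among which are the integer ones; the
  others are dropped by positivity.\<close>

lemma card_vinogradov_le_avg:
  assumes X: "finite X" and Q: "Q > 0"
  shows "real (card (vinogradov_pairs s k X))
    \<le> avg k Q (\<lambda>P. cmod (exp_sum Q (\<lambda>x j. x ^ j) (\<lambda>_. 1) X P) ^ (2 * s))"
proof -
  define U where "U = PiE {..<s} (\<lambda>_. X)"
  have U: "finite U" unfolding U_def using X by (intro finite_PiE) auto
  define w where "w = (\<lambda>u v j. (\<Sum>i<s. u i ^ j) - (\<Sum>i<s. v i ^ j) :: int)"
  let ?S = "\<lambda>u v. \<Sum>P\<in>freqs k Q. unit_exp (moment (w u v) P / Q)"
  have pow: "(exp_sum Q (\<lambda>x j. x ^ j) (\<lambda>_. 1) X P) ^ s = (\<Sum>u\<in>U. unit_exp (moment (\<lambda>j. \<Sum>i<s. u i ^ j) P / Q))" for P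
    unfolding exp_sum_def U_def sum_power_PiE[OF X] moment_sum_left
    by (intro sum.cong refl) (simp add: sum_divide_distrib unit_exp_sum)
  have "complex_of_real (\<Sum>P\<in>freqs k Q. cmod (exp_sum Q (\<lambda>x j. x ^ j) (\<lambda>_. 1) X P) ^ (2 * s)) = (\<Sum>u\<in>U. \<Sum>v\<in>U. ?S u v)"
  proof -
    have "complex_of_real (cmod (exp_sum Q (\<lambda>x j. x ^ j) (\<lambda>_. 1) X P) ^ (2 * s))
        = (\<Sum>u\<in>U. \<Sum>v\<in>U. unit_exp (moment (w u v) P / Q))" for P
    proof -
      have "cmod (exp_sum Q (\<lambda>x j. x ^ j) (\<lambda>_. 1) X P) ^ (2 * s) = cmod ((exp_sum Q (\<lambda>x j. x ^ j) (\<lambda>_. 1) X P) ^ s) ^ 2"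
        by (simp add: norm_power mult.commute[of 2] flip: power_mult)
      then have "complex_of_real (cmod (exp_sum Q (\<lambda>x j. x ^ j) (\<lambda>_. 1) X P) ^ (2 * s))
        = complex_of_real (cmod ((exp_sum Q (\<lambda>x j. x ^ j) (\<lambda>_. 1) X P) ^ s) ^ 2)" by (simp only:)
      then show ?thesis
        unfolding pow norm_square_sum w_def moment_diff_left
        by (simp add: diff_divide_distrib flip: unit_exp_minus unit_exp_add)
    qed
    then have "complex_of_real (\<Sum>P\<in>freqs k Q. cmod (exp_sum Q (\<lambda>x j. x ^ j) (\<lambda>_. 1) X P) ^ (2 * s))
       = (\<Sum>P\<in>freqs k Q. \<Sum>u\<in>U. \<Sum>v\<in>U. unit_exp (moment (w u v) P / Q))"
      by (simp only: of_real_sum)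
    also have "\<dots> = (\<Sum>u\<in>U. \<Sum>P\<in>freqs k Q. \<Sum>v\<in>U. unit_exp (moment (w u v) P / Q))"
      by (rule sum.swap)
    also have "\<dots> = (\<Sum>u\<in>U. \<Sum>v\<in>U. ?S u v)"
      by (intro sum.cong refl) (rule sum.swap)
    finally show ?thesis .
  qed
  also have "\<dots> = (\<Sum>u\<in>U. \<Sum>v\<in>U. of_real (if \<forall>j\<le>k. int Q dvd w u v j then real (card (freqs k Q)) else 0))"
  proof (intro sum.cong refl)
    fix u v
    show "?S u v = of_real (if \<forall>j\<le>k. int Q dvd w u v j then real (card (freqs k Q)) else 0)"
    proof (cases "\<forall>j\<le>k. int Q dvd w u v j")
      case True
      have "unit_exp (moment (w u v) P / Q) = 1" if "P \<in> freqs k Q" for P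
      proof -
        have "int Q dvd moment (w u v) P"
          using that True unfolding moment_def by (intro dvd_sum dvd_mult) (auto simp: freqs_def)
        then obtain r where "moment (w u v) P = int Q * r" by (elim dvdE)
        then have "real_of_int (moment (w u v) P) / Q = of_int r" using Q by simp
        then show ?thesis by simp
      qed
      then show ?thesis using True by simp
    next
      case False
      then obtain j where "j \<le> k" "\<not> int Q dvd w u v j" by blast
      then show ?thesis using sum_freqs_character[OF _ _ Q] False by auto
    qed
  qed
  finally have eq: "(\<Sum>P\<in>freqs k Q. cmod (exp_sum Q (\<lambda>x j. x ^ j) (\<lambda>_. 1) X P) ^ (2 * s))
     = (\<Sum>u\<in>U. \<Sum>v\<in>U. if \<forall>j\<le>k. int Q dvd w u v j then real (card (freqs k Q)) else 0)"
    by (simp only: of_real_sum[symmetric] of_real_eq_iff)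
  have "real (card (vinogradov_pairs s k X)) * real (card (freqs k Q))
     = (\<Sum>(u, v)\<in>vinogradov_pairs s k X. real (card (freqs k Q)))"
    by simp
  also have "\<dots> = (\<Sum>(u, v)\<in>vinogradov_pairs s k X. if \<forall>j\<le>k. int Q dvd w u v j then real (card (freqs k Q)) else 0)"
  proof (intro sum.cong refl)
    fix x assume "x \<in> vinogradov_pairs s k X"
    moreover obtain u v where x: "x = (u, v)" by fastforce
    ultimately have uv: "\<forall>j\<in>{1..k}. (\<Sum>i<s. u i ^ j) = (\<Sum>i<s. v i ^ j)"
      by (simp add: vinogradov_pairs_def)
    have "w u v j = 0" if "j \<le> k" for j
      using uv that by (cases "j = 0") (auto simp: w_def)
    then show "(case x of (u, v) \<Rightarrow> real (card (freqs k Q))) =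
      (case x of (u, v) \<Rightarrow> if \<forall>j\<le>k. int Q dvd w u v j then real (card (freqs k Q)) else 0)"
      by (simp add: x)
  qed
  also have "\<dots> \<le> (\<Sum>(u, v)\<in>U \<times> U. if \<forall>j\<le>k. int Q dvd w u v j then real (card (freqs k Q)) else 0)"
  proof (rule sum_mono2)
    show "finite (U \<times> U)" using U by simp
    show "vinogradov_pairs s k X \<subseteq> U \<times> U"
      unfolding vinogradov_pairs_def U_def by blast
  qed (simp add: case_prod_unfold)
  also have "\<dots> = (\<Sum>P\<in>freqs k Q. cmod (exp_sum Q (\<lambda>x j. x ^ j) (\<lambda>_. 1) X P) ^ (2 * s))"
    unfolding eq by (simp add: sum.cartesian_product)
  finally show ?thesis
    using card_freqs_pos[OF Q, of k] by (simp add: avg_def pos_le_divide_eq)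
qed

text \<open>Fix one prime p > k and take p^n just above N. A class modulo p^n then contains at most
  one element of X, all \<open>lam c\<close> can be 1, and decoupling is the mean value estimate.
  Only the diameter of X matters, so intervals centred at 0 are covered.\<close>

theorem vinogradov_mean_value:
  fixes \<epsilon> :: real
  assumes k: "1 \<le> k" and \<epsilon>: "\<epsilon> > 0"
  obtains C where "C > 0" "\<And>N X. N \<ge> 1 \<Longrightarrow> finite X \<Longrightarrow> (\<And>x x'. x \<in> X \<Longrightarrow> x' \<in> X \<Longrightarrow> \<bar>x - x'\<bar> < int N) \<Longrightarrow>
    real (card (vinogradov_pairs (tri k) k X)) \<le> C * real N powr (tri k + \<epsilon>)"
proof -
  obtain p where p: "prime p" "k < p" using bigger_prime by blast
  have p2: "p \<ge> 2" using p prime_ge_2_nat by auto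
  obtain C where C: "C \<ge> 1" "\<And>n. decoupling p k n (C * real p powr (\<epsilon> * real n))"
    using decoupling_rate_all[OF p(1) k p(2) \<epsilon>] by (auto simp: decoupling_rate_def)
  show ?thesis
  proof (rule that[of "C * real p powr (tri k + \<epsilon>)"])
    show "C * real p powr (tri k + \<epsilon>) > 0" using C p2 by simp
    fix N :: nat and X :: "int set"
    assume N: "N \<ge> 1" and X: "finite X" "\<And>x x'. x \<in> X \<Longrightarrow> x' \<in> X \<Longrightarrow> \<bar>x - x'\<bar> < int N"
    obtain n' where n': "p ^ n' \<le> N" "N < p ^ (n' + 1)"
      using ex_power_ivl1[OF p2 N] by blast
    define n where "n = n' + 1"
    have Nn: "int N < int p ^ n" using n'(2) unfolding n_def of_nat_power[symmetric] of_nat_less_iff .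
    define Q where "Q = p ^ (k * n)"
    have "configuration p k n X (\<lambda>x j. x ^ j) (\<lambda>x. x) (\<lambda>_. 1) (\<lambda>_. 1)"
      unfolding configuration_def
    proof (intro conjI ballI)
      show "finite X" by fact
      show "near_curve p k (\<lambda>j. x ^ j) x n" for x :: int
        by (auto simp: near_curve_def moment_power power_0_left)
      show "(0 :: real) < 1" by simp
      fix c
      have "cmod (exp_sum Q (\<lambda>x j. x ^ j) (\<lambda>_. 1) (residue_class p (\<lambda>x. x) X n c) P) \<le> 1" for P
      proof -
        have "card (residue_class p (\<lambda>x. x) X n c) \<le> Suc 0"
        proof (subst card_le_Suc0_iff_eq)
          show "\<forall>a\<in>residue_class p (\<lambda>x. x) X n c. \<forall>b\<in>residue_class p (\<lambda>x. x) X n c. a = b"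
          proof (intro ballI)
            fix a b assume "a \<in> residue_class p (\<lambda>x. x) X n c" "b \<in> residue_class p (\<lambda>x. x) X n c"
            then have "a \<in> X" "b \<in> X" "a mod int p ^ n = b mod int p ^ n" by (auto simp: residue_class_def)
            then have "int p ^ n dvd a - b" "\<bar>a - b\<bar> < int p ^ n"
              using less_trans[OF X(2) Nn] by (auto simp: mod_eq_dvd_iff)
            then show "a = b" using zdvd_imp_le[of "int p ^ n" "\<bar>a - b\<bar>"] by (cases "a = b") auto
          qed
        qed (use X in \<open>simp add: residue_class_def\<close>)
        then have "real (card (residue_class p (\<lambda>x. x) X n c)) \<le> 1" by simp
        moreover have "cmod (exp_sum Q (\<lambda>x j. x ^ j) (\<lambda>_. 1) (residue_class p (\<lambda>x. x) X n c) P) \<le> real (card (residue_class p (\<lambda>x. x) X n c))"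
          unfolding exp_sum_def by (rule order_trans[OF norm_sum]) (simp add: norm_mult)
        ultimately show ?thesis by linarith
      qed
      then have "avg k Q (\<lambda>P. cmod (exp_sum Q (\<lambda>x j. x ^ j) (\<lambda>_. 1) (residue_class p (\<lambda>x. x) X n c) P) ^ (2 * tri k)) \<le> avg k Q (\<lambda>_. 1)"
        by (intro avg_mono power_le_one) auto
      then show "avg k (p ^ (k * n)) (\<lambda>P. cmod (exp_sum (p ^ (k * n)) (\<lambda>x j. x ^ j) (\<lambda>_. 1) (residue_class p (\<lambda>x. x) X n c) P) ^ (2 * tri k)) \<le> 1 ^ tri k"
        using p2 by (simp add: avg_const Q_def)
    qed
    then have "avg k Q (\<lambda>P. cmod (exp_sum Q (\<lambda>x j. x ^ j) (\<lambda>_. 1) X P) ^ (2 * tri k))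
        \<le> C * real p powr (\<epsilon> * real n) * (\<Sum>c\<in>{0..<int p ^ n}. 1) ^ tri k"
      using C(2)[of n] unfolding decoupling_def Q_def by blast
    also have "(\<Sum>c\<in>{0..<int p ^ n}. 1) ^ tri k = real p powr (tri k * real n)"
      using p2 by (simp add: nat_power_eq powr_powr mult.commute flip: powr_realpow)
    also have "C * real p powr (\<epsilon> * real n) * real p powr (tri k * real n) = C * (real p ^ n) powr (tri k + \<epsilon>)"
      using p2 by (simp add: powr_powr algebra_simps powr_add flip: powr_realpow)
    also have "\<dots> \<le> C * (real p * real N) powr (tri k + \<epsilon>)"
    proof -
      have "real p ^ n = real p * real (p ^ n')" by (simp add: n_def)
      also have "\<dots> \<le> real p * real N" using n' by (intro mult_left_mono) (auto simp del: of_nat_power)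
      finally show ?thesis using C \<epsilon> by (intro mult_left_mono powr_mono2) auto
    qed
    also have "\<dots> = C * real p powr (tri k + \<epsilon>) * real N powr (tri k + \<epsilon>)"
      by (simp add: powr_mult)
    finally show "real (card (vinogradov_pairs (tri k) k X)) \<le> C * real p powr (tri k + \<epsilon>) * real N powr (tri k + \<epsilon>)"
      using card_vinogradov_le_avg[OF X(1), of Q "tri k" k] p2 by (simp add: Q_def)
  qed
qed

section \<open>Diophantine approximation\<close>

lemma dist_le: "dist_nearest_int x \<le> \<bar>x - of_int n\<bar>"
  unfolding dist_nearest_int_def by (rule round_diff_minimal)

lemma dist_nonneg [simp]: "0 \<le> dist_nearest_int x"
  by (simp add: dist_nearest_int_def)

lemma dist_le_half: "dist_nearest_int x \<le> 1 / 2"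
  unfolding dist_nearest_int_def using of_int_round_abs_le[of x] by (simp add: abs_minus_commute)

lemma dist_minus [simp]: "dist_nearest_int (- x) = dist_nearest_int x"
proof -
  have "dist_nearest_int (- x) \<le> dist_nearest_int x" for x
    using dist_le[of "- x" "- round x"] by (simp add: dist_nearest_int_def)
  from this[of x] this[of "- x"] show ?thesis by simp
qed

lemma dist_ge: "dist_nearest_int y - \<bar>x - y\<bar> \<le> dist_nearest_int x"
  using dist_le[of y "round x"] by (simp add: dist_nearest_int_def)

lemma dist_pos_of_irrational:
  assumes "\<alpha> \<notin> \<rat>" "q \<ge> (1 :: nat)"
  shows "dist_nearest_int (\<alpha> * q) > 0"
proof (rule ccontr)
  assume "\<not> ?thesis"
  then have "\<alpha> * q = of_int (round (\<alpha> * q))" by (simp add: dist_nearest_int_def)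
  then have "\<alpha> = of_int (round (\<alpha> * q)) / of_nat q" using assms by (simp add: field_simps)
  also have "\<dots> \<in> \<rat>" by simp
  finally show False using assms by simp
qed

text \<open>An exponent above the type has nonzero liminf, so the bound holds from some q on;
  irrationality keeps the finitely many earlier distances positive.\<close>

lemma type_one_lower_bound:
  assumes \<alpha>: "\<alpha> \<notin> \<rat>" "diophantine_type \<alpha> = 1" and \<epsilon>: "\<epsilon> > 0"
  obtains c where "c > 0" "\<And>q :: nat. q \<ge> 1 \<Longrightarrow> c * real q powr (- (1 + \<epsilon>)) \<le> dist_nearest_int (\<alpha> * real q)"
proof -
  define g where "g = (\<lambda>q :: nat. real q powr (1 + \<epsilon>) * dist_nearest_int (\<alpha> * real q))"
  have g0: "g q \<ge> 0" for q by (simp add: g_def)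
  have gpos: "g q > 0" if "q \<ge> 1" for q
    using dist_pos_of_irrational[OF \<alpha>(1) that] that by (simp add: g_def)
  have "liminf (\<lambda>q. ereal (g q)) \<noteq> 0"
  proof
    assume "liminf (\<lambda>q. ereal (g q)) = 0"
    then have "ereal (1 + \<epsilon>) \<le> diophantine_type \<alpha>"
      unfolding diophantine_type_def by (intro Sup_upper imageI) (simp add: g_def)
    then show False using \<alpha>(2) \<epsilon> by (simp add: one_ereal_def)
  qed
  moreover have "0 \<le> liminf (\<lambda>q. ereal (g q))"
    by (rule Liminf_bounded) (simp add: g0)
  ultimately have "0 < liminf (\<lambda>q. ereal (g q))" by simp
  then obtain c0 where c0: "0 < ereal c0" "ereal c0 < liminf (\<lambda>q. ereal (g q))"
    using ereal_dense2 by blast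
  have "eventually (\<lambda>q. ereal c0 < ereal (g q)) sequentially"
    by (rule less_LiminfD[OF c0(2)])
  then obtain q0 where q0: "\<And>q. q \<ge> q0 \<Longrightarrow> c0 < g q"
    by (auto simp: eventually_sequentially)
  define c where "c = Min (insert c0 (g ` {1..q0}))"
  have "c > 0" unfolding c_def using c0 gpos by (subst Min_gr_iff) auto
  moreover have "c \<le> g q" if "q \<ge> 1" for q
  proof (cases "q \<le> q0")
    case True
    then show ?thesis unfolding c_def using that by (intro Min_le) auto
  next
    case False
    have "c \<le> c0" unfolding c_def by (intro Min_le) auto
    then show ?thesis using q0[of q] False by simp
  qed
  then have "c * real q powr (- (1 + \<epsilon>)) \<le> dist_nearest_int (\<alpha> * real q)" if "q \<ge> 1" for q
    unfolding powr_minus_divide using that by (simp add: g_def divide_le_eq mult.commute)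
  ultimately show ?thesis using that by blast
qed

section \<open>Geometric sums and sums of reciprocal distances\<close>

lemma sin_pi_ge: "0 \<le> y \<Longrightarrow> y \<le> 1 / 2 \<Longrightarrow> 2 * y \<le> sin (pi * y)"
proof -
  assume y: "0 \<le> y" "y \<le> 1 / 2"
  have "concave_on {0..pi/2} sin"
    by (rule f''_le0_imp_concave[where f' = cos and f'' = "\<lambda>x. - sin x"])
       (auto intro!: derivative_eq_intros sin_ge_zero)
  from concave_onD[OF this, of "2 * y" 0 "pi / 2"] y
  show ?thesis by (simp add: mult.commute)
qed

lemma norm_unit_exp_diff_ge: "4 * dist_nearest_int x \<le> cmod (unit_exp x - 1)"
proof -
  define y where "y = x - of_int (round x)"
  have y: "dist_nearest_int x = \<bar>y\<bar>" "\<bar>y\<bar> \<le> 1 / 2"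
    using dist_le_half[of x] by (auto simp: y_def dist_nearest_int_def)
  have "unit_exp x = unit_exp (y + of_int (round x))" by (simp add: y_def)
  also have "\<dots> = unit_exp y" by (rule unit_exp_add_of_int)
  finally have e: "unit_exp x = cis (2 * pi * y)" by (simp only: unit_exp_def)
  have "cmod (unit_exp x - 1) ^ 2 = (cos (2 * pi * y) - 1) ^ 2 + sin (2 * pi * y) ^ 2"
    unfolding e cmod_power2 by simp
  also have "\<dots> = 2 - 2 * cos (2 * (pi * y))"
    using sin_cos_squared_add[of "2 * pi * y"] by (simp add: power2_diff algebra_simps)
  also have "\<dots> = (2 * \<bar>sin (pi * y)\<bar>) ^ 2"
    unfolding cos_double_sin by (simp add: power_mult_distrib)
  finally have "cmod (unit_exp x - 1) = 2 * \<bar>sin (pi * y)\<bar>"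
    by (rule power2_eq_imp_eq) auto
  moreover have "\<bar>sin (pi * y)\<bar> = \<bar>sin (pi * \<bar>y\<bar>)\<bar>" by (simp add: abs_if)
  ultimately show ?thesis
    using sin_pi_ge[of "\<bar>y\<bar>"] y by linarith
qed

lemma norm_geometric_le:
  fixes a b :: int
  assumes "dist_nearest_int x > 0"
  shows "cmod (\<Sum>h\<in>{a..<b}. unit_exp (of_int h * x)) \<le> 1 / (2 * dist_nearest_int x)"
proof (cases "a \<le> b")
  case True
  have "(\<Sum>h\<in>{a..<b}. unit_exp (of_int h * x)) * (unit_exp x - 1) = unit_exp (of_int b * x) - unit_exp (of_int a * x)"
    using True
  proof (induction b rule: int_ge_induct)
    case (step b)
    have "{a..<b + 1} = insert b {a..<b}" using step.hyps by auto
    then show ?case using step.IH by (simp add: algebra_simps unit_exp_add)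
  qed simp
  then have "cmod (\<Sum>h\<in>{a..<b}. unit_exp (of_int h * x)) * cmod (unit_exp x - 1) \<le> 2"
    using norm_triangle_ineq4[of "unit_exp (of_int b * x)" "unit_exp (of_int a * x)"]
    by (simp flip: norm_mult)
  moreover have "cmod (\<Sum>h\<in>{a..<b}. unit_exp (of_int h * x)) * (4 * dist_nearest_int x)
      \<le> cmod (\<Sum>h\<in>{a..<b}. unit_exp (of_int h * x)) * cmod (unit_exp x - 1)"
    by (intro mult_left_mono norm_unit_exp_diff_ge) auto
  ultimately show ?thesis using assms by (simp add: field_simps)
qed (use assms in simp)

text \<open>This is \<open>min(H, 1/\<parallel>x\<parallel>)\<close>, in a form that gives \<open>H\<close> where \<open>\<parallel>x\<parallel> = 0\<close>.\<close>

definition capped :: "real \<Rightarrow> real \<Rightarrow> real" where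
  "capped H x = 1 / max (1 / H) (dist_nearest_int x)"

lemma capped_nonneg: "H > 0 \<Longrightarrow> 0 \<le> capped H x"
  by (simp add: capped_def le_max_iff_disj)

lemma capped_le: "H > 0 \<Longrightarrow> capped H x \<le> H"
proof -
  assume H: "H > 0"
  have "1 / max (1 / H) (dist_nearest_int x) \<le> 1 / (1 / H)"
    using H by (intro divide_left_mono mult_pos_pos) (auto simp: less_max_iff_disj)
  then show ?thesis by (simp add: capped_def)
qed

lemma capped_le_inverse: "H > 0 \<Longrightarrow> d > 0 \<Longrightarrow> d \<le> dist_nearest_int x \<Longrightarrow> capped H x \<le> 1 / d"
  unfolding capped_def by (intro divide_left_mono mult_pos_pos) (auto simp: less_max_iff_disj)

lemma norm_geometric_capped:
  fixes B :: nat
  shows "cmod (\<Sum>h\<in>{- int B..int B}. unit_exp (of_int h * x)) \<le> capped (2 * B + 1) x"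
proof (cases "dist_nearest_int x \<le> 1 / (2 * B + 1)")
  case True
  have "cmod (\<Sum>h\<in>{- int B..int B}. unit_exp (of_int h * x)) \<le> real (card {- int B..int B})"
    by (rule order_trans[OF norm_sum]) simp
  then show ?thesis using True by (simp add: capped_def max_def)
next
  case False
  then have d: "dist_nearest_int x > 0" by (smt (verit) divide_nonneg_nonneg of_nat_0_le_iff)
  have "{- int B..int B} = {- int B..<int B + 1}" by auto
  then have "cmod (\<Sum>h\<in>{- int B..int B}. unit_exp (of_int h * x)) \<le> 1 / (2 * dist_nearest_int x)"
    using norm_geometric_le[OF d] by simp
  also have "\<dots> \<le> 1 / dist_nearest_int x" using d by (intro divide_left_mono) auto
  finally show ?thesis using False by (simp add: capped_def max_def)
qed

text \<open>Sort the points by sign and by the multiple of \<delta> just below their distance to the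
  nearest integer. Each box holds at most one point; box i > 0 contributes at most 1 / (i \<delta>),
  box 0 at most H.\<close>

lemma sum_capped_spaced:
  fixes \<phi> :: "nat \<Rightarrow> real"
  assumes H: "H > 0" and \<delta>: "\<delta> > 0" and fin: "finite S"
    and sp: "\<And>s t. s \<in> S \<Longrightarrow> t \<in> S \<Longrightarrow> s \<noteq> t \<Longrightarrow> \<delta> \<le> dist_nearest_int (\<phi> s - \<phi> t)"
    and J: "1 / (2 * \<delta>) \<le> real J"
  shows "(\<Sum>t\<in>S. capped H (\<phi> t)) \<le> 2 * (H + harm J / \<delta>)"
proof -
  define y where "y = (\<lambda>t. \<phi> t - of_int (round (\<phi> t)))"
  have y: "dist_nearest_int (\<phi> t) = \<bar>y t\<bar>" "\<bar>y t\<bar> \<le> 1 / 2" for t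
    using dist_le_half[of "\<phi> t"] by (auto simp: y_def dist_nearest_int_def)
  define j where "j = (\<lambda>t. nat \<lfloor>\<bar>y t\<bar> / \<delta>\<rfloor>)"
  have j: "real (j t) * \<delta> \<le> \<bar>y t\<bar>" "\<bar>y t\<bar> < (real (j t) + 1) * \<delta>" for t
  proof -
    have nn: "0 \<le> \<bar>y t\<bar> / \<delta>" using \<delta> by simp
    then have "real (j t) = of_int \<lfloor>\<bar>y t\<bar> / \<delta>\<rfloor>" by (simp add: j_def)
    then have "real (j t) \<le> \<bar>y t\<bar> / \<delta>" "\<bar>y t\<bar> / \<delta> < real (j t) + 1" by linarith+
    then show "real (j t) * \<delta> \<le> \<bar>y t\<bar>" "\<bar>y t\<bar> < (real (j t) + 1) * \<delta>"
      using \<delta> by (simp_all add: field_simps)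
  qed
  define g where "g = (\<lambda>i :: nat. if i = 0 then H else 1 / (real i * \<delta>))"
  have g: "g i \<ge> 0" for i using H \<delta> by (simp add: g_def)
  have le_g: "capped H (\<phi> t) \<le> g (j t)" for t
  proof (cases "j t = 0")
    case False
    then have "real (j t) * \<delta> > 0" using \<delta> by simp
    then show ?thesis using capped_le_inverse[OF H, of "real (j t) * \<delta>" "\<phi> t"] j(1)[of t] False
      by (simp add: g_def y(1))
  qed (use capped_le[OF H] in \<open>simp add: g_def\<close>)
  have jJ: "j t \<le> J" for t
  proof -
    have "real (j t) * \<delta> \<le> 1 / 2" using j(1)[of t] y(2)[of t] by linarith
    also have "\<dots> \<le> real J * \<delta>" using J \<delta> by (simp add: field_simps)
    finally show ?thesis using \<delta> by simp
  qed
  define F where "F = (\<lambda>t. (y t \<ge> 0, j t))"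
  have inj: "inj_on F S"
  proof (rule inj_onI, rule ccontr)
    fix s t assume st: "s \<in> S" "t \<in> S" "F s = F t" "s \<noteq> t"
    then have e: "(y s \<ge> 0) = (y t \<ge> 0)" "j s = j t" by (auto simp: F_def)
    have "\<delta> \<le> dist_nearest_int (\<phi> s - \<phi> t)" using sp st by blast
    also have "\<dots> \<le> \<bar>y s - y t\<bar>"
      using dist_le[of "\<phi> s - \<phi> t" "round (\<phi> s) - round (\<phi> t)"] by (simp add: y_def algebra_simps)
    also have "\<dots> = \<bar>\<bar>y s\<bar> - \<bar>y t\<bar>\<bar>" using e(1) by auto
    also have "\<dots> < \<delta>" using j[of s] j[of t] unfolding e(2) distrib_right mult_1 by linarith
    finally show False by simp
  qed
  have "(\<Sum>t\<in>S. capped H (\<phi> t)) \<le> (\<Sum>t\<in>S. g (snd (F t)))"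
    using le_g by (intro sum_mono) (simp add: F_def)
  also have "\<dots> = (\<Sum>x\<in>F ` S. g (snd x))" using inj by (simp add: sum.reindex)
  also have "\<dots> \<le> (\<Sum>x\<in>(UNIV :: bool set) \<times> {..J}. g (snd x))"
    using jJ g by (intro sum_mono2) (auto simp: F_def)
  also have "\<dots> = 2 * (\<Sum>i\<le>J. g i)"
  proof -
    have "(\<Sum>x\<in>(UNIV :: bool set) \<times> {..J}. g (snd x)) = (\<Sum>b\<in>(UNIV :: bool set). \<Sum>i\<le>J. g i)"
      by (simp add: sum.cartesian_product case_prod_unfold del: sum_constant)
    then show ?thesis by (simp add: UNIV_bool)
  qed
  also have "(\<Sum>i\<le>J. g i) = H + (\<Sum>i=1..J. 1 / (real i * \<delta>))"
    by (simp add: sum.atMost_shift sum.atLeast1_atMost_eq g_def)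
  also have "(\<Sum>i=1..J. 1 / (real i * \<delta>)) = harm J / \<delta>"
    by (simp add: harm_def sum_divide_distrib field_simps)
  finally show ?thesis .
qed

text \<open>Differences inside a block of length L are \<beta> t with 1 \<le> t < L, so every block
  is spaced, wherever it lies.\<close>

lemma sum_capped_blocks:
  fixes \<beta> :: real
  assumes H: "H > 0" and \<delta>: "\<delta> > 0" and L: "L \<ge> 1"
    and sp: "\<And>t. 1 \<le> t \<Longrightarrow> t < L \<Longrightarrow> \<delta> \<le> dist_nearest_int (\<beta> * real t)"
    and J: "1 / (2 * \<delta>) \<le> real J"
  shows "(\<Sum>t\<in>{1..T}. capped H (\<beta> * real t)) \<le> (real T / real L + 1) * (2 * (H + harm J / \<delta>))"
proof -
  define K where "K = 2 * (H + harm J / \<delta>)"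
  have K: "K \<ge> 0" using H \<delta> by (auto simp: K_def harm_nonneg intro!: add_nonneg_nonneg divide_nonneg_nonneg)
  have "(\<Sum>t\<in>{1..T}. capped H (\<beta> * real t))
     = (\<Sum>i\<in>{..T div L}. \<Sum>t\<in>{t \<in> {1..T}. t div L = i}. capped H (\<beta> * real t))"
    by (rule sum.group[symmetric]) (auto intro: div_le_mono)
  also have "\<dots> \<le> (\<Sum>i\<in>{..T div L}. K)"
  proof (intro sum_mono)
    fix i
    show "(\<Sum>t\<in>{t \<in> {1..T}. t div L = i}. capped H (\<beta> * real t)) \<le> K"
      unfolding K_def
    proof (rule sum_capped_spaced[OF H \<delta> _ _ J])
      have sp': "\<delta> \<le> dist_nearest_int (\<beta> * real s - \<beta> * real t)" if "s < t" "s div L = t div L" for s t :: nat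
      proof -
        have "t - s < L"
        proof -
          have "L * (s div L) \<le> s" by simp
          moreover have "t < L * (t div L) + L" using L dividend_less_times_div[of L t] by simp
          ultimately show ?thesis using that by simp
        qed
        then have "\<delta> \<le> dist_nearest_int (\<beta> * real (t - s))" using sp[of "t - s"] that by simp
        also have "\<beta> * real (t - s) = - (\<beta> * real s - \<beta> * real t)" using that by (simp add: of_nat_diff algebra_simps)
        finally show ?thesis unfolding dist_minus .
      qed
      show "\<delta> \<le> dist_nearest_int (\<beta> * real s - \<beta> * real t)"
        if "s \<in> {t \<in> {1..T}. t div L = i}" "t \<in> {t \<in> {1..T}. t div L = i}" "s \<noteq> t" for s t
      proof (cases "s < t")
        case False
        then show ?thesis using sp'[of t s] that dist_minus[of "\<beta> * real s - \<beta> * real t"] by simp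
      qed (use sp' that in auto)
    qed auto
  qed
  also have "\<dots> = (real (T div L) + 1) * K" by (simp add: algebra_simps)
  also have "\<dots> \<le> (real T / real L + 1) * K"
    using K of_nat_div_le_of_nat[of T L] by (intro mult_right_mono add_right_mono) auto
  finally show ?thesis by (simp add: K_def)
qed

text \<open>For 2 t \<le> q the point \<beta> t is within 1 / (2 q) of t h / q, which is at least 1
  / q away from the integers; so blocks of length q div 2 + 1 are spaced by 1 / (2 q). The
  denominator q is fixed before H and T, hence its size can be studied separately.\<close>

lemma sum_capped_Dirichlet:
  fixes \<beta> :: real
  assumes Q: "Q \<ge> (1 :: nat)"
  obtains q where "1 \<le> q" "q \<le> Q" "dist_nearest_int (\<beta> * real q) < 1 / real Q"
    "\<And>H T. H > 0 \<Longrightarrow> (\<Sum>t\<in>{1..T}. capped H (\<beta> * real t)) \<le> (2 * real T / real q + 1) * (2 * H + 4 * real q * harm q)"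
proof -
  obtain h k where hk: "coprime h k" "0 < k" "k \<le> int Q" "\<bar>of_int k * \<beta> - of_int h\<bar> < 1 / Q"
    using Dirichlet_approx_coprime[of Q \<beta>] Q by auto
  define q where "q = nat k"
  have q: "1 \<le> q" "q \<le> Q" "k = int q" using hk by (auto simp: q_def)
  have appr: "\<bar>\<beta> * real q - of_int h\<bar> < 1 / Q" using hk(4) q(3) by (simp add: mult.commute)
  define L where "L = q div 2 + 1"
  have sp: "1 / (2 * real q) \<le> dist_nearest_int (\<beta> * real t)" if t: "1 \<le> t" "t < L" for t
  proof -
    have tq: "2 * t \<le> q" using t by (simp add: L_def)
    define x where "x = real t * of_int h / q"
    have "1 / real q \<le> dist_nearest_int x"
    proof -
      define m where "m = int t * h - round x * int q"
      have "m \<noteq> 0"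
      proof
        assume "m = 0"
        then have "k dvd int t * h" by (simp add: m_def q(3))
        then have "k dvd int t" using hk(1) coprime_commute coprime_dvd_mult_left_iff by blast
        then show False using t tq by (auto simp: q(3) dest: dvd_imp_le)
      qed
      then have "1 \<le> \<bar>real_of_int m\<bar>" by linarith
      moreover have "x - of_int (round x) = of_int m / q"
        using q by (simp add: x_def m_def field_simps)
      ultimately show ?thesis by (simp add: dist_nearest_int_def divide_right_mono)
    qed
    moreover have "\<bar>\<beta> * real t - x\<bar> \<le> 1 / (2 * real q)"
    proof -
      have "\<beta> * real t - x = real t / q * (\<beta> * real q - of_int h)"
        using q by (simp add: x_def field_simps)
      then have "\<bar>\<beta> * real t - x\<bar> = real t / q * \<bar>\<beta> * real q - of_int h\<bar>"
        by (simp add: abs_mult)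
      also have "\<dots> \<le> (1 / 2) * (1 / Q)"
        using appr tq q by (intro mult_mono) (auto simp: divide_simps)
      also have "\<dots> \<le> (1 / 2) * (1 / q)"
        using q by (intro mult_left_mono divide_left_mono) auto
      finally show ?thesis by simp
    qed
    ultimately show ?thesis using dist_ge[of x "\<beta> * real t"] by (simp add: field_simps)
  qed
  show ?thesis
  proof (rule that[of q])
    show "dist_nearest_int (\<beta> * real q) < 1 / Q" using dist_le[of "\<beta> * real q" h] appr by linarith
    fix H :: real and T :: nat assume H: "H > 0"
    have "(\<Sum>t\<in>{1..T}. capped H (\<beta> * real t)) \<le> (real T / real L + 1) * (2 * (H + harm q / (1 / (2 * real q))))"
      by (rule sum_capped_blocks[OF H _ _ sp]) (use q in \<open>auto simp: L_def\<close>)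
    also have "2 * (H + harm q / (1 / (2 * real q))) = 2 * H + 4 * real q * harm q" by simp
    also have "(real T / real L + 1) * (2 * H + 4 * real q * harm q) \<le> (2 * real T / real q + 1) * (2 * H + 4 * real q * harm q)"
    proof (intro mult_right_mono add_right_mono)
      have "real q \<le> 2 * real L" by (simp add: L_def flip: of_nat_mult of_nat_add)
      then have "real T * real q \<le> 2 * real T * real L" using mult_left_mono[of "real q" "2 * real L" "real T"] by simp
      then show "real T / real L \<le> 2 * real T / real q" using q by (simp add: L_def field_simps)
      show "0 \<le> 2 * H + 4 * real q * harm q" using H by (intro add_nonneg_nonneg mult_nonneg_nonneg harm_nonneg) auto
    qed
    finally show "(\<Sum>t\<in>{1..T}. capped H (\<beta> * real t)) \<le> (2 * real T / real q + 1) * (2 * H + 4 * real q * harm q)" .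
  qed (use q in auto)
qed

section \<open>The divisor bound\<close>

lemma card_divisors_prime_power_mult:
  assumes "prime p" "m > (0 :: nat)"
  shows "card {d. d dvd p ^ a * m} \<le> (a + 1) * card {d. d dvd m}"
proof -
  have "{d. d dvd p ^ a * m} \<subseteq> (\<lambda>(i, e). p ^ i * e) ` ({..a} \<times> {d. d dvd m})"
  proof
    fix d assume "d \<in> {d. d dvd p ^ a * m}"
    then obtain b e where "d = b * e" "b dvd p ^ a" "e dvd m" by (auto dest: division_decomp)
    moreover then obtain i where "i \<le> a" "b = p ^ i" using assms(1) by (auto simp: divides_primepow_nat)
    ultimately show "d \<in> (\<lambda>(i, e). p ^ i * e) ` ({..a} \<times> {d. d dvd m})" by force
  qed
  moreover have fin: "finite ({..a} \<times> {d. d dvd m})" using assms by simp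
  ultimately have "card {d. d dvd p ^ a * m} \<le> card ({..a} \<times> {d. d dvd m})"
    by (meson card_image_le card_mono finite_imageI le_trans)
  then show ?thesis by (simp add: card_cartesian_product)
qed

text \<open>Strip off one prime at a time. A prime p \<ge> P satisfies p^\<epsilon> \<ge> 2 and
  costs nothing, as a + 1 \<le> 2^a; each of the at most P smaller primes costs a factor A.\<close>

theorem divisor_bound:
  assumes \<epsilon>: "\<epsilon> > (0 :: real)"
  obtains C where "C > 0" "\<And>n :: nat. n \<ge> 1 \<Longrightarrow> real (card {d. d dvd n}) \<le> C * real n powr \<epsilon>"
proof -
  \<comment> \<open>Makes a + 1 \<le> A (1 + a \<epsilon> ln 2), and the bracket is at most
    2^(\<epsilon> a).\<close>
  define A where "A = 1 + 1 / (\<epsilon> * ln 2)"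
  have A: "A \<ge> 1" using \<epsilon> by (simp add: A_def)
  obtain P :: nat where P: "real P \<ge> 2 powr (1 / \<epsilon>)" using real_arch_simple by blast
  define F where "F = (\<lambda>n. card {p. p < P \<and> prime p \<and> p dvd (n :: nat)})"
  have small: "real a + 1 \<le> A * (real p powr \<epsilon>) ^ a" if "p \<ge> 2" for a p :: nat
  proof -
    have l2: "ln (2 :: real) > 0" by simp
    have "real a + 1 \<le> A * (1 + real a * (\<epsilon> * ln 2))"
      using \<epsilon> l2 by (simp add: A_def field_simps)
    also have "1 + real a * (\<epsilon> * ln 2) \<le> exp (real a * (\<epsilon> * ln 2))" by (rule exp_ge_add_one_self)
    also have "\<dots> = (2 powr \<epsilon>) ^ a" by (simp add: powr_def exp_of_nat_mult)
    also have "\<dots> \<le> (real p powr \<epsilon>) ^ a" using that \<epsilon> by (intro power_mono powr_mono2) auto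
    finally show ?thesis using A by simp
  qed
  have large: "real a + 1 \<le> (real p powr \<epsilon>) ^ a" if "p \<ge> P" for a p :: nat
  proof -
    have "2 = (2 powr (1 / \<epsilon>)) powr \<epsilon>" using \<epsilon> by (simp add: powr_powr)
    also have "\<dots> \<le> real p powr \<epsilon>" using P that \<epsilon> by (intro powr_mono2) auto
    finally have "2 ^ a \<le> (real p powr \<epsilon>) ^ a" by (intro power_mono) auto
    moreover have "real (a + 1) \<le> real (2 ^ a)"
      using less_exp[of a] by (simp only: of_nat_le_iff Suc_eq_plus1[symmetric] Suc_le_eq)
    ultimately show ?thesis by simp
  qed
  have main: "n \<ge> 1 \<Longrightarrow> real (card {d. d dvd n}) \<le> A ^ F n * real n powr \<epsilon>" for n
  proof (induction n rule: less_induct)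
    case (less n)
    show ?case
    proof (cases "n = 1")
      case True
      have "1 \<le> A ^ F 1" using A by simp
      then show ?thesis using True by simp
    next
      case False
      then obtain p where p: "prime p" "p dvd n" using prime_factor_nat by blast
      define a where "a = multiplicity p n"
      obtain m where m: "n = p ^ a * m" "\<not> p dvd m"
        using multiplicity_decompose'[of n p] p less.prems not_prime_1 unfolding a_def by (metis nat_dvd_1_iff_1 not_one_le_zero)
      have a: "a \<ge> 1" using m p by (cases a) auto
      have m1: "m \<ge> 1" using m less.prems by (cases m) auto
      have p2: "p \<ge> 2" using p prime_ge_2_nat by auto
      have "p ^ a \<ge> 2" using p2 a self_le_power[of p a] by simp
      then have "m < n" using m m1 by simp
      then have IH: "real (card {d. d dvd m}) \<le> A ^ F m * real m powr \<epsilon>" using less.IH m1 by blast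
      have Fm: "F n \<ge> F m + (if p < P then 1 else 0)"
      proof -
        let ?A = "\<lambda>n. {q. q < P \<and> prime q \<and> q dvd n}"
        have fin: "finite (?A n)" for n by (rule finite_subset[of _ "{..<P}"]) auto
        have sub: "?A m \<subseteq> ?A n" using m(1) by auto
        show ?thesis
        proof (cases "p < P")
          case True
          have "insert p (?A m) \<subseteq> ?A n" using sub True p by auto
          then have "card (insert p (?A m)) \<le> card (?A n)" using fin by (intro card_mono)
          then show ?thesis using True m(2) fin[of m] by (simp add: F_def)
        next
          case False
          then show ?thesis using card_mono[OF fin sub] by (simp add: F_def)
        qed
      qed
      have ap: "real a + 1 \<le> A ^ (if p < P then 1 else 0) * (real p powr \<epsilon>) ^ a"
        using small[OF p2, of a] large[of p a] by auto
      have "real (card {d. d dvd n}) \<le> (real a + 1) * real (card {d. d dvd m})"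
      proof -
        have "card {d. d dvd n} \<le> (a + 1) * card {d. d dvd m}"
          using card_divisors_prime_power_mult[OF p(1), of m a] m1 by (simp add: m(1)[symmetric])
        then have "real (card {d. d dvd n}) \<le> real ((a + 1) * card {d. d dvd m})"
          by (simp only: of_nat_le_iff)
        then show ?thesis by (simp add: algebra_simps)
      qed
      also have "\<dots> \<le> (A ^ (if p < P then 1 else 0) * (real p powr \<epsilon>) ^ a) * (A ^ F m * real m powr \<epsilon>)"
        using ap IH A by (intro mult_mono) auto
      also have "\<dots> = A ^ (F m + (if p < P then 1 else 0)) * ((real p powr \<epsilon>) ^ a * real m powr \<epsilon>)"
        by (simp add: power_add)
      also have "(real p powr \<epsilon>) ^ a * real m powr \<epsilon> = real n powr \<epsilon>"
      proof -
        have "(real p powr \<epsilon>) ^ a = (real p ^ a) powr \<epsilon>"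
          by (induction a) (auto simp: powr_mult)
        then show ?thesis by (simp add: m(1) powr_mult)
      qed
      also have "A ^ (F m + (if p < P then 1 else 0)) * real n powr \<epsilon> \<le> A ^ F n * real n powr \<epsilon>"
        using A Fm by (intro mult_right_mono power_increasing) auto
      finally show ?thesis .
    qed
  qed
  have FP: "F n \<le> P" for n
  proof -
    have "F n \<le> card {..<P}" unfolding F_def by (intro card_mono) auto
    then show ?thesis by simp
  qed
  show ?thesis
  proof (rule that[of "A ^ P"])
    show "real (card {d. d dvd n}) \<le> A ^ P * real n powr \<epsilon>" if "n \<ge> 1" for n :: nat
    proof -
      have "A ^ F n * real n powr \<epsilon> \<le> A ^ P * real n powr \<epsilon>"
        using A FP by (intro mult_right_mono power_increasing) auto
      then show ?thesis using main[OF that] by linarith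
    qed
  qed (use A in simp)
qed

text \<open>A value t = w z is attained at most once for each divisor w of t.\<close>

lemma sum_products_le:
  fixes F :: "nat \<Rightarrow> real"
  assumes F: "\<And>t. 0 \<le> F t" and D: "\<And>t. t \<in> {1..N * M} \<Longrightarrow> real (card {d. d dvd t}) \<le> D"
  shows "(\<Sum>w\<in>{1..<N}. \<Sum>z\<in>{1..<M}. F (w * z)) \<le> D * (\<Sum>t\<in>{1..N * M}. F t)"
proof -
  define S where "S = {1..<N} \<times> {1..<M}"
  have img: "(\<lambda>(w, z). w * z) ` S \<subseteq> {1..N * M}"
    by (auto simp: S_def intro!: mult_le_mono)
  have "(\<Sum>w\<in>{1..<N}. \<Sum>z\<in>{1..<M}. F (w * z)) = (\<Sum>x\<in>S. F (case x of (w, z) \<Rightarrow> w * z))"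
    by (simp add: S_def sum.cartesian_product case_prod_unfold)
  also have "\<dots> = (\<Sum>t\<in>{1..N * M}. \<Sum>x\<in>{x \<in> S. (case x of (w, z) \<Rightarrow> w * z) = t}. F (case x of (w, z) \<Rightarrow> w * z))"
    by (rule sum.group[symmetric]) (use img in \<open>auto simp: S_def\<close>)
  also have "\<dots> = (\<Sum>t\<in>{1..N * M}. real (card {x \<in> S. (case x of (w, z) \<Rightarrow> w * z) = t}) * F t)"
    by (intro sum.cong refl) simp
  also have "\<dots> \<le> (\<Sum>t\<in>{1..N * M}. D * F t)"
  proof (intro sum_mono mult_right_mono F)
    fix t assume t: "t \<in> {1..N * M}"
    have "card {x \<in> S. (case x of (w, z) \<Rightarrow> w * z) = t} \<le> card {d. d dvd t}"
    proof (rule card_inj_on_le[of fst])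
      show "inj_on fst {x \<in> S. (case x of (w, z) \<Rightarrow> w * z) = t}"
        using t by (auto simp: inj_on_def S_def)
    qed (use t in auto)
    then show "real (card {x \<in> S. (case x of (w, z) \<Rightarrow> w * z) = t}) \<le> D" using D[OF t] by linarith
  qed
  also have "\<dots> = D * (\<Sum>t\<in>{1..N * M}. F t)" by (simp add: sum_distrib_left)
  finally show ?thesis .
qed

section \<open>Large sieve and Weyl sums\<close>

text \<open>Pair the sums with their own conjugates, apply Cauchy--Schwarz in g and bound the Gram
  matrix by its row sums (Schur's test); then one factor S cancels. Row sums stand in for a minimal
  spacing, which the points arising here need not have.\<close>

lemma large_sieve_dual:
  fixes \<phi> :: "'y \<Rightarrow> real" and A :: "int \<Rightarrow> complex"
  assumes Y: "finite Y" "Y \<noteq> {}"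
    and \<Delta>: "\<And>y. y \<in> Y \<Longrightarrow> (\<Sum>y'\<in>Y. capped (2 * real B + 1) (\<phi> y - \<phi> y')) \<le> \<Delta>"
  shows "(\<Sum>y\<in>Y. cmod (\<Sum>g\<in>{- int B..int B}. A g * unit_exp (of_int g * \<phi> y)) ^ 2)
    \<le> \<Delta> * (\<Sum>g\<in>{- int B..int B}. cmod (A g) ^ 2)"
proof -
  define I where "I = {- int B..int B}"
  have I: "finite I" by (simp add: I_def)
  define U where "U = (\<lambda>y. \<Sum>g\<in>I. A g * unit_exp (of_int g * \<phi> y))"
  define V where "V = (\<lambda>g. \<Sum>y\<in>Y. unit_exp (of_int g * \<phi> y) * cnj (U y))"
  define S where "S = (\<Sum>y\<in>Y. cmod (U y) ^ 2)"
  define c where "c = (\<lambda>y y'. capped (2 * real B + 1) (\<phi> y - \<phi> y'))"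
  have c: "c y y' \<ge> 0" for y y' by (auto simp: c_def intro!: capped_nonneg)
  have c_sym: "c y y' = c y' y" for y y'
    using dist_minus[of "\<phi> y - \<phi> y'"] by (simp add: c_def capped_def)
  have S0: "S \<ge> 0" by (auto simp: S_def intro!: sum_nonneg)
  have "complex_of_real S = (\<Sum>y\<in>Y. U y * cnj (U y))"
    by (simp only: S_def of_real_sum complex_norm_square)
  also have "\<dots> = (\<Sum>y\<in>Y. \<Sum>g\<in>I. A g * (unit_exp (of_int g * \<phi> y) * cnj (U y)))"
    by (subst U_def) (simp add: sum_distrib_right mult.assoc)
  also have "\<dots> = (\<Sum>g\<in>I. A g * V g)"
    unfolding V_def sum_distrib_left by (rule sum.swap)
  finally have "S = cmod (\<Sum>g\<in>I. A g * V g)" using S0 by (metis abs_of_nonneg norm_of_real)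
  also have "\<dots> \<le> (\<Sum>g\<in>I. cmod (A g) * cmod (V g))"
    by (rule order_trans[OF norm_sum]) (simp add: norm_mult)
  finally have "S ^ 2 \<le> (\<Sum>g\<in>I. cmod (A g) * cmod (V g)) ^ 2" using S0 by (intro power_mono) auto
  also have "\<dots> \<le> (\<Sum>g\<in>I. cmod (A g) ^ 2) * (\<Sum>g\<in>I. cmod (V g) ^ 2)"
    by (rule Cauchy_Schwarz_ineq_sum)
  also have "(\<Sum>g\<in>I. cmod (V g) ^ 2) \<le> \<Delta> * S"
  proof -
    have "complex_of_real (\<Sum>g\<in>I. cmod (V g) ^ 2)
      = (\<Sum>g\<in>I. \<Sum>y\<in>Y. \<Sum>y'\<in>Y. cnj (U y) * U y' * unit_exp (of_int g * (\<phi> y - \<phi> y')))"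
      unfolding of_real_sum
    proof (rule sum.cong[OF refl])
      fix g
      show "complex_of_real (cmod (V g) ^ 2) = (\<Sum>y\<in>Y. \<Sum>y'\<in>Y. cnj (U y) * U y' * unit_exp (of_int g * (\<phi> y - \<phi> y')))"
        unfolding V_def norm_square_sum
        by (intro sum.cong refl)
           (simp add: right_diff_distrib diff_conv_add_uminus[of "_ * _"] unit_exp_add unit_exp_minus mult_ac del: add_uminus_conv_diff)
    qed
    also have "\<dots> = (\<Sum>y\<in>Y. \<Sum>g\<in>I. \<Sum>y'\<in>Y. cnj (U y) * U y' * unit_exp (of_int g * (\<phi> y - \<phi> y')))"
      by (rule sum.swap)
    also have "\<dots> = (\<Sum>y\<in>Y. \<Sum>y'\<in>Y. cnj (U y) * U y' * (\<Sum>g\<in>I. unit_exp (of_int g * (\<phi> y - \<phi> y'))))"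
      unfolding sum_distrib_left by (rule sum.cong[OF refl], rule sum.swap)
    finally have eq: "complex_of_real (\<Sum>g\<in>I. cmod (V g) ^ 2) = \<dots>" .
    have "(\<Sum>g\<in>I. cmod (V g) ^ 2) = cmod (complex_of_real (\<Sum>g\<in>I. cmod (V g) ^ 2))"
      unfolding norm_of_real by (intro abs_of_nonneg[symmetric] sum_nonneg) auto
    also have "\<dots> \<le> (\<Sum>y\<in>Y. \<Sum>y'\<in>Y. cmod (cnj (U y) * U y' * (\<Sum>g\<in>I. unit_exp (of_int g * (\<phi> y - \<phi> y')))))"
      unfolding eq by (rule order_trans[OF norm_sum]) (intro sum_mono norm_sum)
    also have "\<dots> \<le> (\<Sum>y\<in>Y. \<Sum>y'\<in>Y. cmod (U y) * cmod (U y') * c y y')"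
      unfolding norm_mult complex_mod_cnj I_def c_def
      using norm_geometric_capped[of "\<phi> _ - \<phi> _" B] by (intro sum_mono mult_left_mono) (auto simp: add.commute)
    also have "\<dots> \<le> (\<Sum>y\<in>Y. \<Sum>y'\<in>Y. (cmod (U y) ^ 2 / 2) * c y y' + (cmod (U y') ^ 2 / 2) * c y y')"
    proof (intro sum_mono)
      fix y y'
      have "cmod (U y) * cmod (U y') \<le> cmod (U y) ^ 2 / 2 + cmod (U y') ^ 2 / 2"
        using sum_squares_bound[of "cmod (U y)" "cmod (U y')"] by simp
      then show "cmod (U y) * cmod (U y') * c y y' \<le> (cmod (U y) ^ 2 / 2) * c y y' + (cmod (U y') ^ 2 / 2) * c y y'"
        using mult_right_mono[OF _ c[of y y']] by (metis distrib_right)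
    qed
    also have "\<dots> = (\<Sum>y\<in>Y. (cmod (U y) ^ 2 / 2) * (\<Sum>y'\<in>Y. c y y')) + (\<Sum>y\<in>Y. \<Sum>y'\<in>Y. (cmod (U y') ^ 2 / 2) * c y y')"
      by (simp only: sum.distrib sum_distrib_left)
    also have "(\<Sum>y\<in>Y. \<Sum>y'\<in>Y. (cmod (U y') ^ 2 / 2) * c y y') = (\<Sum>y\<in>Y. (cmod (U y) ^ 2 / 2) * (\<Sum>y'\<in>Y. c y y'))"
      unfolding sum_distrib_left by (subst sum.swap) (simp add: c_sym)
    also have "(\<Sum>y\<in>Y. (cmod (U y) ^ 2 / 2) * (\<Sum>y'\<in>Y. c y y')) + (\<Sum>y\<in>Y. (cmod (U y) ^ 2 / 2) * (\<Sum>y'\<in>Y. c y y'))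
       \<le> (\<Sum>y\<in>Y. (cmod (U y) ^ 2 / 2) * \<Delta>) + (\<Sum>y\<in>Y. (cmod (U y) ^ 2 / 2) * \<Delta>)"
      using \<Delta> unfolding c_def by (intro add_mono sum_mono mult_left_mono) auto
    also have "\<dots> = \<Delta> * S" by (simp add: S_def sum_distrib_left mult.commute flip: sum.distrib)
    finally show ?thesis .
  qed
  finally have main: "S ^ 2 \<le> (\<Sum>g\<in>I. cmod (A g) ^ 2) * (\<Delta> * S)"
    by (simp add: mult_left_mono sum_nonneg)
  show ?thesis
  proof (cases "S = 0")
    case True
    obtain y where y: "y \<in> Y" using Y by blast
    have "0 \<le> (\<Sum>y'\<in>Y. capped (2 * real B + 1) (\<phi> y - \<phi> y'))" by (intro sum_nonneg capped_nonneg) auto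
    then have "0 \<le> \<Delta>" using \<Delta>[OF y] by linarith
    then have "0 \<le> \<Delta> * (\<Sum>g\<in>I. cmod (A g) ^ 2)" by (intro mult_nonneg_nonneg sum_nonneg) auto
    then show ?thesis using True by (simp add: S_def U_def I_def)
  next
    case False
    then have "S > 0" using S0 by simp
    then have "S \<le> \<Delta> * (\<Sum>g\<in>I. cmod (A g) ^ 2)"
      using main by (simp add: power2_eq_square mult_ac)
    then show ?thesis by (simp add: S_def U_def I_def)
  qed
qed

text \<open>Within a group of equal \<open>G u\<close> the phase \<psi> factors out and the sieve
  sees \<open>R u\<close> only. Cauchy--Schwarz costs the number of groups, and the square norm of
  the collected coefficients is at most the number of pairs agreeing in both G and R.\<close>

lemma grouped_large_sieve:
  fixes \<phi> :: "'y \<Rightarrow> real" and b :: "'u \<Rightarrow> complex" and G :: "'u \<Rightarrow> 'h" and R :: "'u \<Rightarrow> int"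
  assumes Y: "finite Y" "Y \<noteq> {}" and U: "finite U" and b: "\<And>u. u \<in> U \<Longrightarrow> cmod (b u) \<le> 1"
    and R: "\<And>u. u \<in> U \<Longrightarrow> \<bar>R u\<bar> \<le> int B"
    and \<Delta>: "\<And>y. y \<in> Y \<Longrightarrow> (\<Sum>y'\<in>Y. capped (2 * real B + 1) (\<phi> y - \<phi> y')) \<le> \<Delta>"
  shows "(\<Sum>y\<in>Y. cmod (\<Sum>u\<in>U. b u * unit_exp (\<psi> y (G u) + of_int (R u) * \<phi> y)) ^ 2)
    \<le> real (card (G ` U)) * \<Delta> * real (card {(u, v) \<in> U \<times> U. G u = G v \<and> R u = R v})"
proof -
  define I where "I = {- int B..int B}"
  define T where "T = G ` U"
  have T: "finite T" using U by (simp add: T_def)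
  define F where "F = (\<lambda>\<eta> g. {u \<in> U. (G u, R u) = (\<eta>, g)})"
  define A where "A = (\<lambda>\<eta> g. \<Sum>u\<in>F \<eta> g. b u)"
  have \<Delta>0: "\<Delta> \<ge> 0"
  proof -
    obtain y where y: "y \<in> Y" using Y by blast
    have "0 \<le> (\<Sum>y'\<in>Y. capped (2 * real B + 1) (\<phi> y - \<phi> y'))" by (intro sum_nonneg capped_nonneg) auto
    then show ?thesis using \<Delta>[OF y] by linarith
  qed
  have group: "(\<Sum>u\<in>U. h u) = (\<Sum>\<eta>\<in>T. \<Sum>g\<in>I. \<Sum>u\<in>F \<eta> g. h u)" for h :: "'u \<Rightarrow> 'z :: comm_monoid_add"
  proof -
    have "(\<Sum>u\<in>U. h u) = (\<Sum>x\<in>T \<times> I. sum h {u \<in> U. (G u, R u) = x})"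
      by (rule sum.group[symmetric]) (use U T R in \<open>auto simp: T_def I_def abs_le_iff minus_le_iff[of "R _"]\<close>)
    then show ?thesis by (simp add: sum.cartesian_product F_def case_prod_unfold prod_eq_iff)
  qed
  define E where "E = (\<lambda>y \<eta>. \<Sum>g\<in>I. A \<eta> g * unit_exp (of_int g * \<phi> y))"
  have "cmod (\<Sum>u\<in>U. b u * unit_exp (\<psi> y (G u) + of_int (R u) * \<phi> y)) ^ 2
      \<le> real (card T) * (\<Sum>\<eta>\<in>T. cmod (E y \<eta>) ^ 2)" for y
  proof -
    have "(\<Sum>u\<in>U. b u * unit_exp (\<psi> y (G u) + of_int (R u) * \<phi> y)) = (\<Sum>\<eta>\<in>T. unit_exp (\<psi> y \<eta>) * E y \<eta>)"
      unfolding group E_def A_def sum_distrib_left sum_distrib_right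
      by (intro sum.cong refl) (auto simp: F_def unit_exp_add)
    then have "cmod (\<Sum>u\<in>U. b u * unit_exp (\<psi> y (G u) + of_int (R u) * \<phi> y)) \<le> (\<Sum>\<eta>\<in>T. cmod (E y \<eta>))"
      by (simp add: order_trans[OF norm_sum] norm_mult)
    then have "cmod (\<Sum>u\<in>U. b u * unit_exp (\<psi> y (G u) + of_int (R u) * \<phi> y)) ^ 2 \<le> (\<Sum>\<eta>\<in>T. cmod (E y \<eta>)) ^ 2"
      by (intro power_mono) auto
    also have "\<dots> \<le> real (card T) * (\<Sum>\<eta>\<in>T. cmod (E y \<eta>) ^ 2)"
      using sum_squared_le_sum_of_squares[of "\<lambda>\<eta>. cmod (E y \<eta>)" T] by (simp add: mult.commute)
    finally show ?thesis .
  qed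
  then have "(\<Sum>y\<in>Y. cmod (\<Sum>u\<in>U. b u * unit_exp (\<psi> y (G u) + of_int (R u) * \<phi> y)) ^ 2)
     \<le> (\<Sum>y\<in>Y. real (card T) * (\<Sum>\<eta>\<in>T. cmod (E y \<eta>) ^ 2))"
    by (intro sum_mono)
  also have "\<dots> = real (card T) * (\<Sum>\<eta>\<in>T. \<Sum>y\<in>Y. cmod (E y \<eta>) ^ 2)"
    by (subst sum.swap) (simp add: sum_distrib_left)
  also have "\<dots> \<le> real (card T) * (\<Sum>\<eta>\<in>T. \<Delta> * (\<Sum>g\<in>I. cmod (A \<eta> g) ^ 2))"
    unfolding E_def I_def by (intro mult_left_mono sum_mono large_sieve_dual Y \<Delta>) auto
  also have "\<dots> \<le> real (card T) * (\<Sum>\<eta>\<in>T. \<Delta> * (\<Sum>g\<in>I. \<Sum>u\<in>F \<eta> g. real (card (F \<eta> g))))"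
  proof (intro mult_left_mono sum_mono \<Delta>0)
    fix \<eta> g
    have "cmod (A \<eta> g) \<le> (\<Sum>u\<in>F \<eta> g. 1)"
      unfolding A_def using b by (intro order_trans[OF norm_sum] sum_mono) (auto simp: F_def)
    then have "cmod (A \<eta> g) ^ 2 \<le> real (card (F \<eta> g)) ^ 2" by (intro power_mono) auto
    then show "cmod (A \<eta> g) ^ 2 \<le> (\<Sum>u\<in>F \<eta> g. real (card (F \<eta> g)))" by (simp add: power2_eq_square)
  qed auto
  also have "\<dots> = real (card T) * \<Delta> * (\<Sum>\<eta>\<in>T. \<Sum>g\<in>I. \<Sum>u\<in>F \<eta> g. real (card (F (G u) (R u))))"
    by (simp add: sum_distrib_left[symmetric] mult.assoc F_def cong: sum.cong) (auto simp: F_def intro!: sum.cong)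
  also have "(\<Sum>\<eta>\<in>T. \<Sum>g\<in>I. \<Sum>u\<in>F \<eta> g. real (card (F (G u) (R u)))) = (\<Sum>u\<in>U. real (card (F (G u) (R u))))"
    by (rule group[symmetric])
  also have "\<dots> = real (card (Sigma U (\<lambda>u. F (G u) (R u))))"
    using U by (subst card_SigmaI) (auto simp: F_def)
  also have "Sigma U (\<lambda>u. F (G u) (R u)) = {(u, v) \<in> U \<times> U. G u = G v \<and> R u = R v}"
    by (auto simp: F_def)
  finally show ?thesis by (simp add: T_def)
qed

section \<open>Mean values of Weyl sums over shifts\<close>

lemma weyl_mean_value:
  fixes \<Phi> :: "real poly"
  assumes k: "k \<ge> 2" and deg: "degree \<Phi> \<le> k" and M: "M \<ge> 1" and s: "s \<ge> 1"
    and \<Delta>: "\<And>y. y < M \<Longrightarrow> (\<Sum>y'<M. capped (2 * real (s * M ^ (k - 1)) + 1) (real k * coeff \<Phi> k * (real y - real y'))) \<le> \<Delta>"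
  shows "(\<Sum>y<M. cmod (\<Sum>x\<in>{- int M..<int M}. unit_exp (poly \<Phi> (of_int x + real y))) ^ (2 * s))
    \<le> real (3 * s) ^ (k - 2) * real M ^ tri (k - 2) * \<Delta> * real (card (vinogradov_pairs s (k - 1) {- int M..<int M}))"
proof -
  define l where "l = k - 1"
  have l: "l \<ge> 1" "k = Suc l" using k by (auto simp: l_def)
  define X where "X = {- int M..<int M}"
  define U where "U = PiE {..<s} (\<lambda>_. X)"
  have U: "finite U" unfolding U_def X_def by (intro finite_PiE) auto
  define c where "c = (\<lambda>(y :: nat) j. coeff (pcompose \<Phi> [:real y, 1:]) j)"
  define S where "S = (\<lambda>j (u :: nat \<Rightarrow> int). \<Sum>i<s. u i ^ j)"
  define G where "G = (\<lambda>u. restrict (\<lambda>j. S j u) {..<l})"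
  have S_bound: "\<bar>S j u\<bar> \<le> int (s * M ^ j)" if "u \<in> U" for j u
  proof -
    have "\<bar>S j u\<bar> \<le> (\<Sum>i<s. int M ^ j)"
      unfolding S_def
    proof (rule order_trans[OF sum_abs], intro sum_mono)
      fix i assume "i \<in> {..<s}"
      then have "u i \<in> X" using that by (auto simp: U_def)
      then have "\<bar>u i\<bar> \<le> int M" by (auto simp: X_def)
      then show "\<bar>u i ^ j\<bar> \<le> int M ^ j" unfolding power_abs by (intro power_mono) auto
    qed
    then show ?thesis by simp
  qed
  have poly_eq: "poly \<Phi> (of_int x + real y) = (\<Sum>j\<le>k. c y j * of_int x ^ j)" for x y
  proof -
    have "poly \<Phi> (of_int x + real y) = poly (pcompose \<Phi> [:real y, 1:]) (of_int x)"
      by (simp add: poly_pcompose add.commute)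
    also have "\<dots> = (\<Sum>j\<le>k. c y j * of_int x ^ j)"
      unfolding poly_altdef c_def using deg
      by (intro sum.mono_neutral_left) (auto simp: degree_pcompose coeff_eq_0)
    finally show ?thesis .
  qed
  have comp: "pcompose \<Phi> [:y, 1:] = (\<Sum>i\<le>k. smult (coeff \<Phi> i) ([:y, 1:] ^ i))" for y :: real
  proof -
    have "pcompose \<Phi> [:y, 1:] = pcompose (\<Sum>i\<le>k. monom (coeff \<Phi> i) i) [:y, 1:]"
      using poly_as_sum_of_monoms'[OF deg] by simp
    then show ?thesis by (simp add: pcompose_sum monom_altdef pcompose_smult pcompose_linear_power pcompose_pCons)
  qed
  have high: "coeff ([:y, 1:] ^ i) j = 0" if "i < j" for i j and y :: real
    using that by (intro coeff_eq_0) (simp add: degree_power_eq)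
  \<comment> \<open>The top coefficient is the same for every y, so its phase is a unimodular weight
    on u.\<close>
  have ck: "c y k = coeff \<Phi> k" for y
  proof -
    have "c y k = (\<Sum>i\<le>k. coeff \<Phi> i * coeff ([:real y, 1:] ^ i) k)"
      by (simp add: c_def comp coeff_sum)
    also have "\<dots> = (\<Sum>i\<in>{k}. coeff \<Phi> i * coeff ([:real y, 1:] ^ i) k)"
      by (intro sum.mono_neutral_right) (auto simp: high)
    finally show ?thesis by (simp add: coeff_linear_poly_power)
  qed
  \<comment> \<open>The next coefficient moves linearly in y; its values are the points of the large
    sieve.\<close>
  have cl: "c y l = coeff \<Phi> l + real k * coeff \<Phi> k * real y" for y
  proof -
    have "c y l = (\<Sum>i\<le>k. coeff \<Phi> i * coeff ([:real y, 1:] ^ i) l)"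
      by (simp add: c_def comp coeff_sum)
    also have "\<dots> = (\<Sum>i\<in>{l, k}. coeff \<Phi> i * coeff ([:real y, 1:] ^ i) l)"
      by (intro sum.mono_neutral_right) (auto simp: high l)
    also have "\<dots> = coeff \<Phi> l + real k * coeff \<Phi> k * real y"
      using coeff_linear_poly_power[of l l "real y" 1] coeff_linear_poly_power[of l k "real y" 1] by (simp add: l mult_ac)
    finally show ?thesis .
  qed
  define \<psi> where "\<psi> = (\<lambda>y \<eta>. \<Sum>j<l. c y j * of_int (\<eta> j))"
  have expand: "(\<Sum>x\<in>X. unit_exp (poly \<Phi> (of_int x + real y))) ^ s
    = (\<Sum>u\<in>U. unit_exp (coeff \<Phi> k * of_int (S k u)) * unit_exp (\<psi> y (G u) + of_int (S l u) * c y l))" for y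
  proof -
    have "(\<Sum>x\<in>X. unit_exp (poly \<Phi> (of_int x + real y))) ^ s = (\<Sum>u\<in>U. \<Prod>i<s. unit_exp (poly \<Phi> (of_int (u i) + real y)))"
      unfolding U_def by (rule sum_power_PiE) (simp add: X_def)
    also have "\<dots> = (\<Sum>u\<in>U. unit_exp (coeff \<Phi> k * of_int (S k u)) * unit_exp (\<psi> y (G u) + of_int (S l u) * c y l))"
    proof (intro sum.cong refl)
      fix u
      have "(\<Sum>i<s. poly \<Phi> (of_int (u i) + real y)) = (\<Sum>j\<le>k. c y j * of_int (S j u))"
        unfolding poly_eq S_def of_int_sum of_int_power sum_distrib_left by (rule sum.swap)
      also have "\<dots> = coeff \<Phi> k * of_int (S k u) + ((\<Sum>j<l. c y j * of_int (S j u)) + of_int (S l u) * c y l)"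
        by (simp add: l lessThan_Suc_atMost[symmetric] ck[unfolded l] mult.commute)
      also have "(\<Sum>j<l. c y j * of_int (S j u)) = \<psi> y (G u)"
        by (simp add: \<psi>_def G_def)
      finally show "(\<Prod>i<s. unit_exp (poly \<Phi> (of_int (u i) + real y)))
        = unit_exp (coeff \<Phi> k * of_int (S k u)) * unit_exp (\<psi> y (G u) + of_int (S l u) * c y l)"
        by (simp only: unit_exp_sum[symmetric] finite_lessThan unit_exp_add[symmetric])
    qed
    finally show ?thesis .
  qed
  \<comment> \<open>The power sums of order j = 1, ..., k - 2 take on the order of M^j values and
    the one of order 0 is always s, whence the exponent \<open>tri (k - 2)\<close>.\<close>
  have card_G: "real (card (G ` U)) \<le> real (3 * s) ^ (k - 2) * real M ^ tri (k - 2)"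
  proof -
    have "G ` U \<subseteq> PiE {..<l} (\<lambda>j. if j = 0 then {int s} else {- int (s * M ^ j)..int (s * M ^ j)})"
      using S_bound by (auto simp: G_def S_def abs_le_iff minus_le_iff[of "sum _ _"] split: if_splits)
    then have "card (G ` U) \<le> card (PiE {..<l} (\<lambda>j. if j = 0 then {int s} else {- int (s * M ^ j)..int (s * M ^ j)}))"
      by (intro card_mono finite_PiE) auto
    also have "\<dots> = (\<Prod>j<l. if j = 0 then 1 else 2 * (s * M ^ j) + 1)"
      by (subst card_PiE) (auto intro!: prod.cong simp: nat_add_distrib nat_mult_distrib nat_power_eq)
    also have "\<dots> = (\<Prod>j<l - 1. 2 * (s * M ^ Suc j) + 1)"
    proof -
      obtain n where n: "l = Suc n" using l by (cases l) auto
      show ?thesis unfolding n by (subst prod.lessThan_Suc_shift) (simp del: power_Suc)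
    qed
    also have "\<dots> \<le> (\<Prod>j<l - 1. (3 * s) * M ^ Suc j)"
      using s M by (intro prod_mono) (auto simp: Suc_le_eq)
    also have "\<dots> = (3 * s) ^ (l - 1) * M ^ (\<Sum>j<l - 1. Suc j)"
      by (simp add: prod.distrib power_sum del: power_Suc)
    also have "(\<Sum>j<n. Suc j) = tri n" for n by (induction n) (auto simp: tri_Suc)
    finally have "real (card (G ` U)) \<le> real ((3 * s) ^ (k - 2) * M ^ tri (k - 2))"
      by (simp only: of_nat_le_iff l_def diff_diff_left one_add_one)
    then show ?thesis by simp
  qed
  have D0: "\<Delta> \<ge> 0"
  proof -
    have "0 \<le> (\<Sum>y'<M. capped (2 * real (s * M ^ (k - 1)) + 1) (real k * coeff \<Phi> k * (real 0 - real y')))"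
      by (intro sum_nonneg capped_nonneg) (auto intro: add_nonneg_pos)
    then show ?thesis using \<Delta>[of 0] M by linarith
  qed
  have "(\<Sum>y<M. cmod (\<Sum>x\<in>X. unit_exp (poly \<Phi> (of_int x + real y))) ^ (2 * s))
     = (\<Sum>y<M. cmod (\<Sum>u\<in>U. unit_exp (coeff \<Phi> k * of_int (S k u)) * unit_exp (\<psi> y (G u) + of_int (S l u) * c y l)) ^ 2)"
    unfolding expand[symmetric] by (simp add: norm_power mult.commute flip: power_mult)
  also have "\<dots> \<le> real (card (G ` U)) * \<Delta> * real (card {(u, v) \<in> U \<times> U. G u = G v \<and> S l u = S l v})"
  proof (rule grouped_large_sieve[where B = "s * M ^ (k - 1)"])
    show "(\<Sum>y'<M. capped (2 * real (s * M ^ (k - 1)) + 1) (c y l - c y' l)) \<le> \<Delta>" if "y \<in> {..<M}" for y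
      using \<Delta>[of y] that by (simp add: cl right_diff_distrib)
    show "\<bar>S l u\<bar> \<le> int (s * M ^ (k - 1))" if "u \<in> U" for u
      using S_bound[OF that, of l] by (simp add: l_def)
  qed (use M U in \<open>auto simp: lessThan_empty_iff\<close>)
  also have "\<dots> \<le> (real (3 * s) ^ (k - 2) * real M ^ tri (k - 2)) * \<Delta> * real (card (vinogradov_pairs s l X))"
  proof (intro mult_mono card_G)
    have "{(u, v) \<in> U \<times> U. G u = G v \<and> S l u = S l v} \<subseteq> vinogradov_pairs s l X"
    proof (clarify)
      fix u v assume uv: "u \<in> U" "v \<in> U" "G u = G v" "S l u = S l v"
      have "S j u = S j v" if "j \<in> {1..l}" for j
      proof (cases "j = l")
        case False
        then have "j < l" using that by simp
        then show ?thesis using fun_cong[OF uv(3), of j] by (simp add: G_def)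
      qed (use uv in simp)
      then show "(u, v) \<in> vinogradov_pairs s l X"
        using uv by (auto simp: vinogradov_pairs_def U_def S_def)
    qed
    moreover have "finite (vinogradov_pairs s l X)"
      by (rule finite_subset[of _ "U \<times> U"]) (use U in \<open>auto simp: vinogradov_pairs_def U_def\<close>)
    ultimately show "real (card {(u, v) \<in> U \<times> U. G u = G v \<and> S l u = S l v}) \<le> real (card (vinogradov_pairs s l X))"
      by (simp add: card_mono)
  qed (use D0 in auto)
  finally show ?thesis by (simp add: X_def l_def)
qed

text \<open>A difference of two translates has no term of degree Suc l, and its coefficient of
  degree l is proportional to the difference of the shifts; this is how v - v' gets into the leading
  coefficient.\<close>

lemma coeff_pcompose_shift:
  fixes f :: "real poly"
  assumes "degree f \<le> Suc l"
  shows "coeff (pcompose f [:y, 1:]) (Suc l) = coeff f (Suc l)"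
    "coeff (pcompose f [:y, 1:]) l = coeff f l + real (Suc l) * coeff f (Suc l) * y"
proof -
  let ?k = "Suc l"
  have comp: "pcompose f [:y, 1:] = (\<Sum>i\<le>?k. smult (coeff f i) ([:y, 1:] ^ i))"
  proof -
    have "pcompose f [:y, 1:] = pcompose (\<Sum>i\<le>?k. monom (coeff f i) i) [:y, 1:]"
      using poly_as_sum_of_monoms'[OF assms] by simp
    then show ?thesis
      by (simp add: pcompose_sum monom_altdef pcompose_smult pcompose_linear_power pcompose_pCons pcompose_add pcompose_mult del: sum.atMost_Suc)
  qed
  have high: "coeff ([:y, 1:] ^ i) j = 0" if "i < j" for i j
    using that by (intro coeff_eq_0) (simp add: degree_power_eq)
  have "coeff (pcompose f [:y, 1:]) ?k = (\<Sum>i\<in>{?k}. coeff f i * coeff ([:y, 1:] ^ i) ?k)"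
    unfolding comp coeff_sum coeff_smult by (intro sum.mono_neutral_right) (auto simp: high)
  then show "coeff (pcompose f [:y, 1:]) ?k = coeff f ?k"
    using coeff_linear_poly_power[of ?k ?k y 1] by simp
  have "coeff (pcompose f [:y, 1:]) l = (\<Sum>i\<in>{l, ?k}. coeff f i * coeff ([:y, 1:] ^ i) l)"
    unfolding comp coeff_sum coeff_smult by (intro sum.mono_neutral_right) (auto simp: high)
  also have "\<dots> = coeff f l + real ?k * coeff f ?k * y"
    using coeff_linear_poly_power[of l l y 1] coeff_linear_poly_power[of l ?k y 1] by (simp add: mult_ac del: power_Suc)
  finally show "coeff (pcompose f [:y, 1:]) l = coeff f l + real ?k * coeff f ?k * y" .
qed

text \<open>For every \<open>y < M\<close>, each \<open>u < M\<close> is \<open>x + y\<close> for some \<open>x \<in> [-M, M)\<close>, so averaging over \<open>y\<close> costs nothing and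
  no cut-off function is needed.\<close>

lemma cauchy_step:
  fixes F :: "real \<Rightarrow> real" and M :: nat
  assumes M: "M \<ge> 1" and U: "U \<subseteq> {..<M}" and V: "finite V"
  shows "cmod (\<Sum>u\<in>U. \<Sum>v\<in>V. unit_exp (F (real u + g v))) ^ 2
    \<le> real (card U) * (\<Sum>v\<in>V. \<Sum>v'\<in>V. cmod (\<Sum>y<M. \<Sum>x\<in>{- int M..<int M}.
        unit_exp (F (of_int x + real y + g v) - F (of_int x + real y + g v'))) / real M)"
proof -
  define X where "X = {- int M..<int M}"
  define A where "A = (\<lambda>t. cmod (\<Sum>v\<in>V. unit_exp (F (t + g v))) ^ 2)"
  have finU: "finite U" using U finite_subset by blast
  have A0: "A t \<ge> 0" for t by (simp add: A_def)
  have A_exp: "complex_of_real (A t) = (\<Sum>v\<in>V. \<Sum>v'\<in>V. unit_exp (F (t + g v) - F (t + g v')))" for t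
    unfolding A_def norm_square_sum diff_conv_add_uminus unit_exp_add unit_exp_minus ..
  \<comment> \<open>The shifted copy of U lies in [-M, M), and nonnegativity of A allows enlarging
    it to the whole interval.\<close>
  have shift: "(\<Sum>u\<in>U. A (real u)) \<le> (\<Sum>x\<in>X. A (of_int x + real y))" if y: "y < M" for y
  proof -
    have "(\<Sum>u\<in>U. A (real u)) = (\<Sum>x\<in>(\<lambda>u. int u - int y) ` U. A (of_int x + real y))"
      by (subst sum.reindex) (auto simp: inj_on_def)
    also have "\<dots> \<le> (\<Sum>x\<in>X. A (of_int x + real y))"
      using U y by (intro sum_mono2 A0) (auto simp: X_def)
    finally show ?thesis .
  qed
  have "real M * (\<Sum>u\<in>U. A (real u)) = (\<Sum>y<M. \<Sum>u\<in>U. A (real u))" by simp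
  also have "\<dots> \<le> (\<Sum>y<M. \<Sum>x\<in>X. A (of_int x + real y))"
    using shift by (intro sum_mono) auto
  finally have le: "(\<Sum>u\<in>U. A (real u)) \<le> (\<Sum>y<M. \<Sum>x\<in>X. A (of_int x + real y)) / real M"
    using M by (simp add: pos_le_divide_eq mult.commute)
  have "complex_of_real (\<Sum>y<M. \<Sum>x\<in>X. A (of_int x + real y))
     = (\<Sum>y<M. \<Sum>x\<in>X. \<Sum>v\<in>V. \<Sum>v'\<in>V. unit_exp (F (of_int x + real y + g v) - F (of_int x + real y + g v')))"
    unfolding of_real_sum A_exp ..
  also have "\<dots> = (\<Sum>v\<in>V. \<Sum>v'\<in>V. \<Sum>y<M. \<Sum>x\<in>X. unit_exp (F (of_int x + real y + g v) - F (of_int x + real y + g v')))"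
    (is "(\<Sum>y<M. \<Sum>x\<in>X. \<Sum>v\<in>V. \<Sum>v'\<in>V. ?t y x v v') = _")
  proof -
    have "(\<Sum>y<M. \<Sum>x\<in>X. \<Sum>v\<in>V. \<Sum>v'\<in>V. ?t y x v v') = (\<Sum>y<M. \<Sum>v\<in>V. \<Sum>x\<in>X. \<Sum>v'\<in>V. ?t y x v v')"
      by (rule sum.cong[OF refl], rule sum.swap)
    also have "\<dots> = (\<Sum>v\<in>V. \<Sum>y<M. \<Sum>x\<in>X. \<Sum>v'\<in>V. ?t y x v v')" by (rule sum.swap)
    also have "\<dots> = (\<Sum>v\<in>V. \<Sum>y<M. \<Sum>v'\<in>V. \<Sum>x\<in>X. ?t y x v v')"
      by (rule sum.cong[OF refl], rule sum.cong[OF refl], rule sum.swap)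
    also have "\<dots> = (\<Sum>v\<in>V. \<Sum>v'\<in>V. \<Sum>y<M. \<Sum>x\<in>X. ?t y x v v')"
      by (rule sum.cong[OF refl], rule sum.swap)
    finally show ?thesis .
  qed
  finally have eq: "complex_of_real (\<Sum>y<M. \<Sum>x\<in>X. A (of_int x + real y)) = \<dots>" .
  have "(\<Sum>y<M. \<Sum>x\<in>X. A (of_int x + real y)) = cmod (complex_of_real (\<Sum>y<M. \<Sum>x\<in>X. A (of_int x + real y)))"
    unfolding norm_of_real using A0 by (intro abs_of_nonneg[symmetric] sum_nonneg) auto
  also have "\<dots> \<le> (\<Sum>v\<in>V. \<Sum>v'\<in>V. cmod (\<Sum>y<M. \<Sum>x\<in>X. unit_exp (F (of_int x + real y + g v) - F (of_int x + real y + g v'))))"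
    unfolding eq by (rule order_trans[OF norm_sum]) (intro sum_mono norm_sum)
  finally have le2: "(\<Sum>u\<in>U. A (real u)) \<le> (\<Sum>v\<in>V. \<Sum>v'\<in>V. cmod (\<Sum>y<M. \<Sum>x\<in>X.
      unit_exp (F (of_int x + real y + g v) - F (of_int x + real y + g v'))) / real M)"
    using le M by (simp add: sum_divide_distrib[symmetric]) (meson divide_right_mono of_nat_0_le_iff order_trans)
  have "cmod (\<Sum>u\<in>U. \<Sum>v\<in>V. unit_exp (F (real u + g v))) ^ 2 \<le> (\<Sum>u\<in>U. cmod (\<Sum>v\<in>V. unit_exp (F (real u + g v)))) ^ 2"
    by (intro power_mono norm_sum) auto
  also have "\<dots> \<le> real (card U) * (\<Sum>u\<in>U. A (real u))"
    using sum_squared_le_sum_of_squares[of "\<lambda>u. cmod (\<Sum>v\<in>V. unit_exp (F (real u + g v)))" U]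
    by (simp add: A_def mult.commute)
  also have "\<dots> \<le> real (card U) * (\<Sum>v\<in>V. \<Sum>v'\<in>V. cmod (\<Sum>y<M. \<Sum>x\<in>X.
      unit_exp (F (of_int x + real y + g v) - F (of_int x + real y + g v'))) / real M)"
    using le2 by (intro mult_left_mono) auto
  finally show ?thesis by (simp add: X_def)
qed

lemma capped_minus: "capped H (- x) = capped H x"
  by (simp add: capped_def)

lemma sum_capped_differences:
  assumes H: "H > 0" and y: "y < M"
  shows "(\<Sum>y'<M. capped H (c * (real y - real y'))) \<le> 2 * (H + (\<Sum>z\<in>{1..<M}. capped H (c * real z)))"
proof -
  define E where "E = (\<Sum>z\<in>{1..<M}. capped H (c * real z))"
  have split: "{..<M} = {..<y} \<union> insert y {y<..<M}" using y by auto
  have 1: "(\<Sum>y'<y. capped H (c * (real y - real y'))) \<le> E"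
  proof -
    have "(\<Sum>y'<y. capped H (c * (real y - real y'))) = (\<Sum>z\<in>{1..y}. capped H (c * real z))"
      by (rule sum.reindex_bij_witness[of _ "\<lambda>z. y - z" "\<lambda>z. y - z"]) (auto simp: of_nat_diff)
    also have "\<dots> \<le> E" unfolding E_def using y H by (intro sum_mono2) (auto intro: capped_nonneg)
    finally show ?thesis .
  qed
  have 2: "(\<Sum>y'\<in>{y<..<M}. capped H (c * (real y - real y'))) \<le> E"
  proof -
    have "(\<Sum>y'\<in>{y<..<M}. capped H (c * (real y - real y'))) = (\<Sum>z\<in>{1..<M - y}. capped H (c * real z))"
    proof (rule sum.reindex_bij_witness[of _ "\<lambda>z. y + z" "\<lambda>z. z - y"])
      fix z assume "z \<in> {y<..<M}"
      then have "c * real (z - y) = - (c * (real y - real z))" by (simp add: of_nat_diff algebra_simps)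
      then show "capped H (c * real (z - y)) = capped H (c * (real y - real z))"
        by (simp only: capped_minus)
    qed auto
    also have "\<dots> \<le> E" unfolding E_def using H by (intro sum_mono2) (auto intro: capped_nonneg)
    finally show ?thesis .
  qed
  have "(\<Sum>y'<M. capped H (c * (real y - real y'))) = (\<Sum>y'<y. capped H (c * (real y - real y')))
      + (capped H 0 + (\<Sum>y'\<in>{y<..<M}. capped H (c * (real y - real y'))))"
    unfolding split by (subst sum.union_disjoint) auto
  also have "\<dots> \<le> E + (H + E)" using 1 2 capped_le[OF H, of 0] by (intro add_mono) auto
  also have "\<dots> \<le> 2 * (H + E)" using H by simp
  finally show ?thesis by (simp add: E_def)
qed

lemma power_mean:
  fixes z :: "'i \<Rightarrow> real"
  assumes "finite I" "\<And>i. i \<in> I \<Longrightarrow> 0 \<le> z i" "q \<ge> 1" "real (card I) \<le> N"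
  shows "(\<Sum>i\<in>I. z i) ^ q \<le> N ^ (q - 1) * (\<Sum>i\<in>I. z i ^ q)"
proof -
  have "(\<Sum>i\<in>I. z i) ^ q \<le> (\<Sum>i\<in>I. 1) ^ (q - 1) * (\<Sum>i\<in>I. z i ^ q / 1 ^ (q - 1))"
    using assms by (intro jensen_power) auto
  also have "\<dots> = real (card I) ^ (q - 1) * (\<Sum>i\<in>I. z i ^ q)" by simp
  also have "\<dots> \<le> N ^ (q - 1) * (\<Sum>i\<in>I. z i ^ q)"
    using assms by (intro mult_right_mono power_mono sum_nonneg) auto
  finally show ?thesis .
qed

text \<open>Hoelder over the pairs (v', y) brings in moments of order 2 s. The leading coefficient
  for v' is a multiple of w = |v - v'|, so the sieve sums involve \<beta> w z, and the products w z
  are collected by the divisor bound into one sum over t \<le> N M.\<close>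

lemma weyl_average:
  fixes f :: "real poly"
  assumes k: "k \<ge> 2" and deg: "degree f \<le> Suc k" and M: "M \<ge> 1" and N: "N \<ge> 1" and v: "v < N"
    and D: "\<And>t. t \<in> {1..N * M} \<Longrightarrow> real (card {d. d dvd t}) \<le> D"
  defines "s \<equiv> tri (k - 1)"
  defines "H \<equiv> 2 * real (s * M ^ (k - 1)) + 1"
  shows "(\<Sum>v'\<in>{..<N} - {v}. cmod (\<Sum>y<M. \<Sum>x\<in>{- int M..<int M}.
      unit_exp (c * poly f (of_int x + real y + real M * real v) - c * poly f (of_int x + real y + real M * real v')))) ^ (2 * s)
    \<le> (real N * real M) ^ (2 * s - 1) * (real (3 * s) ^ (k - 2) * real M ^ tri (k - 2) *
        real (card (vinogradov_pairs s (k - 1) {- int M..<int M})) *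
        (4 * (real N * H + D * (\<Sum>t\<in>{1..N * M}. capped H (real k * (c * real (Suc k) * coeff f (Suc k) * real M) * real t)))))"
proof -
  have s: "s \<ge> 1" using tri_pos[of "k - 1"] k by (simp add: s_def)
  have H: "H > 0" by (auto simp: H_def intro: add_nonneg_pos)
  define X where "X = {- int M..<int M}"
  define \<Phi> where "\<Phi> = (\<lambda>v'. smult c (pcompose f [:real M * real v, 1:] - pcompose f [:real M * real v', 1:]))"
  define T where "T = (\<lambda>v' (y :: nat). \<Sum>x\<in>X. unit_exp (poly (\<Phi> v') (of_int x + real y)))"
  have poly_\<Phi>: "poly (\<Phi> v') t = c * poly f (t + real M * real v) - c * poly f (t + real M * real v')" for v' t
    by (simp add: \<Phi>_def poly_pcompose right_diff_distrib add.commute)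
  have deg_\<Phi>: "degree (\<Phi> v') \<le> k" for v'
  proof (rule degree_le, intro allI impI)
    fix i assume i: "k < i"
    show "coeff (\<Phi> v') i = 0"
    proof (cases "i = Suc k")
      case True
      then show ?thesis using coeff_pcompose_shift(1)[OF deg] by (simp add: \<Phi>_def)
    next
      case False
      then have "degree f < i" using i deg by simp
      then show ?thesis by (simp add: \<Phi>_def coeff_eq_0 degree_pcompose)
    qed
  qed
  have lead: "coeff (\<Phi> v') k = (c * real (Suc k) * coeff f (Suc k) * real M) * (real v - real v')" for v'
    by (simp add: \<Phi>_def coeff_pcompose_shift(2)[OF deg] algebra_simps)
  define \<beta> where "\<beta> = real k * (c * real (Suc k) * coeff f (Suc k) * real M)"
  define W where "W = {..<N} - {v}"
  define Ew where "Ew = (\<lambda>w :: nat. \<Sum>z\<in>{1..<M}. capped H (\<beta> * real (w * z)))"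
  define dst where "dst = (\<lambda>v'. if v' < v then v - v' else v' - v)"
  define J where "J = real (card (vinogradov_pairs s (k - 1) X))"
  define A where "A = real (3 * s) ^ (k - 2) * real M ^ tri (k - 2)"
  have A0: "A \<ge> 0" "J \<ge> 0" by (auto simp: A_def J_def)
  have mean: "(\<Sum>y<M. cmod (T v' y) ^ (2 * s)) \<le> A * J * (2 * (H + Ew (dst v')))" for v'
  proof -
    have "(\<Sum>y'<M. capped H (real k * coeff (\<Phi> v') k * (real y - real y'))) \<le> 2 * (H + Ew (dst v'))" if "y < M" for y
    proof -
      have "capped H (real k * coeff (\<Phi> v') k * real z) = capped H (\<beta> * real (dst v' * z))" for z
      proof (cases "v' < v")
        case True
        then show ?thesis by (simp add: lead \<beta>_def dst_def of_nat_diff mult_ac)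
      next
        case False
        then have "real k * coeff (\<Phi> v') k * real z = - (\<beta> * real (dst v' * z))"
          by (simp add: lead \<beta>_def dst_def of_nat_diff algebra_simps)
        then show ?thesis by (simp only: capped_minus)
      qed
      then show ?thesis using sum_capped_differences[OF H that, of "real k * coeff (\<Phi> v') k"] by (simp add: Ew_def)
    qed
    then have "(\<Sum>y<M. cmod (T v' y) ^ (2 * s)) \<le> real (3 * s) ^ (k - 2) * real M ^ tri (k - 2) * (2 * (H + Ew (dst v'))) * J"
      unfolding T_def X_def J_def using weyl_mean_value[OF k deg_\<Phi> M s, of v' "2 * (H + Ew (dst v'))"] by (simp add: H_def)
    then show ?thesis by (simp add: A_def mult_ac)
  qed
  have Ew0: "Ew w \<ge> 0" for w using H by (auto simp: Ew_def intro!: sum_nonneg capped_nonneg)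
  have sum_dst: "(\<Sum>v'\<in>W. H + Ew (dst v')) \<le> 2 * (\<Sum>w\<in>{1..<N}. H + Ew w)"
  proof -
    have W: "W = {..<v} \<union> {v<..<N}" using v by (auto simp: W_def)
    have "(\<Sum>v'<v. H + Ew (dst v')) = (\<Sum>w\<in>{1..v}. H + Ew w)"
      by (rule sum.reindex_bij_witness[of _ "\<lambda>w. v - w" "\<lambda>v'. v - v'"]) (auto simp: dst_def)
    also have "\<dots> \<le> (\<Sum>w\<in>{1..<N}. H + Ew w)"
      using v H Ew0 by (intro sum_mono2) (auto intro: add_nonneg_nonneg less_imp_le)
    finally have 1: "(\<Sum>v'<v. H + Ew (dst v')) \<le> (\<Sum>w\<in>{1..<N}. H + Ew w)" .
    have "(\<Sum>v'\<in>{v<..<N}. H + Ew (dst v')) = (\<Sum>w\<in>{1..<N - v}. H + Ew w)"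
      by (rule sum.reindex_bij_witness[of _ "\<lambda>w. v + w" "\<lambda>v'. v' - v"]) (auto simp: dst_def)
    also have "\<dots> \<le> (\<Sum>w\<in>{1..<N}. H + Ew w)"
      using H Ew0 by (intro sum_mono2) (auto intro: add_nonneg_nonneg less_imp_le)
    finally have 2: "(\<Sum>v'\<in>{v<..<N}. H + Ew (dst v')) \<le> (\<Sum>w\<in>{1..<N}. H + Ew w)" .
    show ?thesis unfolding W using 1 2 by (subst sum.union_disjoint) auto
  qed
  also have "(\<Sum>w\<in>{1..<N}. H + Ew w) \<le> real N * H + D * (\<Sum>t\<in>{1..N * M}. capped H (\<beta> * real t))"
  proof -
    have "(\<Sum>w\<in>{1..<N}. Ew w) \<le> D * (\<Sum>t\<in>{1..N * M}. capped H (\<beta> * real t))"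
      unfolding Ew_def using H by (intro sum_products_le[of "\<lambda>t. capped H (\<beta> * real t)"] D capped_nonneg) auto
    moreover have "(\<Sum>w\<in>{1..<N}. H) \<le> real N * H" using H by (auto intro: mult_right_mono)
    ultimately show ?thesis by (simp add: sum.distrib)
  qed
  finally have dst_le: "(\<Sum>v'\<in>W. H + Ew (dst v')) \<le> 2 * (real N * H + D * (\<Sum>t\<in>{1..N * M}. capped H (\<beta> * real t)))"
    by simp
  have "(\<Sum>v'\<in>W. cmod (\<Sum>y<M. T v' y)) ^ (2 * s) \<le> (\<Sum>(v', y)\<in>W \<times> {..<M}. cmod (T v' y)) ^ (2 * s)"
    unfolding sum.cartesian_product[symmetric]
    by (intro power_mono sum_mono norm_sum sum_nonneg) auto
  also have "\<dots> \<le> (real N * real M) ^ (2 * s - 1) * (\<Sum>(v', y)\<in>W \<times> {..<M}. cmod (T v' y) ^ (2 * s))"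
  proof -
    have "card (W \<times> {..<M}) \<le> card {..<N} * M"
      unfolding card_cartesian_product W_def by (intro mult_le_mono card_mono) auto
    then have "real (card (W \<times> {..<M})) \<le> real N * real M" by (simp flip: of_nat_mult)
    then show ?thesis
      using power_mean[of "W \<times> {..<M}" "\<lambda>(v', y). cmod (T v' y)" "2 * s" "real N * real M"] s
      by (simp add: case_prod_unfold W_def)
  qed
  also have "(\<Sum>(v', y)\<in>W \<times> {..<M}. cmod (T v' y) ^ (2 * s)) = (\<Sum>v'\<in>W. \<Sum>y<M. cmod (T v' y) ^ (2 * s))"
    by (simp add: sum.cartesian_product)
  also have "\<dots> \<le> (\<Sum>v'\<in>W. A * J * (2 * (H + Ew (dst v'))))" by (intro sum_mono mean)
  also have "\<dots> = A * J * (2 * (\<Sum>v'\<in>W. H + Ew (dst v')))" by (simp only: sum_distrib_left)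
  also have "\<dots> \<le> A * J * (4 * (real N * H + D * (\<Sum>t\<in>{1..N * M}. capped H (\<beta> * real t))))"
    using dst_le A0 by (intro mult_left_mono) auto
  finally have "(\<Sum>v'\<in>W. cmod (\<Sum>y<M. T v' y)) ^ (2 * s) \<le> (real N * real M) ^ (2 * s - 1) *
      (A * J * (4 * (real N * H + D * (\<Sum>t\<in>{1..N * M}. capped H (\<beta> * real t)))))"
    by (simp add: mult_left_mono)
  then show ?thesis unfolding T_def poly_\<Phi> W_def X_def A_def J_def \<beta>_def .
qed

section \<open>Bilinear sums\<close>

lemma harm_le_powr:
  assumes "a > 0" "q \<ge> 1"
  shows "harm q \<le> (1 + 1 / a) * real q powr a"
proof -
  have "harm q \<le> 1 + ln (real q)"
    using euler_mascheroni_sequence_decreasing[of 1 q] assms by (simp add: harm_expand)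
  also have "ln (real q) \<le> real q powr a / a"
    using assms by (intro ln_powr_bound) auto
  also have "1 \<le> real q powr a" using assms by (intro ge_one_powr_ge_zero) auto
  finally show ?thesis by (simp add: algebra_simps)
qed

text \<open>With K = k (k - 1) and m close to K r / (K + 1), the first bound on \<omega> says that
  \<omega> K r is at most m up to rounding and \<omega> r at most r - m; the second says that the
  approximating denominators stay small enough. The first binds for k \<ge> 3, the second for k = 2,
  where it reads \<omega> \<le> 1/5.\<close>

definition admissible :: "nat \<Rightarrow> real \<Rightarrow> bool" where
  "admissible k \<omega> \<longleftrightarrow> k \<ge> 2 \<and> 0 < \<omega> \<and> \<omega> * (real (k * (k - 1)) + 1) \<le> 1 \<and>
     \<omega> * (1 + 2 * real (k * (k - 1))) \<le> 1 + (real k - 2) * (real (k * (k - 1)) / (real (k * (k - 1)) + 1))"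

definition splitting :: "nat \<Rightarrow> nat \<Rightarrow> nat \<Rightarrow> nat \<Rightarrow> bool" where
  "splitting k r m n \<longleftrightarrow> m + n = r \<and>
     real m \<le> real (k * (k - 1)) / (real (k * (k - 1)) + 1) * real r \<and>
     real (k * (k - 1)) / (real (k * (k - 1)) + 1) * real r \<le> real m + 1"

context
  fixes k :: nat and \<omega> :: real and r m n :: nat
  assumes adm: "admissible k \<omega>" and spl: "splitting k r m n"
begin

text \<open>Here 2^(\<omega> K r) is the saving X wanted before the root and 2^(\<omega> r) the
  range Y of frequencies. X is at most about M, Y at most N to keep the diagonal small, and the
  bound on Y X^2 handles denominators as large as Y X M.\<close>

lemma splitting_facts:
  defines "K \<equiv> real (k * (k - 1))"
  shows "2 powr (\<omega> * K * r) \<le> 2 * real (2 ^ m)"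
    "2 powr (\<omega> * r) \<le> real (2 ^ n)"
    "2 powr (\<omega> * r) * (2 powr (\<omega> * K * r)) ^ 2 \<le> 2 ^ k * (real (2 ^ n) * real (2 ^ m) ^ (k - 1))"
    "2 powr (\<omega> * r) \<le> 2 powr r" "2 powr (\<omega> * K * r) \<le> 2 powr r"
proof -
  have k: "k \<ge> 2" and \<omega>: "\<omega> > 0" and o1: "\<omega> * (K + 1) \<le> 1"
    and o2: "\<omega> * (1 + 2 * K) \<le> 1 + (real k - 2) * (K / (K + 1))"
    using adm by (auto simp: admissible_def K_def)
  have mn: "m + n = r" and m1: "real m \<le> K / (K + 1) * r" and m2: "K / (K + 1) * r \<le> real m + 1"
    using spl by (auto simp: splitting_def K_def)
  have K: "K \<ge> 2"
  proof -
    have "2 * 1 \<le> k * (k - 1)" using k by (intro mult_le_mono) auto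
    then have "real 2 \<le> real (k * (k - 1))" unfolding of_nat_le_iff by simp
    then show ?thesis unfolding K_def of_nat_numeral .
  qed
  have \<omega>le: "\<omega> \<le> 1 / (K + 1)" using o1 K by (simp add: pos_le_divide_eq)
  have "\<omega> * K \<le> 1 / (K + 1) * K" using \<omega>le K by (intro mult_right_mono) auto
  then have oK: "\<omega> * K \<le> K / (K + 1)" by simp
  have "\<omega> * K * r \<le> K / (K + 1) * r" using oK by (intro mult_right_mono) auto
  then have e1: "\<omega> * K * r \<le> real m + 1" using m2 by linarith
  have "2 powr (\<omega> * K * r) \<le> 2 powr (real m + 1)" using e1 by (intro powr_mono) auto
  also have "\<dots> = 2 * real (2 ^ m)" by (simp add: powr_add powr_realpow)
  finally show "2 powr (\<omega> * K * r) \<le> 2 * real (2 ^ m)" .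
  have "\<omega> * r \<le> 1 / (K + 1) * r" using \<omega>le by (intro mult_right_mono) auto
  also have "\<dots> = r - K / (K + 1) * r" using K by (simp add: field_simps)
  also have "\<dots> \<le> real r - real m" using m1 by simp
  also have "\<dots> = real n" using mn by simp
  finally have "2 powr (\<omega> * r) \<le> 2 powr real n" by (intro powr_mono) auto
  then show "2 powr (\<omega> * r) \<le> real (2 ^ n)" by (simp add: powr_realpow)
  have "2 powr (\<omega> * r) * (2 powr (\<omega> * K * r)) ^ 2 = 2 powr (\<omega> * (1 + 2 * K) * r)"
    by (simp add: power2_eq_square algebra_simps flip: powr_add)
  also have "\<dots> \<le> 2 powr (real r + (real k - 2) * (real m + 1))"
  proof (intro powr_mono)
    have "\<omega> * (1 + 2 * K) * r \<le> (1 + (real k - 2) * (K / (K + 1))) * r"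
      using o2 by (intro mult_right_mono) auto
    also have "\<dots> = r + (real k - 2) * (K / (K + 1) * r)" by (simp only: distrib_right mult_1 mult.assoc)
    also have "\<dots> \<le> r + (real k - 2) * (real m + 1)" using m2 k by (intro add_left_mono mult_left_mono) auto
    finally show "\<omega> * (1 + 2 * K) * r \<le> r + (real k - 2) * (real m + 1)" .
  qed simp
  also have "\<dots> \<le> 2 powr (real k + (real n + (real k - 1) * real m))"
    using mn by (intro powr_mono) (auto simp: algebra_simps)
  also have "\<dots> = 2 ^ k * (real (2 ^ n) * real (2 ^ m) ^ (k - 1))"
    using k by (simp add: powr_add of_nat_diff mult.commute powr_realpow[symmetric] powr_powr)
  finally show "2 powr (\<omega> * r) * (2 powr (\<omega> * K * r)) ^ 2 \<le> 2 ^ k * (real (2 ^ n) * real (2 ^ m) ^ (k - 1))" .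
  have "\<omega> \<le> 1" using \<omega>le K by (smt (verit) divide_le_eq_1_pos)
  then have "\<omega> * r \<le> 1 * real r" by (intro mult_right_mono) auto
  then show "2 powr (\<omega> * r) \<le> 2 powr r" by (intro powr_mono) auto
  have "K / (K + 1) \<le> 1" using K by (simp add: divide_le_eq)
  then have "\<omega> * K * r \<le> 1 * real r" using oK by (intro mult_right_mono) auto
  then show "2 powr (\<omega> * K * r) \<le> 2 powr r" by (intro powr_mono) auto
qed

end

text \<open>All that the Diophantine hypothesis contributes: compared with its trivial size N M^k
  the total is smaller by X = 2^(\<omega> K r), up to 2^(\<epsilon> r). The denominator q of
  \<alpha> B is at most about B X by Dirichlet and at least about X by type one, since a smaller q
  would bring \<alpha> B q too close to an integer.\<close>

lemma capped_total:
  fixes \<alpha> \<epsilon> :: real and s :: nat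
  assumes adm: "admissible k \<omega>" and \<alpha>: "\<alpha> \<notin> \<rat>" "diophantine_type \<alpha> = 1" and \<epsilon>: "\<epsilon> > 0" and s: "s \<ge> 1"
  obtains C D where "C > 0" "\<And>r. \<And>t :: nat. t \<in> {1..2 ^ r} \<Longrightarrow> real (card {d. d dvd t}) \<le> D r"
    "\<And>r m n h. splitting k r m n \<Longrightarrow> 1 \<le> h \<Longrightarrow> real h \<le> 4 * 2 powr (\<omega> * r) \<Longrightarrow>
      real (2 ^ n) * (2 * real (s * (2 ^ m) ^ (k - 1)) + 1) +
      D r * (\<Sum>t\<in>{1..2 ^ n * 2 ^ m}. capped (2 * real (s * (2 ^ m) ^ (k - 1)) + 1)
         (real k * (real h * real (Suc k) * \<alpha> * real (2 ^ m)) * real t))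
      \<le> C * (real (2 ^ n) * real (2 ^ m) ^ k * 2 powr ((\<epsilon> - \<omega> * real (k * (k - 1))) * r))"
proof -
  define K where "K = real (k * (k - 1))"
  have k: "k \<ge> 2" using adm by (simp add: admissible_def)
  \<comment> \<open>Half of \<epsilon> pays for the divisor bound, half for the losses in q and in
    the harmonic number.\<close>
  define \<delta> where "\<delta> = \<epsilon> / 2"
  have \<delta>: "\<delta> > 0" using \<epsilon> by (simp add: \<delta>_def)
  obtain Cd where Cd: "Cd > 0" "\<And>t :: nat. t \<ge> 1 \<Longrightarrow> real (card {d. d dvd t}) \<le> Cd * real t powr \<delta>"
    using divisor_bound[OF \<delta>] by blast
  have \<delta>5: "\<delta> / 5 > 0" using \<delta> by simp
  obtain c0 where c0: "c0 > 0" "\<And>q :: nat. q \<ge> 1 \<Longrightarrow> c0 * real q powr (- (1 + \<delta> / 5)) \<le> dist_nearest_int (\<alpha> * real q)"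
    using type_one_lower_bound[OF \<alpha> \<delta>5] by blast
  define kk where "kk = real (k * Suc k)"
  have kk: "kk \<ge> 1"
  proof -
    have "1 * 1 \<le> k * Suc k" using k by (intro mult_le_mono) auto
    then have "real 1 \<le> real (k * Suc k)" unfolding of_nat_le_iff by simp
    then show ?thesis by (simp add: kk_def)
  qed
  define C5 where "C5 = (32 * kk ^ 2) powr (\<delta> / 5)"
  define C6 where "C6 = (1 + 1 / (\<delta> / 3)) * (8 * kk) powr (\<delta> / 3)"
  define D where "D = (\<lambda>r :: nat. Cd * 2 powr (\<delta> * r))"
  have C5: "C5 > 0" using kk by (simp add: C5_def)
  have C6: "C6 > 0" using kk \<delta> by (auto simp: C6_def intro!: mult_pos_pos add_pos_pos)
  define C7 where "C7 = 4 * (3 * real s * C5 / c0) + 16 * C6 + 12 * real s + 4 * (8 * kk * 2 ^ k * C6)"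
  have C7: "C7 \<ge> 0" unfolding C7_def using C5 C6 c0 kk by (intro add_nonneg_nonneg mult_nonneg_nonneg divide_nonneg_nonneg) auto
  define C where "C = 6 * real s + Cd * C7"
  have C: "C > 0" using s Cd C7 by (auto simp: C_def intro!: add_pos_nonneg)
  show ?thesis
  proof (rule that[OF C, of D])
    fix r t :: nat assume t: "t \<in> {1..2 ^ r}"
    have "real t powr \<delta> \<le> (2 powr r) powr \<delta>"
      using t \<delta> by (intro powr_mono2) (auto simp: powr_realpow simp flip: of_nat_power)
    then have "Cd * real t powr \<delta> \<le> D r" using Cd by (simp add: D_def powr_powr mult.commute)
    then show "real (card {d. d dvd t}) \<le> D r" using Cd(2)[of t] t by auto
  next
    fix r m n h :: nat
    assume spl: "splitting k r m n" and h: "1 \<le> h" "real h \<le> 4 * 2 powr (\<omega> * r)"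
    define M where "M = real (2 ^ m)"
    define N where "N = real (2 ^ n)"
    define E where "E = 2 powr (\<delta> * r)"
    define X where "X = 2 powr (\<omega> * K * r)"
    define Y where "Y = 2 powr (\<omega> * r)"
    define P where "P = 2 powr r"
    note sf = splitting_facts[OF adm spl, folded K_def M_def N_def, folded X_def Y_def P_def]
    have mn: "m + n = r" using spl by (simp add: splitting_def)
    have M: "M \<ge> 1" and N: "N \<ge> 1" by (auto simp: M_def N_def)
    have NM: "N * M = P" using mn by (simp add: M_def N_def P_def powr_realpow mult.commute flip: power_add)
    have E: "E \<ge> 1" using \<delta> by (simp add: E_def ge_one_powr_ge_zero)
    have K0: "K \<ge> 0" by (simp add: K_def)
    have \<omega>: "\<omega> > 0" using adm by (simp add: admissible_def)
    have X: "X \<ge> 1" "Y \<ge> 1" "P \<ge> 1" using \<omega> K0 by (auto simp: X_def Y_def P_def ge_one_powr_ge_zero)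
    have MP: "M \<le> P" using N M mult_right_mono[of 1 N M] by (simp add: NM)
    define B where "B = h * (k * Suc k) * 2 ^ m"
    have B_real: "real B = real h * kk * M" by (simp add: B_def kk_def M_def)
    have "1 * 1 * 1 \<le> h * (k * Suc k) * 2 ^ m" using h k by (intro mult_le_mono) auto
    then have B1: "B \<ge> 1" by (simp add: B_def)
    then have B1r: "real B \<ge> 1" by simp
    have B_le: "real B \<le> 4 * kk * (Y * M)"
    proof -
      have "real h * (kk * M) \<le> (4 * Y) * (kk * M)" using h kk M by (intro mult_right_mono) (auto simp: Y_def)
      then show ?thesis by (simp add: B_real mult_ac)
    qed
    have B_P: "real B \<le> 4 * kk * P ^ 2"
    proof -
      have "Y * M \<le> P * P" using sf(4) MP X M by (intro mult_mono) auto
      then have "4 * kk * (Y * M) \<le> 4 * kk * P ^ 2" using kk by (intro mult_left_mono) (auto simp: power2_eq_square)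
      then show ?thesis using B_le by linarith
    qed
    \<comment> \<open>About B X: large enough to force q up to X, small enough for the term q harm
      q.\<close>
    define Q where "Q = nat \<lceil>real B * X\<rceil>"
    have BX1: "real B * X \<ge> 1" using mult_mono[of 1 "real B" 1 X] B1r X by simp
    have Q: "real B * X \<le> real Q" "real Q \<le> 2 * (real B * X)" "Q \<ge> 1"
    proof -
      have "real Q = of_int \<lceil>real B * X\<rceil>" using BX1 by (simp add: Q_def)
      then show "real B * X \<le> real Q" "real Q \<le> 2 * (real B * X)" using BX1 by linarith+
      then have "real Q \<ge> 1" using BX1 by linarith
      then show "Q \<ge> 1" by simp
    qed
    have Q_P: "real Q \<le> 8 * kk * P ^ 3"
    proof -
      have "real B * X \<le> (4 * kk * P ^ 2) * P" using B_P sf(5) X kk by (intro mult_mono) auto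
      then show ?thesis using Q(2) by (simp add: power3_eq_cube power2_eq_square)
    qed
    obtain q where q: "1 \<le> q" "q \<le> Q" "dist_nearest_int (\<alpha> * real B * real q) < 1 / real Q"
      and sum: "\<And>H T. H > 0 \<Longrightarrow> (\<Sum>t\<in>{1..T}. capped H (\<alpha> * real B * real t)) \<le> (2 * real T / real q + 1) * (2 * H + 4 * real q * harm q)"
      using sum_capped_Dirichlet[OF Q(3), of "\<alpha> * real B"] by blast
    have q_low: "1 / real q \<le> C5 * E / (c0 * X)"
    proof -
      have Bq: "B * q \<ge> 1" using B1 q by (simp add: Suc_le_eq)
      define z where "z = real (B * q)"
      have "real 1 \<le> real (B * q)" using Bq unfolding of_nat_le_iff .
      then have z: "z \<ge> 1" unfolding z_def of_nat_1 .
      have "c0 * z powr (- (1 + \<delta> / 5)) < 1 / real Q"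
        using c0(2)[OF Bq] q(3) by (simp add: z_def mult.assoc)
      also have "\<dots> \<le> 1 / (real B * X)" using Q(1) BX1 by (intro divide_left_mono) auto
      finally have lt: "c0 * z powr (- (1 + \<delta> / 5)) < 1 / (real B * X)" .
      define w where "w = z * z powr (\<delta> / 5)"
      have w: "w > 0" using z by (simp add: w_def)
      have "z powr (- (1 + \<delta> / 5)) = 1 / w"
        unfolding powr_minus_divide powr_add w_def using z by simp
      then have "c0 / w < 1 / (real B * X)" using lt by simp
      then have "c0 < 1 / (real B * X) * w" unfolding pos_divide_less_eq[OF w] .
      then have "c0 < w / (real B * X)" by simp
      moreover have "0 < real B * X" using BX1 by linarith
      ultimately have "c0 * (real B * X) < w" by (simp only: pos_less_divide_eq)
      then have "c0 * (real B * X) < z * z powr (\<delta> / 5)" by (simp only: w_def)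
      also have "z powr (\<delta> / 5) \<le> C5 * E"
      proof -
        \<comment> \<open>B q is at most a constant times P^5; this is where the exponent \<delta> /
          5 comes from.\<close>
        have "z \<le> (4 * kk * P ^ 2) * (8 * kk * P ^ 3)"
          unfolding z_def of_nat_mult using B_P Q_P q(2) kk X by (intro mult_mono) auto
        also have "\<dots> = 32 * kk ^ 2 * P ^ 5" by (simp add: eval_nat_numeral)
        finally have "z powr (\<delta> / 5) \<le> (32 * kk ^ 2 * P ^ 5) powr (\<delta> / 5)" using \<delta> z by (intro powr_mono2) auto
        also have "\<dots> = C5 * (P ^ 5) powr (\<delta> / 5)" using kk X by (simp add: C5_def powr_mult)
        also have "(P ^ 5) powr (\<delta> / 5) = E"
          using X by (simp add: E_def P_def powr_powr mult.commute flip: powr_realpow)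
        finally show ?thesis .
      qed
      finally have "c0 * (real B * X) \<le> z * (C5 * E)" using z by (simp add: mult_left_mono)
      then have "real B * (c0 * X) \<le> real B * (real q * (C5 * E))" by (simp add: z_def mult_ac)
      then have "c0 * X \<le> real q * (C5 * E)" using B1r by simp
      then show ?thesis using q c0 X by (simp add: field_simps)
    qed
    have hq: "harm q \<le> C6 * E"
    proof -
      have "harm q \<le> (1 + 1 / (\<delta> / 3)) * real q powr (\<delta> / 3)" using \<delta> q by (intro harm_le_powr) auto
      also have "real q powr (\<delta> / 3) \<le> (8 * kk * P ^ 3) powr (\<delta> / 3)" using \<delta> q Q_P by (intro powr_mono2) auto
      also have "\<dots> = (8 * kk) powr (\<delta> / 3) * (P ^ 3) powr (\<delta> / 3)" using kk X by (simp add: powr_mult)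
      also have "(P ^ 3) powr (\<delta> / 3) = E"
        using X by (simp add: E_def P_def powr_powr mult.commute flip: powr_realpow)
      finally show ?thesis using \<delta> by (simp add: C6_def mult.assoc mult_left_mono)
    qed
    have hq0: "harm q \<ge> (0 :: real)" by (rule harm_nonneg)
    define H where "H = 2 * real (s * (2 ^ m) ^ (k - 1)) + 1"
    have Mk: "M ^ (k - 1) \<ge> 1" using M by (rule one_le_power)
    have H: "H > 0" "H \<le> 3 * real s * M ^ (k - 1)"
    proof -
      have "1 * 1 \<le> real s * M ^ (k - 1)" using s Mk by (intro mult_mono) auto
      then show "H > 0" "H \<le> 3 * real s * M ^ (k - 1)" by (auto simp: H_def M_def)
    qed
    define G where "G = N * M ^ k / X"
    have G0: "G \<ge> 0" using N M X by (simp add: G_def)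
    have Mkk: "M ^ k = M ^ (k - 1) * M" using k by (cases k) auto
    have NMG: "N * M ^ (k - 1) \<le> 2 * G"
    proof -
      have "X * (N * M ^ (k - 1)) \<le> (2 * M) * (N * M ^ (k - 1))" using sf(1) N M by (intro mult_right_mono) auto
      then show ?thesis using X by (simp add: G_def Mkk pos_le_divide_eq mult_ac)
    qed
    have MG: "M ^ (k - 1) \<le> 2 * G"
    proof -
      have "1 * M ^ (k - 1) \<le> N * M ^ (k - 1)" using N Mk by (intro mult_right_mono) auto
      then show ?thesis using NMG by linarith
    qed
    have PG: "N * M \<le> 2 * G"
    proof -
      have "M ^ 1 \<le> M ^ (k - 1)" using M k by (intro power_increasing) auto
      then have "N * M \<le> N * M ^ (k - 1)" using N by (intro mult_left_mono) auto
      then show ?thesis using NMG by linarith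
    qed
    \<comment> \<open>The second bound in \<open>admissible\<close> enters here: q may be as large
      as a multiple of Y X M, and this has to stay below the target G.\<close>
    have YG: "Y * X * M \<le> 2 ^ k * G"
    proof -
      have "Y * X ^ 2 * M \<le> (2 ^ k * (N * M ^ (k - 1))) * M" using sf(3) M by (intro mult_right_mono) auto
      then show ?thesis using X by (simp add: G_def Mkk pos_le_divide_eq mult_ac power2_eq_square)
    qed
    have t1: "N * M * H * (1 / real q) \<le> (3 * real s * C5 / c0) * (E * G)"
    proof -
      have "N * M * H * (1 / real q) \<le> N * M * (3 * real s * M ^ (k - 1)) * (C5 * E / (c0 * X))"
        using H q_low N M s by (intro mult_mono) auto
      also have "\<dots> = (3 * real s * C5 / c0) * (E * G)" by (simp add: G_def Mkk field_simps)
      finally show ?thesis .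
    qed
    have t2: "N * M * harm q \<le> (2 * C6) * (E * G)"
    proof -
      have "N * M * harm q \<le> (2 * G) * (C6 * E)" by (rule mult_mono[OF PG hq]) (use hq0 G0 in auto)
      then show ?thesis by (simp add: mult_ac)
    qed
    have GE: "G \<le> E * G" using mult_right_mono[OF E G0] by simp
    have t3: "H \<le> (6 * real s) * (E * G)"
    proof -
      have "3 * real s * M ^ (k - 1) \<le> 3 * real s * (2 * (E * G))" using MG GE by (intro mult_left_mono) auto
      also have "\<dots> = (6 * real s) * (E * G)" by simp
      finally show ?thesis using H by linarith
    qed
    have t4: "real q * harm q \<le> (8 * kk * 2 ^ k * C6) * (E * G)"
    proof -
      have "real q \<le> 2 * (real B * X)" using q Q(2) by linarith
      also have "\<dots> \<le> 2 * ((4 * kk * (Y * M)) * X)" using B_le X by (intro mult_left_mono mult_right_mono) auto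
      also have "\<dots> = 8 * kk * (Y * X * M)" by simp
      also have "\<dots> \<le> 8 * kk * (2 ^ k * G)" using YG kk by (intro mult_left_mono) auto
      finally have "real q * harm q \<le> (8 * kk * (2 ^ k * G)) * (C6 * E)" using hq hq0 kk G0 by (intro mult_mono) auto
      then show ?thesis by (simp add: mult_ac)
    qed
    have "(\<Sum>t\<in>{1..2 ^ n * 2 ^ m}. capped H (\<alpha> * real B * real t)) \<le> (2 * real (2 ^ n * 2 ^ m) / real q + 1) * (2 * H + 4 * real q * harm q)"
      by (rule sum[OF H(1)])
    also have "real (2 ^ n * 2 ^ m) = N * M" by (simp add: N_def M_def)
    also have "(2 * (N * M) / real q + 1) * (2 * H + 4 * real q * harm q)
       = 4 * (N * M * H * (1 / real q)) + 8 * (N * M * harm q) + 2 * H + 4 * (real q * harm q)"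
      using q by (simp add: field_simps)
    also have "\<dots> \<le> 4 * ((3 * real s * C5 / c0) * (E * G)) + 8 * ((2 * C6) * (E * G)) + 2 * ((6 * real s) * (E * G)) + 4 * ((8 * kk * 2 ^ k * C6) * (E * G))"
      using t1 t2 t3 t4 by linarith
    also have "\<dots> = C7 * (E * G)" by (simp add: C7_def algebra_simps)
    finally have S: "(\<Sum>t\<in>{1..2 ^ n * 2 ^ m}. capped H (\<alpha> * real B * real t)) \<le> C7 * (E * G)" .
    have "N * H \<le> 6 * real s * (E * (E * G))"
    proof -
      have "N * H \<le> N * (3 * real s * M ^ (k - 1))" using H N by (intro mult_left_mono) auto
      also have "\<dots> = 3 * real s * (N * M ^ (k - 1))" by simp
      also have "\<dots> \<le> 3 * real s * (2 * (E * (E * G)))"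
      proof (intro mult_left_mono)
        have "0 \<le> E * G" using E G0 by simp
        then have "E * G \<le> E * (E * G)" using mult_right_mono[OF E] by fastforce
        then show "N * M ^ (k - 1) \<le> 2 * (E * (E * G))" using NMG GE by linarith
      qed auto
      finally show ?thesis by simp
    qed
    moreover have "D r * (\<Sum>t\<in>{1..2 ^ n * 2 ^ m}. capped H (\<alpha> * real B * real t)) \<le> (Cd * E) * (C7 * (E * G))"
      unfolding D_def E_def[symmetric] using S Cd E by (intro mult_left_mono) auto
    ultimately have "N * H + D r * (\<Sum>t\<in>{1..2 ^ n * 2 ^ m}. capped H (\<alpha> * real B * real t)) \<le> C * (E * (E * G))"
      by (simp add: C_def algebra_simps)
    also have "E * (E * G) = N * M ^ k * 2 powr ((\<epsilon> - \<omega> * K) * r)"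
    proof -
      have "\<delta> * r + \<delta> * r = \<epsilon> * r" by (simp add: \<delta>_def)
      then have "E * E = 2 powr (\<epsilon> * r)" by (simp only: E_def powr_add[symmetric])
      moreover have "2 powr ((\<epsilon> - \<omega> * K) * r) = 2 powr (\<epsilon> * r) / X"
        unfolding X_def left_diff_distrib powr_diff ..
      ultimately show ?thesis by (simp add: G_def mult.assoc[symmetric])
    qed
    finally have fin: "N * H + D r * (\<Sum>t\<in>{1..2 ^ n * 2 ^ m}. capped H (\<alpha> * real B * real t)) \<le> C * (N * M ^ k * 2 powr ((\<epsilon> - \<omega> * K) * r))" .
    have "\<alpha> * real B * real t = real k * (real h * real (Suc k) * \<alpha> * real (2 ^ m)) * real t" for t
      by (simp add: B_def algebra_simps)
    then show "real (2 ^ n) * (2 * real (s * (2 ^ m) ^ (k - 1)) + 1) +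
      D r * (\<Sum>t\<in>{1..2 ^ n * 2 ^ m}. capped (2 * real (s * (2 ^ m) ^ (k - 1)) + 1)
         (real k * (real h * real (Suc k) * \<alpha> * real (2 ^ m)) * real t))
      \<le> C * (real (2 ^ n) * real (2 ^ m) ^ k * 2 powr ((\<epsilon> - \<omega> * real (k * (k - 1))) * r))"
      using fin by (simp only: N_def M_def H_def K_def)
  qed
qed

text \<open>For fixed v, after division by M, the diagonal v' = v contributes 2 M and all other v'
  together a constant times N M 2^((\<epsilon> - \<omega>) r). The splitting point makes both at
  most a constant times 2^((1 - \<omega> + \<epsilon>) r).\<close>

lemma bilinear_bound:
  fixes f :: "real poly" and \<epsilon> :: real
  assumes adm: "admissible k \<omega>" and deg: "degree f = Suc k"
    and \<alpha>: "coeff f (Suc k) \<notin> \<rat>" "diophantine_type (coeff f (Suc k)) = 1" and \<epsilon>: "\<epsilon> > 0"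
  obtains C where "C > 0"
    "\<And>r m n h U V. splitting k r m n \<Longrightarrow> 1 \<le> h \<Longrightarrow> real h \<le> 4 * 2 powr (\<omega> * r) \<Longrightarrow>
      U \<subseteq> {..<2 ^ m} \<Longrightarrow> V \<subseteq> {..<2 ^ n} \<Longrightarrow>
      cmod (\<Sum>u\<in>U. \<Sum>v\<in>V. unit_exp (real h * poly f (real u + real (2 ^ m) * real v))) ^ 2
        \<le> C * 2 powr ((1 - \<omega> + \<epsilon>) * r) * real (card U) * real (card V)"
proof -
  have k: "k \<ge> 2" using adm by (simp add: admissible_def)
  \<comment> \<open>2 s = k (k - 1) is the critical exponent for degree k - 1, where the system has
    M^s solutions up to M^\<epsilon>.\<close>
  define s where "s = tri (k - 1)"
  define K where "K = real (k * (k - 1))"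
  have K: "K = real (2 * s)"
    unfolding K_def s_def two_tri using k by (simp add: mult.commute)
  have s: "s \<ge> 1" using tri_pos[of "k - 1"] k by (simp add: s_def)
  obtain C1 D where C1: "C1 > 0" and D: "\<And>r. \<And>t :: nat. t \<in> {1..2 ^ r} \<Longrightarrow> real (card {d. d dvd t}) \<le> D r"
    and total: "\<And>r m n h. splitting k r m n \<Longrightarrow> 1 \<le> h \<Longrightarrow> real h \<le> 4 * 2 powr (\<omega> * r) \<Longrightarrow>
      real (2 ^ n) * (2 * real (s * (2 ^ m) ^ (k - 1)) + 1) +
      D r * (\<Sum>t\<in>{1..2 ^ n * 2 ^ m}. capped (2 * real (s * (2 ^ m) ^ (k - 1)) + 1)
         (real k * (real h * real (Suc k) * coeff f (Suc k) * real (2 ^ m)) * real t))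
      \<le> C1 * (real (2 ^ n) * real (2 ^ m) ^ k * 2 powr ((\<epsilon> - \<omega> * real (k * (k - 1))) * r))"
    using capped_total[OF adm \<alpha> \<epsilon> s] by blast
  have k1: "1 \<le> k - 1" using k by simp
  obtain Cj where Cj: "Cj > 0" and J: "\<And>N X. N \<ge> 1 \<Longrightarrow> finite X \<Longrightarrow> (\<And>x x'. x \<in> X \<Longrightarrow> x' \<in> X \<Longrightarrow> \<bar>x - x'\<bar> < int N) \<Longrightarrow>
    real (card (vinogradov_pairs (tri (k - 1)) (k - 1) X)) \<le> Cj * real N powr (real (tri (k - 1)) + \<epsilon>)"
    using vinogradov_mean_value[OF k1 \<epsilon>] by blast
  define C2 where "C2 = real (3 * s) ^ (k - 2) * (Cj * 2 powr (real s + \<epsilon>)) * (4 * C1)"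
  have C2: "C2 > 0" using C1 Cj s by (auto simp: C2_def intro!: mult_pos_pos)
  define C3 where "C3 = root (2 * s) C2"
  have s2: "0 < 2 * s" using s by simp
  have C3: "C3 > 0" "C3 ^ (2 * s) = C2"
    unfolding C3_def using real_root_gt_zero[OF s2 C2] real_root_pow_pos[OF s2 C2] by auto
  have main: "cmod (\<Sum>u\<in>U. \<Sum>v\<in>V. unit_exp (real h * poly f (real u + real (2 ^ m) * real v))) ^ 2
        \<le> (2 + C3) * 2 powr ((1 - \<omega> + \<epsilon>) * r) * real (card U) * real (card V)"
    if spl: "splitting k r m n" and h: "1 \<le> h" "real h \<le> 4 * 2 powr (\<omega> * r)"
      and U: "U \<subseteq> {..<2 ^ m}" and V: "V \<subseteq> {..<2 ^ n}" for r m n h :: nat and U V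
  proof -
    define M where "M = real (2 ^ m)"
    define N where "N = real (2 ^ n)"
    have M: "M \<ge> 1" and N: "N \<ge> 1" by (auto simp: M_def N_def)
    have mn: "m + n = r" using spl by (simp add: splitting_def)
    have NM: "N * M = 2 powr r" using mn by (simp add: M_def N_def powr_realpow mult.commute flip: power_add)
    have MP: "M \<le> 2 powr r" using mult_right_mono[of 1 N M] N M by (simp add: NM)
    define X where "X = {- int (2 ^ m)..<int (2 ^ m)}"
    have finV: "finite V" using V finite_subset by blast
    let ?S = "\<lambda>v v'. \<Sum>y<2 ^ m. \<Sum>x\<in>X. unit_exp (real h * poly f (of_int x + real y + real (2 ^ m) * real v)
        - real h * poly f (of_int x + real y + real (2 ^ m) * real v'))"
    define Jc where "Jc = real (card (vinogradov_pairs s (k - 1) X))"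
    have Jle: "Jc \<le> (Cj * 2 powr (real s + \<epsilon>)) * (M ^ s * 2 powr (\<epsilon> * r))"
    proof -
      have "Jc \<le> Cj * real (2 * 2 ^ m) powr (real s + \<epsilon>)"
        unfolding Jc_def s_def by (rule J) (auto simp: X_def)
      also have "real (2 * 2 ^ m) = 2 * M" by (simp add: M_def)
      also have "(2 * M) powr (real s + \<epsilon>) = 2 powr (real s + \<epsilon>) * (M ^ s * M powr \<epsilon>)"
        using M by (simp add: powr_mult powr_add powr_realpow)
      also have "M powr \<epsilon> \<le> (2 powr r) powr \<epsilon>" using M MP \<epsilon> by (intro powr_mono2) auto
      also have "(2 powr r) powr \<epsilon> = 2 powr (\<epsilon> * r)" by (simp add: powr_powr mult.commute)
      finally show ?thesis using Cj M by (simp add: mult_ac)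
    qed
    have Z: "(\<Sum>v'\<in>{..<2 ^ n} - {v}. cmod (?S v v')) \<le> C3 * (N * M ^ 2 * 2 powr ((\<epsilon> - \<omega>) * r))" if v: "v < 2 ^ n" for v
    proof -
      define W where "W = real (2 ^ n) * (2 * real (s * (2 ^ m) ^ (k - 1)) + 1) +
        D r * (\<Sum>t\<in>{1..2 ^ n * 2 ^ m}. capped (2 * real (s * (2 ^ m) ^ (k - 1)) + 1)
         (real k * (real h * real (Suc k) * coeff f (Suc k) * real (2 ^ m)) * real t))"
      have W: "W \<le> C1 * (N * M ^ k * 2 powr ((\<epsilon> - \<omega> * K) * r))"
        using total[OF spl h] by (simp only: W_def N_def M_def K_def)
      have "2 ^ n * 2 ^ m = (2 :: nat) ^ r" using mn by (simp add: mult.commute flip: power_add)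
      then have D': "real (card {d. d dvd t}) \<le> D r" if "t \<in> {1..2 ^ n * 2 ^ m}" for t :: nat
        using D[of t r] that by simp
      have one: "(1 :: nat) \<le> 2 ^ m" "(1 :: nat) \<le> 2 ^ n" by auto
      have "(\<Sum>v'\<in>{..<2 ^ n} - {v}. cmod (?S v v')) ^ (2 * s) \<le> (N * M) ^ (2 * s - 1) *
          (real (3 * s) ^ (k - 2) * M ^ tri (k - 2) * Jc * (4 * W))"
        using weyl_average[OF k eq_refl[OF deg] one v D', of "real h"]
        unfolding s_def[symmetric] X_def[symmetric] W_def Jc_def[symmetric] N_def[symmetric] M_def[symmetric] by fast
      also have "\<dots> \<le> (N * M) ^ (2 * s - 1) * (real (3 * s) ^ (k - 2) * M ^ tri (k - 2) *
          ((Cj * 2 powr (real s + \<epsilon>)) * (M ^ s * 2 powr (\<epsilon> * r))) * (4 * (C1 * (N * M ^ k * 2 powr ((\<epsilon> - \<omega> * K) * r)))))"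
      proof -
        have W0: "Jc \<ge> 0" by (simp add: Jc_def)
        have R0: "0 \<le> C1 * (N * M ^ k * 2 powr ((\<epsilon> - \<omega> * K) * r))" using C1 N M by simp
        have "Jc * (4 * W) \<le> Jc * (4 * (C1 * (N * M ^ k * 2 powr ((\<epsilon> - \<omega> * K) * r))))"
          using W W0 by (intro mult_left_mono) auto
        also have "\<dots> \<le> ((Cj * 2 powr (real s + \<epsilon>)) * (M ^ s * 2 powr (\<epsilon> * r))) * (4 * (C1 * (N * M ^ k * 2 powr ((\<epsilon> - \<omega> * K) * r))))"
          using Jle R0 by (intro mult_right_mono) auto
        finally show ?thesis using N M unfolding mult.assoc by (intro mult_left_mono) auto
      qed
      also have "\<dots> = C2 * (N ^ (2 * s - 1) * N) * (M ^ (2 * s - 1) * M ^ tri (k - 2) * M ^ s * M ^ k) *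
          (2 powr (\<epsilon> * r) * 2 powr ((\<epsilon> - \<omega> * K) * r))"
        unfolding C2_def power_mult_distrib by (simp only: mult_ac)
      also have "N ^ (2 * s - 1) * N = N ^ (2 * s)"
        using s by (subst power_Suc2[symmetric]) simp
      also have "M ^ (2 * s - 1) * M ^ tri (k - 2) * M ^ s * M ^ k = (M ^ 2) ^ (2 * s)"
      proof -
        obtain j where j: "k = Suc (Suc j)" using k by (metis add_2_eq_Suc le_Suc_ex)
        \<comment> \<open>The powers of M add up to exactly 4 s, the trivial amount, so the whole
          factor 2^(-\<omega> K r) is saved before the root.\<close>
        have "(2 * s - 1) + tri (k - 2) + s + k = 2 * (2 * s)"
          using s by (simp add: s_def j tri_Suc)
        then show ?thesis by (simp only: power_add[symmetric] power_mult[symmetric])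
      qed
      also have "2 powr (\<epsilon> * r) * 2 powr ((\<epsilon> - \<omega> * K) * r) = (2 powr ((2 * \<epsilon> / K - \<omega>) * r)) ^ (2 * s)"
      proof -
        have K0: "K > 0" using s by (simp add: K)
        have "(2 powr ((2 * \<epsilon> / K - \<omega>) * r)) ^ (2 * s) = 2 powr (((2 * \<epsilon> / K - \<omega>) * r) * K)"
          unfolding K by (subst powr_realpow[symmetric]) (auto simp: powr_powr)
        also have "((2 * \<epsilon> / K - \<omega>) * r) * K = \<epsilon> * r + (\<epsilon> - \<omega> * K) * r"
          using K0 by (simp add: field_simps)
        finally show ?thesis by (simp add: powr_add)
      qed
      also have "C2 * N ^ (2 * s) * (M ^ 2) ^ (2 * s) * (2 powr ((2 * \<epsilon> / K - \<omega>) * r)) ^ (2 * s)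
          = (C3 * (N * M ^ 2 * 2 powr ((2 * \<epsilon> / K - \<omega>) * r))) ^ (2 * s)"
        by (simp only: C3(2)[symmetric] power_mult_distrib mult.assoc)
      finally have "(\<Sum>v'\<in>{..<2 ^ n} - {v}. cmod (?S v v')) \<le> C3 * (N * M ^ 2 * 2 powr ((2 * \<epsilon> / K - \<omega>) * r))"
        using s C3 N M by (subst (asm) power_mono_iff) (auto intro!: sum_nonneg mult_nonneg_nonneg)
      also have "\<dots> \<le> C3 * (N * M ^ 2 * 2 powr ((\<epsilon> - \<omega>) * r))"
      proof -
        have "2 * 1 \<le> 2 * s" using s by (intro mult_le_mono2)
        then have "K \<ge> 2" unfolding K by simp
        then have "2 * \<epsilon> / K \<le> \<epsilon>" using \<epsilon> by (simp add: divide_le_eq)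
        then show ?thesis using C3 N M by (intro mult_left_mono powr_mono mult_right_mono) auto
      qed
      finally show ?thesis .
    qed
    have row: "(\<Sum>v'\<in>V. cmod (?S v v') / M) \<le> (2 + C3) * 2 powr ((1 - \<omega> + \<epsilon>) * r)" if v: "v \<in> V" for v
    proof -
      have v2: "v < 2 ^ n" using v V by auto
      have diag: "cmod (?S v v) = 2 * M ^ 2"
      proof -
        have "?S v v = of_real (2 * M ^ 2)"
          by (simp add: X_def M_def power2_eq_square)
        then show ?thesis using M by (simp only: norm_of_real) simp
      qed
      have rem: "(\<Sum>v'\<in>V. cmod (?S v v')) = cmod (?S v v) + (\<Sum>v'\<in>V - {v}. cmod (?S v v'))"
        by (rule sum.remove[OF finV v])
      have sub: "(\<Sum>v'\<in>V - {v}. cmod (?S v v')) \<le> (\<Sum>v'\<in>{..<2 ^ n} - {v}. cmod (?S v v'))"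
        using V by (intro sum_mono2) auto
      have "(\<Sum>v'\<in>V. cmod (?S v v')) \<le> 2 * M ^ 2 + C3 * (N * M ^ 2 * 2 powr ((\<epsilon> - \<omega>) * r))"
        using order_trans[OF sub Z[OF v2]] unfolding rem diag by simp
      then have "(\<Sum>v'\<in>V. cmod (?S v v')) / M \<le> (2 * M ^ 2 + C3 * (N * M ^ 2 * 2 powr ((\<epsilon> - \<omega>) * r))) / M"
        using M by (intro divide_right_mono) auto
      also have "\<dots> = 2 * M + C3 * ((N * M) * 2 powr ((\<epsilon> - \<omega>) * r))"
        using M by (simp add: add_divide_distrib power2_eq_square)
      finally have le: "(\<Sum>v'\<in>V. cmod (?S v v')) / M \<le> 2 * M + C3 * ((N * M) * 2 powr ((\<epsilon> - \<omega>) * r))" .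
      have e1: "(N * M) * 2 powr ((\<epsilon> - \<omega>) * r) = 2 powr ((1 - \<omega> + \<epsilon>) * r)"
        unfolding NM powr_add[symmetric] by (simp add: algebra_simps)
      have e2: "M \<le> 2 powr ((1 - \<omega> + \<epsilon>) * r)"
      proof -
        have "2 powr (\<omega> * r) * M \<le> N * M"
          using splitting_facts(2)[OF adm spl] M by (intro mult_right_mono) (auto simp: N_def)
        then have "M \<le> 2 powr r / 2 powr (\<omega> * r)" unfolding NM by (simp add: pos_le_divide_eq mult.commute)
        also have "\<dots> = 2 powr ((1 - \<omega>) * r)" by (simp add: left_diff_distrib powr_diff)
        also have "\<dots> \<le> 2 powr ((1 - \<omega> + \<epsilon>) * r)" using \<epsilon> by (intro powr_mono mult_right_mono) auto
        finally show ?thesis .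
      qed
      have "(\<Sum>v'\<in>V. cmod (?S v v')) / M \<le> 2 * 2 powr ((1 - \<omega> + \<epsilon>) * r) + C3 * 2 powr ((1 - \<omega> + \<epsilon>) * r)"
        using le e2 unfolding e1 by linarith
      then show ?thesis by (simp add: distrib_right sum_divide_distrib)
    qed
    have "cmod (\<Sum>u\<in>U. \<Sum>v\<in>V. unit_exp (real h * poly f (real u + real (2 ^ m) * real v))) ^ 2
        \<le> real (card U) * (\<Sum>v\<in>V. \<Sum>v'\<in>V. cmod (?S v v') / M)"
      unfolding X_def M_def
      by (rule cauchy_step[where F = "\<lambda>t. real h * poly f t" and g = "\<lambda>v. real (2 ^ m) * real v"]) (use U finV in auto)
    also have "\<dots> \<le> real (card U) * (\<Sum>v\<in>V. (2 + C3) * 2 powr ((1 - \<omega> + \<epsilon>) * r))"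
      using row by (intro mult_left_mono sum_mono) auto
    finally show ?thesis by (simp add: mult_ac)
  qed
  show ?thesis
    by (rule that[of "2 + C3"]) (use C3 main in auto)
qed

section \<open>From exponential sums to discrepancy\<close>

text \<open>The majorant is the average of the Fejer-type kernel \<open>|D\<^sub>R|\<^sup>4\<close> over the grid points \<open>j/(4R)\<close> in a slightly
  enlarged interval. Its error \<open>R\<^bsup>-1/2\<^esup>\<close> is worse than the \<open>R\<^bsup>-1\<^esup>\<close> of the sharp inequality but is still absorbed.\<close>

definition dirichlet_sum :: "nat \<Rightarrow> real \<Rightarrow> complex" where
  "dirichlet_sum R t = (\<Sum>j<R. unit_exp (real j * t))"

definition pair_square :: "nat \<Rightarrow> (nat \<times> nat) set" where
  "pair_square R = {..<R} \<times> {..<R}"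

definition pair_freq :: "nat \<times> nat \<Rightarrow> nat \<times> nat \<Rightarrow> int" where
  "pair_freq p p' = int (fst p + snd p) - int (fst p' + snd p')"

text \<open>The zeroth Fourier coefficient of the fourth power of the Dirichlet sum.\<close>

definition additive_energy :: "nat \<Rightarrow> nat" where
  "additive_energy R = card {(p, p') \<in> pair_square R \<times> pair_square R. pair_freq p p' = 0}"

lemma finite_pair_square [simp]: "finite (pair_square R)"
  by (simp add: pair_square_def)

lemma pair_freq_bound: "p \<in> pair_square R \<Longrightarrow> p' \<in> pair_square R \<Longrightarrow> \<bar>pair_freq p p'\<bar> \<le> 2 * int R"
  by (auto simp: pair_square_def pair_freq_def)

lemma norm_dirichlet_sum_le:
  assumes "d > 0" "d \<le> dist_nearest_int t"
  shows "cmod (dirichlet_sum R t) \<le> 1 / (2 * d)"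
proof -
  have "dirichlet_sum R t = (\<Sum>h\<in>{0..<int R}. unit_exp (of_int h * t))"
    unfolding dirichlet_sum_def
    by (rule sum.reindex_bij_witness[of _ nat int]) auto
  then have "cmod (dirichlet_sum R t) \<le> 1 / (2 * dist_nearest_int t)"
    using norm_geometric_le[of t 0 "int R"] assms by simp
  also have "\<dots> \<le> 1 / (2 * d)" using assms by (intro divide_left_mono) auto
  finally show ?thesis .
qed

lemma dirichlet_sum_fourth:
  "complex_of_real (cmod (dirichlet_sum R t) ^ 4)
    = (\<Sum>p\<in>pair_square R. \<Sum>p'\<in>pair_square R. unit_exp (of_int (pair_freq p p') * t))"
proof -
  have sq: "dirichlet_sum R t ^ 2 = (\<Sum>p\<in>pair_square R. unit_exp (real (fst p + snd p) * t))"
    unfolding dirichlet_sum_def pair_square_def power2_eq_square sum_product sum.cartesian_product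
    by (intro sum.cong refl) (auto simp: unit_exp_add distrib_right)
  have "cmod (dirichlet_sum R t) ^ 4 = cmod (dirichlet_sum R t ^ 2) ^ 2"
    by (simp add: norm_power flip: power_mult)
  then have "complex_of_real (cmod (dirichlet_sum R t) ^ 4) = complex_of_real (cmod (dirichlet_sum R t ^ 2) ^ 2)"
    by (simp only:)
  also have "\<dots> = (\<Sum>p\<in>pair_square R. \<Sum>p'\<in>pair_square R. unit_exp (of_int (pair_freq p p') * t))"
    unfolding sq norm_square_sum
    by (intro sum.cong refl)
       (simp add: pair_freq_def algebra_simps flip: unit_exp_minus unit_exp_add)
  finally show ?thesis .
qed

text \<open>R^2 pairs have fewer than 2 R different sums, so by Cauchy--Schwarz there are at least
  R^4 / (2 R) coincidences.\<close>

lemma additive_energy_ge: "real R ^ 3 \<le> 2 * real (additive_energy R)"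
proof (cases "R = 0")
  case False
  define P where "P = pair_square R"
  define F where "F = (\<lambda>c. {p \<in> P. fst p + snd p = c})"
  have P: "finite P" by (simp add: P_def)
  have "card P = (\<Sum>c\<in>{..<2 * R}. card (F c))"
  proof -
    have "(\<Sum>p\<in>P. 1) = (\<Sum>c\<in>{..<2 * R}. \<Sum>p\<in>{p \<in> P. fst p + snd p = c}. 1 :: nat)"
      by (rule sum.group[symmetric]) (auto simp: P_def pair_square_def)
    then show ?thesis by (simp add: F_def)
  qed
  then have "real R ^ 2 = (\<Sum>c\<in>{..<2 * R}. real (card (F c)))"
    by (simp add: P_def pair_square_def card_cartesian_product power2_eq_square flip: of_nat_mult of_nat_sum)
  then have "(real R ^ 2) ^ 2 \<le> (2 * real R) ^ (2 - 1) * (\<Sum>c\<in>{..<2 * R}. real (card (F c)) ^ 2)"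
    by (simp only:) (intro power_mean, auto)
  also have "(\<Sum>c\<in>{..<2 * R}. real (card (F c)) ^ 2) = real (additive_energy R)"
  proof -
    have "{(p, p') \<in> P \<times> P. pair_freq p p' = 0} = Sigma P (\<lambda>p. F (fst p + snd p))"
      by (auto simp: pair_freq_def F_def)
    then have "additive_energy R = (\<Sum>p\<in>P. card (F (fst p + snd p)))"
      unfolding additive_energy_def P_def[symmetric] using P by (simp add: F_def)
    also have "\<dots> = (\<Sum>c\<in>{..<2 * R}. \<Sum>p\<in>{p \<in> P. fst p + snd p = c}. card (F (fst p + snd p)))"
      by (rule sum.group[symmetric]) (auto simp: P_def pair_square_def)
    also have "\<dots> = (\<Sum>c\<in>{..<2 * R}. card (F c) ^ 2)"
      by (intro sum.cong refl) (simp add: F_def power2_eq_square)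
    finally show ?thesis by simp
  qed
  finally have "real R * real R ^ 3 \<le> real R * (2 * real (additive_energy R))"
    by (simp add: power2_eq_square power3_eq_cube mult_ac)
  then show ?thesis using False by simp
qed simp

text \<open>With p and the first entry of p' fixed, the frequency runs through distinct integers of
  size at most 2 R.\<close>

lemma sum_inverse_freq_le:
  "(\<Sum>p\<in>pair_square R. \<Sum>p'\<in>{p' \<in> pair_square R. pair_freq p p' \<noteq> 0}. 1 / \<bar>real_of_int (pair_freq p p')\<bar>)
    \<le> real R ^ 3 * (2 * harm (2 * R))"
proof -
  have one: "(\<Sum>j\<in>{j. j < R \<and> c - int j \<noteq> 0}. 1 / \<bar>real_of_int (c - int j)\<bar>) \<le> 2 * harm (2 * R)"
    if c: "\<And>j. j < R \<Longrightarrow> \<bar>c - int j\<bar> \<le> 2 * int R" for c :: int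
  proof -
    have "(\<Sum>j\<in>{j. j < R \<and> c - int j \<noteq> 0}. 1 / \<bar>real_of_int (c - int j)\<bar>)
      = (\<Sum>i\<in>(\<lambda>j. c - int j) ` {j. j < R \<and> c - int j \<noteq> 0}. 1 / \<bar>real_of_int i\<bar>)"
      by (subst sum.reindex) (auto simp: inj_on_def)
    also have "\<dots> \<le> (\<Sum>i\<in>int ` {1..2 * R} \<union> (\<lambda>i. - int i) ` {1..2 * R}. 1 / \<bar>real_of_int i\<bar>)"
    proof (rule sum_mono2)
      show "(\<lambda>j. c - int j) ` {j. j < R \<and> c - int j \<noteq> 0} \<subseteq> int ` {1..2 * R} \<union> (\<lambda>i. - int i) ` {1..2 * R}"
      proof
        fix i assume "i \<in> (\<lambda>j. c - int j) ` {j. j < R \<and> c - int j \<noteq> 0}"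
        then have i: "i \<noteq> 0" "\<bar>i\<bar> \<le> 2 * int R" using c by auto
        show "i \<in> int ` {1..2 * R} \<union> (\<lambda>i. - int i) ` {1..2 * R}"
        proof (cases "i > 0")
          case True
          then have "i = int (nat i)" "nat i \<in> {1..2 * R}" using i by auto
          then show ?thesis by blast
        next
          case False
          then have "i = - int (nat (- i))" "nat (- i) \<in> {1..2 * R}" using i by auto
          then show ?thesis by blast
        qed
      qed
    qed auto
    also have "\<dots> = (\<Sum>i\<in>int ` {1..2 * R}. 1 / \<bar>real_of_int i\<bar>) + (\<Sum>i\<in>(\<lambda>i. - int i) ` {1..2 * R}. 1 / \<bar>real_of_int i\<bar>)"
      by (rule sum.union_disjoint) auto
    also have "(\<Sum>i\<in>int ` {1..2 * R}. 1 / \<bar>real_of_int i\<bar>) = harm (2 * R)"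
      by (subst sum.reindex) (auto simp: harm_def inverse_eq_divide)
    also have "(\<Sum>i\<in>(\<lambda>i. - int i) ` {1..2 * R}. 1 / \<bar>real_of_int i\<bar>) = harm (2 * R)"
      by (subst sum.reindex) (auto simp: harm_def inverse_eq_divide inj_on_def)
    finally show ?thesis by simp
  qed
  have "(\<Sum>p\<in>pair_square R. \<Sum>p'\<in>{p' \<in> pair_square R. pair_freq p p' \<noteq> 0}. 1 / \<bar>real_of_int (pair_freq p p')\<bar>)
    \<le> (\<Sum>p\<in>pair_square R. \<Sum>i<R. 2 * harm (2 * R))"
  proof (rule sum_mono)
    fix p assume p: "p \<in> pair_square R"
    have "{p' \<in> pair_square R. pair_freq p p' \<noteq> 0}
      = Sigma {..<R} (\<lambda>i. {j. j < R \<and> (int (fst p + snd p) - int i) - int j \<noteq> 0})"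
      by (auto simp: pair_square_def pair_freq_def)
    then have "(\<Sum>p'\<in>{p' \<in> pair_square R. pair_freq p p' \<noteq> 0}. 1 / \<bar>real_of_int (pair_freq p p')\<bar>)
      = (\<Sum>i<R. \<Sum>j\<in>{j. j < R \<and> (int (fst p + snd p) - int i) - int j \<noteq> 0}. 1 / \<bar>real_of_int ((int (fst p + snd p) - int i) - int j)\<bar>)"
      by (simp add: sum.Sigma pair_freq_def case_prod_unfold algebra_simps)
    also have "\<dots> \<le> (\<Sum>i<R. 2 * harm (2 * R))"
      using p by (intro sum_mono one) (auto simp: pair_square_def)
    finally show "(\<Sum>p'\<in>{p' \<in> pair_square R. pair_freq p p' \<noteq> 0}. 1 / \<bar>real_of_int (pair_freq p p')\<bar>) \<le> (\<Sum>i<R. 2 * harm (2 * R))" .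
  qed
  also have "\<dots> = real R ^ 3 * (2 * harm (2 * R))"
    by (simp add: pair_square_def card_cartesian_product power3_eq_cube)
  finally show ?thesis .
qed

lemma geometric_unit_exp:
  fixes a b :: int
  assumes "a \<le> b"
  shows "(\<Sum>h\<in>{a..<b}. unit_exp (of_int h * x)) * (unit_exp x - 1) = unit_exp (of_int b * x) - unit_exp (of_int a * x)"
  using assms
proof (induction b rule: int_ge_induct)
  case (step b)
  have "{a..<b + 1} = insert b {a..<b}" using step.hyps by auto
  then show ?case using step.IH by (simp add: algebra_simps unit_exp_add)
qed simp

lemma dist_frequency:
  assumes "L > 0" "2 * \<bar>l\<bar> \<le> int L"
  shows "dist_nearest_int (real_of_int l / real L) = \<bar>real_of_int l\<bar> / real L"
proof (rule antisym)
  show "dist_nearest_int (real_of_int l / real L) \<le> \<bar>real_of_int l\<bar> / real L"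
    using dist_le[of "real_of_int l / real L" 0] by (simp add: abs_divide)
  define m where "m = round (real_of_int l / real L)"
  have "\<bar>l\<bar> \<le> \<bar>l - m * int L\<bar>"
  proof (cases "m = 0")
    case False
    then have "int L \<le> \<bar>m * int L\<bar>" using assms(1) by (simp add: abs_mult)
    then show ?thesis using assms(2) by linarith
  qed simp
  then have "real_of_int \<bar>l\<bar> \<le> real_of_int \<bar>l - m * int L\<bar>" unfolding of_int_le_iff .
  then have "\<bar>real_of_int l\<bar> \<le> \<bar>real_of_int l - of_int m * real L\<bar>" by simp
  also have "real_of_int l - of_int m * real L = (real_of_int l / real L - of_int m) * real L"
    using assms(1) by (simp add: left_diff_distrib)
  also have "\<bar>\<dots>\<bar> = \<bar>real_of_int l / real L - of_int m\<bar> * real L" by (simp only: abs_mult abs_of_nat)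
  finally show "\<bar>real_of_int l\<bar> / real L \<le> dist_nearest_int (real_of_int l / real L)"
    using assms(1) by (simp add: pos_divide_le_eq dist_nearest_int_def m_def)
qed

text \<open>For points of the interval, the sum of the kernel over the widened grid nearly equals
  the sum over a full period, which is constant. Expanding the same sum in frequencies isolates the
  length as main term. Only an upper bound is sought, since passing to complements yields the lower
  one.\<close>

lemma count_upper:
  fixes x :: "nat \<Rightarrow> real"
  assumes G: "finite G" "G \<noteq> {}" and R: "R \<ge> 1" and B: "B \<ge> 0"
    and hB: "\<And>h. 1 \<le> h \<Longrightarrow> h \<le> 2 * R \<Longrightarrow> cmod (\<Sum>n\<in>G. unit_exp (real h * x n)) \<le> B * real (card G)"
    and lh: "0 \<le> lo" "lo \<le> hi" "hi \<le> 1"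
  shows "real (card {n \<in> G. lo \<le> x n \<and> x n \<le> hi}) / real (card G) \<le> (hi - lo) + (34 / sqrt R + 2 * B * harm (2 * R))"
proof -
  \<comment> \<open>The frequencies are at most 2 R in size, so on 4 R grid points no nonzero one is
    aliased to 0.\<close>
  define L where "L = 4 * R"
  \<comment> \<open>Widening by about sqrt R of the 4 R grid points costs O(1 / sqrt R) in length
    and keeps the omitted points at distance at least E / L from x.\<close>
  define E where "E = nat \<lceil>sqrt R\<rceil>"
  define A where "A = {n \<in> G. lo \<le> x n \<and> x n \<le> hi}"
  define g where "g = real (card G)"
  have g: "g > 0" using G by (simp add: g_def card_gt_0_iff)
  have sR: "sqrt R \<ge> 1" using R by simp
  have E: "sqrt R \<le> real E" "real E \<le> sqrt R + 1" "real E > 0"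
    using sR by (auto simp: E_def intro: order_less_le_trans)
  have L: "real L > 0" "L > 0" using R by (auto simp: L_def)
  define a where "a = \<lfloor>real L * lo\<rfloor> - int E"
  define b where "b = \<lceil>real L * hi\<rceil> + int E + 1"
  have Lle: "real L * lo \<le> real L * hi" using lh L by (intro mult_left_mono) auto
  have ab: "a < b"
  proof -
    have "\<lfloor>real L * lo\<rfloor> \<le> \<lceil>real L * hi\<rceil>" using Lle by linarith
    then show ?thesis by (simp add: a_def b_def)
  qed
  have J_len: "real_of_int (b - a) \<le> real L * (hi - lo) + (2 * real E + 3)"
    unfolding a_def b_def right_diff_distrib by linarith
  have J_frac: "real_of_int (b - a) / real L \<le> (hi - lo) + 2 / sqrt R"
  proof -
    have "real_of_int (b - a) / real L \<le> (real L * (hi - lo) + (2 * real E + 3)) / real L"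
      using J_len L by (intro divide_right_mono) auto
    also have "\<dots> = (hi - lo) + (2 * real E + 3) / (4 * real R)"
      using R by (simp add: L_def add_divide_distrib)
    also have "(2 * real E + 3) / (4 * real R) \<le> (8 * sqrt R) / (4 * real R)"
    proof (rule divide_right_mono)
      show "2 * real E + 3 \<le> 8 * sqrt R" using E sR by linarith
    qed simp
    also have "\<dots> = 2 / sqrt R" using R by (simp add: field_simps)
    finally show ?thesis by simp
  qed
  have hm: "harm (2 * R) \<ge> (0 :: real)" by (rule harm_nonneg)
  have A_le: "real (card A) \<le> g" unfolding g_def A_def using G by (simp add: card_mono)
  show ?thesis
  \<comment> \<open>If the widened interval covers a whole period, the claimed bound is at least
    1.\<close>
  proof (cases "b - a \<ge> int L")
    case True
    then have "real L \<le> real_of_int (b - a)" by linarith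
    then have "1 \<le> real_of_int (b - a) / real L" using L by simp
    then have "1 \<le> (hi - lo) + 2 / sqrt R" using J_frac by linarith
    moreover have "2 / sqrt R \<le> 34 / sqrt R" using R by (intro divide_right_mono) auto
    moreover have "0 \<le> 2 * B * harm (2 * R)" using B hm by simp
    moreover have "real (card A) / g \<le> 1" using A_le g by simp
    ultimately show ?thesis unfolding A_def g_def by linarith
  next
    case False
    define W where "W = (\<lambda>S t. \<Sum>j\<in>S. cmod (dirichlet_sum R (t - real_of_int j / real L)) ^ 4)"
    define Z where "Z = real (additive_energy R)"
    have Z: "real R ^ 3 \<le> 2 * Z" using additive_energy_ge by (simp add: Z_def)
    have R3: "real R ^ 3 > 0" using R by simp
    have Z0: "Z > 0" using Z R3 by linarith
    have W_exp: "complex_of_real (W S t) = (\<Sum>p\<in>pair_square R. \<Sum>p'\<in>pair_square R.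
        unit_exp (of_int (pair_freq p p') * t) * (\<Sum>j\<in>S. unit_exp (of_int j * (- (of_int (pair_freq p p') / real L)))))"
      if "finite S" for S :: "int set" and t
    proof -
      have "complex_of_real (W S t) = (\<Sum>j\<in>S. \<Sum>p\<in>pair_square R. \<Sum>p'\<in>pair_square R.
          unit_exp (of_int (pair_freq p p') * t) * unit_exp (of_int j * (- (of_int (pair_freq p p') / real L))))"
        unfolding W_def of_real_sum dirichlet_sum_fourth
        by (intro sum.cong refl) (simp add: algebra_simps flip: unit_exp_add)
      also have "\<dots> = (\<Sum>p\<in>pair_square R. \<Sum>j\<in>S. \<Sum>p'\<in>pair_square R.
          unit_exp (of_int (pair_freq p p') * t) * unit_exp (of_int j * (- (of_int (pair_freq p p') / real L))))"
        by (rule sum.swap)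
      also have "\<dots> = (\<Sum>p\<in>pair_square R. \<Sum>p'\<in>pair_square R.
        unit_exp (of_int (pair_freq p p') * t) * (\<Sum>j\<in>S. unit_exp (of_int j * (- (of_int (pair_freq p p') / real L)))))"
        unfolding sum_distrib_left by (rule sum.cong[OF refl], rule sum.swap)
      finally show ?thesis .
    qed
    have freq: "2 * \<bar>pair_freq p p'\<bar> \<le> int L" if "p \<in> pair_square R" "p' \<in> pair_square R" for p p'
      using pair_freq_bound[OF that] by (simp add: L_def)
    \<comment> \<open>A full grid annihilates every nonzero frequency, leaving L times the
      energy.\<close>
    have full: "W {a..<a + int L} t = real L * Z" for t
    proof -
      have inner: "(\<Sum>j\<in>{a..<a + int L}. unit_exp (of_int j * (- (of_int l / real L)))) = (if l = 0 then of_nat L else 0)"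
        if l: "2 * \<bar>l\<bar> \<le> int L" for l :: int
      proof (cases "l = 0")
        case False
        define \<theta> where "\<theta> = - (of_int l / real L)"
        have "dist_nearest_int \<theta> > 0" unfolding \<theta>_def dist_minus dist_frequency[OF L(2) l] using False L by simp
        then have "unit_exp \<theta> - 1 \<noteq> 0" using norm_unit_exp_diff_ge[of \<theta>] by auto
        moreover have "unit_exp (of_int (a + int L) * \<theta>) = unit_exp (of_int a * \<theta>)"
        proof -
          have "of_int (a + int L) * \<theta> = of_int a * \<theta> + of_int (- l)" using L by (simp add: \<theta>_def field_simps)
          then show ?thesis by (simp only: unit_exp_add_of_int)
        qed
        ultimately show ?thesis using geometric_unit_exp[of a "a + int L" \<theta>] False unfolding \<theta>_def[symmetric] by simp
      qed simp
      have "complex_of_real (W {a..<a + int L} t) = (\<Sum>p\<in>pair_square R. \<Sum>p'\<in>pair_square R.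
          if pair_freq p p' = 0 then of_nat L else 0)"
        by (subst W_exp, simp, intro sum.cong refl, subst inner, erule (1) freq, simp)
      also have "\<dots> = of_nat L * of_nat (additive_energy R)"
      proof -
        have "additive_energy R = (\<Sum>p\<in>pair_square R. card {p' \<in> pair_square R. pair_freq p p' = 0})"
        proof -
          have "{(p, p') \<in> pair_square R \<times> pair_square R. pair_freq p p' = 0}
            = Sigma (pair_square R) (\<lambda>p. {p' \<in> pair_square R. pair_freq p p' = 0})" by auto
          then show ?thesis unfolding additive_energy_def by simp
        qed
        then show ?thesis by (simp add: sum.If_cases sum_distrib_left Int_def mult.commute)
      qed
      also have "\<dots> = complex_of_real (real L * Z)" by (simp add: Z_def)
      finally show ?thesis by (simp only: of_real_eq_iff)
    qed
    define \<tau> where "\<tau> = real L * (real L / (2 * real E)) ^ 4"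
    have tail: "W {b..<a + int L} (x n) \<le> \<tau>" if n: "n \<in> A" for n
    proof -
      have "W {b..<a + int L} (x n) \<le> (\<Sum>j\<in>{b..<a + int L}. (real L / (2 * real E)) ^ 4)"
        unfolding W_def
      proof (intro sum_mono power_mono)
        fix j assume j: "j \<in> {b..<a + int L}"
        define y where "y = real_of_int j / real L - x n"
        have 1: "real E / real L \<le> y"
        proof -
          have "real L * x n \<le> real L * hi" using n L by (intro mult_left_mono) (auto simp: A_def)
          moreover have "real L * hi + real E + 1 \<le> real_of_int j" using j unfolding b_def by simp linarith
          ultimately have "real E \<le> real_of_int j - real L * x n" by linarith
          then have "real E / real L \<le> (real_of_int j - real L * x n) / real L" using L by (intro divide_right_mono) auto
          then show ?thesis using L by (simp add: y_def diff_divide_distrib)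
        qed
        have 2: "y \<le> 1 - real E / real L"
        proof -
          have "real L * lo \<le> real L * x n" using n L by (intro mult_left_mono) (auto simp: A_def)
          moreover have "real_of_int j \<le> real L * lo - real E + real L" using j unfolding a_def by simp linarith
          ultimately have "real_of_int j - real L * x n \<le> real L - real E" by linarith
          then have "(real_of_int j - real L * x n) / real L \<le> (real L - real E) / real L" using L by (intro divide_right_mono) auto
          then show ?thesis using L by (simp add: y_def diff_divide_distrib)
        qed
        have "real E / real L \<le> \<bar>y - of_int m\<bar>" for m
        proof -
          consider "m \<le> 0" | "m \<ge> 1" by linarith
          then show ?thesis
          proof cases
            case 1
            then have "real_of_int m \<le> 0" by simp
            then show ?thesis using \<open>real E / real L \<le> y\<close> by linarith
          next
            case 2
            then have "real_of_int m \<ge> 1" by simp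
            then show ?thesis using \<open>y \<le> 1 - real E / real L\<close> by linarith
          qed
        qed
        then have "real E / real L \<le> dist_nearest_int y" by (simp add: dist_nearest_int_def)
        also have "y = - (x n - real_of_int j / real L)" by (simp add: y_def)
        finally have "real E / real L \<le> dist_nearest_int (x n - real_of_int j / real L)" by (simp only: dist_minus)
        then have "cmod (dirichlet_sum R (x n - real_of_int j / real L)) \<le> 1 / (2 * (real E / real L))"
          using E L by (intro norm_dirichlet_sum_le) auto
        then show "cmod (dirichlet_sum R (x n - real_of_int j / real L)) \<le> real L / (2 * real E)" by simp
      qed auto
      also have "\<dots> = real (card {b..<a + int L}) * (real L / (2 * real E)) ^ 4" by simp
      also have "\<dots> \<le> \<tau>" unfolding \<tau>_def using ab by (intro mult_right_mono) auto
      finally show ?thesis .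
    qed
    have low: "real L * Z - \<tau> \<le> W {a..<b} (x n)" if "n \<in> A" for n
    proof -
      have "{a..<a + int L} = {a..<b} \<union> {b..<a + int L}" using ab False by auto
      then have "W {a..<a + int L} (x n) = W {a..<b} (x n) + W {b..<a + int L} (x n)"
        unfolding W_def by (simp add: sum.union_disjoint[symmetric] ivl_disj_int)
      then show ?thesis using full[of "x n"] tail[OF that] by linarith
    qed
    have W0: "0 \<le> W S t" for S t by (auto simp: W_def intro!: sum_nonneg)
    have "real (card A) * (real L * Z - \<tau>) = (\<Sum>n\<in>A. real L * Z - \<tau>)" by simp
    also have "\<dots> \<le> (\<Sum>n\<in>A. W {a..<b} (x n))" by (intro sum_mono low)
    also have "\<dots> \<le> (\<Sum>n\<in>G. W {a..<b} (x n))" using G W0 by (intro sum_mono2) (auto simp: A_def)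
    also have "\<dots> \<le> real_of_int (b - a) * Z * g + B * g * real L * real R ^ 3 * harm (2 * R)"
    proof -
      define S where "S = (\<lambda>l :: int. \<Sum>n\<in>G. unit_exp (of_int l * x n))"
      define K where "K = (\<lambda>l :: int. \<Sum>j\<in>{a..<b}. unit_exp (of_int j * (- (of_int l / real L))))"
      have S_bound: "cmod (S l) \<le> B * g" if "l \<noteq> 0" "\<bar>l\<bar> \<le> 2 * int R" for l
      proof (cases "l > 0")
        case True
        then show ?thesis using hB[of "nat l"] that by (simp add: S_def g_def)
      next
        case False
        have "S l = (\<Sum>n\<in>G. cnj (unit_exp (real (nat (- l)) * x n)))"
          unfolding S_def using False by (intro sum.cong refl) (simp flip: unit_exp_minus)
        then have "cmod (S l) = cmod (\<Sum>n\<in>G. unit_exp (real (nat (- l)) * x n))"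
          by (simp only: cnj_sum[symmetric] complex_mod_cnj)
        then show ?thesis using hB[of "nat (- l)"] that False by (simp add: g_def)
      qed
      have K_bound: "cmod (K l) \<le> real L / 2 * (1 / \<bar>real_of_int l\<bar>)" if "l \<noteq> 0" "2 * \<bar>l\<bar> \<le> int L" for l
      proof -
        have d: "dist_nearest_int (- (of_int l / real L)) = \<bar>real_of_int l\<bar> / real L"
          by (simp add: dist_frequency[OF L(2) that(2)])
        then have "cmod (K l) \<le> 1 / (2 * dist_nearest_int (- (of_int l / real L)))"
          unfolding K_def using that L by (intro norm_geometric_le) auto
        then show ?thesis unfolding d by simp
      qed
      have "complex_of_real (\<Sum>n\<in>G. W {a..<b} (x n)) = (\<Sum>n\<in>G. \<Sum>p\<in>pair_square R. \<Sum>p'\<in>pair_square R.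
          unit_exp (of_int (pair_freq p p') * x n) * K (pair_freq p p'))"
        unfolding of_real_sum K_def by (subst W_exp) auto
      also have "\<dots> = (\<Sum>p\<in>pair_square R. \<Sum>n\<in>G. \<Sum>p'\<in>pair_square R.
          unit_exp (of_int (pair_freq p p') * x n) * K (pair_freq p p'))" by (rule sum.swap)
      also have "\<dots> = (\<Sum>p\<in>pair_square R. \<Sum>p'\<in>pair_square R. S (pair_freq p p') * K (pair_freq p p'))"
        unfolding S_def sum_distrib_right by (rule sum.cong[OF refl], rule sum.swap)
      finally have eq: "complex_of_real (\<Sum>n\<in>G. W {a..<b} (x n)) = \<dots>" .
      have "(\<Sum>n\<in>G. W {a..<b} (x n)) = cmod (complex_of_real (\<Sum>n\<in>G. W {a..<b} (x n)))"
        unfolding norm_of_real using W0 by (intro abs_of_nonneg[symmetric] sum_nonneg) auto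
      also have "\<dots> \<le> (\<Sum>p\<in>pair_square R. \<Sum>p'\<in>pair_square R. cmod (S (pair_freq p p')) * cmod (K (pair_freq p p')))"
        unfolding eq by (rule order_trans[OF norm_sum]) (intro sum_mono order_trans[OF norm_sum], simp add: norm_mult)
      \<comment> \<open>Frequency 0 yields the length of the widened interval; each other one
        combines the hypothesis on exponential sums with a geometric sum over the grid.\<close>
      also have "\<dots> \<le> (\<Sum>p\<in>pair_square R. (\<Sum>p'\<in>{p' \<in> pair_square R. pair_freq p p' = 0}. g * real_of_int (b - a)) +
          (\<Sum>p'\<in>{p' \<in> pair_square R. pair_freq p p' \<noteq> 0}. (B * g) * (real L / 2 * (1 / \<bar>real_of_int (pair_freq p p')\<bar>))))"
      proof (rule sum_mono)
        fix p assume p: "p \<in> pair_square R"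
        have split: "pair_square R = {p' \<in> pair_square R. pair_freq p p' = 0} \<union> {p' \<in> pair_square R. pair_freq p p' \<noteq> 0}"
          by auto
        have "(\<Sum>p'\<in>pair_square R. cmod (S (pair_freq p p')) * cmod (K (pair_freq p p')))
          = (\<Sum>p'\<in>{p' \<in> pair_square R. pair_freq p p' = 0}. cmod (S (pair_freq p p')) * cmod (K (pair_freq p p')))
          + (\<Sum>p'\<in>{p' \<in> pair_square R. pair_freq p p' \<noteq> 0}. cmod (S (pair_freq p p')) * cmod (K (pair_freq p p')))"
          by (subst split, rule sum.union_disjoint) auto
        also have "\<dots> \<le> (\<Sum>p'\<in>{p' \<in> pair_square R. pair_freq p p' = 0}. g * real_of_int (b - a)) +
          (\<Sum>p'\<in>{p' \<in> pair_square R. pair_freq p p' \<noteq> 0}. (B * g) * (real L / 2 * (1 / \<bar>real_of_int (pair_freq p p')\<bar>)))"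
        proof (intro add_mono sum_mono)
          fix p' assume "p' \<in> {p' \<in> pair_square R. pair_freq p p' = 0}"
          then have "pair_freq p p' = 0" by simp
          then show "cmod (S (pair_freq p p')) * cmod (K (pair_freq p p')) \<le> g * real_of_int (b - a)"
            using ab by (simp add: S_def K_def g_def flip: of_int_diff)
        next
          fix p' assume "p' \<in> {p' \<in> pair_square R. pair_freq p p' \<noteq> 0}"
          then show "cmod (S (pair_freq p p')) * cmod (K (pair_freq p p')) \<le> (B * g) * (real L / 2 * (1 / \<bar>real_of_int (pair_freq p p')\<bar>))"
            using freq[OF p, of p'] pair_freq_bound[OF p, of p'] B g
            by (intro mult_mono S_bound K_bound) auto
        qed
        finally show "(\<Sum>p'\<in>pair_square R. cmod (S (pair_freq p p')) * cmod (K (pair_freq p p'))) \<le> \<dots>" .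
      qed
      also have "\<dots> = g * real_of_int (b - a) * Z + (B * g) * (real L / 2) *
          (\<Sum>p\<in>pair_square R. \<Sum>p'\<in>{p' \<in> pair_square R. pair_freq p p' \<noteq> 0}. 1 / \<bar>real_of_int (pair_freq p p')\<bar>)"
      proof -
        have "Z = (\<Sum>p\<in>pair_square R. real (card {p' \<in> pair_square R. pair_freq p p' = 0}))"
        proof -
          have "{(p, p') \<in> pair_square R \<times> pair_square R. pair_freq p p' = 0}
            = Sigma (pair_square R) (\<lambda>p. {p' \<in> pair_square R. pair_freq p p' = 0})" by auto
          then show ?thesis unfolding Z_def additive_energy_def by simp
        qed
        then have "g * real_of_int (b - a) * Z = (\<Sum>p\<in>pair_square R. \<Sum>p'\<in>{p' \<in> pair_square R. pair_freq p p' = 0}. g * real_of_int (b - a))"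
          by (simp add: sum_distrib_left mult_ac)
        then show ?thesis by (simp only: sum.distrib sum_distrib_left mult.assoc)
      qed
      also have "\<dots> \<le> g * real_of_int (b - a) * Z + (B * g) * (real L / 2) * (real R ^ 3 * (2 * harm (2 * R)))"
        using sum_inverse_freq_le[of R] B g L by (intro add_left_mono mult_left_mono) auto
      finally show ?thesis by (simp add: mult_ac)
    qed
    finally have main: "real (card A) * (real L * Z) \<le> real_of_int (b - a) * Z * g + B * g * real L * real R ^ 3 * harm (2 * R) + real (card A) * \<tau>"
      by (simp add: algebra_simps)
    have "real (card A) * (real L * Z) \<le> (real L * Z) * (g * ((hi - lo) + 2 / sqrt R) + g * (2 * B * harm (2 * R)) + g * (32 / sqrt R))"
    proof -
      have 1: "real_of_int (b - a) * Z * g \<le> (real L * Z) * (g * ((hi - lo) + 2 / sqrt R))"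
      proof -
        have "real_of_int (b - a) \<le> real L * ((hi - lo) + 2 / sqrt R)" using J_frac L by (simp add: pos_divide_le_eq mult.commute)
        then have "real_of_int (b - a) * (Z * g) \<le> (real L * ((hi - lo) + 2 / sqrt R)) * (Z * g)" using Z0 g by (intro mult_right_mono) auto
        then show ?thesis by (simp only: mult_ac)
      qed
      have 2: "B * g * real L * real R ^ 3 * harm (2 * R) \<le> (real L * Z) * (g * (2 * B * harm (2 * R)))"
      proof -
        have "(B * g * real L * harm (2 * R)) * real R ^ 3 \<le> (B * g * real L * harm (2 * R)) * (2 * Z)"
          using Z B g L hm by (intro mult_left_mono mult_nonneg_nonneg) auto
        then show ?thesis by (simp only: mult_ac)
      qed
      have 3: "real (card A) * \<tau> \<le> (real L * Z) * (g * (32 / sqrt R))"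
      proof -
        have E4: "real R ^ 2 \<le> real E ^ 4"
        proof -
          have "sqrt R ^ 4 \<le> real E ^ 4" using E sR by (intro power_mono) auto
          moreover have "sqrt R ^ 4 = (sqrt R ^ 2) ^ 2" by (simp only: power_mult[symmetric]) simp
          ultimately show ?thesis by simp
        qed
        have "(real L / (2 * real E)) ^ 4 = 16 * real R ^ 4 / real E ^ 4"
          by (simp add: L_def power_divide power_mult_distrib)
        also have "\<dots> \<le> 16 * real R ^ 4 / real R ^ 2"
          using E4 R by (intro divide_left_mono mult_pos_pos) (use E(3) in auto)
        also have "\<dots> = 16 * real R ^ 3 / real R" using R by (simp add: eval_nat_numeral)
        also have "\<dots> \<le> 16 * (2 * Z) / real R" using Z by (intro divide_right_mono mult_left_mono) auto
        also have "\<dots> \<le> 16 * (2 * Z) / sqrt R"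
        proof -
          have "sqrt R \<le> real R" using R sR mult_left_mono[of 1 "sqrt R" "sqrt R"] by simp
          then show ?thesis using Z0 sR R by (intro divide_left_mono) auto
        qed
        finally have "\<tau> \<le> real L * (16 * (2 * Z) / sqrt R)" unfolding \<tau>_def using L by (intro mult_left_mono) auto
        then have "real (card A) * \<tau> \<le> g * (real L * (16 * (2 * Z) / sqrt R))"
          using A_le Z0 L by (intro mult_mono) (auto simp: \<tau>_def)
        then show ?thesis by (simp add: mult_ac)
      qed
      show ?thesis using main 1 2 3 unfolding distrib_left by linarith
    qed
    then have "real (card A) \<le> g * ((hi - lo) + 2 / sqrt R) + g * (2 * B * harm (2 * R)) + g * (32 / sqrt R)"
      using L Z0 by (simp add: mult.commute[of "real (card A)"])
    also have "\<dots> = ((hi - lo) + (34 / sqrt R + 2 * B * harm (2 * R))) * g"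
    proof -
      \<comment> \<open>2 from widening the interval, 32 from the tail of the kernel.\<close>
      have "2 / sqrt R + 32 / sqrt R = 34 / sqrt R" by (simp add: add_divide_distrib[symmetric])
      then show ?thesis by (simp add: algebra_simps)
    qed
    finally show ?thesis using g by (simp add: pos_divide_le_eq A_def g_def)
  qed
qed

section \<open>From counts in closed intervals to the discrepancy\<close>

lemma measure_bounded_interval:
  fixes I :: "real set"
  assumes "is_interval I" "I \<noteq> {}" "I \<subseteq> {0..<1}"
  shows "measure lborel I = Sup I - Inf I"
proof -
  have bdd: "bdd_below I" "bdd_above I"
    using assms(3) bdd_below_mono[of "{0..<1}" I] bdd_above_mono[of "{0..<1}" I] by simp_all
  have le: "Inf I \<le> Sup I" using bdd assms(2) by (meson cInf_le_cSup)
  have outer: "I \<subseteq> {Inf I..Sup I}" using bdd by (auto intro: cInf_lower cSup_upper)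
  have inner: "{Inf I<..<Sup I} \<subseteq> I"
  proof
    fix z assume z: "z \<in> {Inf I<..<Sup I}"
    obtain a where "a \<in> I" "a < z" using z cInf_less_iff[OF assms(2) bdd(1)] by auto
    moreover obtain b where "b \<in> I" "z < b" using z less_cSup_iff[OF assms(2) bdd(2)] by auto
    ultimately show "z \<in> I" using assms(1) unfolding is_interval_1 by (meson less_imp_le)
  qed
  have meas: "I \<in> sets lborel" using assms(1) by (simp add: real_interval_borel_measurable)
  have "measure lborel I \<le> measure lborel {Inf I..Sup I}"
    using outer meas le by (intro measure_mono_fmeasurable) (auto simp: fmeasurable_def)
  moreover have "measure lborel {Inf I<..<Sup I} \<le> measure lborel I"
  proof (rule measure_mono_fmeasurable[OF inner])
    show "I \<in> fmeasurable lborel"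
      by (rule fmeasurableI2[of "{Inf I..Sup I}"]) (use outer meas le in \<open>auto simp: fmeasurable_def\<close>)
  qed simp
  ultimately show ?thesis using le by simp
qed

lemma unit_exp_frac: "unit_exp (real h * frac y) = unit_exp (real h * y)"
proof -
  have "real h * y = real h * frac y + of_int (int h * \<lfloor>y\<rfloor>)" by (simp add: frac_def algebra_simps)
  then show ?thesis by (simp only: unit_exp_add_of_int)
qed

text \<open>The complement of I is covered by the closed intervals [0, lo] and [hi, 1]; the upper
  bound for these two gives the lower bound for I, at twice the error.\<close>

lemma discrepancy_le:
  assumes G: "finite G" "G \<noteq> {}" and R: "R \<ge> 1" and B: "B \<ge> 0"
    and hB: "\<And>h. 1 \<le> h \<Longrightarrow> h \<le> 2 * R \<Longrightarrow> cmod (\<Sum>n\<in>G. unit_exp (real h * f n)) \<le> B * real (card G)"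
  shows "discrepancy f G \<le> 2 * (34 / sqrt R + 2 * B * harm (2 * R))"
  unfolding discrepancy_def
proof (rule cSUP_least)
  have "{} \<in> {I :: real set. is_interval I \<and> I \<subseteq> {0..<1}}" by simp
  then show "{I :: real set. is_interval I \<and> I \<subseteq> {0..<1}} \<noteq> {}" by blast
next
  fix I :: "real set" assume "I \<in> {I. is_interval I \<and> I \<subseteq> {0..<1}}"
  then have I: "is_interval I" "I \<subseteq> {0..<1}" by auto
  define err where "err = 34 / sqrt R + 2 * B * harm (2 * R)"
  define g where "g = real (card G)"
  have g: "g > 0" using G by (simp add: g_def card_gt_0_iff)
  have "(0 :: real) \<le> harm (2 * R)" by (rule harm_nonneg)
  then have err: "err \<ge> 0" using B by (simp add: err_def)
  have upper: "real (card {n \<in> G. lo \<le> frac (f n) \<and> frac (f n) \<le> hi}) / g \<le> (hi - lo) + err"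
    if "0 \<le> lo" "lo \<le> hi" "hi \<le> 1" for lo hi
    unfolding err_def g_def using that hB
    by (intro count_upper G R B) (auto simp: unit_exp_frac)
  show "\<bar>real (card {n \<in> G. frac (f n) \<in> I}) / real (card G) - measure lborel I\<bar> \<le> 2 * (34 / sqrt R + 2 * B * harm (2 * R))"
  proof (cases "I = {}")
    case True
    then show ?thesis using err by (simp add: err_def)
  next
    case False
    define lo hi where "lo = Inf I" and "hi = Sup I"
    define N where "N = {n \<in> G. frac (f n) \<in> I}"
    have bdd: "bdd_below I" "bdd_above I"
      using I(2) bdd_below_mono[of "{0..<1}" I] bdd_above_mono[of "{0..<1}" I] by simp_all
    have outer: "lo \<le> z" "z \<le> hi" if "z \<in> I" for z
      using that bdd by (auto simp: lo_def hi_def intro: cInf_lower cSup_upper)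
    have lh: "0 \<le> lo" "lo \<le> hi" "hi \<le> 1"
    proof -
      show "0 \<le> lo" unfolding lo_def using False I(2) by (intro cInf_greatest) auto
      show "hi \<le> 1" unfolding hi_def using False I(2) by (intro cSup_least) auto
      obtain z where "z \<in> I" using False by auto
      then show "lo \<le> hi" using outer[of z] by linarith
    qed
    have inner: "z \<in> I" if z: "lo < z" "z < hi" for z
    proof -
      obtain a where "a \<in> I" "a < z" using z cInf_less_iff[OF False bdd(1), of z] unfolding lo_def by blast
      moreover obtain b where "b \<in> I" "z < b" using z less_cSup_iff[OF False bdd(2), of z] unfolding hi_def by blast
      ultimately show ?thesis using I(1) unfolding is_interval_1 by (meson less_imp_le)
    qed
    have "real (card N) \<le> real (card {n \<in> G. lo \<le> frac (f n) \<and> frac (f n) \<le> hi})"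
      unfolding of_nat_le_iff N_def using G outer by (intro card_mono) auto
    then have "real (card N) / g \<le> real (card {n \<in> G. lo \<le> frac (f n) \<and> frac (f n) \<le> hi}) / g"
      using g by (intro divide_right_mono) auto
    then have 1: "real (card N) / g \<le> (hi - lo) + err" using upper[OF lh] by linarith
    have "G = N \<union> {n \<in> G. frac (f n) \<notin> I}" by (auto simp: N_def)
    moreover have "{n \<in> G. frac (f n) \<notin> I} \<subseteq> {n \<in> G. 0 \<le> frac (f n) \<and> frac (f n) \<le> lo} \<union> {n \<in> G. hi \<le> frac (f n) \<and> frac (f n) \<le> 1}"
    proof
      fix n assume n: "n \<in> {n \<in> G. frac (f n) \<notin> I}"
      have "\<not> (lo < frac (f n) \<and> frac (f n) < hi)" using inner[of "frac (f n)"] n by auto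
      moreover have "0 \<le> frac (f n)" "frac (f n) \<le> 1" using frac_lt_1[of "f n"] by auto
      ultimately show "n \<in> {n \<in> G. 0 \<le> frac (f n) \<and> frac (f n) \<le> lo} \<union> {n \<in> G. hi \<le> frac (f n) \<and> frac (f n) \<le> 1}"
        using n by auto
    qed
    ultimately have "G \<subseteq> N \<union> ({n \<in> G. 0 \<le> frac (f n) \<and> frac (f n) \<le> lo} \<union> {n \<in> G. hi \<le> frac (f n) \<and> frac (f n) \<le> 1})"
      by blast
    then have "card G \<le> card (N \<union> ({n \<in> G. 0 \<le> frac (f n) \<and> frac (f n) \<le> lo} \<union> {n \<in> G. hi \<le> frac (f n) \<and> frac (f n) \<le> 1}))"
      using G by (intro card_mono) (auto simp: N_def)
    also have "\<dots> \<le> card N + (card {n \<in> G. 0 \<le> frac (f n) \<and> frac (f n) \<le> lo} + card {n \<in> G. hi \<le> frac (f n) \<and> frac (f n) \<le> 1})"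
      by (meson add_left_mono card_Un_le order_trans)
    finally have "g \<le> real (card N) + (real (card {n \<in> G. 0 \<le> frac (f n) \<and> frac (f n) \<le> lo}) + real (card {n \<in> G. hi \<le> frac (f n) \<and> frac (f n) \<le> 1}))"
      unfolding g_def by linarith
    then have "g / g \<le> (real (card N) + (real (card {n \<in> G. 0 \<le> frac (f n) \<and> frac (f n) \<le> lo}) + real (card {n \<in> G. hi \<le> frac (f n) \<and> frac (f n) \<le> 1}))) / g"
      using g by (intro divide_right_mono) auto
    moreover have "g / g = 1" using g by simp
    ultimately have 2: "(hi - lo) - 2 * err \<le> real (card N) / g"
      using upper[of 0 lo] upper[of hi 1] lh unfolding add_divide_distrib by linarith
    have "measure lborel I = hi - lo"
      using measure_bounded_interval[OF I(1) False I(2)] by (simp add: hi_def lo_def)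
    then have "\<bar>real (card N) / g - measure lborel I\<bar> \<le> 2 * err" using 1 2 err by linarith
    then show ?thesis unfolding N_def g_def err_def .
  qed
qed

lemma discrepancy_le_1:
  assumes "finite G"
  shows "discrepancy f G \<le> 1"
  unfolding discrepancy_def
proof (rule cSUP_least)
  have "{} \<in> {I :: real set. is_interval I \<and> I \<subseteq> {0..<1}}" by simp
  then show "{I :: real set. is_interval I \<and> I \<subseteq> {0..<1}} \<noteq> {}" by blast
next
  fix I :: "real set" assume "I \<in> {I. is_interval I \<and> I \<subseteq> {0..<1}}"
  then have I: "is_interval I" "I \<subseteq> {0..<1}" by auto
  have "measure lborel I \<le> 1"
  proof (cases "I = {}")
    case False
    have "Sup I \<le> 1" "0 \<le> Inf I" using False I(2) by (auto intro!: cSup_least cInf_greatest)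
    then show ?thesis using measure_bounded_interval[OF I(1) False I(2)] by simp
  qed simp
  moreover have "real (card {n \<in> G. frac (f n) \<in> I}) / real (card G) \<le> 1"
  proof -
    have "card {n \<in> G. frac (f n) \<in> I} \<le> card G" using assms by (intro card_mono) auto
    then show ?thesis by (cases "card G = 0") auto
  qed
  moreover have "0 \<le> real (card {n \<in> G. frac (f n) \<in> I}) / real (card G)" "0 \<le> measure lborel I" by auto
  ultimately show "\<bar>real (card {n \<in> G. frac (f n) \<in> I}) / real (card G) - measure lborel I\<bar> \<le> 1" by linarith
qed

section \<open>Numbers with a fixed digit sum\<close>

text \<open>Both ranges are extended to the larger one, where the additional digits are 0.\<close>

lemma binary_digit_sum_eq:
  assumes "n < 2 ^ r"
  shows "binary_digit_sum n = (\<Sum>i<r. n div 2 ^ i mod 2)"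
proof -
  have zero: "n div 2 ^ i mod 2 = 0" if "n < 2 ^ j" "j \<le> i" for i j
  proof -
    have "(2 :: nat) ^ j \<le> 2 ^ i" using that by (intro power_increasing) auto
    then have "n < 2 ^ i" using that(1) by linarith
    then show ?thesis by simp
  qed
  have n: "n < 2 ^ n" by simp
  have "(\<Sum>i<n. n div 2 ^ i mod 2) = (\<Sum>i<max n r. n div 2 ^ i mod 2)"
    using zero[OF n] by (intro sum.mono_neutral_left) auto
  also have "\<dots> = (\<Sum>i<r. n div 2 ^ i mod 2)"
    using zero[OF assms] by (intro sum.mono_neutral_right) auto
  finally show ?thesis by (simp add: binary_digit_sum_def)
qed

lemma binary_digit_sum_append:
  assumes "u < 2 ^ m"
  shows "binary_digit_sum (u + 2 ^ m * v) = binary_digit_sum u + binary_digit_sum v"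
proof -
  have v: "v < 2 ^ v" by simp
  have "u + 2 ^ m * v < 2 ^ m * (v + 1)" using assms by simp
  also have "\<dots> \<le> 2 ^ m * 2 ^ v" using v by (intro mult_left_mono) (auto simp: Suc_le_eq)
  finally have "u + 2 ^ m * v < 2 ^ (m + v)" by (simp add: power_add)
  then have "binary_digit_sum (u + 2 ^ m * v) = (\<Sum>i<m + v. (u + 2 ^ m * v) div 2 ^ i mod 2)"
    by (rule binary_digit_sum_eq)
  also have "\<dots> = (\<Sum>i<m. (u + 2 ^ m * v) div 2 ^ i mod 2) + (\<Sum>j<v. (u + 2 ^ m * v) div 2 ^ (m + j) mod 2)"
    using sum.atLeastLessThan_concat[of 0 m "m + v" "\<lambda>i. (u + 2 ^ m * v) div 2 ^ i mod 2"]
      sum.shift_bounds_nat_ivl[of "\<lambda>i. (u + 2 ^ m * v) div 2 ^ i mod 2" 0 m v]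
    by (simp add: lessThan_atLeast0 add.commute)
  also have "(\<Sum>i<m. (u + 2 ^ m * v) div 2 ^ i mod 2) = (\<Sum>i<m. u div 2 ^ i mod 2)"
  proof (rule sum.cong[OF refl])
    fix i assume "i \<in> {..<m}"
    then obtain c where "m = i + Suc c" using less_imp_Suc_add by fastforce
    then have e: "u + 2 ^ m * v = u + (2 * (2 ^ c * v)) * 2 ^ i" by (simp add: power_add mult_ac)
    have "(u + 2 ^ m * v) div 2 ^ i = 2 * (2 ^ c * v) + u div 2 ^ i"
      unfolding e by (rule div_mult_self1) simp
    then show "(u + 2 ^ m * v) div 2 ^ i mod 2 = u div 2 ^ i mod 2" by simp
  qed
  also have "(\<Sum>j<v. (u + 2 ^ m * v) div 2 ^ (m + j) mod 2) = (\<Sum>j<v. v div 2 ^ j mod 2)"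
  proof (rule sum.cong[OF refl])
    fix j
    have "(u + 2 ^ m * v) div 2 ^ (m + j) = v div 2 ^ j"
      using assms by (simp add: power_add div_mult2_eq)
    then show "(u + 2 ^ m * v) div 2 ^ (m + j) mod 2 = v div 2 ^ j mod 2" by simp
  qed
  finally show ?thesis
    by (simp add: binary_digit_sum_eq[OF assms] binary_digit_sum_eq[OF v])
qed

lemma finite_fixed_digit_sum_set [simp]: "finite (fixed_digit_sum_set s r)"
  by (rule finite_subset[of _ "{..<2 ^ r}"]) (auto simp: fixed_digit_sum_set_def)

text \<open>Pascal's rule, splitting by the digit in position r.\<close>

lemma card_fixed_digit_sum_set: "card (fixed_digit_sum_set s r) = r choose s"
proof (induction r arbitrary: s)
  case 0
  have "fixed_digit_sum_set s 0 = (if s = 0 then {0} else {})"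
    by (auto simp: fixed_digit_sum_set_def binary_digit_sum_def)
  then show ?case by (cases s) auto
next
  case (Suc r)
  define T where "T = (if s = 0 then {} else fixed_digit_sum_set (s - 1) r)"
  have one: "binary_digit_sum 1 = 1" by (simp add: binary_digit_sum_def)
  have "fixed_digit_sum_set s (Suc r) = fixed_digit_sum_set s r \<union> (\<lambda>u. u + 2 ^ r) ` T"
  proof (intro equalityI subsetI)
    fix n assume n: "n \<in> fixed_digit_sum_set s (Suc r)"
    show "n \<in> fixed_digit_sum_set s r \<union> (\<lambda>u. u + 2 ^ r) ` T"
    proof (cases "n < 2 ^ r")
      case False
      define u where "u = n - 2 ^ r"
      have nu: "n = u + 2 ^ r" using False by (simp add: u_def)
      have u: "u < 2 ^ r" using n nu by (simp add: fixed_digit_sum_set_def)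
      have "s = binary_digit_sum u + 1"
        using n binary_digit_sum_append[OF u, of 1] one by (simp add: fixed_digit_sum_set_def nu)
      then show ?thesis using u nu by (auto simp: T_def fixed_digit_sum_set_def)
    qed (use n in \<open>simp add: fixed_digit_sum_set_def\<close>)
  next
    fix n assume "n \<in> fixed_digit_sum_set s r \<union> (\<lambda>u. u + 2 ^ r) ` T"
    then show "n \<in> fixed_digit_sum_set s (Suc r)"
    proof
      assume "n \<in> (\<lambda>u. u + 2 ^ r) ` T"
      then obtain u where u: "n = u + 2 ^ r" "u \<in> T" by auto
      then have "u < 2 ^ r" "s = binary_digit_sum u + 1" by (auto simp: T_def fixed_digit_sum_set_def split: if_splits)
      then show ?thesis using binary_digit_sum_append[of u r 1] one u(1) by (simp add: fixed_digit_sum_set_def)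
    qed (simp add: fixed_digit_sum_set_def)
  qed
  moreover have "fixed_digit_sum_set s r \<inter> (\<lambda>u. u + 2 ^ r) ` T = {}"
    by (auto simp: fixed_digit_sum_set_def)
  moreover have "card ((\<lambda>u. u + 2 ^ r) ` T) = card T" by (intro card_image inj_onI) auto
  moreover have "finite T" by (simp add: T_def)
  ultimately have "card (fixed_digit_sum_set s (Suc r)) = (r choose s) + card T"
    using Suc.IH by (simp add: card_Un_disjoint)
  also have "\<dots> = Suc r choose s" using Suc.IH by (cases s) (auto simp: T_def)
  finally show ?case .
qed

text \<open>For each digit sum t of the low part the elements form a full product, the only
  structure the bilinear estimate asks for. The condition t \<le> s keeps the truncated subtraction
  s - t from admitting false elements.\<close>

lemma fixed_digit_sum_set_split:
  defines "V \<equiv> \<lambda>s t n. if t \<le> s then fixed_digit_sum_set (s - t) n else {}"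
  shows "bij_betw (\<lambda>(t, u, v). u + 2 ^ m * v)
    (SIGMA t:{..m}. fixed_digit_sum_set t m \<times> V s t n) (fixed_digit_sum_set s (m + n))"
proof (rule bij_betw_imageI)
  have mod_div: "(u + 2 ^ m * v) mod 2 ^ m = u" "(u + 2 ^ m * v) div 2 ^ m = v" if "u < 2 ^ m" for u v :: nat
    using that by auto
  show "inj_on (\<lambda>(t, u, v). u + 2 ^ m * v) (SIGMA t:{..m}. fixed_digit_sum_set t m \<times> V s t n)"
  proof (rule inj_onI)
    fix p q assume p: "p \<in> (SIGMA t:{..m}. fixed_digit_sum_set t m \<times> V s t n)" and q: "q \<in> (SIGMA t:{..m}. fixed_digit_sum_set t m \<times> V s t n)"
      and eq: "(case p of (t, u, v) \<Rightarrow> u + 2 ^ m * v) = (case q of (t, u, v) \<Rightarrow> u + 2 ^ m * v)"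
    obtain t u v t' u' v' where pq: "p = (t, u, v)" "q = (t', u', v')" by (metis prod_cases3)
    have u: "u < 2 ^ m" "u' < 2 ^ m" "t = binary_digit_sum u" "t' = binary_digit_sum u'"
      using p q by (auto simp: fixed_digit_sum_set_def pq)
    have e: "u + 2 ^ m * v = u' + 2 ^ m * v'" using eq by (simp add: pq)
    have "u = u'" "v = v'"
      using mod_div[OF u(1), of v] mod_div[OF u(2), of v'] unfolding e by linarith+
    then show "p = q" using u pq by simp
  qed
  show "(\<lambda>(t, u, v). u + 2 ^ m * v) ` (SIGMA t:{..m}. fixed_digit_sum_set t m \<times> V s t n) = fixed_digit_sum_set s (m + n)"
  proof (intro equalityI subsetI)
    fix x assume "x \<in> (\<lambda>(t, u, v). u + 2 ^ m * v) ` (SIGMA t:{..m}. fixed_digit_sum_set t m \<times> V s t n)"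
    then obtain t u v where x: "x = u + 2 ^ m * v" "u \<in> fixed_digit_sum_set t m" "v \<in> V s t n" by auto
    then have u: "u < 2 ^ m" "binary_digit_sum u = t" and v: "v < 2 ^ n" "binary_digit_sum v + t = s"
      by (auto simp: fixed_digit_sum_set_def V_def split: if_splits)
    have "u + 2 ^ m * v < 2 ^ m * (v + 1)" using u by simp
    also have "\<dots> \<le> 2 ^ m * 2 ^ n" using v by (intro mult_left_mono) (auto simp: Suc_le_eq)
    finally have "x < 2 ^ (m + n)" by (simp add: power_add x(1))
    then show "x \<in> fixed_digit_sum_set s (m + n)"
      using binary_digit_sum_append[OF u(1), of v] u v x(1) by (simp add: fixed_digit_sum_set_def)
  next
    fix x assume x: "x \<in> fixed_digit_sum_set s (m + n)"
    define u v where "u = x mod 2 ^ m" and "v = x div 2 ^ m"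
    have eq: "x = u + 2 ^ m * v" by (simp add: u_def v_def)
    have u: "u < 2 ^ m" by (simp add: u_def)
    have v: "v < 2 ^ n" using x by (simp add: v_def fixed_digit_sum_set_def power_add less_mult_imp_div_less mult.commute)
    have s: "s = binary_digit_sum u + binary_digit_sum v"
      using x binary_digit_sum_append[OF u, of v] by (simp add: fixed_digit_sum_set_def eq)
    have "binary_digit_sum u \<le> (\<Sum>i<m. 1)" unfolding binary_digit_sum_eq[OF u] by (intro sum_mono) simp
    then have "(binary_digit_sum u, u, v) \<in> (SIGMA t:{..m}. fixed_digit_sum_set t m \<times> V s t n)"
      using u v s by (auto simp: fixed_digit_sum_set_def V_def)
    then show "x \<in> (\<lambda>(t, u, v). u + 2 ^ m * v) ` (SIGMA t:{..m}. fixed_digit_sum_set t m \<times> V s t n)"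
      using eq by (intro image_eqI) auto
  qed
qed

text \<open>Each of the m + 1 products embeds into the whole set, so |U| |V| is at most its
  cardinality and every term obeys the same bound.\<close>

lemma digit_sum_exponential_sum:
  fixes F :: "nat \<Rightarrow> complex"
  assumes X: "X \<ge> 0"
    and bound: "\<And>U V. U \<subseteq> {..<2 ^ m} \<Longrightarrow> V \<subseteq> {..<2 ^ n} \<Longrightarrow>
      cmod (\<Sum>u\<in>U. \<Sum>v\<in>V. F (u + 2 ^ m * v)) ^ 2 \<le> X * real (card U) * real (card V)"
  shows "cmod (\<Sum>x\<in>fixed_digit_sum_set s (m + n). F x) \<le> real (m + 1) * sqrt (X * real (card (fixed_digit_sum_set s (m + n))))"
proof -
  define V where "V = (\<lambda>t. if t \<le> s then fixed_digit_sum_set (s - t) n else {})"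
  define P where "P = (\<lambda>t. fixed_digit_sum_set t m \<times> V t)"
  define G where "G = fixed_digit_sum_set s (m + n)"
  have fin: "finite (V t)" "finite (P t)" for t by (auto simp: V_def P_def)
  have bij: "bij_betw (\<lambda>(t, u, v). u + 2 ^ m * v) (Sigma {..m} P) G"
    using fixed_digit_sum_set_split[of m s n] unfolding P_def V_def G_def .
  have "(\<Sum>x\<in>G. F x) = (\<Sum>(t, u, v)\<in>Sigma {..m} P. F (u + 2 ^ m * v))"
    using sum.reindex_bij_betw[OF bij, of F] by (simp add: case_prod_unfold)
  also have "\<dots> = (\<Sum>t\<le>m. \<Sum>(u, v)\<in>P t. F (u + 2 ^ m * v))"
    using fin by (simp add: sum.Sigma case_prod_unfold)
  also have "\<dots> = (\<Sum>t\<le>m. \<Sum>u\<in>fixed_digit_sum_set t m. \<Sum>v\<in>V t. F (u + 2 ^ m * v))"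
    by (simp add: P_def sum.cartesian_product)
  finally have "cmod (\<Sum>x\<in>G. F x) \<le> (\<Sum>t\<le>m. cmod (\<Sum>u\<in>fixed_digit_sum_set t m. \<Sum>v\<in>V t. F (u + 2 ^ m * v)))"
    by (simp add: norm_sum)
  also have "\<dots> \<le> (\<Sum>t\<le>m. sqrt (X * real (card G)))"
  proof (rule sum_mono)
    fix t assume t: "t \<in> {..m}"
    have "card (P t) = card ({t} \<times> P t)" by (simp add: card_cartesian_product)
    also have "\<dots> \<le> card (Sigma {..m} P)" using t fin by (intro card_mono) auto
    also have "\<dots> = card G" using bij by (rule bij_betw_same_card)
    finally have PG: "real (card (fixed_digit_sum_set t m)) * real (card (V t)) \<le> real (card G)"
      by (simp add: P_def card_cartesian_product flip: of_nat_mult)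
    have "cmod (\<Sum>u\<in>fixed_digit_sum_set t m. \<Sum>v\<in>V t. F (u + 2 ^ m * v)) ^ 2
      \<le> X * real (card (fixed_digit_sum_set t m)) * real (card (V t))"
      by (rule bound) (auto simp: V_def fixed_digit_sum_set_def split: if_splits)
    also have "\<dots> \<le> X * real (card G)" using mult_left_mono[OF PG X] by (simp add: mult.assoc)
    finally show "cmod (\<Sum>u\<in>fixed_digit_sum_set t m. \<Sum>v\<in>V t. F (u + 2 ^ m * v)) \<le> sqrt (X * real (card G))"
      by (rule real_le_rsqrt)
  qed
  also have "\<dots> = real (m + 1) * sqrt (X * real (card G))" by simp
  finally show ?thesis unfolding G_def .
qed

section \<open>Assembling the discrepancy bound\<close>

lemma splitting_exists:
  obtains m n where "splitting k r m n" "m \<le> r"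
proof -
  define c where "c = real (k * (k - 1)) / (real (k * (k - 1)) + 1)"
  have c: "0 \<le> c" "c \<le> 1" by (auto simp: c_def divide_le_eq_1 add_nonneg_pos simp del: of_nat_mult)
  define m where "m = nat \<lfloor>c * real r\<rfloor>"
  have cr: "0 \<le> c * real r" "c * real r \<le> real r" using c by (auto simp: mult_left_le_one_le)
  have m: "real m \<le> c * real r" "c * real r \<le> real m + 1"
    using cr unfolding m_def by linarith+
  then have "m \<le> r" using cr by linarith
  then have "splitting k r m (r - m)" using m by (simp add: splitting_def c_def)
  then show ?thesis using \<open>m \<le> r\<close> that by blast
qed

lemma exponential_sum_bound:
  fixes f :: "real poly"
  assumes adm: "admissible k \<omega>" and deg: "degree f = Suc k"
    and \<alpha>: "coeff f (Suc k) \<notin> \<rat>" "diophantine_type (coeff f (Suc k)) = 1" and \<epsilon>: "\<epsilon> > 0"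
  obtains C where "C > 0"
    "\<And>r s h. 1 \<le> h \<Longrightarrow> real h \<le> 4 * 2 powr (\<omega> * real r) \<Longrightarrow>
      cmod (\<Sum>x\<in>fixed_digit_sum_set s r. unit_exp (real h * poly f (real x)))
        \<le> (real r + 1) * sqrt (C * 2 powr ((1 - \<omega> + \<epsilon>) * real r) * real (card (fixed_digit_sum_set s r)))"
proof -
  obtain C where C: "C > 0"
    "\<And>r m n h U V. splitting k r m n \<Longrightarrow> 1 \<le> h \<Longrightarrow> real h \<le> 4 * 2 powr (\<omega> * real r) \<Longrightarrow>
      U \<subseteq> {..<2 ^ m} \<Longrightarrow> V \<subseteq> {..<2 ^ n} \<Longrightarrow>
      cmod (\<Sum>u\<in>U. \<Sum>v\<in>V. unit_exp (real h * poly f (real u + real (2 ^ m) * real v))) ^ 2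
        \<le> C * 2 powr ((1 - \<omega> + \<epsilon>) * real r) * real (card U) * real (card V)"
    using bilinear_bound[OF adm deg \<alpha> \<epsilon>] by blast
  have "cmod (\<Sum>x\<in>fixed_digit_sum_set s r. unit_exp (real h * poly f (real x)))
        \<le> (real r + 1) * sqrt (C * 2 powr ((1 - \<omega> + \<epsilon>) * real r) * real (card (fixed_digit_sum_set s r)))"
    if h: "1 \<le> h" "real h \<le> 4 * 2 powr (\<omega> * real r)" for r s h
  proof -
    obtain m n where spl: "splitting k r m n" and "m \<le> r" by (rule splitting_exists)
    then have r: "r = m + n" by (simp add: splitting_def)
    have "cmod (\<Sum>x\<in>fixed_digit_sum_set s (m + n). unit_exp (real h * poly f (real x)))
        \<le> real (m + 1) * sqrt (C * 2 powr ((1 - \<omega> + \<epsilon>) * real r) * real (card (fixed_digit_sum_set s (m + n))))"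
    proof (rule digit_sum_exponential_sum)
      fix U V :: "nat set" assume "U \<subseteq> {..<2 ^ m}" "V \<subseteq> {..<2 ^ n}"
      from C(2)[OF spl h this]
      show "cmod (\<Sum>u\<in>U. \<Sum>v\<in>V. unit_exp (real h * poly f (real (u + 2 ^ m * v)))) ^ 2
        \<le> C * 2 powr ((1 - \<omega> + \<epsilon>) * real r) * real (card U) * real (card V)" by simp
    qed (use C(1) in simp)
    also have "\<dots> \<le> (real r + 1) * sqrt (C * 2 powr ((1 - \<omega> + \<epsilon>) * real r) * real (card (fixed_digit_sum_set s (m + n))))"
      using \<open>m \<le> r\<close> C(1) by (intro mult_right_mono) auto
    finally show ?thesis unfolding r .
  qed
  then show ?thesis using C(1) that by blast
qed

lemma sqrt_mult_powr:
  assumes "C > 0" "g > 0"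
  shows "sqrt (C * 2 powr x * g) = sqrt C * 2 powr (x / 2) * g powr (- 1 / 2) * g"
proof -
  have "sqrt (C * 2 powr x * g) = sqrt C * sqrt (2 powr x) * sqrt g" using assms by (simp add: real_sqrt_mult)
  also have "sqrt (2 powr x) = 2 powr (x / 2)" by (simp add: powr_half_sqrt[symmetric] powr_powr)
  also have "sqrt g = g powr (- 1 / 2) * g"
  proof -
    have "g powr (- 1 / 2) * g = g powr (- 1 / 2) * g powr 1" using assms by simp
    also have "\<dots> = g powr (1 / 2)" unfolding powr_add[symmetric] by simp
    finally show ?thesis using assms by (simp add: powr_half_sqrt)
  qed
  finally show ?thesis by (simp add: mult.assoc)
qed

text \<open>With R = 2^(\<omega> r) rounded up, the frequencies up to 2 R lie in the range of
  \<open>exponential_sum_bound\<close>. The error 1 / sqrt R is at most 2^(-\<omega> r / 2) and is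
  absorbed because |G| \<le> 2^r.\<close>

lemma discrepancy_bound:
  fixes f :: "real poly"
  assumes adm: "admissible k \<omega>" and deg: "degree f = Suc k"
    and \<alpha>: "coeff f (Suc k) \<notin> \<rat>" "diophantine_type (coeff f (Suc k)) = 1" and \<epsilon>: "\<epsilon> > 0"
  obtains r0 where "\<And>r s. r0 \<le> r \<Longrightarrow> s \<le> r \<Longrightarrow>
    discrepancy (\<lambda>n. poly f (real n)) (fixed_digit_sum_set s r)
      \<le> real (r choose s) powr (- 1 / 2) * 2 powr ((1 - \<omega>) / 2 * real r + \<epsilon> * real r)"
proof -
  have \<omega>: "0 < \<omega>" "\<omega> \<le> 1"
  proof -
    show "0 < \<omega>" using adm by (simp add: admissible_def)
    have "\<omega> * 1 \<le> \<omega> * (real (k * (k - 1)) + 1)" using \<open>0 < \<omega>\<close> by (intro mult_left_mono) auto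
    then show "\<omega> \<le> 1" using adm unfolding admissible_def by linarith
  qed
  \<comment> \<open>Of the four parts of \<epsilon>, one goes to the exponential sums, one to the
    harmonic number and two to the factor linear in r.\<close>
  define a where "a = \<epsilon> / 4"
  have a: "a > 0" using \<epsilon> by (simp add: a_def)
  obtain C where C: "C > 0"
    "\<And>r s h. 1 \<le> h \<Longrightarrow> real h \<le> 4 * 2 powr (\<omega> * real r) \<Longrightarrow>
      cmod (\<Sum>x\<in>fixed_digit_sum_set s r. unit_exp (real h * poly f (real x)))
        \<le> (real r + 1) * sqrt (C * 2 powr ((1 - \<omega> + 2 * a) * real r) * real (card (fixed_digit_sum_set s r)))"
    using exponential_sum_bound[OF adm deg \<alpha>, of "2 * a"] a by auto
  define c where "c = 4 * sqrt C * ((1 + 1 / a) * 4 powr a)"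
  have c: "c > 0" using C a by (simp add: c_def add_pos_pos)
  have "eventually (\<lambda>r. 68 + c * (real r + 1) \<le> 2 powr (2 * a * real r)) at_top"
    using a c by real_asymp
  then obtain r0 where r0: "\<And>r. r0 \<le> r \<Longrightarrow> 68 + c * (real r + 1) \<le> 2 powr (2 * a * real r)"
    unfolding eventually_at_top_linorder by blast
  have "discrepancy (\<lambda>n. poly f (real n)) (fixed_digit_sum_set s r)
      \<le> real (r choose s) powr (- 1 / 2) * 2 powr ((1 - \<omega>) / 2 * real r + \<epsilon> * real r)"
    if r: "r0 \<le> r" and s: "s \<le> r" for r s
  proof -
    define G where "G = fixed_digit_sum_set s r"
    define g where "g = real (card G)"
    define X where "X = 2 powr (\<omega> * real r)"
    define R where "R = nat \<lceil>X\<rceil>"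
    define P where "P = g powr (- 1 / 2) * 2 powr ((1 - \<omega>) / 2 * real r)"
    have gC: "g = real (r choose s)" by (simp add: g_def G_def card_fixed_digit_sum_set)
    have g: "1 \<le> g" unfolding gC using s zero_less_binomial[OF s] by linarith
    have G: "finite G" "G \<noteq> {}" using g by (auto simp: G_def g_def)
    have X: "1 \<le> X" unfolding X_def using \<omega> by (intro ge_one_powr_ge_zero) auto
    have R: "X \<le> real R" "real R \<le> X + 1" "R \<ge> 1" unfolding R_def using X by linarith+
    have P: "P > 0" using g by (simp add: P_def)
    define B where "B = (real r + 1) * sqrt C * 2 powr ((1 - \<omega> + 2 * a) * real r / 2) * g powr (- 1 / 2)"
    have B: "B = (real r + 1) * sqrt C * 2 powr (a * real r) * P"
    proof -
      have "(1 - \<omega> + 2 * a) * real r / 2 = a * real r + (1 - \<omega>) / 2 * real r" by (simp add: field_simps)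
      then have "2 powr ((1 - \<omega> + 2 * a) * real r / 2) = 2 powr (a * real r) * 2 powr ((1 - \<omega>) / 2 * real r)"
        by (simp only: powr_add)
      then show ?thesis unfolding B_def P_def by (simp only: mult_ac)
    qed
    have B0: "B \<ge> 0" unfolding B using P C by simp
    have 1: "discrepancy (\<lambda>n. poly f (real n)) G \<le> 2 * (34 / sqrt R + 2 * B * harm (2 * R))"
    proof (rule discrepancy_le[OF G R(3) B0])
      fix h :: nat assume h: "1 \<le> h" "h \<le> 2 * R"
      then have "real h \<le> 2 * real R" by linarith
      then have "real h \<le> 4 * 2 powr (\<omega> * real r)" using R X unfolding X_def[symmetric] by linarith
      from C(2)[OF h(1) this, of s]
      have "cmod (\<Sum>n\<in>G. unit_exp (real h * poly f (real n)))
        \<le> (real r + 1) * sqrt (C * 2 powr ((1 - \<omega> + 2 * a) * real r) * g)"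
        unfolding G_def g_def .
      also have "sqrt (C * 2 powr ((1 - \<omega> + 2 * a) * real r) * g)
        = sqrt C * 2 powr ((1 - \<omega> + 2 * a) * real r / 2) * g powr (- 1 / 2) * g"
        using C(1) g by (intro sqrt_mult_powr) auto
      finally show "cmod (\<Sum>n\<in>G. unit_exp (real h * poly f (real n))) \<le> B * real (card G)"
        unfolding B_def g_def[symmetric] by (simp only: mult_ac)
    qed
    have 2: "34 / sqrt R \<le> 34 * P"
    proof -
      have "g \<le> 2 ^ r"
      proof -
        have "card G \<le> card {..<2 ^ r :: nat}" by (intro card_mono) (auto simp: G_def fixed_digit_sum_set_def)
        then have "real (card G) \<le> real (2 ^ r)" unfolding of_nat_le_iff by simp
        then show ?thesis by (simp add: g_def)
      qed
      then have "(2 ^ r) powr (- 1 / 2) \<le> g powr (- 1 / 2)" using g by (intro powr_mono2') auto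
      moreover have "(2 ^ r) powr (- 1 / 2) = (2 :: real) powr (real r * (- 1 / 2))"
        by (simp only: powr_realpow[symmetric] powr_powr)
      ultimately have "2 powr (real r * (- 1 / 2)) * 2 powr ((1 - \<omega>) / 2 * real r) \<le> P"
        unfolding P_def by (intro mult_right_mono) auto
      moreover have "2 powr (real r * (- 1 / 2)) * 2 powr ((1 - \<omega>) / 2 * real r) = 1 / sqrt X"
      proof -
        have "real r * (- 1 / 2) + (1 - \<omega>) / 2 * real r = - (\<omega> * real r * (1 / 2))" by (simp add: field_simps)
        then have "2 powr (real r * (- 1 / 2)) * 2 powr ((1 - \<omega>) / 2 * real r) = 2 powr (- (\<omega> * real r * (1 / 2)))"
          by (simp flip: powr_add)
        also have "\<dots> = 1 / (X powr (1 / 2))" by (simp only: powr_minus X_def powr_powr inverse_eq_divide)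
        finally show ?thesis using X by (simp add: powr_half_sqrt)
      qed
      moreover have "34 / sqrt R \<le> 34 / sqrt X" using R X by (intro divide_left_mono mult_pos_pos) auto
      ultimately show ?thesis by simp
    qed
    define H where "H = (1 + 1 / a) * 4 powr a * 2 powr (a * real r)"
    have "harm (2 * R) \<le> (1 + 1 / a) * 4 powr a * 2 powr (a * real r)"
    proof -
      have "harm (2 * R) \<le> (1 + 1 / a) * real (2 * R) powr a" using R by (intro harm_le_powr a) auto
      also have "real (2 * R) powr a \<le> (4 * 2 powr real r) powr a"
      proof (rule powr_mono2)
        have "X \<le> 2 powr real r" unfolding X_def using \<omega> by (intro powr_mono) (auto simp: mult_left_le_one_le)
        then show "real (2 * R) \<le> 4 * 2 powr real r" using R X by simp
      qed (use a in auto)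
      also have "(4 * 2 powr real r) powr a = 4 powr a * 2 powr (a * real r)"
        by (simp add: powr_mult powr_powr mult.commute)
      finally show ?thesis using a by (simp add: mult.assoc mult_left_mono)
    qed
    then have 3: "2 * B * harm (2 * R) \<le> 2 * B * H" unfolding H_def
      using B0 by (intro mult_left_mono) auto
    have 4: "4 * B * H = c * (real r + 1) * 2 powr (2 * a * real r) * P"
    proof -
      have "2 powr (2 * a * real r) = 2 powr (a * real r) * 2 powr (a * real r)" unfolding powr_add[symmetric] by (simp add: mult.assoc)
      then show ?thesis by (simp add: B c_def H_def mult_ac)
    qed
    have "discrepancy (\<lambda>n. poly f (real n)) G \<le> 2 * (34 * P + 2 * B * H)"
      by (rule order_trans[OF 1]) (intro mult_left_mono add_mono 2 3, simp)
    also have "\<dots> = 68 * P + c * (real r + 1) * 2 powr (2 * a * real r) * P"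
      unfolding 4[symmetric] by simp
    also have "68 * P \<le> 68 * 2 powr (2 * a * real r) * P"
      using a P ge_one_powr_ge_zero[of 2 "2 * a * real r"] by simp
    also have "68 * 2 powr (2 * a * real r) * P + c * (real r + 1) * 2 powr (2 * a * real r) * P
      = (68 + c * (real r + 1)) * (2 powr (2 * a * real r) * P)" by (simp add: algebra_simps)
    also have "\<dots> \<le> 2 powr (2 * a * real r) * (2 powr (2 * a * real r) * P)"
      using r0[OF r] P by (intro mult_right_mono) auto
    also have "\<dots> = 2 powr (\<epsilon> * real r) * P"
    proof -
      have "\<epsilon> * real r = 2 * a * real r + 2 * a * real r" by (simp add: a_def)
      then show ?thesis by (simp only: powr_add mult.assoc)
    qed
    also have "\<dots> = real (r choose s) powr (- 1 / 2) * 2 powr ((1 - \<omega>) / 2 * real r + \<epsilon> * real r)"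
      by (simp add: P_def gC powr_add mult_ac)
    finally show ?thesis unfolding G_def by simp
  qed
  then show ?thesis by (rule that)
qed

theorem theorem2p12:
  fixes f :: "real poly" and d :: nat
  assumes "degree f = d" and "d \<ge> 3" and "coeff f 0 = 0"
    and "coeff f d \<notin> \<rat>" and "diophantine_type (coeff f d) = 1"
  shows "\<forall>\<epsilon>::real. \<epsilon> > 0 \<longrightarrow> (\<exists>r0::nat. \<forall>r\<ge>r0. \<forall>s\<le>r.
    discrepancy (\<lambda>n. poly f (real n)) (fixed_digit_sum_set s r) \<le>
      real (r choose s) powr (- beta1 d) * 2 powr (gamma1 d * real r + \<epsilon> * real r) +
      real (r choose s) powr (- beta2 d) * 2 powr (gamma2 d * real r + \<epsilon> * real r) +
      real (r choose s) powr (- beta3 d) * 2 powr (gamma3 d * real r + \<epsilon> * real r))"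
proof (intro allI impI)
  fix \<epsilon> :: real assume \<epsilon>: "\<epsilon> > 0"
  define k where "k = d - 1"
  define K where "K = real (k * (k - 1))"
  have k: "d = Suc k" "k \<ge> 2" using assms(2) by (auto simp: k_def)
  have Kk: "K = real k * (real k - 1)" using k by (simp add: K_def of_nat_diff)
  have deg: "degree f = Suc k" and \<alpha>: "coeff f (Suc k) \<notin> \<rat>" "diophantine_type (coeff f (Suc k)) = 1"
    using assms k by auto
  show "\<exists>r0::nat. \<forall>r\<ge>r0. \<forall>s\<le>r.
    discrepancy (\<lambda>n. poly f (real n)) (fixed_digit_sum_set s r) \<le>
      real (r choose s) powr (- beta1 d) * 2 powr (gamma1 d * real r + \<epsilon> * real r) +
      real (r choose s) powr (- beta2 d) * 2 powr (gamma2 d * real r + \<epsilon> * real r) +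
      real (r choose s) powr (- beta3 d) * 2 powr (gamma3 d * real r + \<epsilon> * real r)"
  proof (cases "d = 3")
    case False
    then have k3: "k \<ge> 3" using assms(2) k by linarith
    have K0: "K \<ge> 0" by (simp add: K_def)
    \<comment> \<open>As k - 2 \<ge> 1, the value 1 / (K + 1) meets the second bound as well; here d
      \<ge> 4 is used.\<close>
    have "(1 + 2 * K) / (K + 1) \<le> 1 + (real k - 2) * (K / (K + 1))"
    proof -
      have "1 * K \<le> (real k - 2) * K" using k3 K0 by (intro mult_right_mono) auto
      then have "1 + 2 * K \<le> (K + 1) + (real k - 2) * K" by linarith
      then have "(1 + 2 * K) / (K + 1) \<le> ((K + 1) + (real k - 2) * K) / (K + 1)" using K0 by (intro divide_right_mono) auto
      then show ?thesis using K0 by (simp add: add_divide_distrib)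
    qed
    then have adm: "admissible k (1 / (K + 1))"
      using k K0 unfolding admissible_def K_def[symmetric] by simp
    have gam: "(1 - 1 / (K + 1)) / 2 = gamma3 d"
    proof -
      have "(1 - 1 / (K + 1)) / 2 = K / (2 * (K + 1))" using K0 by (simp add: field_simps)
      moreover have "(real d - 1) * (real d - 2) = K" "real d ^ 2 - 3 * real d + 3 = K + 1"
        unfolding Kk k(1) by (simp_all add: algebra_simps power2_eq_square)
      ultimately show ?thesis by (simp only: gamma3_def)
    qed
    obtain r0 where "\<And>r s. r0 \<le> r \<Longrightarrow> s \<le> r \<Longrightarrow>
      discrepancy (\<lambda>n. poly f (real n)) (fixed_digit_sum_set s r)
      \<le> real (r choose s) powr (- 1 / 2) * 2 powr ((1 - 1 / (K + 1)) / 2 * real r + \<epsilon> * real r)"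
      using discrepancy_bound[OF adm deg \<alpha> \<epsilon>] by blast
    then have "discrepancy (\<lambda>n. poly f (real n)) (fixed_digit_sum_set s r)
      \<le> real (r choose s) powr (- beta3 d) * 2 powr (gamma3 d * real r + \<epsilon> * real r)"
      if "r0 \<le> r" "s \<le> r" for r s
      using that unfolding gam beta3_def by simp
    then show ?thesis by (meson add_increasing zero_le_mult_iff add_nonneg_nonneg powr_ge_zero mult_nonneg_nonneg)
  next
    case True
    have k2: "k = 2" using True k by simp
    have w: "(1 - 1 / 6) / 2 = (5 / 12 :: real)" by simp
    \<comment> \<open>Admissibility would allow \<omega> up to 1/5; 1/6 is the least value for which
      the resulting bound, without \<epsilon>, is at most 1 at |G| = 2^(5r/6).\<close>
    have adm: "admissible k (1 / 6)" by (simp add: admissible_def k2)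
    have b: "beta2 d = 6 / 13" "gamma2 d = 5 / 13" by (simp_all add: True beta2_def gamma2_def)
    obtain r0 where r0: "\<And>r s. r0 \<le> r \<Longrightarrow> s \<le> r \<Longrightarrow>
      discrepancy (\<lambda>n. poly f (real n)) (fixed_digit_sum_set s r)
      \<le> real (r choose s) powr (- 1 / 2) * 2 powr ((1 - 1 / 6) / 2 * real r + \<epsilon> * real r)"
      using discrepancy_bound[OF adm deg \<alpha> \<epsilon>] by blast
    have "discrepancy (\<lambda>n. poly f (real n)) (fixed_digit_sum_set s r)
      \<le> real (r choose s) powr (- beta2 d) * 2 powr (gamma2 d * real r + \<epsilon> * real r)"
      if r: "r0 \<le> r" and s: "s \<le> r" for r s
    proof -
      define \<kappa> where "\<kappa> = log 2 (real (r choose s))"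
      have "real (r choose s) = 2 powr \<kappa>" using zero_less_binomial[OF s] by (simp add: \<kappa>_def)
      then have pw: "real (r choose s) powr x * 2 powr y = 2 powr (\<kappa> * x + y)" for x y
        by (simp add: powr_powr powr_add)
      show ?thesis
      \<comment> \<open>Without \<epsilon> both exponents are linear in \<kappa> and vanish at 5 r /
        6; beyond it the one with slope -1/2 is the smaller.\<close>
      proof (cases "\<kappa> \<le> 5 / 6 * real r")
        case True
        have "0 \<le> \<epsilon> * real r" using \<epsilon> by simp
        then have "0 \<le> \<kappa> * (- (6 / 13)) + (5 / 13 * real r + \<epsilon> * real r)" using True by linarith
        then have "1 \<le> real (r choose s) powr (- beta2 d) * 2 powr (gamma2 d * real r + \<epsilon> * real r)"
          unfolding pw b by (intro ge_one_powr_ge_zero) auto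
        then show ?thesis using discrepancy_le_1[OF finite_fixed_digit_sum_set, of "\<lambda>n. poly f (real n)" s r] by linarith
      next
        case False
        then have "\<kappa> * (- 1 / 2) + ((1 - 1 / 6) / 2 * real r + \<epsilon> * real r) \<le> \<kappa> * (- (6 / 13)) + (5 / 13 * real r + \<epsilon> * real r)"
          unfolding w by linarith
        then show ?thesis using r0[OF r s] unfolding pw b by (meson order_trans powr_mono one_le_numeral)
      qed
    qed
    moreover have "0 \<le> real (r choose s) powr x * 2 powr y" for r s :: nat and x y :: real by simp
    ultimately show ?thesis by (meson add_increasing add_increasing2)
  qed
qed

end
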